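(* Let $\mathfrak g_0=\mathfrak{sp}(2n,\mathbb R)$, let $1\le\ell\le q\le r\le n$ be integers and let $a_1\ge a_2\ge\dots\ge a_{n-r}\ge 0$ be integers. Put $$\lambda_1=-n+\frac{q+r-\ell+1}{2}$$ and let $L_\lambda$ be the irreducible highest weight $(\mathfrak g,K)$-module with highest weight $$\lambda=(\underbrace{\lambda_1,\dots,\lambda_1}_{q},\underbrace{\lambda_1-1,\dots,\lambda_1-1}_{r-q},\underbrace{\lambda_1-2-a_{n-r},\dots,\lambda_1-2-a_1}_{n-r}).$$ Then $L_\lambda$ is unitary.
   Context: $G$ is the connected simply connected Lie group with Lie algebra $\mathfrak g_0=\mathfrak{sp}(2n,\mathbb R)$ (of rank $n$), $K$ is the fixed point subgroup of a Cartan involution, $\mathfrak g_0=\mathfrak k_0\oplus\mathfrak p_0$ the Cartan decomposition; dropping the subscript $0$ means complexification, so $\mathfrak k\cong\mathfrak{gl}(n,\mathbb C)$. $\mathfrak t\subset\mathfrak k$ is a compact Cartan subalgebra of $\mathfrak g$, and $\mathfrak t^*$ is identified with $\mathbb C^n$ via standard coordinates $\varepsilon_1,\dots,\varepsilon_n$. The positive compact roots are $\varepsilon_i-\varepsilon_j$ ($i<j$) and the positive noncompact roots are $\varepsilon_i+\varepsilon_j$ ($i\le j$). $\mathfrak p^\pm$ is the sum of the root spaces for the positive (resp. negative) noncompact roots. For a $\mathfrak k$-dominant integral $\lambda$, $F_\lambda$ is the irreducible finite-dimensional $\mathfrak k$-module of highest weight $\lambda$, $N(\lambda)=U(\mathfrak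 g)\otimes_{U(\mathfrak k\oplus\mathfrak p^+)}F_\lambda$, and $L_\lambda=L(\lambda)$ is its unique irreducible quotient. A $(\mathfrak g,K)$-module is called unitary if it is isomorphic to the $(\mathfrak g,K)$-module of $K$-finite vectors of a unitary representation of $G$. *)

theory Defs
  imports "HOL-Analysis.Analysis" "HOL-Library.Poly_Mapping" "HOL-Library.Function_Algebras"
begin

text \<open>
  The rank is \<open>n = CARD('n)\<close>.  The index type \<open>'n\<close> is linearly ordered because the positive
  compact roots are \<open>\<epsilon>\<^sub>i - \<epsilon>\<^sub>j\<close> with \<open>i < j\<close>; its \<open>m\<close>-th smallest element plays the role of
  the index \<open>m\<close>.  Matrices of size \<open>2n\<close> are indexed by \<open>'n + 'n\<close>, i.e. they consist of four
  blocks of size \<open>n\<close>.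
\<close>

type_synonym ('a, 'n) mat2 = "'a ^ ('n + 'n) ^ ('n + 'n)"

section \<open>The Lie algebra\<close>

definition symp_form :: "('a::comm_ring_1, 'n::finite) mat2" where
  "symp_form = (\<chi> i j. case (i, j) of
      (Inl a, Inr b) \<Rightarrow> if a = b then 1 else 0
    | (Inr a, Inl b) \<Rightarrow> if a = b then - 1 else 0
    | _ \<Rightarrow> 0)"

text \<open>
  Over the reals this is \<open>\<g>\<^sub>0\<close>, over the complex numbers its complexification \<open>\<g>\<close>.  Likewise for
  \<open>sp_compact\<close>, which is the fixed point set of the Cartan involution \<open>X \<mapsto> - X\<^sup>T\<close> over the reals
  and its complexification over the complex numbers (so the transpose is not conjugated there).
\<close>

definition sp_alg :: "('a::comm_ring_1, 'n::finite) mat2 set" where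
  "sp_alg = {X. transpose X ** symp_form + symp_form ** X = 0}"

definition sp_compact :: "('a::comm_ring_1, 'n::finite) mat2 set" where
  "sp_compact = {X \<in> sp_alg. - transpose X = X}"

definition bracket :: "('a::comm_ring_1, 'n::finite) mat2 \<Rightarrow> ('a, 'n) mat2 \<Rightarrow> ('a, 'n) mat2" where
  "bracket X Y = X ** Y - Y ** X"

abbreviation mscale :: "complex \<Rightarrow> (complex, 'n::finite) mat2 \<Rightarrow> (complex, 'n) mat2" where
  "mscale c \<equiv> map_matrix ((*) c)"

abbreviation complexify :: "(real, 'n::finite) mat2 \<Rightarrow> (complex, 'n) mat2" where
  "complexify \<equiv> map_matrix complex_of_real"

text \<open>
  The compact Cartan subalgebra \<open>\<t>\<close> consists of the matrices with off-diagonal blocks \<open>-\<i> D\<close>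
  (upper right) and \<open>\<i> D\<close> (lower left), \<open>D\<close> diagonal.  \<open>cartan h\<close> is the element with
  \<open>\<epsilon>\<^sub>j (cartan h) = h\<^sub>j\<close>.
\<close>

definition cartan :: "complex ^ 'n \<Rightarrow> (complex, 'n::finite) mat2" where
  "cartan h = (\<chi> i j. case (i, j) of
      (Inl a, Inr b) \<Rightarrow> if a = b then - \<i> * h $ a else 0
    | (Inr a, Inl b) \<Rightarrow> if a = b then \<i> * h $ a else 0
    | _ \<Rightarrow> 0)"

definition root_space :: "(complex ^ 'n \<Rightarrow> complex) \<Rightarrow> (complex, 'n::finite) mat2 set" where
  "root_space \<alpha> = {X \<in> sp_alg. \<forall>h. bracket (cartan h) X = mscale (\<alpha> h) X}"

text \<open>Position of an index, counted from 1.\<close>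

definition pos :: "'n::{finite,linorder} \<Rightarrow> nat" where
  "pos i = card {j. j \<le> i}"

definition sp_plus :: "(complex, 'n::{finite,linorder}) mat2 set" where
  "sp_plus = module.span mscale
     (\<Union>(i, j) \<in> {(i, j). i \<le> j}. root_space (\<lambda>h. h $ i + h $ j))"

section \<open>Modules over Lie algebras\<close>

text \<open>
  A complex vector space is a type \<open>'v::ab_group_add\<close> with a scalar multiplication \<open>s\<close>
  satisfying \<open>vector_space s\<close>.
\<close>

definition lie_module ::
  "(complex, 'n::finite) mat2 set \<Rightarrow> (complex \<Rightarrow> 'v \<Rightarrow> 'v::ab_group_add) \<Rightarrow>
     ((complex, 'n) mat2 \<Rightarrow> 'v \<Rightarrow> 'v) \<Rightarrow> bool" where
  "lie_module A s \<rho> \<longleftrightarrow> vector_space s \<and>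
     (\<forall>X\<in>A. Vector_Spaces.linear s s (\<rho> X)) \<and>
     (\<forall>X\<in>A. \<forall>Y\<in>A. \<forall>v. \<rho> (X + Y) v = \<rho> X v + \<rho> Y v) \<and>
     (\<forall>X\<in>A. \<forall>c v. \<rho> (mscale c X) v = s c (\<rho> X v)) \<and>
     (\<forall>X\<in>A. \<forall>Y\<in>A. \<forall>v. \<rho> (bracket X Y) v = \<rho> X (\<rho> Y v) - \<rho> Y (\<rho> X v))"

definition irreducible_module ::
  "(complex, 'n::finite) mat2 set \<Rightarrow> (complex \<Rightarrow> 'v \<Rightarrow> 'v::ab_group_add) \<Rightarrow>
     ((complex, 'n) mat2 \<Rightarrow> 'v \<Rightarrow> 'v) \<Rightarrow> bool" where
  "irreducible_module A s \<rho> \<longleftrightarrow> lie_module A s \<rho> \<and> (\<exists>v::'v. v \<noteq> 0) \<and>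
     (\<forall>W. module.subspace s W \<and> (\<forall>X\<in>A. \<rho> X ` W \<subseteq> W) \<longrightarrow> W = {0} \<or> W = UNIV)"

text \<open>\<open>is_F \<lambda> s \<sigma>\<close>: the \<open>\<k>\<close>-module \<open>(s, \<sigma>)\<close> is (a copy of) \<open>F\<^sub>\<lambda>\<close>.\<close>

definition is_F ::
  "real ^ 'n::{finite,linorder} \<Rightarrow> (complex \<Rightarrow> 'f \<Rightarrow> 'f::ab_group_add) \<Rightarrow>
     ((complex, 'n) mat2 \<Rightarrow> 'f \<Rightarrow> 'f) \<Rightarrow> bool" where
  "is_F lam s \<sigma> \<longleftrightarrow> irreducible_module sp_compact s \<sigma> \<and>
     (\<exists>B. finite B \<and> module.span s B = UNIV) \<and>
     (\<exists>v. v \<noteq> 0 \<and>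
        (\<forall>h. \<sigma> (cartan h) v = s (\<Sum>i\<in>UNIV. of_real (lam $ i) * h $ i) v) \<and>
        (\<forall>i j. i < j \<longrightarrow> (\<forall>X \<in> root_space (\<lambda>h. h $ i - h $ j). \<sigma> X v = 0)))"

section \<open>The module \<open>N(\<lambda>)\<close>\<close>

text \<open>
  \<open>N(\<lambda>)\<close> is the tensor product of \<open>U(\<g>)\<close> and \<open>F\<^sub>\<lambda>\<close> over \<open>U(\<k> \<oplus> \<p>\<^sup>+)\<close>, where \<open>\<p>\<^sup>+\<close> acts
  on \<open>F\<^sub>\<lambda>\<close> by \<open>0\<close>.  It is presented by generators and relations: the word
  \<open>([X\<^sub>1, \<dots>, X\<^sub>k], f)\<close> stands for \<open>X\<^sub>1 \<cdots> X\<^sub>k \<otimes> f\<close>.  The first four rules give the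
  tensor product of the tensor algebra of \<open>\<g>\<close> with \<open>F\<^sub>\<lambda>\<close>, \<open>comm\<close> passes to \<open>U(\<g>)\<close>, and the last two
  balance the tensor product over \<open>\<k> \<oplus> \<p>\<^sup>+\<close>.
\<close>

type_synonym ('n, 'f) free_words = "((complex, 'n) mat2 list \<times> 'f) \<Rightarrow>\<^sub>0 complex"

abbreviation word :: "(complex, 'n::finite) mat2 list \<Rightarrow> 'f \<Rightarrow> ('n, 'f) free_words" where
  "word u f \<equiv> Poly_Mapping.single (u, f) 1"

abbreviation fscale :: "complex \<Rightarrow> ('n::finite, 'f) free_words \<Rightarrow> ('n, 'f) free_words" where
  "fscale c \<equiv> Poly_Mapping.map ((*) c)"

definition sp_words :: "('n::finite, 'f) free_words set" where
  "sp_words = {x. fst ` Poly_Mapping.keys x \<subseteq> lists sp_alg}"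

definition prepend :: "(complex, 'n::finite) mat2 \<Rightarrow> ('n, 'f) free_words \<Rightarrow> ('n, 'f) free_words"
  where
  "prepend X x =
     (\<Sum>(u, f) \<in> Poly_Mapping.keys x. Poly_Mapping.single (X # u, f) (Poly_Mapping.lookup x (u, f)))"

inductive_set N_relators ::
  "(complex \<Rightarrow> 'f \<Rightarrow> 'f::ab_group_add) \<Rightarrow>
     ((complex, 'n::{finite,linorder}) mat2 \<Rightarrow> 'f \<Rightarrow> 'f) \<Rightarrow> ('n, 'f) free_words set"
  for s \<sigma> where
  add: "\<lbrakk>u \<in> lists sp_alg; w \<in> lists sp_alg; X \<in> sp_alg; Y \<in> sp_alg\<rbrakk> \<Longrightarrow>
     word (u @ (X + Y) # w) f - word (u @ X # w) f - word (u @ Y # w) f \<in> N_relators s \<sigma>"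
| scale: "\<lbrakk>u \<in> lists sp_alg; w \<in> lists sp_alg; X \<in> sp_alg\<rbrakk> \<Longrightarrow>
     word (u @ mscale c X # w) f - fscale c (word (u @ X # w) f) \<in> N_relators s \<sigma>"
| add_F: "u \<in> lists sp_alg \<Longrightarrow> word u (f + f') - word u f - word u f' \<in> N_relators s \<sigma>"
| scale_F: "u \<in> lists sp_alg \<Longrightarrow> word u (s c f) - fscale c (word u f) \<in> N_relators s \<sigma>"
| comm: "\<lbrakk>u \<in> lists sp_alg; w \<in> lists sp_alg; X \<in> sp_alg; Y \<in> sp_alg\<rbrakk> \<Longrightarrow>
     word (u @ X # Y # w) f - word (u @ Y # X # w) f - word (u @ bracket X Y # w) f
       \<in> N_relators s \<sigma>"
| balance_k: "\<lbrakk>u \<in> lists sp_alg; Y \<in> sp_compact\<rbrakk> \<Longrightarrow>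
     word (u @ [Y]) f - word u (\<sigma> Y f) \<in> N_relators s \<sigma>"
| balance_p: "\<lbrakk>u \<in> lists sp_alg; Z \<in> sp_plus\<rbrakk> \<Longrightarrow> word (u @ [Z]) f \<in> N_relators s \<sigma>"

definition N_class ::
  "(complex \<Rightarrow> 'f \<Rightarrow> 'f::ab_group_add) \<Rightarrow>
     ((complex, 'n::{finite,linorder}) mat2 \<Rightarrow> 'f \<Rightarrow> 'f) \<Rightarrow>
     ('n, 'f) free_words \<Rightarrow> ('n, 'f) free_words set" where
  "N_class s \<sigma> x = {x + r | r. r \<in> module.span fscale (N_relators s \<sigma>)}"

definition N_carrier ::
  "(complex \<Rightarrow> 'f \<Rightarrow> 'f::ab_group_add) \<Rightarrow>
     ((complex, 'n::{finite,linorder}) mat2 \<Rightarrow> 'f \<Rightarrow> 'f) \<Rightarrow> ('n, 'f) free_words set set" where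
  "N_carrier s \<sigma> = N_class s \<sigma> ` sp_words"

text \<open>
  The vector space operations on \<open>N(\<lambda>)\<close> and the action of \<open>X \<in> \<g>\<close> are those of \<open>sp_words\<close>, \<open>X\<close>
  acting by \<open>prepend X\<close>, computed on representatives.
\<close>

definition N_epimorphism ::
  "(complex \<Rightarrow> 'f \<Rightarrow> 'f::ab_group_add) \<Rightarrow>
     ((complex, 'n::{finite,linorder}) mat2 \<Rightarrow> 'f \<Rightarrow> 'f) \<Rightarrow>
   (complex \<Rightarrow> 'v \<Rightarrow> 'v::ab_group_add) \<Rightarrow> ((complex, 'n) mat2 \<Rightarrow> 'v \<Rightarrow> 'v) \<Rightarrow>
   (('n, 'f) free_words set \<Rightarrow> 'v) \<Rightarrow> bool" where
  "N_epimorphism s \<sigma> t \<rho> \<phi> \<longleftrightarrow>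
     (\<forall>x\<in>sp_words. \<forall>y\<in>sp_words.
        \<phi> (N_class s \<sigma> (x + y)) = \<phi> (N_class s \<sigma> x) + \<phi> (N_class s \<sigma> y)) \<and>
     (\<forall>x\<in>sp_words. \<forall>c. \<phi> (N_class s \<sigma> (fscale c x)) = t c (\<phi> (N_class s \<sigma> x))) \<and>
     (\<forall>x\<in>sp_words. \<forall>X\<in>sp_alg. \<phi> (N_class s \<sigma> (prepend X x)) = \<rho> X (\<phi> (N_class s \<sigma> x))) \<and>
     \<phi> ` N_carrier s \<sigma> = UNIV"

definition irreducible_quotient_of_N ::
  "(complex \<Rightarrow> 'f \<Rightarrow> 'f::ab_group_add) \<Rightarrow>
     ((complex, 'n::{finite,linorder}) mat2 \<Rightarrow> 'f \<Rightarrow> 'f) \<Rightarrow>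
   (complex \<Rightarrow> 'v \<Rightarrow> 'v::ab_group_add) \<Rightarrow> ((complex, 'n) mat2 \<Rightarrow> 'v \<Rightarrow> 'v) \<Rightarrow> bool" where
  "irreducible_quotient_of_N s \<sigma> t \<rho> \<longleftrightarrow>
     irreducible_module sp_alg t \<rho> \<and> (\<exists>\<phi>. N_epimorphism s \<sigma> t \<rho> \<phi>)"

section \<open>The group \<open>G\<close>\<close>

definition Sp_group :: "(real, 'n::finite) mat2 set" where
  "Sp_group = {g. transpose g ** symp_form ** g = symp_form}"

text \<open>
  \<open>G\<close> is the universal cover of the connected group \<open>Sp_group\<close>: homotopy classes (relative to the
  end points) of paths starting at the identity, multiplied pointwise.
\<close>

type_synonym 'n Gelem = "(real \<Rightarrow> (real, 'n) mat2) set"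

definition Sp_paths :: "(real \<Rightarrow> (real, 'n::finite) mat2) set" where
  "Sp_paths = {p. path p \<and> path_image p \<subseteq> Sp_group \<and> pathstart p = mat 1}"

definition pclass :: "(real \<Rightarrow> (real, 'n::finite) mat2) \<Rightarrow> 'n Gelem" where
  "pclass p = {q. homotopic_paths Sp_group p q}"

definition G_group :: "'n::finite Gelem set" where
  "G_group = pclass ` Sp_paths"

definition G_mult :: "'n::finite Gelem \<Rightarrow> 'n Gelem \<Rightarrow> 'n Gelem" where
  "G_mult a b = (\<Union>p\<in>a. \<Union>q\<in>b. pclass (\<lambda>t. p t ** q t))"

definition G_proj :: "'n::finite Gelem \<Rightarrow> (real, 'n) mat2" where
  "G_proj a = pathfinish (SOME p. p \<in> a)"

definition G_topology :: "'n::finite Gelem topology" where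
  "G_topology = topology_generated_by
     {{pclass (p +++ q) | q. path q \<and> path_image q \<subseteq> Sp_group \<inter> U \<and> pathstart q = pathfinish p}
      | p U. p \<in> Sp_paths \<and> open U \<and> pathfinish p \<in> U}"

text \<open>The lift of the Cartan involution \<open>g \<mapsto> (g\<^sup>-\<^sup>1)\<^sup>T\<close> and its fixed point subgroup \<open>K\<close>.\<close>

definition G_cartan_inv :: "'n::finite Gelem \<Rightarrow> 'n Gelem" where
  "G_cartan_inv a = (\<Union>p\<in>a. pclass (\<lambda>t. transpose (matrix_inv (p t))))"

definition K_group :: "'n::finite Gelem set" where
  "K_group = {a \<in> G_group. G_cartan_inv a = a}"

definition mat_exp :: "(real, 'n::finite) mat2 \<Rightarrow> (real, 'n) mat2" where
  "mat_exp X = suminf (\<lambda>k. (1 / fact k) *\<^sub>R (((**) X ^^ k) (mat 1)))"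

definition G_exp :: "(real, 'n::finite) mat2 \<Rightarrow> 'n Gelem" where
  "G_exp X = pclass (\<lambda>t. mat_exp (t *\<^sub>R X))"

section \<open>\<open>(\<g>, K)\<close>-modules and unitarity\<close>

definition K_finite :: "(complex \<Rightarrow> 'v \<Rightarrow> 'v::ab_group_add) \<Rightarrow> ('n::finite Gelem \<Rightarrow> 'v \<Rightarrow> 'v) \<Rightarrow> 'v \<Rightarrow> bool"
  where
  "K_finite s \<kappa> v \<longleftrightarrow> (\<exists>B. finite B \<and> (\<forall>k\<in>K_group. \<kappa> k v \<in> module.span s B))"

text \<open>
  Since \<open>K\<close> acts locally finitely, continuity and differentiability of \<open>k \<mapsto> \<kappa> k v\<close> (which takes
  values in a finite-dimensional subspace) can be tested with arbitrary linear functionals.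
\<close>

definition gK_module ::
  "(complex \<Rightarrow> 'v \<Rightarrow> 'v::ab_group_add) \<Rightarrow> ((complex, 'n::finite) mat2 \<Rightarrow> 'v \<Rightarrow> 'v) \<Rightarrow>
     ('n Gelem \<Rightarrow> 'v \<Rightarrow> 'v) \<Rightarrow> bool" where
  "gK_module s \<rho> \<kappa> \<longleftrightarrow> lie_module sp_alg s \<rho> \<and>
     (\<forall>k\<in>K_group. Vector_Spaces.linear s s (\<kappa> k) \<and> bij (\<kappa> k)) \<and>
     (\<forall>k\<in>K_group. \<forall>k'\<in>K_group. \<kappa> (G_mult k k') = \<kappa> k \<circ> \<kappa> k') \<and>
     (\<forall>v. K_finite s \<kappa> v) \<and>
     (\<forall>v f. Vector_Spaces.linear s (*) f \<longrightarrow>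
        continuous_map (subtopology G_topology K_group) euclidean (\<lambda>k. f (\<kappa> k v))) \<and>
     (\<forall>X\<in>sp_compact. \<forall>v f. Vector_Spaces.linear s (*) f \<longrightarrow>
        ((\<lambda>t. f (\<kappa> (G_exp (t *\<^sub>R X)) v)) has_vector_derivative f (\<rho> (complexify X) v)) (at 0)) \<and>
     (\<forall>k\<in>K_group. \<forall>X\<in>sp_alg. \<forall>v.
        \<kappa> k (\<rho> X v) =
        \<rho> (complexify (G_proj k) ** X ** complexify (matrix_inv (G_proj k))) (\<kappa> k v))"

text \<open>The case distinction is there because \<^locale>\<open>Metric_space\<close> wants symmetry on the whole type.\<close>

definition ip_dist :: "'h set \<Rightarrow> ('h \<Rightarrow> 'h \<Rightarrow> complex) \<Rightarrow> 'h \<Rightarrow> 'h::ab_group_add \<Rightarrow> real" where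
  "ip_dist H ip x y = (if x \<in> H \<and> y \<in> H then sqrt (Re (ip (x - y) (x - y))) else 0)"

definition hilbert_space ::
  "(complex \<Rightarrow> 'h \<Rightarrow> 'h::ab_group_add) \<Rightarrow> 'h set \<Rightarrow> ('h \<Rightarrow> 'h \<Rightarrow> complex) \<Rightarrow> bool" where
  "hilbert_space s H ip \<longleftrightarrow> vector_space s \<and> module.subspace s H \<and>
     (\<forall>x\<in>H. \<forall>y\<in>H. \<forall>z\<in>H. ip (x + y) z = ip x z + ip y z) \<and>
     (\<forall>x\<in>H. \<forall>y\<in>H. \<forall>c. ip (s c x) y = c * ip x y) \<and>
     (\<forall>x\<in>H. \<forall>y\<in>H. ip y x = cnj (ip x y)) \<and>
     (\<forall>x\<in>H. x \<noteq> 0 \<longrightarrow> Re (ip x x) > 0) \<and>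
     Metric_space.mcomplete H (ip_dist H ip)"

definition unitary_rep ::
  "(complex \<Rightarrow> 'h \<Rightarrow> 'h::ab_group_add) \<Rightarrow> 'h set \<Rightarrow> ('h \<Rightarrow> 'h \<Rightarrow> complex) \<Rightarrow>
     ('n::finite Gelem \<Rightarrow> 'h \<Rightarrow> 'h) \<Rightarrow> bool" where
  "unitary_rep s H ip \<pi> \<longleftrightarrow> hilbert_space s H ip \<and>
     (\<forall>g\<in>G_group. \<pi> g ` H = H) \<and>
     (\<forall>g\<in>G_group. \<forall>x\<in>H. \<forall>y\<in>H. \<pi> g (x + y) = \<pi> g x + \<pi> g y) \<and>
     (\<forall>g\<in>G_group. \<forall>x\<in>H. \<forall>c. \<pi> g (s c x) = s c (\<pi> g x)) \<and>
     (\<forall>g\<in>G_group. \<forall>x\<in>H. \<forall>y\<in>H. ip (\<pi> g x) (\<pi> g y) = ip x y) \<and>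
     (\<forall>g\<in>G_group. \<forall>g'\<in>G_group. \<forall>x\<in>H. \<pi> (G_mult g g') x = \<pi> g (\<pi> g' x)) \<and>
     (\<forall>x\<in>H. continuous_map G_topology (Metric_space.mtopology H (ip_dist H ip)) (\<lambda>g. \<pi> g x))"

text \<open>
  \<open>T\<close> identifies the \<open>(\<g>, K)\<close>-module with that of the \<open>K\<close>-finite vectors, on which
  \<open>X \<in> \<g>\<^sub>0\<close> acts by the derivative of \<open>\<pi> (G_exp (t *\<^sub>R X))\<close> at \<open>t = 0\<close> (and \<open>\<g>\<close> by complex linearity).
\<close>

definition K_finite_iso ::
  "(complex \<Rightarrow> 'v \<Rightarrow> 'v::ab_group_add) \<Rightarrow> ((complex, 'n::finite) mat2 \<Rightarrow> 'v \<Rightarrow> 'v) \<Rightarrow>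
     ('n Gelem \<Rightarrow> 'v \<Rightarrow> 'v) \<Rightarrow>
   (complex \<Rightarrow> 'h \<Rightarrow> 'h::ab_group_add) \<Rightarrow> 'h set \<Rightarrow> ('h \<Rightarrow> 'h \<Rightarrow> complex) \<Rightarrow>
     ('n Gelem \<Rightarrow> 'h \<Rightarrow> 'h) \<Rightarrow> ('v \<Rightarrow> 'h) \<Rightarrow> bool" where
  "K_finite_iso s \<rho> \<kappa> s' H ip \<pi> T \<longleftrightarrow>
     Vector_Spaces.linear s s' T \<and>
     bij_betw T UNIV {x \<in> H. K_finite s' \<pi> x} \<and>
     (\<forall>k\<in>K_group. \<forall>v. T (\<kappa> k v) = \<pi> k (T v)) \<and>
     (\<forall>X\<in>sp_alg. \<forall>v.
        ((\<lambda>t::real. ip_dist H ip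
            (s' (of_real (1 / t)) (\<pi> (G_exp (t *\<^sub>R X)) (T v) - T v)) (T (\<rho> (complexify X) v)))
         \<longlongrightarrow> 0) (at 0))"

text \<open>
  The Hilbert space ranges over all linear subspaces of \<open>nat \<Rightarrow> complex\<close> with an arbitrary complete
  inner product; every Hilbert space of Hilbert dimension at most that of the continuum is
  isometric to one of these.  No generality is lost for modules of countable dimension, as one may
  replace a Hilbert space by the closure of its \<open>K\<close>-finite vectors.
\<close>

definition unitary_gK_module ::
  "(complex \<Rightarrow> 'v \<Rightarrow> 'v::ab_group_add) \<Rightarrow> ((complex, 'n::finite) mat2 \<Rightarrow> 'v \<Rightarrow> 'v) \<Rightarrow>
     ('n Gelem \<Rightarrow> 'v \<Rightarrow> 'v) \<Rightarrow> bool" where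
  "unitary_gK_module s \<rho> \<kappa> \<longleftrightarrow>
     (\<exists>(H :: (nat \<Rightarrow> complex) set) ip \<pi> T.
        unitary_rep (\<lambda>c x i. c * x i) H ip \<pi> \<and>
        K_finite_iso s \<rho> \<kappa> (\<lambda>c x i. c * x i) H ip \<pi> T)"

end

theory Submission
  imports Defs
begin

text \<open>The module is found in the theta lift from the compact group \<open>O(k)\<close>, where \<open>k = 2n - q - r + l - 1\<close>,
so that \<open>\<lambda>\<^sub>1 = - k/2\<close>. The Lie algebra acts on polynomials in the entries of an \<open>n \<times> k\<close> matrix by quadratic
elements of the Weyl algebra, its real form by operators that are skew for the Fischer inner product, and a
product of minors is a highest weight vector of weight \<open>\<lambda>\<close>. The submodule of
\<open>L\<^sub>\<lambda> \<times>\<close> Fock generated by the pair of highest weight vectors is the graph of an embedding: by skewness, a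
submodule of Fock that is orthogonal to the highest weight vector is orthogonal to all that this vector generates.

Polynomials are analytic vectors with a common radius, so the exponential series defines unitary operators near
the identity. They are multiplicative there, and holonomy along paths extends them to the universal cover. On
\<open>K\<close>, which is generated by one-parameter subgroups, this agrees with the given action. Finally, the
\<open>K\<close>-finite vectors are polynomials, because the one-parameter group of the centre of \<open>K\<close> acts on degree \<open>d\<close> by
the character \<open>exp (- i t (d + n k/2))\<close>.\<close>

text \<open>Sums over finitely supported functions and series both claim the notation \<open>\<Sum>x. f x\<close>.\<close>
no_syntax
  "_Sum_any" :: "pttrn \<Rightarrow> 'a \<Rightarrow> 'a::comm_monoid_add"    (\<open>(\<open>indent=2 notation=\<open>binder \<Sum>\<close>\<close>\<Sum>_. _)\<close> [0, 10] 10)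

section \<open>Exponential and logarithm in a Banach algebra\<close>

text \<open>G is given only through homotopy classes of paths of matrices, and the operators of the
  representation are unbounded. The central obstacle is therefore that exponentials multiply near
  the identity. No Baker-Campbell-Hausdorff series is summed: the logarithm of exp (t X) h is
  followed as a curve in t, and skewness takes the place of a uniqueness theorem for y' = X y. The
  analysis is set up for a Banach algebra acting on a space without topology, so that it serves for
  the algebra itself as well as for polynomials. The numbers come from a Young diagram with one
  column of length M = n - q and further columns of length at most m = n - r. A row of the matrix
  loses 1 from its weight for each minor in which it occurs, which gives the steps of \<lambda>
  after q and after r rows. Such a diagram belongs to O(k) when its first two columns have total
  length at most k; as M + m = 2 n - q - r, this is exactly 1 \<le> l. The same inequality makes the
  product of minors harmonic, that is, annihilated by p^+.\<close>

lemma has_vector_derivative_series: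
  fixes f f' :: "nat \<Rightarrow> real \<Rightarrow> 'b::banach"
  assumes S: "convex S"
    and d: "\<And>n t. t \<in> S \<Longrightarrow> (f n has_vector_derivative f' n t) (at t within S)"
    and b: "\<And>n t. t \<in> S \<Longrightarrow> norm (f' n t) \<le> M n" and M: "summable M"
    and s: "\<And>t. t \<in> S \<Longrightarrow> summable (\<lambda>n. f n t)"
    and t: "t \<in> S"
  shows "((\<lambda>t. \<Sum>n. f n t) has_vector_derivative (\<Sum>n. f' n t)) (at t within S)"
proof -
  have u: "uniform_limit S (\<lambda>n t. \<Sum>i<n. f' i t) (\<lambda>t. \<Sum>i. f' i t) sequentially"
    by (rule Weierstrass_m_test[OF b M])
  have "\<exists>g. \<forall>x\<in>S. (\<lambda>n. f n x) sums (g x) \<and> (g has_derivative (\<lambda>h. h *\<^sub>R (\<Sum>i. f' i x))) (at x within S)"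
  proof (rule has_derivative_series[where f=f and f'="\<lambda>i x h. h *\<^sub>R f' i x" and g'="\<lambda>x h. h *\<^sub>R (\<Sum>i. f' i x)", OF S _ _ t summable_sums[OF s[OF t]]])
    show "(f n has_derivative (\<lambda>h. h *\<^sub>R f' n x)) (at x within S)" if "x \<in> S" for n x
      using d[OF that] by (simp add: has_vector_derivative_def)
    fix e :: real assume e: "e > 0"
    from uniform_limitD[OF u e]
    show "\<forall>\<^sub>F n in sequentially. \<forall>x\<in>S. \<forall>h. norm ((\<Sum>i<n. h *\<^sub>R f' i x) - h *\<^sub>R (\<Sum>i. f' i x)) \<le> e * norm h"
    proof eventually_elim
      case (elim n)
      show ?case
      proof (intro ballI allI)
        fix x h assume "x \<in> S"
        have "norm ((\<Sum>i<n. h *\<^sub>R f' i x) - h *\<^sub>R (\<Sum>i. f' i x)) = \<bar>h\<bar> * norm ((\<Sum>i<n. f' i x) - (\<Sum>i. f' i x))"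
          by (simp add: scaleR_right.sum[symmetric] scaleR_diff_right[symmetric])
        also have "\<dots> \<le> \<bar>h\<bar> * e"
          using elim \<open>x \<in> S\<close> by (intro mult_left_mono) (auto simp: dist_norm intro: less_imp_le)
        finally show "norm ((\<Sum>i<n. h *\<^sub>R f' i x) - h *\<^sub>R (\<Sum>i. f' i x)) \<le> e * norm h"
          by (simp add: mult.commute)
      qed
    qed
  qed
  then obtain g where g: "\<And>x. x \<in> S \<Longrightarrow> (\<lambda>n. f n x) sums (g x)"
      "\<And>x. x \<in> S \<Longrightarrow> (g has_derivative (\<lambda>h. h *\<^sub>R (\<Sum>i. f' i x))) (at x within S)" by blast
  have "((\<lambda>t. \<Sum>n. f n t) has_derivative (\<lambda>h. h *\<^sub>R (\<Sum>i. f' i t))) (at t within S)"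
    by (rule has_derivative_transform[OF t _ g(2)[OF t]]) (simp add: g(1)[THEN sums_unique])
  then show ?thesis by (simp add: has_vector_derivative_def)
qed

lemma has_vector_derivative_power:
  fixes N :: "real \<Rightarrow> 'a::real_normed_algebra_1"
  assumes "(N has_vector_derivative N') (at t within S)"
  shows "((\<lambda>t. N t ^ m) has_vector_derivative (\<Sum>a<m. N t ^ a * N' * N t ^ (m - Suc a))) (at t within S)"
proof (induction m)
  case (Suc m)
  have eq: "(\<Sum>a<Suc m. N t ^ a * N' * N t ^ (Suc m - Suc a)) =
      (\<Sum>a<m. N t ^ a * N' * N t ^ (m - Suc a)) * N t + N t ^ m * N'"
    by (auto simp: sum_distrib_right mult.assoc power_Suc2[symmetric] Suc_diff_Suc intro!: sum.cong)
  have "((\<lambda>t. N t ^ m * N t) has_vector_derivative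
      (N t ^ m * N' + (\<Sum>a<m. N t ^ a * N' * N t ^ (m - Suc a)) * N t)) (at t within S)"
    by (rule has_vector_derivative_mult[OF Suc assms])
  then show ?case by (simp only: eq power_Suc2 add.commute)
qed simp

lemma norm_power_sum_le:
  fixes N N' :: "'a::real_normed_algebra_1"
  assumes "norm N \<le> r" "norm N' \<le> c"
  shows "norm (\<Sum>a<m. N ^ a * N' * N ^ (m - Suc a)) \<le> real m * (c * r ^ (m - 1))"
proof -
  have r: "0 \<le> r" and c: "0 \<le> c" using assms norm_ge_zero order_trans by blast+
  have "norm (N ^ a * N' * N ^ (m - Suc a)) \<le> c * r ^ (m - 1)" if "a < m" for a
  proof -
    have "norm (N ^ a * N' * N ^ (m - Suc a)) \<le> r ^ a * c * r ^ (m - Suc a)" using assms r c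
      by (intro norm_mult_ineq[THEN order_trans] mult_mono norm_power_ineq[THEN order_trans] power_mono)
        (auto intro!: mult_nonneg_nonneg)
    also have "\<dots> = c * r ^ (a + (m - Suc a))" by (simp add: power_add)
    also have "a + (m - Suc a) = m - 1" using that by simp
    finally show ?thesis .
  qed
  then have "norm (\<Sum>a<m. N ^ a * N' * N ^ (m - Suc a)) \<le> (\<Sum>a<m. c * r ^ (m - 1))"
    by (intro sum_norm_le) auto
  then show ?thesis by simp
qed

text \<open>The Mercator series of log (1 + N).\<close>

definition lnp :: "'a::{real_normed_algebra_1,banach} \<Rightarrow> 'a" where
  "lnp N = (\<Sum>m. ((- 1) ^ m / real (Suc m)) *\<^sub>R N ^ Suc m)"

lemma norm_lnp_term: "norm (((- 1) ^ m / real (Suc m)) *\<^sub>R (N::'a::real_normed_algebra_1) ^ Suc m) \<le> norm N ^ Suc m"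
proof -
  have "norm (((- 1) ^ m / real (Suc m)) *\<^sub>R N ^ Suc m) = norm (N ^ Suc m) / real (Suc m)"
    by (simp add: power_abs abs_mult)
  also have "\<dots> \<le> norm (N ^ Suc m) / 1" by (intro divide_left_mono) auto
  also have "\<dots> \<le> norm N ^ Suc m" using norm_power_ineq[of N "Suc m"] by simp
  finally show ?thesis .
qed

lemma summable_lnp:
  fixes N :: "'a::{real_normed_algebra_1,banach}"
  assumes "norm N < 1" shows "summable (\<lambda>m. ((- 1) ^ m / real (Suc m)) *\<^sub>R N ^ Suc m)"
  by (rule summable_comparison_test'[where g="\<lambda>m. norm N ^ Suc m" and N=0])
    (use assms norm_lnp_term in \<open>auto simp: summable_mult2 intro!: summable_mult summable_geometric\<close>)

lemma norm_lnp_le: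
  fixes N :: "'a::{real_normed_algebra_1,banach}"
  assumes "norm N < 1" shows "norm (lnp N) \<le> norm N / (1 - norm N)"
proof -
  have "norm (lnp N) \<le> (\<Sum>m. norm N ^ Suc m)" unfolding lnp_def using assms
    by (intro norm_suminf_le norm_lnp_term) (auto intro!: summable_mult summable_geometric)
  also have "\<dots> = norm N / (1 - norm N)"
    using assms by (simp add: suminf_mult summable_geometric suminf_geometric)
  finally show ?thesis .
qed

lemma lnp_0 [simp]: "lnp 0 = 0" by (simp add: lnp_def)

lemma summable_deriv_geometric:
  fixes r :: real assumes "0 \<le> r" "r < 1" shows "summable (\<lambda>m. real (Suc m) * r ^ m)"
  using termdiff_converges[of r 1 "\<lambda>_. 1"] assms by (simp add: diffs_def summable_geometric)

text \<open>\<open>N t\<close> and \<open>N' t\<close> need not commute, so the derivative remains a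
  series. The majorant c r^m of its terms arises from the m + 1 positions of N' against the
  coefficient 1 / (m + 1).\<close>

lemma has_vector_derivative_lnp:
  fixes N :: "real \<Rightarrow> 'a::{real_normed_algebra_1,banach}"
  assumes S: "convex S" and d: "\<And>t. t \<in> S \<Longrightarrow> (N has_vector_derivative N' t) (at t within S)"
    and r: "\<And>t. t \<in> S \<Longrightarrow> norm (N t) \<le> r" "r < 1" and c: "\<And>t. t \<in> S \<Longrightarrow> norm (N' t) \<le> c" and t: "t \<in> S"
  shows "((\<lambda>t. lnp (N t)) has_vector_derivative
    (\<Sum>m. ((- 1) ^ m / real (Suc m)) *\<^sub>R (\<Sum>a<Suc m. N t ^ a * N' t * N t ^ (m - a)))) (at t within S)"
  unfolding lnp_def
proof (rule has_vector_derivative_series[OF S _ _ _ _ t, where M="\<lambda>m. c * r ^ m"])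
  have r0: "0 \<le> r" using r(1)[OF t] norm_ge_zero order_trans by blast
  show "summable (\<lambda>m. c * r ^ m)" using r0 r by (intro summable_mult summable_geometric) auto
  fix n s assume s: "s \<in> S"
  show "((\<lambda>t. ((- 1) ^ n / real (Suc n)) *\<^sub>R N t ^ Suc n) has_vector_derivative
      ((- 1) ^ n / real (Suc n)) *\<^sub>R (\<Sum>a<Suc n. N s ^ a * N' s * N s ^ (n - a))) (at s within S)"
    using bounded_linear.has_vector_derivative[OF bounded_linear_scaleR_right has_vector_derivative_power[OF d[OF s], of "Suc n"]]
    by simp
  have "norm (((- 1) ^ n / real (Suc n)) *\<^sub>R (\<Sum>a<Suc n. N s ^ a * N' s * N s ^ (n - a)))
     = (1 / real (Suc n)) * norm (\<Sum>a<Suc n. N s ^ a * N' s * N s ^ (n - a))"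
    by (simp only: norm_scaleR) (simp add: power_abs)
  also have "\<dots> \<le> (1 / real (Suc n)) * (real (Suc n) * (c * r ^ n))"
    using norm_power_sum_le[OF r(1)[OF s] c[OF s], of "Suc n"] by (intro mult_left_mono) auto
  also have "\<dots> = c * r ^ n" by simp
  finally show "norm (((- 1) ^ n / real (Suc n)) *\<^sub>R (\<Sum>a<Suc n. N s ^ a * N' s * N s ^ (n - a))) \<le> c * r ^ n" .
next
  show "summable (\<lambda>m. ((- 1) ^ m / real (Suc m)) *\<^sub>R N s ^ Suc m)" if "s \<in> S" for s
    by (rule summable_lnp) (use r that in force)
qed

lemma suminf_geometric_mult:
  fixes x :: "'a::{real_normed_algebra_1,banach}"
  assumes "norm x < 1"
  shows "(\<Sum>m. x ^ m) * (1 - x) = 1"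
proof -
  note su = complete_algebra_summable_geometric[OF assms]
  have "(\<Sum>m. x ^ Suc m) = (\<Sum>m. x ^ m * x)" by (simp only: power_Suc2)
  also have "\<dots> = (\<Sum>m. x ^ m) * x" by (rule suminf_mult2[OF su, symmetric])
  finally show ?thesis
    using suminf_split_head[OF su] by (simp add: right_diff_distrib)
qed

lemma sum_power_commuting:
  fixes x y :: "'a::real_algebra_1"
  assumes com: "x * y = y * x"
  shows "(\<Sum>a<Suc m. x ^ a * y * x ^ (m - a)) = real (Suc m) *\<^sub>R (x ^ m * y)"
proof -
  have "(\<Sum>a<Suc m. x ^ a * y * x ^ (m - a)) = (\<Sum>a<Suc m. x ^ m * y)"
  proof (intro sum.cong refl)
    fix a assume "a \<in> {..<Suc m}"
    then have "x ^ m = x ^ a * x ^ (m - a)" by (simp add: power_add[symmetric])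
    then show "x ^ a * y * x ^ (m - a) = x ^ m * y" by (metis mult.assoc power_commuting_commutes[OF com])
  qed
  then show ?thesis by (simp add: scaleR_conv_of_real)
qed

text \<open>Commutation collapses the series to N' times the geometric series in - N, that is to (1
  + N)^-1 N'. The quotient is handed over as a solution A of (1 + N) A = N', so that callers need
  not produce an inverse.\<close>

lemma has_vector_derivative_lnp_commuting:
  fixes N :: "real \<Rightarrow> 'a::{real_normed_algebra_1,banach}"
  assumes S: "convex S" and d: "\<And>t. t \<in> S \<Longrightarrow> (N has_vector_derivative N' t) (at t within S)"
    and r: "\<And>t. t \<in> S \<Longrightarrow> norm (N t) \<le> r" "r < 1" and c: "\<And>t. t \<in> S \<Longrightarrow> norm (N' t) \<le> c" and t: "t \<in> S"
    and com: "N t * N' t = N' t * N t" and A: "(1 + N t) * A = N' t"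
  shows "((\<lambda>t. lnp (N t)) has_vector_derivative A) (at t within S)"
proof -
  have n1: "norm (- N t) < 1" using r t by force
  have e: "((- 1) ^ m / real (Suc m)) *\<^sub>R (\<Sum>a<Suc m. N t ^ a * N' t * N t ^ (m - a)) = (- N t) ^ m * N' t" for m
    unfolding sum_power_commuting[OF com] by (cases "even m") (auto simp: power_minus[of "N t" m])
  have "(\<lambda>m. (- N t) ^ m * N' t) sums ((\<Sum>m. (- N t) ^ m) * N' t)"
    by (intro sums_mult2 summable_sums complete_algebra_summable_geometric n1)
  moreover have "(\<Sum>m. (- N t) ^ m) * (1 + N t) = 1" using suminf_geometric_mult[OF n1] by simp
  ultimately have "(\<Sum>m. (- N t) ^ m * N' t) = A" using A by (metis mult.assoc mult_1 sums_unique)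
  then show ?thesis using has_vector_derivative_lnp[OF S d r c t] by (simp only: e)
qed

lemma has_vector_derivative_exp_commuting:
  fixes W :: "real \<Rightarrow> 'a::{real_normed_algebra_1,banach}"
  assumes S: "convex S" and d: "\<And>t. t \<in> S \<Longrightarrow> (W has_vector_derivative W' t) (at t within S)"
    and r: "\<And>t. t \<in> S \<Longrightarrow> norm (W t) \<le> r" and c: "\<And>t. t \<in> S \<Longrightarrow> norm (W' t) \<le> c" and t: "t \<in> S"
    and com: "W t * W' t = W' t * W t"
  shows "((\<lambda>t. exp (W t)) has_vector_derivative exp (W t) * W' t) (at t within S)"
proof -
  let ?W = "\<lambda>t m a. W t ^ a * W' t * W t ^ (m - Suc a)"
  have "((\<lambda>t. \<Sum>m. W t ^ m /\<^sub>R fact m) has_vector_derivative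
     (\<Sum>m. (\<Sum>a<m. ?W t m a) /\<^sub>R fact m)) (at t within S)"
  proof (rule has_vector_derivative_series[OF S _ _ _ _ t, where M="\<lambda>m. (if m = 0 then 0 else c * (r ^ (m - 1) /\<^sub>R fact (m - 1)))"])
    show "summable (\<lambda>m. (if m = 0 then 0 else c * (r ^ (m - 1) /\<^sub>R fact (m - 1))))"
      by (subst summable_Suc_iff[symmetric]) (use summable_exp_generic[of r] in \<open>auto intro!: summable_mult simp: \<close>)
    fix n s assume s: "s \<in> S"
    show "((\<lambda>t. W t ^ n /\<^sub>R fact n) has_vector_derivative
      (\<Sum>a<n. ?W s n a) /\<^sub>R fact n) (at s within S)"
      by (intro bounded_linear.has_vector_derivative[OF bounded_linear_scaleR_right] has_vector_derivative_power d s)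
    have "norm ((\<Sum>a<n. ?W s n a) /\<^sub>R fact n) \<le> (real n * (c * r ^ (n - 1))) /\<^sub>R fact n"
      using norm_power_sum_le[OF r(1)[OF s] c[OF s], of n] by (auto intro!: mult_left_mono)
    also have "(real n * (c * r ^ (n - 1))) /\<^sub>R fact n = (if n = 0 then 0 else c * (r ^ (n - 1) /\<^sub>R fact (n - 1)))"
      by (cases n) (auto simp: divide_simps)
    finally show "norm ((\<Sum>a<n. ?W s n a) /\<^sub>R fact n) \<le>
       (if n = 0 then 0 else c * (r ^ (n - 1) /\<^sub>R fact (n - 1)))" .
  next
    show "summable (\<lambda>m. W s ^ m /\<^sub>R fact m)" for s by (rule summable_exp_generic)
  qed
  moreover have "(\<lambda>m. (\<Sum>a<m. ?W t m a) /\<^sub>R fact m) sums (exp (W t) * W' t)"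
  proof -
    have h: "(\<Sum>a<Suc m. ?W t (Suc m) a) = real (Suc m) *\<^sub>R (W t ^ m * W' t)" for m
      using sum_power_commuting[OF com, of m] by (simp del: sum.lessThan_Suc)
    have "inverse (fact (Suc m)) * real (Suc m) = inverse (fact m)" for m by (simp add: fact_Suc divide_simps)
    then have e: "(\<Sum>a<Suc m. ?W t (Suc m) a) /\<^sub>R fact (Suc m) = (W t ^ m /\<^sub>R fact m) * W' t" for m
      by (simp only: h scaleR_scaleR mult_scaleR_left)
    have "(\<lambda>m. (W t ^ m /\<^sub>R fact m) * W' t) sums (exp (W t) * W' t)"
      unfolding exp_def by (intro sums_mult2 summable_sums summable_exp_generic)
    then have "(\<lambda>m. (\<Sum>a<Suc m. ?W t (Suc m) a) /\<^sub>R fact (Suc m)) sums (exp (W t) * W' t)"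
      by (simp only: e)
    from sums_Suc[OF this] show ?thesis by simp
  qed
  ultimately show ?thesis unfolding exp_def[symmetric] by (simp add: sums_iff exp_def)
qed

lemma has_vector_derivative_zero_eq:
  fixes f :: "real \<Rightarrow> 'a::real_normed_vector"
  assumes "\<And>t. t \<in> {a..b} \<Longrightarrow> (f has_vector_derivative 0) (at t within {a..b})" "s \<in> {a..b}" "t \<in> {a..b}"
  shows "f s = f t"
proof -
  have "\<exists>c. \<forall>x\<in>{a..b}. f x = c"
    by (rule has_derivative_zero_constant) (use assms(1) in \<open>auto simp: has_vector_derivative_def\<close>)
  then show ?thesis using assms by auto
qed

text \<open>Along the segment t N everything commutes, and exp (- log (1 + t N)) (1 + t N) has
  derivative 0, so it keeps its value 1 from t = 0.\<close>

lemma exp_lnp: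
  fixes N :: "'a::{real_normed_algebra_1,banach}"
  assumes N: "norm N < 1"
  shows "exp (lnp N) = 1 + N"
proof -
  let ?e = "\<lambda>t. exp (- lnp (t *\<^sub>R N))"
  \<comment> \<open>The Neumann series of (1 + t N)^-1. The bound on I t N below supplies the
    uniform derivative bound that the series lemmas ask for.\<close>
  define I where "I t = (\<Sum>m. (- (t *\<^sub>R N)) ^ m)" for t :: real
  have nt: "norm (- (t *\<^sub>R N)) < 1" if "t \<in> {0..1}" for t
    using that N by (simp) (metis mult_left_le_one_le norm_ge_zero order_le_less_trans)
  have I: "I t * (1 + t *\<^sub>R N) = 1" if "t \<in> {0..1}" for t
    unfolding I_def using suminf_geometric_mult[OF nt[OF that]] by simp
  have cI: "I t * N = N * I t" if "t \<in> {0..1}" for t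
  proof -
    note su = complete_algebra_summable_geometric[OF nt[OF that]]
    have "(- (t *\<^sub>R N)) ^ m * N = N * (- (t *\<^sub>R N)) ^ m" for m by (rule power_commuting_commutes) simp
    then show ?thesis unfolding I_def
      by (subst suminf_mult2[OF su], subst suminf_mult[OF su, symmetric]) (simp only: \<open>\<And>m. (- (t *\<^sub>R N)) ^ m * N = N * (- (t *\<^sub>R N)) ^ m\<close>)
  qed
  have I2: "(1 + t *\<^sub>R N) * I t = 1" if "t \<in> {0..1}" for t
  proof -
    have "(1 + t *\<^sub>R N) * I t = I t * (1 + t *\<^sub>R N)"
      by (simp only: distrib_left distrib_right cI[OF that] mult_scaleR_left mult_scaleR_right mult_1_left mult_1_right)
    then show ?thesis using I[OF that] by simp
  qed
  have nI: "norm (I t * N) \<le> norm N / (1 - norm N)" if t: "t \<in> {0..1}" for t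
  proof -
    have "(1 + t *\<^sub>R N) * (I t * N) = N" by (simp only: mult.assoc[symmetric] I2[OF t] mult_1_left)
    then have "I t * N = N - (t *\<^sub>R N) * (I t * N)" by (simp only: distrib_right mult_1_left eq_diff_eq)
    then have "norm (I t * N) \<le> norm N + norm ((t *\<^sub>R N) * (I t * N))" by (metis norm_triangle_ineq4)
    also have "norm ((t *\<^sub>R N) * (I t * N)) \<le> norm N * norm (I t * N)"
      using t by (intro norm_mult_ineq[THEN order_trans] mult_right_mono) (auto simp: mult_left_le_one_le)
    finally show ?thesis using N by (simp add: field_simps)
  qed
  have d1: "((\<lambda>t. lnp (t *\<^sub>R N)) has_vector_derivative I t * N) (at t within {0..1})" if t: "t \<in> {0..1}" for t
    by (rule has_vector_derivative_lnp_commuting[where N'="\<lambda>_. N" and r="norm N" and c="norm N"])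
      (use t N I2[OF t] in \<open>auto intro!: derivative_eq_intros simp: mult_left_le_one_le mult.assoc[symmetric]\<close>)
  have com: "lnp (t *\<^sub>R N) * (I t * N) = (I t * N) * lnp (t *\<^sub>R N)" if t: "t \<in> {0..1}" for t
  proof -
    have s: "summable (\<lambda>m. ((- 1) ^ m / real (Suc m)) *\<^sub>R (t *\<^sub>R N) ^ Suc m)"
      by (rule summable_lnp) (use nt[OF t] in simp)
    have "(t *\<^sub>R N) ^ k * (I t * N) = (I t * N) * (t *\<^sub>R N) ^ k" for k
      by (rule power_commuting_commutes) (simp add: cI[OF t] mult.assoc)
    then show ?thesis unfolding lnp_def
      by (subst suminf_mult2[OF s], subst suminf_mult[OF s, symmetric])
        (simp only: mult_scaleR_left mult_scaleR_right \<open>\<And>k. (t *\<^sub>R N) ^ k * (I t * N) = I t * N * (t *\<^sub>R N) ^ k\<close>)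
  qed
  have d2: "(?e has_vector_derivative ?e t * - (I t * N)) (at t within {0..1})" if t: "t \<in> {0..1}" for t
  proof (rule has_vector_derivative_exp_commuting[where r="norm N / (1 - norm N)" and c="norm N / (1 - norm N)"])
    fix s :: real assume s: "s \<in> {0..1}"
    have sN: "norm (s *\<^sub>R N) \<le> norm N" using s by (simp add: mult_left_le_one_le)
    have "norm (lnp (s *\<^sub>R N)) \<le> norm (s *\<^sub>R N) / (1 - norm (s *\<^sub>R N))"
      by (rule norm_lnp_le) (use nt[OF s] in simp)
    also have "\<dots> \<le> norm N / (1 - norm N)" using sN N by (intro frac_le) auto
    finally show "norm (- lnp (s *\<^sub>R N)) \<le> norm N / (1 - norm N)" by simp
  qed (use d1 nI com t in \<open>auto intro!: derivative_eq_intros\<close>)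
  have "?e 0 * (1 + 0 *\<^sub>R N) = ?e 1 * (1 + 1 *\<^sub>R N)"
  proof (rule has_vector_derivative_zero_eq[where f="\<lambda>t. ?e t * (1 + t *\<^sub>R N)" and a=0 and b=1])
    fix t :: real assume t: "t \<in> {0..1}"
    have "((\<lambda>t. ?e t * (1 + t *\<^sub>R N)) has_vector_derivative
       (?e t * N + (?e t * - (I t * N)) * (1 + t *\<^sub>R N))) (at t within {0..1})"
      by (intro has_vector_derivative_mult d2[OF t]) (auto intro!: derivative_eq_intros)
    moreover have "(I t * N) * (1 + t *\<^sub>R N) = N" by (simp only: cI[OF t] mult.assoc I[OF t] mult_1_right)
    ultimately show "((\<lambda>t. ?e t * (1 + t *\<^sub>R N)) has_vector_derivative 0) (at t within {0..1})"
      by (simp add: mult.assoc)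
  qed auto
  then have "exp (- lnp N) * (1 + N) = 1" by simp
  then have "exp (lnp N) * exp (- lnp N) * (1 + N) = exp (lnp N)" by (simp only: mult.assoc mult_1_right)
  then show ?thesis by (simp only: exp_minus_inverse mult_1_left)
qed

lemma norm_exp_minus_1_le:
  fixes X :: "'a::{real_normed_algebra_1,banach}"
  shows "norm (exp X - 1) \<le> exp (norm X) - 1"
proof -
  have "exp X - 1 = (\<Sum>n. X ^ Suc n /\<^sub>R fact (Suc n))"
    unfolding exp_def by (subst suminf_split_head[OF summable_exp_generic]) simp
  moreover have "exp (norm X) - 1 = (\<Sum>n. norm X ^ Suc n /\<^sub>R fact (Suc n))"
    unfolding exp_def by (subst suminf_split_head[OF summable_exp_generic]) simp
  moreover have "norm (\<Sum>n. X ^ Suc n /\<^sub>R fact (Suc n)) \<le> (\<Sum>n. norm X ^ Suc n /\<^sub>R fact (Suc n))"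
  proof (rule norm_suminf_le)
    show "summable (\<lambda>n. norm X ^ Suc n /\<^sub>R fact (Suc n))"
      using summable_exp_generic[of "norm X"] by (subst summable_Suc_iff)
    show "norm (X ^ Suc n /\<^sub>R fact (Suc n)) \<le> norm X ^ Suc n /\<^sub>R fact (Suc n)" for n
      using norm_power_ineq[of X "Suc n"] by (simp add: mult_left_mono del: power_Suc)
  qed
  ultimately show ?thesis by simp
qed

text \<open>The logarithm of exp (t X) is followed from t = 0 with constant derivative X. The bound
  concerns the whole segment because closeness at t = 1 alone does not fix the branch, as the
  complex number X = 2 pi i shows.\<close>

lemma lnp_exp:
  fixes X :: "'a::{real_normed_algebra_1,banach}"
  assumes b: "\<And>t. t \<in> {0..1} \<Longrightarrow> norm (exp (t *\<^sub>R X) - 1) \<le> r" and r: "r < 1"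
  shows "lnp (exp X - 1) = X"
proof -
  have d: "((\<lambda>t. lnp (exp (t *\<^sub>R X) - 1)) has_vector_derivative X) (at t within {0..1})" if t: "t \<in> {0..1}" for t
  proof (rule has_vector_derivative_lnp_commuting[where N'="\<lambda>t. exp (t *\<^sub>R X) * X" and r=r and c="(r + 1) * norm X"])
    fix s :: real assume s: "s \<in> {0..1}"
    show "((\<lambda>t. exp (t *\<^sub>R X) - 1) has_vector_derivative exp (s *\<^sub>R X) * X) (at s within {0..1})"
      using exp_scaleR_has_vector_derivative_right[of X s "{0..1}"] by (auto intro!: derivative_eq_intros)
    have "norm (exp (s *\<^sub>R X)) \<le> norm (exp (s *\<^sub>R X) - 1) + norm (1::'a)"
      by (metis diff_add_cancel norm_triangle_ineq)
    then have "norm (exp (s *\<^sub>R X)) \<le> r + 1" using b[OF s] by simp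
    then show "norm (exp (s *\<^sub>R X) * X) \<le> (r + 1) * norm X"
      by (intro norm_mult_ineq[THEN order_trans] mult_right_mono) auto
  next
    have "X * exp (t *\<^sub>R X) = exp (t *\<^sub>R X) * X" by (rule exp_times_scaleR_commute[symmetric])
    then show "(exp (t *\<^sub>R X) - 1) * (exp (t *\<^sub>R X) * X) = exp (t *\<^sub>R X) * X * (exp (t *\<^sub>R X) - 1)"
      by (simp add: algebra_simps)
  qed (use b r t in auto)
  have "lnp (exp (1 *\<^sub>R X) - 1) - 1 *\<^sub>R X = lnp (exp (0 *\<^sub>R X) - 1) - 0 *\<^sub>R X"
    by (rule has_vector_derivative_zero_eq[where f="\<lambda>t. lnp (exp (t *\<^sub>R X) - 1) - t *\<^sub>R X" and a=0 and b=1])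
      (use d in \<open>auto intro!: derivative_eq_intros\<close>)
  then show ?thesis by simp
qed

section \<open>Analytic vectors\<close>

text \<open>The product majorant makes the double family absolutely summable, so summation along
  antidiagonals agrees with summation over j first. In \<open>u_curve\<close> j counts commutators
  and i counts powers.\<close>

lemma cauchy_swap_sums:
  fixes f :: "nat \<Rightarrow> nat \<Rightarrow> 'b::banach"
  assumes f: "\<And>j i. norm (f j i) \<le> a j * b i" and a: "summable a" and b: "summable b"
    and a0: "\<And>j. 0 \<le> a j" and b0: "\<And>i. 0 \<le> b i"
  shows "(\<lambda>m. \<Sum>j\<le>m. f j (m - j)) sums (\<Sum>i. \<Sum>j. f j i)"
    and "summable (\<lambda>i. \<Sum>j. f j i)" and "summable (\<lambda>j. f j i)"
proof -
  have sa: "a summable_on UNIV" and sb: "b summable_on UNIV"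
    using a b a0 b0 by (auto intro!: norm_summable_imp_summable_on)
  have absf: "(\<lambda>x. norm (case x of (i, j) \<Rightarrow> f j i)) summable_on UNIV \<times> UNIV"
  proof (rule Infinite_Sum.abs_summable_on_comparison_test[where g="\<lambda>(i, j). a j * b i"])
    have "(\<lambda>i. b i * (\<Sum>\<^sub>\<infinity>j. a j)) summable_on UNIV" using sb by (rule summable_on_cmult_left)
    then show "(\<lambda>x. norm (case x of (i, j) \<Rightarrow> a j * b i)) summable_on UNIV \<times> UNIV"
      using a0 b0 sa infsum_nonneg[of UNIV a] by (subst Infinite_Sum.abs_summable_on_Sigma_iff)
        (auto simp: infsum_cmult_left' mult.commute intro!: summable_on_cmult_left)
  qed (use f a0 b0 in \<open>auto intro: order_trans\<close>)
  then have sf: "(\<lambda>(i, j). f j i) summable_on UNIV \<times> UNIV" by (rule Infinite_Sum.abs_summable_summable)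
  have rowabs: "summable (\<lambda>j. norm (f j i))" for i
    by (rule summable_comparison_test'[where g="\<lambda>j. a j * b i" and N=0]) (use a f in \<open>auto intro: summable_mult2\<close>)
  then show row: "summable (\<lambda>j. f j i)" for i by (rule summable_norm_cancel)
  have "((\<lambda>(i, j). f j i) has_sum (\<Sum>\<^sub>\<infinity>(i, j)\<in>UNIV \<times> UNIV. f j i)) (Sigma UNIV (\<lambda>_. UNIV))"
    using sf by (simp add: has_sum_infsum)
  note tot = this
  have r1: "((\<lambda>i. \<Sum>j. f j i) has_sum (\<Sum>\<^sub>\<infinity>(i, j)\<in>UNIV \<times> UNIV. f j i)) UNIV"
    using has_sum_SigmaD[OF tot, of "\<lambda>i. \<Sum>j. f j i"] norm_summable_imp_has_sum[OF rowabs summable_sums[OF row]] by simp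
  from has_sum_imp_sums[OF r1] show "summable (\<lambda>i. \<Sum>j. f j i)" by (rule sums_summable)
  have tot2: "(\<Sum>\<^sub>\<infinity>(i, j)\<in>UNIV \<times> UNIV. f j i) = (\<Sum>i. \<Sum>j. f j i)"
    using has_sum_imp_sums[OF r1] by (rule sums_unique)
  have bij: "bij_betw (\<lambda>(m, j). (m - j, j)) (SIGMA m:UNIV. {..m}) (UNIV \<times> (UNIV::nat set))"
    by (rule bij_betwI[where g="\<lambda>(i, j). (i + j, j)"]) auto
  have "((\<lambda>(m, j). f j (m - j)) has_sum (\<Sum>i. \<Sum>j. f j i)) (SIGMA m:UNIV. {..m})"
    using tot has_sum_reindex_bij_betw[OF bij, of "\<lambda>(i, j). f j i"] unfolding tot2
    by (simp add: case_prod_unfold)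
  then have "((\<lambda>m. \<Sum>j\<le>m. f j (m - j)) has_sum (\<Sum>i. \<Sum>j. f j i)) UNIV"
    by (rule has_sum_SigmaD) (auto intro!: has_sum_finiteI)
  then show "(\<lambda>m. \<Sum>j\<le>m. f j (m - j)) sums (\<Sum>i. \<Sum>j. f j i)" by (rule has_sum_imp_sums)
qed

lemma norm_scaleR_inverse_fact_le:
  fixes x :: "'b::real_normed_vector"
  assumes "norm x \<le> c * fact m" shows "norm (x /\<^sub>R fact m) \<le> c"
  using assms by (simp add: divide_inverse[symmetric] mult.commute[of "inverse (fact m)"] pos_divide_le_eq)

text \<open>Assumption \<open>bound\<close>: every vector of the module is analytic with radius at least \<open>1/R\<close>, uniformly in the vector.\<close>

locale analytic_rep =
  fixes Ba :: "'a::{real_normed_algebra_1,banach} set" and coord :: "'a \<Rightarrow> 'a \<Rightarrow> real"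
    and \<iota> :: "'f::real_vector \<Rightarrow> 'h::banach" and \<rho> :: "'a \<Rightarrow> 'f \<Rightarrow> 'f" and R :: real
  assumes fin: "finite Ba" and coord: "\<And>b. bounded_linear (coord b)"
    and expand: "\<And>x. (\<Sum>b\<in>Ba. coord b x *\<^sub>R b) = x"
    and lin_iota: "linear \<iota>" and lin_rho: "\<And>X. linear (\<rho> X)" and lin_rho': "\<And>w. linear (\<lambda>X. \<rho> X w)"
    and R1: "R \<ge> 1"
    and bound: "\<And>w. \<exists>M. \<forall>Xs. norm (\<iota> (foldr \<rho> Xs w)) \<le> M * fact (length Xs) * (\<Prod>X\<leftarrow>Xs. R * norm X)"
begin

definition u :: "'a \<Rightarrow> 'f \<Rightarrow> 'h" where "u X w = (\<Sum>m. \<iota> ((\<rho> X ^^ m) w) /\<^sub>R fact m)"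

definition adp :: "'a \<Rightarrow> nat \<Rightarrow> 'a \<Rightarrow> 'a" where "adp Z j = (\<lambda>Y. Z * Y - Y * Z) ^^ j"

text \<open>The function (exp z - 1) / z evaluated at ad Z and applied to Y. It governs the
  derivative of the exponential: (exp Z)' = dexp Z Z' exp Z.\<close>

definition dexp :: "'a \<Rightarrow> 'a \<Rightarrow> 'a" where "dexp Z Y = (\<Sum>j. adp Z j Y /\<^sub>R fact (Suc j))"

lemma foldr_linear: "linear (foldr \<rho> Xs)"
  by (induction Xs) (auto simp: linear_id id_def[symmetric] intro: linear_compose[unfolded o_def] lin_rho)

lemma funpow_linear: "linear (\<rho> X ^^ m)"
  by (induction m) (auto simp: linear_id id_def[symmetric] intro: linear_compose[unfolded o_def] lin_rho)

lemma obtain_bound: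
  obtains M where "M \<ge> 0" "\<And>Xs. norm (\<iota> (foldr \<rho> Xs w)) \<le> M * fact (length Xs) * (\<Prod>X\<leftarrow>Xs. R * norm X)"
proof -
  obtain M where M: "\<And>Xs. norm (\<iota> (foldr \<rho> Xs w)) \<le> M * fact (length Xs) * (\<Prod>X\<leftarrow>Xs. R * norm X)"
    using bound[of w] by blast
  have "M \<ge> 0" using M[of "[]"] norm_ge_zero order_trans by (auto intro: order_trans[OF norm_ge_zero])
  with M that show ?thesis by blast
qed

lemma summable_u:
  assumes "R * norm X < 1" shows "summable (\<lambda>m. \<iota> ((\<rho> X ^^ m) w) /\<^sub>R fact m)"
proof -
  obtain M where M: "M \<ge> 0" "\<And>Xs. norm (\<iota> (foldr \<rho> Xs w)) \<le> M * fact (length Xs) * (\<Prod>X\<leftarrow>Xs. R * norm X)"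
    using obtain_bound[of w] by blast
  show ?thesis
  proof (rule summable_comparison_test'[where g="\<lambda>m. M * (R * norm X) ^ m" and N=0])
    show "summable (\<lambda>m. M * (R * norm X) ^ m)" using assms R1 by (intro summable_mult summable_geometric) auto
    fix m show "norm (\<iota> ((\<rho> X ^^ m) w) /\<^sub>R fact m) \<le> M * (R * norm X) ^ m"
      by (rule norm_scaleR_inverse_fact_le)
        (use M(2)[of "replicate m X"] in \<open>simp add: mult_ac\<close>)
  qed
qed

text \<open>The space \<open>'f\<close> has no topology, so \<rho> (Z t) cannot be differentiated as
  an operator. Expanding Z t in the finite basis moves the dependence on t into scalar coordinates;
  the prefix \<open>Ys\<close> collects the basis elements split off by the induction.\<close>

lemma word_curve_derivative:
  assumes Z: "(Z has_vector_derivative Z') (at t within S)"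
  shows "((\<lambda>t. \<iota> (foldr \<rho> Ys ((\<rho> (Z t) ^^ m) w))) has_vector_derivative
     (\<Sum>a<m. \<iota> (foldr \<rho> Ys ((\<rho> (Z t) ^^ a) (\<rho> Z' ((\<rho> (Z t) ^^ (m - Suc a)) w)))))) (at t within S)"
proof (induction m arbitrary: Ys)
  case (Suc m)
  have ex: "\<iota> (foldr \<rho> Ys (\<rho> X y)) = (\<Sum>b\<in>Ba. coord b X *\<^sub>R \<iota> (foldr \<rho> (Ys @ [b]) y))" for X y
  proof -
    have "\<rho> X y = \<rho> (\<Sum>b\<in>Ba. coord b X *\<^sub>R b) y" by (simp add: expand)
    also have "\<dots> = (\<Sum>b\<in>Ba. coord b X *\<^sub>R \<rho> b y)"
      using linear_sum[OF lin_rho'[of y], of "\<lambda>b. coord b X *\<^sub>R b" Ba] linear_scale[OF lin_rho'[of y]] by simp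
    finally show ?thesis
      by (simp add: linear_sum[OF foldr_linear] linear_scale[OF foldr_linear] linear_sum[OF lin_iota] linear_scale[OF lin_iota])
  qed
  have "((\<lambda>t. \<Sum>b\<in>Ba. coord b (Z t) *\<^sub>R \<iota> (foldr \<rho> (Ys @ [b]) ((\<rho> (Z t) ^^ m) w))) has_vector_derivative
     (\<Sum>b\<in>Ba. coord b (Z t) *\<^sub>R (\<Sum>a<m. \<iota> (foldr \<rho> (Ys @ [b]) ((\<rho> (Z t) ^^ a) (\<rho> Z' ((\<rho> (Z t) ^^ (m - Suc a)) w)))))
       + coord b Z' *\<^sub>R \<iota> (foldr \<rho> (Ys @ [b]) ((\<rho> (Z t) ^^ m) w)))) (at t within S)"
    by (intro has_vector_derivative_sum has_vector_derivative_scaleR Suc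
        has_real_derivative_iff_has_vector_derivative[THEN iffD2] bounded_linear.has_vector_derivative[OF coord Z])
  also have "(\<Sum>b\<in>Ba. coord b (Z t) *\<^sub>R (\<Sum>a<m. \<iota> (foldr \<rho> (Ys @ [b]) ((\<rho> (Z t) ^^ a) (\<rho> Z' ((\<rho> (Z t) ^^ (m - Suc a)) w)))))
       + coord b Z' *\<^sub>R \<iota> (foldr \<rho> (Ys @ [b]) ((\<rho> (Z t) ^^ m) w)))
     = (\<Sum>a<m. \<iota> (foldr \<rho> Ys (\<rho> (Z t) ((\<rho> (Z t) ^^ a) (\<rho> Z' ((\<rho> (Z t) ^^ (m - Suc a)) w))))))
       + \<iota> (foldr \<rho> Ys (\<rho> Z' ((\<rho> (Z t) ^^ m) w)))"
    unfolding ex sum.distrib scaleR_sum_right by (subst sum.swap) simp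
  also have "\<dots> = (\<Sum>a<Suc m. \<iota> (foldr \<rho> Ys ((\<rho> (Z t) ^^ a) (\<rho> Z' ((\<rho> (Z t) ^^ (Suc m - Suc a)) w)))))"
    by (subst sum.lessThan_Suc_shift) simp
  finally show ?case by (simp add: ex del: foldr_append)
qed simp

text \<open>Moving Z' to the left past the a-th power of Z produces iterated commutators with
  coefficients a choose j. Summed over a < m these give m choose (j + 1).\<close>

lemma funpow_sandwich:
  assumes ad: "\<And>j y. \<rho> Z (\<rho> (adp Z j Z') y) = \<rho> (adp Z j Z') (\<rho> Z y) + \<rho> (adp Z (Suc j) Z') y"
  shows "(\<Sum>a<m. (\<rho> Z ^^ a) (\<rho> Z' ((\<rho> Z ^^ (m - Suc a)) w))) =
     (\<Sum>j<m. real (m choose Suc j) *\<^sub>R \<rho> (adp Z j Z') ((\<rho> Z ^^ (m - Suc j)) w))"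
proof (induction m)
  case (Suc m)
  let ?A = "\<lambda>j. \<rho> (adp Z j Z')"
  have "(\<Sum>a<Suc m. (\<rho> Z ^^ a) (\<rho> Z' ((\<rho> Z ^^ (Suc m - Suc a)) w)))
     = \<rho> Z' ((\<rho> Z ^^ m) w) + \<rho> Z (\<Sum>a<m. (\<rho> Z ^^ a) (\<rho> Z' ((\<rho> Z ^^ (m - Suc a)) w)))"
    by (subst sum.lessThan_Suc_shift) (simp add: linear_sum[OF lin_rho])
  also have "\<rho> Z (\<Sum>a<m. (\<rho> Z ^^ a) (\<rho> Z' ((\<rho> Z ^^ (m - Suc a)) w))) =
     (\<Sum>j<m. real (m choose Suc j) *\<^sub>R ?A j ((\<rho> Z ^^ (m - j)) w))
     + (\<Sum>j<m. real (m choose Suc j) *\<^sub>R ?A (Suc j) ((\<rho> Z ^^ (m - Suc j)) w))"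
    unfolding Suc
    by (auto simp: linear_sum[OF lin_rho] linear_scale[OF lin_rho] ad scaleR_right_distrib sum.distrib[symmetric]
        Suc_diff_Suc funpow_Suc_right simp flip: funpow.simps(2)[unfolded o_def, THEN fun_cong] intro!: sum.cong)
  also have "(\<Sum>j<m. real (m choose Suc j) *\<^sub>R ?A j ((\<rho> Z ^^ (m - j)) w)) =
     (\<Sum>j<Suc m. real (m choose Suc j) *\<^sub>R ?A j ((\<rho> Z ^^ (m - j)) w))"
    by simp
  also have "\<rho> Z' ((\<rho> Z ^^ m) w) + (\<dots> + (\<Sum>j<m. real (m choose Suc j) *\<^sub>R ?A (Suc j) ((\<rho> Z ^^ (m - Suc j)) w)))
    = \<dots> + (\<Sum>j<Suc m. real (m choose j) *\<^sub>R ?A j ((\<rho> Z ^^ (m - j)) w))"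
    by (subst (3) sum.lessThan_Suc_shift) (simp add: adp_def)
  also have "\<dots> = (\<Sum>j<Suc m. real (Suc m choose Suc j) *\<^sub>R ?A j ((\<rho> Z ^^ (Suc m - Suc j)) w))"
    by (simp add: sum.distrib[symmetric] scaleR_add_left[symmetric] add.commute del: sum.lessThan_Suc)
  finally show ?case .
qed simp

lemma norm_adp_le: "norm (adp Z j Y) \<le> (2 * norm Z) ^ j * norm Y"
proof (induction j)
  case (Suc j)
  have "norm (Z * adp Z j Y - adp Z j Y * Z) \<le> norm (Z * adp Z j Y) + norm (adp Z j Y * Z)"
    by (rule norm_triangle_ineq4)
  also have "\<dots> \<le> norm Z * norm (adp Z j Y) + norm (adp Z j Y) * norm Z" by (intro add_mono norm_mult_ineq)
  also have "\<dots> = 2 * norm Z * norm (adp Z j Y)" by simp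
  also have "\<dots> \<le> 2 * norm Z * ((2 * norm Z) ^ j * norm Y)" using Suc by (intro mult_left_mono) auto
  finally show ?case by (simp add: adp_def mult.assoc)
qed (simp add: adp_def)

lemma bounded_linear_rho: "bounded_linear (\<lambda>X. \<iota> (\<rho> X y))"
proof -
  obtain M where M: "M \<ge> 0" "\<And>Xs. norm (\<iota> (foldr \<rho> Xs y)) \<le> M * fact (length Xs) * (\<Prod>X\<leftarrow>Xs. R * norm X)"
    using obtain_bound[of y] by blast
  show ?thesis
    by (rule bounded_linear_intro[where K="M * R"])
     (use M(2)[of "[_]"] in \<open>auto simp: linear_add[OF lin_rho'] linear_scale[OF lin_rho'] linear_add[OF lin_iota] linear_scale[OF lin_iota] algebra_simps\<close>)
qed

lemma summable_dexp: "summable (\<lambda>j. adp Z j Y /\<^sub>R fact (Suc j))"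
proof (rule summable_comparison_test'[where g="\<lambda>j. norm Y * ((2 * norm Z) ^ j /\<^sub>R fact j)" and N=0])
  show "summable (\<lambda>j. norm Y * ((2 * norm Z) ^ j /\<^sub>R fact j))"
    by (intro summable_mult summable_exp_generic)
  fix j :: nat
  have "norm (adp Z j Y /\<^sub>R fact (Suc j)) \<le> norm (adp Z j Y) / fact j"
    by (auto simp: divide_inverse mult.commute simp del: fact_Suc intro!: mult_right_mono le_imp_inverse_le fact_mono)
  also have "\<dots> \<le> ((2 * norm Z) ^ j * norm Y) / fact j" by (intro divide_right_mono norm_adp_le) auto
  finally show "norm (adp Z j Y /\<^sub>R fact (Suc j)) \<le> norm Y * ((2 * norm Z) ^ j /\<^sub>R fact j)"
    by (simp add: field_simps)
qed

text \<open>Differentiating the exponential series term by term and moving Z' to the left yields a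
  double series; summing it over commutators first assembles \<open>dexp\<close>. The commutator
  relation is asked for only at the point of the curve, because \<rho> respects brackets only on the
  Lie algebra.\<close>

lemma u_curve:
  assumes S: "convex S" and d: "\<And>t. t \<in> S \<Longrightarrow> (Z has_vector_derivative Z' t) (at t within S)"
    and r: "\<And>t. t \<in> S \<Longrightarrow> norm (Z t) \<le> r" "R * r < 1" and c: "\<And>t. t \<in> S \<Longrightarrow> norm (Z' t) \<le> c" and t: "t \<in> S"
    and ad: "\<And>j y. \<rho> (Z t) (\<rho> (adp (Z t) j (Z' t)) y) = \<rho> (adp (Z t) j (Z' t)) (\<rho> (Z t) y) + \<rho> (adp (Z t) (Suc j) (Z' t)) y"
  shows "((\<lambda>t. u (Z t) w) has_vector_derivative (\<Sum>i. \<iota> (\<rho> (dexp (Z t) (Z' t)) ((\<rho> (Z t) ^^ i) w)) /\<^sub>R fact i)) (at t within S)"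
    and "summable (\<lambda>i. \<iota> (\<rho> (dexp (Z t) (Z' t)) ((\<rho> (Z t) ^^ i) w)) /\<^sub>R fact i)"
proof -
  let ?A = "\<lambda>j. adp (Z t) j (Z' t)" and ?Y = "\<lambda>i. (\<rho> (Z t) ^^ i) w" and ?G = "\<lambda>i. \<iota> (\<rho> (dexp (Z t) (Z' t)) ((\<rho> (Z t) ^^ i) w))"
  obtain M where M: "M \<ge> 0" "\<And>Xs. norm (\<iota> (foldr \<rho> Xs w)) \<le> M * fact (length Xs) * (\<Prod>X\<leftarrow>Xs. R * norm X)"
    using obtain_bound[of w] by blast
  have r0: "0 \<le> r" using r(1)[OF t] norm_ge_zero order_trans by blast
  have c0: "0 \<le> c" using c(1)[OF t] norm_ge_zero order_trans by blast
  have R0: "0 \<le> R * r" "0 \<le> R" using r0 R1 by auto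
  define D where "D s m = (\<Sum>a<m. \<iota> ((\<rho> (Z s) ^^ a) (\<rho> (Z' s) ((\<rho> (Z s) ^^ (m - Suc a)) w))))" for s m
  have main: "((\<lambda>t. u (Z t) w) has_vector_derivative (\<Sum>m. D t m /\<^sub>R fact m)) (at t within S)"
    unfolding u_def
  proof (rule has_vector_derivative_series[OF S _ _ _ _ t, where M="\<lambda>m. M * (R * c) * (real m * (R * r) ^ (m - 1))"])
    show "summable (\<lambda>m. M * (R * c) * (real m * (R * r) ^ (m - 1)))"
      by (intro summable_mult, subst summable_Suc_iff[symmetric])
         (use summable_deriv_geometric[of "R * r"] R0 r in simp)
    show "((\<lambda>t. \<iota> ((\<rho> (Z t) ^^ n) w) /\<^sub>R fact n) has_vector_derivative D s n /\<^sub>R fact n) (at s within S)" if "s \<in> S" for n s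
      unfolding D_def using word_curve_derivative[OF d[OF that], of "[]" n w]
      by (auto intro: bounded_linear.has_vector_derivative[OF bounded_linear_scaleR_right])
    show "summable (\<lambda>n. \<iota> ((\<rho> (Z s) ^^ n) w) /\<^sub>R fact n)" if "s \<in> S" for s
      by (rule summable_u) (use r(1)[OF that] r(2) R0 in \<open>meson mult_left_mono order_le_less_trans\<close>)
    fix n s assume s: "s \<in> S"
    have "norm (D s n) \<le> (\<Sum>a<n. M * fact n * ((R * r) ^ (n - 1) * (R * c)))" unfolding D_def
    proof (intro sum_norm_le)
      fix a assume a: "a \<in> {..<n}"
      have "norm (\<iota> ((\<rho> (Z s) ^^ a) (\<rho> (Z' s) ((\<rho> (Z s) ^^ (n - Suc a)) w)))) \<le>
         M * fact n * ((R * norm (Z s)) ^ a * ((R * norm (Z' s)) * (R * norm (Z s)) ^ (n - Suc a)))"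
      proof -
        have "length (replicate a (Z s) @ Z' s # replicate (n - Suc a) (Z s)) = n" using a by auto
        then show ?thesis
          using M(2)[of "replicate a (Z s) @ Z' s # replicate (n - Suc a) (Z s)"]
          by (simp del: fact_Suc length_append length_Cons length_replicate)
      qed
      also have "\<dots> \<le> M * fact n * ((R * r) ^ a * ((R * c) * (R * r) ^ (n - Suc a)))"
        using M R0 r0 c0 r(1)[OF s] c[OF s] R1
        by (intro mult_left_mono mult_mono power_mono mult_nonneg_nonneg) (auto intro: mult_nonneg_nonneg)
      also have "(R * r) ^ a * ((R * c) * (R * r) ^ (n - Suc a)) = (R * r) ^ (a + (n - Suc a)) * (R * c)"
        by (simp only: power_add mult_ac)
      also have "a + (n - Suc a) = n - 1" using a by simp
      finally show "norm (\<iota> ((\<rho> (Z s) ^^ a) (\<rho> (Z' s) ((\<rho> (Z s) ^^ (n - Suc a)) w)))) \<le> M * fact n * ((R * r) ^ (n - 1) * (R * c))" .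
    qed
    then have "norm (D s n /\<^sub>R fact n) \<le> (\<Sum>a<n. M * fact n * ((R * r) ^ (n - 1) * (R * c))) / fact n"
      by (simp add: divide_inverse mult.commute mult_left_mono)
    also have "\<dots> = M * (R * c) * (real n * (R * r) ^ (n - 1))" by simp
    finally show "norm (D s n /\<^sub>R fact n) \<le> M * (R * c) * (real n * (R * r) ^ (n - 1))" .
  qed
  \<comment> \<open>With m = i + j + 1 one has (m choose (j + 1)) / m! = 1 / ((j + 1)! i!), so the
    two indices separate.\<close>
  define f where "f j i = \<iota> (\<rho> (?A j) (?Y i)) /\<^sub>R (fact (Suc j) * fact i)" for j i
  have D: "D t (Suc k) /\<^sub>R fact (Suc k) = (\<Sum>j\<le>k. f j (k - j))" for k
  proof -
    have "D t (Suc k) = \<iota> (\<Sum>j<Suc k. real (Suc k choose Suc j) *\<^sub>R \<rho> (?A j) ((\<rho> (Z t) ^^ (Suc k - Suc j)) w))"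
      unfolding D_def by (subst funpow_sandwich[OF ad, symmetric]) (simp only: linear_sum[OF lin_iota])
    then show ?thesis
      by (auto simp: linear_sum[OF lin_iota] linear_scale[OF lin_iota] f_def scaleR_sum_right lessThan_Suc_atMost
          binomial_fact divide_inverse simp del: fact_Suc binomial_Suc_Suc sum.lessThan_Suc sum.atMost_Suc intro!: sum.cong)
  qed
  have fb: "norm (f j i) \<le> (M * (R * norm (Z' t)) * ((2 * norm (Z t)) ^ j /\<^sub>R fact (Suc j))) * (real (Suc i) * (R * norm (Z t)) ^ i)" for j i
  proof -
    have "norm (\<iota> (\<rho> (?A j) (?Y i))) \<le> M * fact (Suc i) * ((R * norm (?A j)) * (R * norm (Z t)) ^ i)"
      using M(2)[of "?A j # replicate i (Z t)"] by simp
    also have "\<dots> \<le> M * fact (Suc i) * ((R * ((2 * norm (Z t)) ^ j * norm (Z' t))) * (R * norm (Z t)) ^ i)"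
      using M R1 norm_adp_le by (intro mult_left_mono mult_right_mono) auto
    finally have "norm (f j i) \<le> (M * fact (Suc i) * ((R * ((2 * norm (Z t)) ^ j * norm (Z' t))) * (R * norm (Z t)) ^ i)) / (fact (Suc j) * fact i)"
      unfolding f_def by (simp add: divide_inverse mult.commute mult_left_mono abs_mult del: fact_Suc)
    also have "\<dots> = (M * (R * norm (Z' t)) * ((2 * norm (Z t)) ^ j /\<^sub>R fact (Suc j))) * (real (Suc i) * (R * norm (Z t)) ^ i)"
    proof -
      have "fact (Suc i) / (fact i :: real) = real (Suc i)" by simp
      then show ?thesis by (simp add: divide_inverse mult_ac del: fact_Suc of_nat_Suc)
    qed
    finally show ?thesis .
  qed
  have sa: "summable (\<lambda>j. M * (R * norm (Z' t)) * ((2 * norm (Z t)) ^ j /\<^sub>R fact (Suc j)))"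
  proof (intro summable_mult, rule summable_comparison_test'[where g="\<lambda>j. (2 * norm (Z t)) ^ j /\<^sub>R fact j" and N=0])
    show "norm ((2 * norm (Z t)) ^ n /\<^sub>R fact (Suc n)) \<le> (2 * norm (Z t)) ^ n /\<^sub>R fact n" for n
      by (auto simp del: fact_Suc intro!: mult_right_mono le_imp_inverse_le fact_mono)
  qed (rule summable_exp_generic)
  have Rt: "R * norm (Z t) < 1" using r(1)[OF t] r(2) R0 by (meson mult_left_mono order_le_less_trans)
  have sb: "summable (\<lambda>i. real (Suc i) * (R * norm (Z t)) ^ i)"
    by (rule summable_deriv_geometric) (use R1 Rt in auto)
  note cs = cauchy_swap_sums[OF fb sa sb]
  have pos: "0 \<le> M * (R * norm (Z' t)) * ((2 * norm (Z t)) ^ j /\<^sub>R fact (Suc j))" "0 \<le> real (Suc i) * (R * norm (Z t)) ^ i" for i j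
    using M R1 by auto
  have col: "(\<Sum>j. f j i) = ?G i /\<^sub>R fact i" for i
  proof -
    have "(\<lambda>j. (\<iota> (\<rho> (?A j /\<^sub>R fact (Suc j)) (?Y i)))) sums ?G i"
      unfolding dexp_def by (rule bounded_linear.sums[OF bounded_linear_rho summable_sums[OF summable_dexp]])
    then have "(\<lambda>j. \<iota> (\<rho> (?A j /\<^sub>R fact (Suc j)) (?Y i)) /\<^sub>R fact i) sums (?G i /\<^sub>R fact i)"
      by (rule sums_scaleR_right)
    then have "(\<lambda>j. f j i) sums (?G i /\<^sub>R fact i)" unfolding f_def using lin_iota lin_rho'
      by (simp add: linear_scale[OF lin_rho'] linear_scale[OF lin_iota] inverse_mult_distrib mult.commute del: fact_Suc)
    then show ?thesis by (simp add: sums_iff)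
  qed
  have "(\<lambda>k. D t (Suc k) /\<^sub>R fact (Suc k)) sums (\<Sum>i. \<Sum>j. f j i)"
    using cs(1)[OF pos] by (simp only: D)
  from sums_Suc[OF this] have "(\<lambda>k. D t k /\<^sub>R fact k) sums (\<Sum>i. ?G i /\<^sub>R fact i)"
    by (simp add: D_def[of _ 0] col)
  then show "((\<lambda>t. u (Z t) w) has_vector_derivative (\<Sum>i. ?G i /\<^sub>R fact i)) (at t within S)"
    using main by (simp add: sums_iff)
  show "summable (\<lambda>i. ?G i /\<^sub>R fact i)" using cs(2)[OF pos] by (simp only: col)
qed

lemma u_add: "R * norm X < 1 \<Longrightarrow> u X (v + w) = u X v + u X w"
  unfolding u_def by (subst suminf_add) (auto intro: summable_u simp: linear_add[OF funpow_linear] linear_add[OF lin_iota] algebra_simps)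

lemma u_scale: "R * norm X < 1 \<Longrightarrow> u X (c *\<^sub>R w) = c *\<^sub>R u X w" unfolding u_def
  by (subst suminf_scaleR_right) (auto intro: summable_u simp: linear_scale[OF funpow_linear] linear_scale[OF lin_iota] mult.commute)

lemma norm_u_diff_le:
  shows "\<exists>M\<ge>0. \<forall>X. R * norm X \<le> 1/2 \<longrightarrow> norm (u X w - \<iota> w) \<le> M * norm X"
proof -
  obtain M where M: "M \<ge> 0" "\<And>Xs. norm (\<iota> (foldr \<rho> Xs w)) \<le> M * fact (length Xs) * (\<Prod>X\<leftarrow>Xs. R * norm X)"
    using obtain_bound[of w] by blast
  have "norm (u X w - \<iota> w) \<le> M * 2 * R * norm X" if X: "R * norm X \<le> 1/2" for X
  proof -
    have s: "summable (\<lambda>m. \<iota> ((\<rho> X ^^ m) w) /\<^sub>R fact m)" by (rule summable_u) (use X in simp)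
    have "u X w - \<iota> w = (\<Sum>m. \<iota> ((\<rho> X ^^ Suc m) w) /\<^sub>R fact (Suc m))"
      unfolding u_def by (subst suminf_split_head[OF s]) simp
    also have "norm \<dots> \<le> (\<Sum>m. M * (R * norm X) * (R * norm X) ^ m)"
    proof (rule norm_suminf_le)
      show "summable (\<lambda>m. M * (R * norm X) * (R * norm X) ^ m)"
        using X R1 by (intro summable_mult summable_geometric) auto
      fix m show "norm (\<iota> ((\<rho> X ^^ Suc m) w) /\<^sub>R fact (Suc m)) \<le> M * (R * norm X) * (R * norm X) ^ m"
        by (rule norm_scaleR_inverse_fact_le)
          (use M(2)[of "replicate (Suc m) X"] in \<open>simp add: mult_ac del: fact_Suc replicate_Suc funpow.simps\<close>)
    qed
    also have "\<dots> = M * (R * norm X) * (1 / (1 - R * norm X))"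
      using X R1 by (subst suminf_mult) (auto simp: suminf_geometric intro!: summable_geometric)
    also have "\<dots> \<le> M * (R * norm X) * 2" using X R1 M by (intro mult_left_mono) (auto simp: field_simps)
    finally show ?thesis by simp
  qed
  then show ?thesis using M R1 by (intro exI[of _ "M * 2 * R"]) auto
qed

end

lemma isometric_extension:
  fixes \<iota> :: "'f::real_vector \<Rightarrow> 'h::real_normed_vector" and f :: "'f \<Rightarrow> 'g::banach"
  assumes li: "linear \<iota>" and lf: "linear f" and iso: "\<And>w. norm (f w) = norm (\<iota> w)"
    and dense: "closure (range \<iota>) = UNIV"
  shows "\<exists>F. bounded_linear F \<and> (\<forall>w. F (\<iota> w) = f w) \<and> (\<forall>x. norm (F x) = norm x)"
proof -
  have dist: "dist (f v) (f w) = dist (\<iota> v) (\<iota> w)" for v w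
    using iso[of "v - w"] by (simp add: dist_norm linear_diff[OF li] linear_diff[OF lf])
  have "\<forall>x n. \<exists>w. dist (\<iota> w) x < inverse (real (Suc n))"
  proof (intro allI)
    fix x :: 'h and n :: nat
    have "x \<in> closure (range \<iota>)" by (simp add: dense)
    moreover have "0 < inverse (real (Suc n))" by simp
    ultimately have "\<exists>y\<in>range \<iota>. dist y x < inverse (real (Suc n))"
      unfolding closure_approachable by blast
    then show "\<exists>w. dist (\<iota> w) x < inverse (real (Suc n))" by blast
  qed
  note ex = this
  define W where "W x n = (SOME w. dist (\<iota> w) x < inverse (real (Suc n)))" for x n
  have W: "dist (\<iota> (W x n)) x < inverse (real (Suc n))" for x n
    unfolding W_def by (rule someI_ex[OF ex[rule_format]])
  have limW: "(\<lambda>n. \<iota> (W x n)) \<longlonglongrightarrow> x" for x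
    by (subst tendsto_dist_iff, rule real_tendsto_sandwich[OF _ _ tendsto_const LIMSEQ_inverse_real_of_nat]) (auto intro!: always_eventually less_imp_le[OF W] simp del: of_nat_Suc)
  have cau: "Cauchy (\<lambda>n. f (W x n))" for x
    using LIMSEQ_imp_Cauchy[OF limW[of x]] by (simp add: Cauchy_def dist)
  define F where "F x = lim (\<lambda>n. f (W x n))" for x
  have FW: "(\<lambda>n. f (W x n)) \<longlonglongrightarrow> F x" for x
    using cau[of x] by (simp add: F_def Cauchy_convergent_iff convergent_LIMSEQ_iff)
  have F: "(\<lambda>n. f (s n)) \<longlonglongrightarrow> F x" if "(\<lambda>n. \<iota> (s n)) \<longlonglongrightarrow> x" for s x
  proof -
    have "(\<lambda>n. \<iota> (s n) - \<iota> (W x n)) \<longlonglongrightarrow> x - x" by (intro tendsto_diff that limW)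
    then have "(\<lambda>n. norm (f (s n) - f (W x n))) \<longlonglongrightarrow> 0"
      using dist by (simp add: tendsto_norm_zero_iff dist_norm[symmetric]) (simp add: dist_norm tendsto_norm_zero_iff)
    then have "(\<lambda>n. f (s n) - f (W x n)) \<longlonglongrightarrow> 0" by (simp add: tendsto_norm_zero_iff)
    from tendsto_add[OF this FW[of x]] show ?thesis by simp
  qed
  have Fi: "F (\<iota> w) = f w" for w using LIMSEQ_unique[OF F[of "\<lambda>_. w" "\<iota> w"]] by simp
  have Fn: "norm (F x) = norm x" for x
    using LIMSEQ_unique[OF tendsto_norm[OF FW[of x]]] tendsto_norm[OF limW[of x]] by (simp add: iso)
  have "bounded_linear F"
  proof (rule bounded_linear_intro[where K=1])
    show "F (x + y) = F x + F y" for x y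
    proof (rule LIMSEQ_unique)
      show "(\<lambda>n. f (W x n + W y n)) \<longlonglongrightarrow> F (x + y)"
        by (rule F) (auto simp: linear_add[OF li] intro: tendsto_add limW)
      show "(\<lambda>n. f (W x n + W y n)) \<longlonglongrightarrow> F x + F y"
        by (auto simp: linear_add[OF lf] intro: tendsto_add FW)
    qed
    show "F (r *\<^sub>R x) = r *\<^sub>R F x" for r x
    proof (rule LIMSEQ_unique)
      show "(\<lambda>n. f (r *\<^sub>R W x n)) \<longlonglongrightarrow> F (r *\<^sub>R x)"
        by (rule F) (auto simp: linear_scale[OF li] intro!: tendsto_scaleR limW)
      show "(\<lambda>n. f (r *\<^sub>R W x n)) \<longlonglongrightarrow> r *\<^sub>R F x"
        by (auto simp: linear_scale[OF lf] intro!: tendsto_scaleR FW)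
    qed
  qed (simp add: Fn)
  with Fi Fn show ?thesis by blast
qed

lemma bounded_linear_eq_on_dense:
  fixes f g :: "'h::real_normed_vector \<Rightarrow> 'g::real_normed_vector"
  assumes "bounded_linear f" "bounded_linear g" "\<And>w. f (\<iota> w) = g (\<iota> w)" "closure (range \<iota>) = UNIV"
  shows "f x = g x"
proof -
  interpret f: bounded_linear f by fact
  interpret g: bounded_linear g by fact
  have "closed {x. f x = g x}" by (intro closed_Collect_eq linear_continuous_on assms)
  then have "closure (range \<iota>) \<subseteq> {x. f x = g x}" by (intro closure_minimal) (use assms(3) in auto)
  then show ?thesis using assms(4) by auto
qed

lemma exp_le_one_plus_two:
  fixes x :: real assumes "0 \<le> x" "x \<le> 1" shows "exp x - 1 \<le> 2 * x"
  using exp_bound[OF assms] assms by (simp add: power2_eq_square) (smt (verit) mult_left_le)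

context analytic_rep
begin

lemma dexp_commuting:
  assumes "Z * X = X * Z" shows "dexp Z X = X" "adp Z (Suc j) X = 0"
proof -
  have *: "adp Z (Suc j) X = 0" for j by (induction j) (use assms in \<open>auto simp: adp_def\<close>)
  then show "adp Z (Suc j) X = 0" .
  have "dexp Z X = (\<Sum>j\<in>{0}. adp Z j X /\<^sub>R fact (Suc j))"
    unfolding dexp_def by (rule suminf_finite) (use * in \<open>auto simp: gr0_conv_Suc\<close>)
  then show "dexp Z X = X" by (simp add: adp_def)
qed

text \<open>The shift a allows the curve to pass through 0 at either end of the unit interval; a = 0
  serves for isometry and a = 1 for the adjoint.\<close>

lemma u_line:
  assumes S: "convex S" and s: "\<And>s. s \<in> S \<Longrightarrow> \<bar>s - a\<bar> \<le> 1" and X: "R * norm X < 1" and t: "t \<in> S"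
  shows "((\<lambda>t. u ((t - a) *\<^sub>R X) w) has_vector_derivative (\<Sum>i. \<iota> (\<rho> X ((\<rho> ((t - a) *\<^sub>R X) ^^ i) w)) /\<^sub>R fact i)) (at t within S)"
    and "summable (\<lambda>i. \<iota> (\<rho> X ((\<rho> ((t - a) *\<^sub>R X) ^^ i) w)) /\<^sub>R fact i)"
proof -
  have 1: "((\<lambda>t. (t - a) *\<^sub>R X) has_vector_derivative X) (at t within S)" for t
    by (auto intro!: derivative_eq_intros)
  have 2: "norm ((t - a) *\<^sub>R X) \<le> norm X" if "t \<in> S" for t
    using s[OF that] by (simp add: mult_left_le_one_le)
  have com: "(t - a) *\<^sub>R X * X = X * (t - a) *\<^sub>R X" by simp
  have 3: "\<rho> ((t - a) *\<^sub>R X) (\<rho> (adp ((t - a) *\<^sub>R X) j X) y) =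
     \<rho> (adp ((t - a) *\<^sub>R X) j X) (\<rho> ((t - a) *\<^sub>R X) y) + \<rho> (adp ((t - a) *\<^sub>R X) (Suc j) X) y" for j y
    by (cases j) (auto simp: dexp_commuting(2)[OF com] linear_0[OF lin_rho'] linear_0[OF lin_rho] linear_scale[OF lin_rho] linear_scale[OF lin_rho'],
      auto simp: adp_def linear_scale[OF lin_rho] linear_scale[OF lin_rho'])
  note uc = u_curve[where Z="\<lambda>t. (t - a) *\<^sub>R X" and Z'="\<lambda>_. X", OF S 1 2 X order_refl t 3, of w]
  then show "((\<lambda>t. u ((t - a) *\<^sub>R X) w) has_vector_derivative (\<Sum>i. \<iota> (\<rho> X ((\<rho> ((t - a) *\<^sub>R X) ^^ i) w)) /\<^sub>R fact i)) (at t within S)"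
    and "summable (\<lambda>i. \<iota> (\<rho> X ((\<rho> ((t - a) *\<^sub>R X) ^^ i) w)) /\<^sub>R fact i)"
    by (simp_all only: dexp_commuting(1)[OF com])
qed

lemma u_0 [simp]: "u 0 w = \<iota> w"
proof -
  have "u 0 w = (\<Sum>m\<in>{0}. \<iota> ((\<rho> 0 ^^ m) w) /\<^sub>R fact m)"
    unfolding u_def by (rule suminf_finite)
      (auto simp: gr0_conv_Suc linear_0[OF lin_rho'] linear_0[OF lin_iota])
  then show ?thesis by simp
qed

end

section \<open>Banach algebras with an anti-involution and their unitary groups\<close>

locale star_algebra =
  fixes star :: "'a::{real_normed_algebra_1,banach} \<Rightarrow> 'a"
  assumes bl_star: "bounded_linear star" and star_mult: "\<And>x y. star (x * y) = star y * star x"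
    and star_1 [simp]: "star 1 = 1" and star_star [simp]: "\<And>x. star (star x) = x"
begin

text \<open>The unitary group of the involution; its Lie algebra consists of the X with star X = -
  X. For the transpose it is the orthogonal group, for the symplectic adjoint it is Sp(2n,
  R).\<close>

definition \<Gamma> :: "'a set" where "\<Gamma> = {g. star g * g = 1 \<and> g * star g = 1}"

lemma star_minus: "star (- X) = - star X" by (rule linear_neg[OF bounded_linear.linear[OF bl_star]])

lemma star_exp: "star (exp X) = exp (star X)"
proof -
  have "star (X ^ n) = star X ^ n" for n by (induction n) (auto simp: star_mult power_commutes)
  then show ?thesis unfolding exp_def
    by (simp add: bounded_linear.suminf[OF bl_star summable_exp_generic] linear_scale[OF bounded_linear.linear[OF bl_star]])
qed

lemma exp_in_\<Gamma>: "star X = - X \<Longrightarrow> exp X \<in> \<Gamma>"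
  using exp_minus_inverse[of X] exp_minus_inverse[of "- X"] by (simp add: \<Gamma>_def star_exp)

lemma mult_in_\<Gamma>: assumes "g \<in> \<Gamma>" "h \<in> \<Gamma>" shows "g * h \<in> \<Gamma>"
proof -
  have "star h * star g * (g * h) = star h * (star g * g) * h" by (simp only: mult.assoc)
  moreover have "g * h * (star h * star g) = g * (h * star h) * star g" by (simp only: mult.assoc)
  ultimately show ?thesis using assms by (simp add: \<Gamma>_def star_mult)
qed

lemma star_in_\<Gamma>: "g \<in> \<Gamma> \<Longrightarrow> star g \<in> \<Gamma>" by (simp add: \<Gamma>_def)

lemma star_lnp: "norm (N :: 'a) < 1 \<Longrightarrow> norm (star N) < 1 \<Longrightarrow> star (lnp N) = lnp (star N)"
proof -
  assume a: "norm N < 1"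
  have "star (N ^ n) = star N ^ n" for n by (induction n) (auto simp: star_mult power_commutes)
  then show ?thesis unfolding lnp_def
    by (simp add: bounded_linear.suminf[OF bl_star summable_lnp[OF a]] linear_scale[OF bounded_linear.linear[OF bl_star]] del: power_Suc of_nat_Suc)
qed

text \<open>With X = log g, star g = g^-1 = exp (- X), and the logarithm of exp (- X) is - X. The
  bound 1/4 gives norm X \<le> 1/3, which keeps exp (- t X) within 2/3 of 1 and so on the right
  branch.\<close>

lemma lnp_skew:
  assumes g: "g \<in> \<Gamma>" and n: "norm (g - 1) \<le> 1/4"
  shows "star (lnp (g - 1)) = - lnp (g - 1)"
proof -
  define X where "X = lnp (g - 1)"
  have eX: "exp X = g" using exp_lnp[of "g - 1"] n by (simp add: X_def)
  have "norm X \<le> norm (g - 1) / (1 - norm (g - 1))" unfolding X_def by (rule norm_lnp_le) (use n in simp)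
  also have "\<dots> \<le> (1/4) / (1 - 1/4)" using n by (intro frac_le) auto
  finally have nX: "norm X \<le> 1/3" by simp
  have "exp (- X) = star g"
  proof -
    have "star g * (exp X * exp (- X)) = exp (- X)" using g by (simp add: eX \<Gamma>_def mult.assoc[symmetric])
    then show ?thesis by (simp add: exp_minus_inverse)
  qed
  have b: "norm (exp (t *\<^sub>R (- X)) - 1) \<le> 2/3" if "t \<in> {0..1}" for t
  proof -
    have "norm (t *\<^sub>R (- X)) \<le> 1/3" using that nX mult_left_le_one_le[of "norm X" t] by simp
    then have "exp (norm (t *\<^sub>R (- X))) - 1 \<le> 2 * (1/3)"
      using exp_le_one_plus_two[OF norm_ge_zero, of "t *\<^sub>R (- X)"] by simp
    then show ?thesis using norm_exp_minus_1_le[of "t *\<^sub>R (- X)"] by simp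
  qed
  have "lnp (star g - 1) = - X" using lnp_exp[OF b] \<open>exp (- X) = star g\<close> by simp
  moreover have "star (lnp (g - 1)) = lnp (star (g - 1))"
  proof (rule star_lnp)
    show "norm (star (g - 1)) < 1"
      using b[of 1] \<open>exp (- X) = star g\<close> by (simp add: linear_diff[OF bounded_linear.linear[OF bl_star]])
  qed (use n in simp)
  ultimately show ?thesis by (simp add: X_def linear_diff[OF bounded_linear.linear[OF bl_star]])
qed

end

section \<open>Unitary operators near the identity\<close>

locale unitary_analytic_rep = analytic_rep Ba coord \<iota> \<rho> R + star_algebra star
  for Ba :: "'a::{real_normed_algebra_1,banach} set" and coord :: "'a \<Rightarrow> 'a \<Rightarrow> real"
    and \<iota> :: "'f::real_vector \<Rightarrow> 'h::{real_inner,banach}" and \<rho> :: "'a \<Rightarrow> 'f \<Rightarrow> 'f" and R :: real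
    and star :: "'a \<Rightarrow> 'a" +
  assumes dense: "closure (range \<iota>) = UNIV"
    and skew: "\<And>X v w. star X = - X \<Longrightarrow> inner (\<iota> (\<rho> X v)) (\<iota> w) = - inner (\<iota> v) (\<iota> (\<rho> X w))"
    and bracket: "\<And>X Y w. star X = - X \<Longrightarrow> star Y = - Y \<Longrightarrow> \<rho> (X * Y - Y * X) w = \<rho> X (\<rho> Y w) - \<rho> Y (\<rho> X w)"
begin

text \<open>The equation y' = X y in weak form. X acts on \<open>'f\<close> only, so it is moved to
  the test vector, and skewness accounts for the sign.\<close>

definition weak :: "'a \<Rightarrow> 'h \<Rightarrow> 'h \<Rightarrow> bool" where
  "weak X y y' \<longleftrightarrow> (\<forall>v. inner y' (\<iota> v) = - inner y (\<iota> (\<rho> X v)))"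

lemma weak_series:
  assumes "star X = - X" "summable (\<lambda>i. \<iota> (w i) /\<^sub>R fact i)" "summable (\<lambda>i. \<iota> (\<rho> X (w i)) /\<^sub>R fact i)"
  shows "weak X (\<Sum>i. \<iota> (w i) /\<^sub>R fact i) (\<Sum>i. \<iota> (\<rho> X (w i)) /\<^sub>R fact i)"
  unfolding weak_def
proof
  fix v
  have "inner (\<Sum>i. \<iota> (\<rho> X (w i)) /\<^sub>R fact i) (\<iota> v) = (\<Sum>i. inner (\<iota> (\<rho> X (w i)) /\<^sub>R fact i) (\<iota> v))"
    by (rule bounded_linear.suminf[OF bounded_linear_inner_left assms(3)])
  also have "\<dots> = (\<Sum>i. - inner (\<iota> (w i) /\<^sub>R fact i) (\<iota> (\<rho> X v)))"
    using skew[OF assms(1)] by simp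
  also have "\<dots> = - (\<Sum>i. inner (\<iota> (w i) /\<^sub>R fact i) (\<iota> (\<rho> X v)))"
    by (rule suminf_minus) (rule bounded_linear.summable[OF bounded_linear_inner_left assms(2)])
  also have "(\<Sum>i. inner (\<iota> (w i) /\<^sub>R fact i) (\<iota> (\<rho> X v))) = inner (\<Sum>i. \<iota> (w i) /\<^sub>R fact i) (\<iota> (\<rho> X v))"
    by (rule bounded_linear.suminf[OF bounded_linear_inner_left assms(2), symmetric])
  finally show "inner (\<Sum>i. \<iota> (\<rho> X (w i)) /\<^sub>R fact i) (\<iota> v) = - inner (\<Sum>i. \<iota> (w i) /\<^sub>R fact i) (\<iota> (\<rho> X v))" .
qed

lemma inner_weak_series:
  assumes "weak X y y'" "summable (\<lambda>i. \<iota> (w i) /\<^sub>R fact i)" "summable (\<lambda>i. \<iota> (\<rho> X (w i)) /\<^sub>R fact i)"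
  shows "inner y' (\<Sum>i. \<iota> (w i) /\<^sub>R fact i) = - inner y (\<Sum>i. \<iota> (\<rho> X (w i)) /\<^sub>R fact i)"
proof -
  have "inner y' (\<Sum>i. \<iota> (w i) /\<^sub>R fact i) = (\<Sum>i. inner y' (\<iota> (w i) /\<^sub>R fact i))"
    by (rule bounded_linear.suminf[OF bounded_linear_inner_right assms(2)])
  also have "\<dots> = (\<Sum>i. - inner y (\<iota> (\<rho> X (w i)) /\<^sub>R fact i))"
    using assms(1) by (simp add: weak_def)
  also have "\<dots> = - (\<Sum>i. inner y (\<iota> (\<rho> X (w i)) /\<^sub>R fact i))"
    by (rule suminf_minus) (rule bounded_linear.summable[OF bounded_linear_inner_right assms(3)])
  also have "(\<Sum>i. inner y (\<iota> (\<rho> X (w i)) /\<^sub>R fact i)) = inner y (\<Sum>i. \<iota> (\<rho> X (w i)) /\<^sub>R fact i)"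
    by (rule bounded_linear.suminf[OF bounded_linear_inner_right assms(3), symmetric])
  finally show ?thesis .
qed

text \<open>One entry solves y' = X y weakly, the other solves it by its series; the sign in
  \<open>weak\<close> cancels the two terms of the product rule. This constancy is the substitute
  for uniqueness of solutions when X is unbounded.\<close>

lemma inner_const:
  assumes y: "\<And>t. t \<in> {0..1} \<Longrightarrow> (y has_vector_derivative y' t) (at t within {0..1})"
    and wk: "\<And>t. t \<in> {0..1} \<Longrightarrow> weak X (y t) (y' t)"
    and X: "R * norm X < 1" and a: "a \<in> {0..1}"
  shows "inner (y 0) (u ((0 - a) *\<^sub>R X) v) = inner (y 1) (u ((1 - a) *\<^sub>R X) v)"
proof (rule has_vector_derivative_zero_eq[where f="\<lambda>t. inner (y t) (u ((t - a) *\<^sub>R X) v)" and a=0 and b=1])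
  fix t :: real assume t: "t \<in> {0..1}"
  have s: "\<bar>s - a\<bar> \<le> 1" if "s \<in> {0..1}" for s using a that by auto
  have ta: "R * norm ((t - a) *\<^sub>R X) < 1"
  proof -
    have "R * norm ((t - a) *\<^sub>R X) \<le> R * norm X"
      using s[OF t] R1 by (intro mult_left_mono) (auto simp: mult_left_le_one_le)
    then show ?thesis using X by simp
  qed
  note ul = u_line[OF convex_real_interval(5) s X t, of v]
  have "inner (y t) (\<Sum>i. \<iota> (\<rho> X ((\<rho> ((t - a) *\<^sub>R X) ^^ i) v)) /\<^sub>R fact i) + inner (y' t) (u ((t - a) *\<^sub>R X) v) = 0"
    unfolding u_def using inner_weak_series[OF wk[OF t] summable_u[OF ta] ul(2)] by simp
  moreover have "((\<lambda>t. inner (y t) (u ((t - a) *\<^sub>R X) v)) has_vector_derivative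
     inner (y t) (\<Sum>i. \<iota> (\<rho> X ((\<rho> ((t - a) *\<^sub>R X) ^^ i) v)) /\<^sub>R fact i) + inner (y' t) (u ((t - a) *\<^sub>R X) v)) (at t within {0..1})"
    by (rule bounded_bilinear.has_vector_derivative[OF bounded_bilinear_inner y[OF t] ul(1)])
  ultimately show "((\<lambda>t. inner (y t) (u ((t - a) *\<^sub>R X) v)) has_vector_derivative 0) (at t within {0..1})" by simp
qed auto

lemma u_line_inner:
  assumes X: "star X = - X" "R * norm X < 1" and a: "a \<in> {0..1}"
  shows "inner (\<iota> w) (u ((0 - a) *\<^sub>R X) v) = inner (u X w) (u ((1 - a) *\<^sub>R X) v)"
proof -
  have "inner (u ((0 - 0) *\<^sub>R X) w) (u ((0 - a) *\<^sub>R X) v) = inner (u ((1 - 0) *\<^sub>R X) w) (u ((1 - a) *\<^sub>R X) v)"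
  proof (rule inner_const[where y="\<lambda>t. u ((t - 0) *\<^sub>R X) w" and y'="\<lambda>t. (\<Sum>i. \<iota> (\<rho> X ((\<rho> ((t - 0) *\<^sub>R X) ^^ i) w)) /\<^sub>R fact i)", OF _ _ X(2) a])
    fix t :: real assume t: "t \<in> {0..1}"
    have s: "\<bar>s - 0\<bar> \<le> 1" if "s \<in> {0..1}" for s :: real using that by auto
    note ul = u_line[OF convex_real_interval(5) s X(2) t, of w]
    show "((\<lambda>t. u ((t - 0) *\<^sub>R X) w) has_vector_derivative (\<Sum>i. \<iota> (\<rho> X ((\<rho> ((t - 0) *\<^sub>R X) ^^ i) w)) /\<^sub>R fact i)) (at t within {0..1})"
      by (rule ul)
    have "R * norm ((t - 0) *\<^sub>R X) \<le> R * norm X"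
      using s[OF t] R1 by (intro mult_left_mono) (auto simp: mult_left_le_one_le)
    then have "R * norm ((t - 0) *\<^sub>R X) < 1" using X by simp
    from weak_series[OF X(1) summable_u[OF this] ul(2)]
    show "weak X (u ((t - 0) *\<^sub>R X) w) (\<Sum>i. \<iota> (\<rho> X ((\<rho> ((t - 0) *\<^sub>R X) ^^ i) w)) /\<^sub>R fact i)"
      by (simp add: u_def)
  qed
  then show ?thesis by simp
qed

lemma norm_u: assumes "star X = - X" "R * norm X < 1" shows "norm (u X w) = norm (\<iota> w)"
  using u_line_inner[OF assms, of 0 w w] by (simp add: norm_eq_sqrt_inner)

definition U :: "'a \<Rightarrow> 'h \<Rightarrow> 'h" where
  "U X = (SOME F. bounded_linear F \<and> (\<forall>w. F (\<iota> w) = u X w) \<and> (\<forall>x. norm (F x) = norm x))"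

lemma U: assumes "star X = - X" "R * norm X < 1"
  shows "bounded_linear (U X)" "U X (\<iota> w) = u X w" "norm (U X x) = norm x"
proof -
  have "linear (u X)" by (rule linearI) (use u_add u_scale assms(2) in auto)
  from someI_ex[OF isometric_extension[OF lin_iota this norm_u[OF assms] dense]]
  show "bounded_linear (U X)" "U X (\<iota> w) = u X w" "norm (U X x) = norm x" unfolding U_def by blast+
qed

lemmas eq_on_dense = bounded_linear_eq_on_dense[OF _ _ _ dense]

lemma inner_U:
  assumes X: "star X = - X" "R * norm X < 1"
  shows "inner (U X x) (U X y) = inner x y"
proof -
  interpret bounded_linear "U X" by (rule U[OF X])
  have "norm (U X x + U X y) = norm (x + y)" by (simp add: add[symmetric] U[OF X])
  then have "inner (U X x + U X y) (U X x + U X y) = inner (x + y) (x + y)" by (simp add: norm_eq)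
  moreover have "inner (U X x) (U X x) = inner x x" "inner (U X y) (U X y) = inner y y"
    using U(3)[OF X] by (simp_all add: norm_eq)
  ultimately show ?thesis by (simp add: inner_add inner_commute)
qed

lemma inner_U_adjoint:
  assumes X: "star X = - X" "R * norm X < 1"
  shows "inner (U X x) y = inner x (U (- X) y)"
proof -
  have X': "star (- X) = - (- X)" "R * norm (- X) < 1" using X by (auto simp: star_minus)
  have "inner (U X x) (\<iota> v) = inner x (U (- X) (\<iota> v))" for v
  proof (rule eq_on_dense[where f="\<lambda>x. inner (U X x) (\<iota> v)"])
    show "inner (U X (\<iota> w)) (\<iota> v) = inner (\<iota> w) (U (- X) (\<iota> v))" for w
      using u_line_inner[OF X, of 1 w v] by (simp add: U[OF X] U[OF X'])
  qed (intro bounded_linear_inner_left bounded_linear_compose[OF bounded_linear_inner_left U(1)[OF X]])+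
  note on_range = this
  show ?thesis
    by (rule eq_on_dense[OF bounded_linear_inner_right bounded_linear_compose[OF bounded_linear_inner_right U(1)[OF X']] on_range])
qed

text \<open>Multiplicativity is not yet available, but adjointness and isometry suffice: <U (- X) U
  X x, y> = <U X x, U X y> = <x, y>.\<close>

lemma U_inverse:
  assumes X: "star X = - X" "R * norm X < 1"
  shows "U (- X) (U X x) = x"
proof -
  have X': "star (- X) = - (- X)" "R * norm (- X) < 1" using X by (auto simp: star_minus)
  have "inner (U (- X) (U X x) - x) y = 0" for y
    using inner_U_adjoint[OF X', of "U X x" y] inner_U[OF X, of x y] by (simp add: inner_diff_left)
  from this[of "U (- X) (U X x) - x"] show ?thesis by simp
qed

text \<open>The algebra acts on itself by left multiplication, with growth constant 1. Thus
  \<open>u_curve\<close> also yields the derivative of exp along a curve that does not commute with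
  its derivative.\<close>

interpretation alg: analytic_rep Ba coord "\<lambda>x. x" "(*)" 1
proof (rule analytic_rep.intro)
  show "bounded_linear (coord b)" for b by (rule coord)
  show "\<exists>M. \<forall>Xs. norm (foldr (*) Xs w) \<le> M * fact (length Xs) * (\<Prod>X\<leftarrow>Xs. 1 * norm X)" for w :: 'a
  proof (intro exI allI)
    fix Xs show "norm (foldr (*) Xs w) \<le> norm w * fact (length Xs) * (\<Prod>X\<leftarrow>Xs. 1 * norm X)"
    proof (induction Xs)
      case (Cons X Xs)
      have p: "0 \<le> (\<Prod>X\<leftarrow>Xs. 1 * norm X)" by (induction Xs) auto
      have "norm (foldr (*) (X # Xs) w) \<le> norm X * norm (foldr (*) Xs w)" by (simp add: norm_mult_ineq)
      also have "\<dots> \<le> norm X * (norm w * fact (length Xs) * (\<Prod>X\<leftarrow>Xs. 1 * norm X))"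
        using Cons by (intro mult_left_mono) auto
      also have "\<dots> = norm w * fact (length Xs) * (\<Prod>X\<leftarrow>X # Xs. 1 * norm X)" by simp
      also have "\<dots> \<le> norm w * fact (length (X # Xs)) * (\<Prod>X\<leftarrow>X # Xs. 1 * norm X)"
        using p by (intro mult_right_mono mult_left_mono fact_mono) auto
      finally show ?case .
    qed simp
  qed
qed (use fin expand in \<open>auto intro!: linearI simp: algebra_simps simp del: real_norm_def\<close>)

lemma exp_curve:
  assumes S: "convex S" and d: "\<And>t. t \<in> S \<Longrightarrow> (Z has_vector_derivative Z' t) (at t within S)"
    and r: "\<And>t. t \<in> S \<Longrightarrow> norm (Z t) \<le> r" "r < 1" and c: "\<And>t. t \<in> S \<Longrightarrow> norm (Z' t) \<le> c" and t: "t \<in> S"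
  shows "((\<lambda>t. exp (Z t)) has_vector_derivative dexp (Z t) (Z' t) * exp (Z t)) (at t within S)"
proof -
  have p: "((*) X ^^ i) 1 = X ^ i" for X :: 'a and i by (induction i) auto
  have "alg.u X 1 = exp X" for X by (simp add: alg.u_def exp_def p)
  moreover have "alg.dexp = dexp" "alg.adp = adp" by (auto simp: fun_eq_iff alg.dexp_def dexp_def alg.adp_def adp_def)
  moreover have "(\<Sum>i. B * Z t ^ i /\<^sub>R fact i) = B * exp (Z t)" for B
    unfolding exp_def by (subst suminf_mult[symmetric]) (auto simp: summable_exp_generic)
  ultimately show ?thesis
    using alg.u_curve(1)[of S Z Z' r c t 1] assms by (simp add: p alg.adp_def algebra_simps)
qed

end

lemma has_vector_derivative_lnp_ex:
  fixes N :: "real \<Rightarrow> 'a::{real_normed_algebra_1,banach}"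
  assumes S: "convex S" and d: "\<And>t. t \<in> S \<Longrightarrow> (N has_vector_derivative N' t) (at t within S)"
    and r: "\<And>t. t \<in> S \<Longrightarrow> norm (N t) \<le> r" "0 \<le> r" "r < 1" and c: "\<And>t. t \<in> S \<Longrightarrow> norm (N' t) \<le> c"
  shows "\<exists>Z'. \<forall>t\<in>S. ((\<lambda>t. lnp (N t)) has_vector_derivative Z' t) (at t within S) \<and> norm (Z' t) \<le> c / (1 - r)"
proof -
  let ?d = "\<lambda>t m. ((- 1) ^ m / real (Suc m)) *\<^sub>R (\<Sum>a<Suc m. N t ^ a * N' t * N t ^ (m - a))"
  show ?thesis
  proof (intro exI ballI conjI)
    fix t assume t: "t \<in> S"
    show "((\<lambda>t. lnp (N t)) has_vector_derivative
      (\<Sum>m. ?d t m)) (at t within S)"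
      by (rule has_vector_derivative_lnp[OF S d r(1,3) c t])
    have "norm (\<Sum>m. ?d t m) \<le> (\<Sum>m. c * r ^ m)"
    proof (rule norm_suminf_le)
      show "summable (\<lambda>m. c * r ^ m)" using r by (intro summable_mult summable_geometric) auto
      fix n
      have "norm (?d t n)
         = (1 / real (Suc n)) * norm (\<Sum>a<Suc n. N t ^ a * N' t * N t ^ (n - a))"
        by (simp only: norm_scaleR) (simp add: power_abs)
      also have "\<dots> \<le> (1 / real (Suc n)) * (real (Suc n) * (c * r ^ n))"
        using norm_power_sum_le[OF r(1)[OF t] c[OF t], of "Suc n"] by (intro mult_left_mono) auto
      also have "\<dots> = c * r ^ n" by simp
      finally show "norm (?d t n) \<le> c * r ^ n" .
    qed
    also have "\<dots> = c / (1 - r)" using r by (subst suminf_mult) (auto simp: suminf_geometric)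
    finally show "norm (\<Sum>m. ?d t m) \<le> c / (1 - r)" .
  qed
qed

lemma norm_lnp_le': "norm (N::'a::{real_normed_algebra_1,banach}) \<le> 1/4 \<Longrightarrow> norm (lnp N) \<le> 4/3 * norm N"
proof -
  assume a: "norm N \<le> 1/4"
  have "norm (lnp N) \<le> norm N / (1 - norm N)" by (rule norm_lnp_le) (use a in simp)
  also have "\<dots> \<le> norm N / (3/4)" using a by (intro divide_left_mono) auto
  finally show ?thesis by simp
qed

lemma norm_exp_minus_1_le': "norm (X::'a::{real_normed_algebra_1,banach}) \<le> 1 \<Longrightarrow> norm (exp X - 1) \<le> 2 * norm X"
  using norm_exp_minus_1_le[of X] exp_le_one_plus_two[OF norm_ge_zero, of X] by linarith

context unitary_analytic_rep
begin

definition L :: "'a \<Rightarrow> 'h \<Rightarrow> 'h" where "L g = U (lnp (g - 1))"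

text \<open>For two elements within \<epsilon> of 1, the curve leading to their product stays within
  4 \<epsilon> of 1, and logarithms there have norm at most 16/3 \<epsilon>. The choice makes R
  times this bound equal to 1/6, well inside the radius of convergence.\<close>

definition \<epsilon> :: real where "\<epsilon> = 1 / (32 * R)"

lemma eps: "0 < \<epsilon>" "\<epsilon> \<le> 1/32" "R * \<epsilon> = 1/32"
  using R1 by (auto simp: \<epsilon>_def field_simps)

lemma lnp_facts:
  assumes "g \<in> \<Gamma>" "norm (g - 1) \<le> 4 * \<epsilon>"
  shows "star (lnp (g - 1)) = - lnp (g - 1)" "R * norm (lnp (g - 1)) \<le> 1/6" "norm (lnp (g - 1)) \<le> 1/6"
    "exp (lnp (g - 1)) = g" "norm (lnp (g - 1)) \<le> 4/3 * norm (g - 1)"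
proof -
  have n: "norm (g - 1) \<le> 1/4" using assms eps by simp
  show l: "norm (lnp (g - 1)) \<le> 4/3 * norm (g - 1)" by (rule norm_lnp_le'[OF n])
  show "star (lnp (g - 1)) = - lnp (g - 1)" by (rule lnp_skew[OF assms(1) n])
  show "exp (lnp (g - 1)) = g" using exp_lnp[of "g - 1"] n by simp
  show "norm (lnp (g - 1)) \<le> 1/6" using l assms eps by simp
  have "norm (lnp (g - 1)) \<le> 16/3 * \<epsilon>" using l assms by simp
  then have "R * norm (lnp (g - 1)) \<le> R * (16/3 * \<epsilon>)" using R1 by (intro mult_left_mono) auto
  then show "R * norm (lnp (g - 1)) \<le> 1/6" using eps(3) by simp
qed

lemma star_adp:
  assumes "star Z = - Z" "star Y = - Y" shows "star (adp Z j Y) = - adp Z j Y"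
proof (induction j)
  case (Suc j)
  have "star (Z * adp Z j Y - adp Z j Y * Z) = star (adp Z j Y) * star Z - star Z * star (adp Z j Y)"
    by (simp add: linear_diff[OF bounded_linear.linear[OF bl_star]] star_mult)
  then show ?case using Suc assms by (simp add: adp_def)
qed (use assms in \<open>simp add: adp_def\<close>)

text \<open>The logarithm \<open>Z\<close> of \<open>exp (t X) h\<close> solves \<open>dexp Z Z' = X\<close>, hence \<open>u Z w\<close>, like \<open>U (t X) (U Y (\<iota> w))\<close>, is a weak solution of \<open>y' = X y\<close>.\<close>

lemma L_mult:
  assumes g: "g \<in> \<Gamma>" "norm (g - 1) \<le> \<epsilon>" and h: "h \<in> \<Gamma>" "norm (h - 1) \<le> \<epsilon>"
  shows "L (g * h) x = L g (L h x)"
proof -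
  define X where "X = lnp (g - 1)"
  define Y where "Y = lnp (h - 1)"
  have g4: "norm (g - 1) \<le> 4 * \<epsilon>" and h4: "norm (h - 1) \<le> 4 * \<epsilon>" using g h eps by auto
  note X = lnp_facts[OF g(1) g4, folded X_def] and Y = lnp_facts[OF h(1) h4, folded Y_def]
  have RX: "R * norm X < 1" and RY: "R * norm Y < 1" using X Y by auto
  \<comment> \<open>The curve 1 + N t leads from h at t = 0 to g h at t = 1.\<close>
  define N where "N t = exp (t *\<^sub>R X) * exp Y - 1" for t :: real
  define Z where "Z t = lnp (N t)" for t
  have \<Gamma>N: "N t + 1 \<in> \<Gamma>" for t unfolding N_def using X(1) Y(1)
    by (auto intro!: mult_in_\<Gamma> exp_in_\<Gamma> simp: linear_scale[OF bounded_linear.linear[OF bl_star]])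
  have nN: "norm (N t) \<le> 4 * \<epsilon>" if t: "t \<in> {0..1}" for t
  proof -
    have tX: "norm (t *\<^sub>R X) \<le> 4/3 * \<epsilon>"
      using mult_left_le_one_le[of "norm X" t] t X(5) g(2) by simp
    then have "norm (exp (t *\<^sub>R X) - 1) \<le> 8/3 * \<epsilon>"
      using norm_exp_minus_1_le'[of "t *\<^sub>R X"] eps by simp
    moreover have "norm (exp Y) \<le> 33/32" using norm_triangle_ineq[of "h - 1" 1] h(2) eps(2) by (simp add: Y(4))
    ultimately have "norm ((exp (t *\<^sub>R X) - 1) * exp Y) \<le> 8/3 * \<epsilon> * (33/32)"
      using eps(1) by (intro norm_mult_ineq[THEN order_trans] mult_mono) auto
    moreover have "N t = (exp (t *\<^sub>R X) - 1) * exp Y + (h - 1)" by (simp add: N_def Y(4) algebra_simps)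
    ultimately have "norm (N t) \<le> 8/3 * \<epsilon> * (33/32) + \<epsilon>"
      using h(2) norm_triangle_ineq[of "(exp (t *\<^sub>R X) - 1) * exp Y" "h - 1"] by simp
    then show ?thesis using eps by simp
  qed
  have Zf: "star (Z t) = - Z t" "R * norm (Z t) \<le> 1/6" "norm (Z t) \<le> 1/6" "exp (Z t) = N t + 1" if "t \<in> {0..1}" for t
    using lnp_facts[OF \<Gamma>N[of t]] nN[OF that] by (auto simp: Z_def)
  have dN: "(N has_vector_derivative X * (N t + 1)) (at t within {0..1})" for t
    unfolding N_def using exp_scaleR_has_vector_derivative_left[of X t, THEN has_vector_derivative_at_within]
    by (auto intro!: derivative_eq_intros simp: mult.assoc)
  have nN1: "norm (N t) \<le> 1/8" if "t \<in> {0..1}" for t using nN[OF that] eps by simp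
  have cN: "norm (X * (N t + 1)) \<le> norm X * 2" if "t \<in> {0..1}" for t
    using norm_triangle_ineq[of "N t" 1] nN1[OF that] by (intro norm_mult_ineq[THEN order_trans] mult_left_mono) auto
  obtain Z' where Z': "\<And>t. t \<in> {0..1} \<Longrightarrow> (Z has_vector_derivative Z' t) (at t within {0..1})"
     "\<And>t. t \<in> {0..1} \<Longrightarrow> norm (Z' t) \<le> norm X * 2 / (1 - 1/8)"
    using has_vector_derivative_lnp_ex[OF convex_real_interval(5)[of 0 1] dN nN1 _ _ cN]
    unfolding Z_def[abs_def] by (auto simp del: atLeastAtMost_iff)
  have nb: "at t within {0..1} \<noteq> bot" if "t \<in> {0..1}" for t :: real
    using that by (simp add: trivial_limit_within)
  \<comment> \<open>The curve Z consists of skew elements, hence so does its derivative. This admits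
    Z' and all iterated commutators to the bracket relation of \<rho>.\<close>
  have starZ': "star (Z' t) = - Z' t" if t: "t \<in> {0..1}" for t
  proof (rule vector_derivative_unique_within[OF nb[OF t]])
    show "((\<lambda>t. star (Z t)) has_vector_derivative star (Z' t)) (at t within {0..1})"
      by (rule bounded_linear.has_vector_derivative[OF bl_star Z'(1)[OF t]])
    have "((\<lambda>t. - Z t) has_vector_derivative - Z' t) (at t within {0..1})"
      by (intro has_vector_derivative_minus Z'(1) t)
    then show "((\<lambda>t. star (Z t)) has_vector_derivative - Z' t) (at t within {0..1})"
      by (rule has_vector_derivative_transform[OF t, rotated]) (simp add: Zf)
  qed
  \<comment> \<open>Two expressions for the derivative of exp (Z t) = exp (t X) h are compared, and
    the invertible factor exp (Z t) is cancelled.\<close>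
  have de: "dexp (Z t) (Z' t) = X" if t: "t \<in> {0..1}" for t
  proof -
    have "((\<lambda>t. exp (Z t)) has_vector_derivative dexp (Z t) (Z' t) * exp (Z t)) (at t within {0..1})"
      by (rule exp_curve[where r="1/6" and c="norm X * 2 / (1 - 1/8)"]) (use Z' Zf t in auto)
    moreover have "((\<lambda>t. exp (Z t)) has_vector_derivative X * exp (Z t)) (at t within {0..1})"
    proof -
      have "((\<lambda>t. N t + 1) has_vector_derivative X * (N t + 1)) (at t within {0..1})"
        using dN[of t] by (auto intro!: derivative_eq_intros)
      then show ?thesis unfolding Zf(4)[OF t]
        by (rule has_vector_derivative_transform[OF t, rotated]) (simp add: Zf)
    qed
    ultimately have "dexp (Z t) (Z' t) * exp (Z t) = X * exp (Z t)"
      by (rule vector_derivative_unique_within[OF nb[OF t]])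
    then have "dexp (Z t) (Z' t) * exp (Z t) * exp (- Z t) = X * exp (Z t) * exp (- Z t)" by simp
    then show ?thesis by (simp add: mult.assoc exp_minus_inverse)
  qed
  \<comment> \<open>At t = 0 the constant is <exp Y w, v>, at t = 1 it is <exp (Z 1) w, exp X v>.
    Passing exp X to the other side as its adjoint exp (- X) gives exp Y w = exp (- X) exp (Z 1)
    w.\<close>
  have key: "inner (u (Z 0) w) (\<iota> v) = inner (u (Z 1) w) (u X v)" for v w
  proof -
    have "inner (u (Z 0) w) (u ((0 - 0) *\<^sub>R X) v) = inner (u (Z 1) w) (u ((1 - 0) *\<^sub>R X) v)"
    proof (rule inner_const[where y="\<lambda>t. u (Z t) w" and y'="\<lambda>t. (\<Sum>i. \<iota> (\<rho> X ((\<rho> (Z t) ^^ i) w)) /\<^sub>R fact i)", OF _ _ RX])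
      fix t :: real assume t: "t \<in> {0..1}"
      have ad: "\<rho> (Z t) (\<rho> (adp (Z t) j (Z' t)) y) = \<rho> (adp (Z t) j (Z' t)) (\<rho> (Z t) y) + \<rho> (adp (Z t) (Suc j) (Z' t)) y" for j y
        using bracket[OF Zf(1)[OF t] star_adp[OF Zf(1)[OF t] starZ'[OF t], of j], of y] by (simp add: adp_def)
      have r: "norm (Z t) \<le> 1/(6*R)" if "t \<in> {0..1}" for t using Zf(2)[OF that] R1 by (simp add: field_simps)
      have r1: "R * (1/(6*R)) < 1" using R1 by simp
      note uc = u_curve[where Z=Z and Z'=Z', OF convex_real_interval(5) Z'(1) r r1 Z'(2) t ad, of w, unfolded de[OF t]]
      show "((\<lambda>t. u (Z t) w) has_vector_derivative (\<Sum>i. \<iota> (\<rho> X ((\<rho> (Z t) ^^ i) w)) /\<^sub>R fact i)) (at t within {0..1})"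
        by (rule uc)
      have "R * norm (Z t) < 1" using Zf(2)[OF t] by simp
      from weak_series[OF X(1) summable_u[OF this] uc(2)]
      show "weak X (u (Z t) w) (\<Sum>i. \<iota> (\<rho> X ((\<rho> (Z t) ^^ i) w)) /\<^sub>R fact i)" by (simp add: u_def)
    qed auto
    then show ?thesis by simp
  qed
  have Z0: "Z 0 = Y" and Z1: "Z 1 = lnp (g * h - 1)" by (auto simp: Z_def N_def Y_def X(4) Y(4)[unfolded Y_def])
  have Z1f: "star (Z 1) = - Z 1" "R * norm (Z 1) < 1" using Zf(1,2)[of 1] by auto
  have X': "star (- X) = - (- X)" "R * norm (- X) < 1" using X RX by (auto simp: star_minus)
  have "U X (U Y (\<iota> w)) = U (Z 1) (\<iota> w)" for w
  proof -
    have "inner (U Y (\<iota> w)) y = inner (U (- X) (U (Z 1) (\<iota> w))) y" for y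
    proof (rule eq_on_dense[OF bounded_linear_inner_right bounded_linear_inner_right])
      fix v
      show "inner (U Y (\<iota> w)) (\<iota> v) = inner (U (- X) (U (Z 1) (\<iota> w))) (\<iota> v)"
        using key[of w v] inner_U_adjoint[OF X', of "U (Z 1) (\<iota> w)" "\<iota> v"]
        by (simp add: Z0 U(2)[OF X(1) RX] U(2)[OF Y(1) RY] U(2)[OF Z1f])
    qed
    then have "U Y (\<iota> w) = U (- X) (U (Z 1) (\<iota> w))" by (metis inner_commute vector_eq_rdot)
    then show ?thesis using U_inverse[OF X', of "U (Z 1) (\<iota> w)"] by simp
  qed
  note on_range = this
  have "U X (U Y x) = U (Z 1) x"
    by (rule eq_on_dense[OF bounded_linear_compose[OF U(1)[OF X(1) RX] U(1)[OF Y(1) RY]] U(1)[OF Z1f] on_range])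
  then show ?thesis by (simp add: L_def Z1 X_def Y_def)
qed

lemma L_props:
  assumes "g \<in> \<Gamma>" "norm (g - 1) \<le> \<epsilon>"
  shows "bounded_linear (L g)" "norm (L g x) = norm x" "inner (L g x) (L g y) = inner x y" "surj (L g)"
proof -
  have g4: "norm (g - 1) \<le> 4 * \<epsilon>" using assms eps by auto
  note X = lnp_facts[OF assms(1) g4]
  have RX: "R * norm (lnp (g - 1)) < 1" using X by auto
  show "bounded_linear (L g)" "norm (L g x) = norm x" "inner (L g x) (L g y) = inner x y"
    unfolding L_def using U[OF X(1) RX] inner_U[OF X(1) RX] by auto
  have X': "star (- lnp (g - 1)) = - (- lnp (g - 1))" "R * norm (- lnp (g - 1)) < 1" using X RX by (auto simp: star_minus)
  show "surj (L g)" unfolding L_def surj_def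
    using U_inverse[OF X'] by (metis minus_minus)
qed

lemma L_exp:
  assumes X: "star X = - X" "norm X \<le> 1/8" shows "L (exp X) = U X"
proof -
  have "lnp (exp X - 1) = X"
  proof (rule lnp_exp)
    fix t :: real assume "t \<in> {0..1}"
    then have "norm (t *\<^sub>R X) \<le> 1/8" using X mult_left_le_one_le[of "norm X" t] by simp
    then show "norm (exp (t *\<^sub>R X) - 1) \<le> 1/4" using norm_exp_minus_1_le'[of "t *\<^sub>R X"] by simp
  qed simp
  then show ?thesis by (simp add: L_def)
qed

lemma L_one: "L 1 x = x"
proof -
  have "L 1 x = U 0 x" using L_exp[of 0] linear_0[OF bounded_linear.linear[OF bl_star]] by simp
  also have "U 0 x = x"
    by (rule eq_on_dense[OF U(1) bounded_linear_ident]) (use U(2)[of 0] linear_0[OF bounded_linear.linear[OF bl_star]] in auto)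
  finally show ?thesis .
qed

lemma L_continuous:
  assumes e: "e > 0"
  shows "\<exists>d>0. \<forall>g\<in>\<Gamma>. norm (g - 1) < d \<longrightarrow> norm (L g x - x) < e"
proof -
  have "x \<in> closure (range \<iota>)" by (simp add: dense)
  then obtain w where w: "norm (\<iota> w - x) < e / 3"
    using e unfolding closure_approachable by (auto simp: dist_norm dest!: spec[of _ "e/3"])
  obtain M where M: "M \<ge> 0" "\<And>X. R * norm X \<le> 1/2 \<Longrightarrow> norm (u X w - \<iota> w) \<le> M * norm X"
    using norm_u_diff_le[of w] by blast
  define d where "d = min \<epsilon> (e / (6 * (M + 1)))"
  have d0: "d > 0" using e eps M by (simp add: d_def)
  have "norm (L g x - x) < e" if g: "g \<in> \<Gamma>" "norm (g - 1) < d" for g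
  proof -
    have ge: "norm (g - 1) \<le> \<epsilon>" and ge': "norm (g - 1) \<le> 4 * \<epsilon>" using g eps by (auto simp: d_def)
    note X = lnp_facts[OF g(1) ge'] and P = L_props[OF g(1) ge]
    have RX: "R * norm (lnp (g - 1)) < 1" using X by auto
    interpret bounded_linear "L g" by (rule P)
    have "norm (L g (\<iota> w) - \<iota> w) \<le> M * (4/3 * norm (g - 1))"
      using M(2)[of "lnp (g - 1)"] X M(1) mult_left_mono[OF X(5) M(1)] by (simp add: L_def U(2)[OF X(1) RX])
    also have "\<dots> \<le> M * (4/3 * (e / (6 * (M + 1))))" using g M by (intro mult_left_mono) (auto simp: d_def)
    also have "\<dots> < e / 3" using M e by (simp add: field_simps) (smt (verit) mult_pos_pos mult_nonneg_nonneg)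
    finally have 1: "norm (L g (\<iota> w) - \<iota> w) < e / 3" .
    have "norm (L g (x - \<iota> w)) < e / 3" using w by (simp add: P norm_minus_commute)
    then have 2: "norm (L g x - L g (\<iota> w)) < e / 3" by (simp add: diff)
    have "norm (L g x - x) = norm ((L g x - L g (\<iota> w)) + (L g (\<iota> w) - \<iota> w) + (\<iota> w - x))" by simp
    then show ?thesis using 1 2 w norm_triangle_ineq[of "(L g x - L g (\<iota> w)) + (L g (\<iota> w) - \<iota> w)" "\<iota> w - x"]
      norm_triangle_ineq[of "L g x - L g (\<iota> w)" "L g (\<iota> w) - \<iota> w"] by linarith
  qed
  then show ?thesis using d0 by blast
qed

lemma u_deriv_0:
  assumes "star X = - X"
  shows "((\<lambda>t. u (t *\<^sub>R X) w) has_vector_derivative \<iota> (\<rho> X w)) (at 0)"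
proof -
  \<comment> \<open>X may be large, so the line is differentiated for the multiple c X with R norm
    (c X) < 1/2; the chain rule undoes the factor.\<close>
  define c where "c = 1 / (2 * R * (norm X + 1))"
  have c: "c > 0" using R1 by (auto simp: c_def intro!: divide_pos_pos mult_pos_pos add_nonneg_pos)
  define Y where "Y = c *\<^sub>R X"
  have RY: "R * norm Y < 1"
  proof -
    have "R * norm Y = R * (c * norm X)" using c by (simp add: Y_def)
    also have "\<dots> = norm X / (2 * (norm X + 1))" using R1 by (simp add: c_def)
    also have "\<dots> < 1" by (simp add: divide_less_eq)
      (smt (verit) norm_ge_zero)
    finally show ?thesis .
  qed
  have "((\<lambda>t. u ((t - 0) *\<^sub>R Y) w) has_vector_derivative (\<Sum>i. \<iota> (\<rho> Y ((\<rho> ((0 - 0) *\<^sub>R Y) ^^ i) w)) /\<^sub>R fact i)) (at 0 within {-1..1})"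
    by (rule u_line) (use RY in auto)
  moreover have "(\<Sum>i. \<iota> (\<rho> Y ((\<rho> 0 ^^ i) w)) /\<^sub>R fact i) = \<iota> (\<rho> Y w)"
  proof -
    have "(\<Sum>i. \<iota> (\<rho> Y ((\<rho> 0 ^^ i) w)) /\<^sub>R fact i) = (\<Sum>i\<in>{0}. \<iota> (\<rho> Y ((\<rho> 0 ^^ i) w)) /\<^sub>R fact i)"
      by (rule suminf_finite)
        (auto simp: gr0_conv_Suc linear_0[OF lin_rho'] linear_0[OF lin_rho] linear_0[OF lin_iota])
    then show ?thesis by simp
  qed
  ultimately have "((\<lambda>t. u (t *\<^sub>R Y) w) has_vector_derivative \<iota> (\<rho> Y w)) (at 0 within {-1..1})" by simp
  then have *: "((\<lambda>t. u (t *\<^sub>R Y) w) has_vector_derivative \<iota> (\<rho> Y w)) (at 0)"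
    by (simp add: at_within_Icc_at)
  have "((\<lambda>t. t / c) has_vector_derivative 1 / c) (at 0)"
    using DERIV_cdivide[OF DERIV_ident, of c 0 UNIV] by (simp add: has_real_derivative_iff_has_vector_derivative)
  from vector_diff_chain_at[OF this, of "\<lambda>t. u (t *\<^sub>R Y) w" "\<iota> (\<rho> Y w)"] *
  have "((\<lambda>t. u (t *\<^sub>R Y) w) \<circ> (\<lambda>t. t / c) has_vector_derivative (1 / c) *\<^sub>R \<iota> (\<rho> Y w)) (at 0)" by simp
  moreover have "(\<lambda>t. u (t *\<^sub>R Y) w) \<circ> (\<lambda>t. t / c) = (\<lambda>t. u (t *\<^sub>R X) w)"
    using less_imp_neq[OF c] by (simp add: Y_def fun_eq_iff)
  moreover have "(1 / c) *\<^sub>R \<iota> (\<rho> Y w) = \<iota> (\<rho> X w)"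
    unfolding Y_def linear_scale[OF lin_rho'] linear_scale[OF lin_iota] scaleR_scaleR
    using less_imp_neq[OF c] by simp
  ultimately show ?thesis by simp
qed

lemma U_invariant:
  assumes W: "subspace W" and inv: "\<And>w. w \<in> W \<Longrightarrow> \<rho> X w \<in> W" and X: "star X = - X" "R * norm X < 1"
    and x: "x \<in> closure (\<iota> ` W)"
  shows "U X x \<in> closure (\<iota> ` W)"
proof -
  have "U X (\<iota> w) \<in> closure (\<iota> ` W)" if w: "w \<in> W" for w
  proof -
    have "(\<rho> X ^^ m) w \<in> W" for m by (induction m) (use w inv in auto)
    then have "(\<Sum>m<n. \<iota> ((\<rho> X ^^ m) w) /\<^sub>R fact m) \<in> \<iota> ` W" for n
      unfolding linear_scale[OF lin_iota, symmetric] linear_sum[OF lin_iota, symmetric]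
      by (intro imageI subspace_sum subspace_scale W)
    moreover have "(\<lambda>n. \<Sum>m<n. \<iota> ((\<rho> X ^^ m) w) /\<^sub>R fact m) \<longlonglongrightarrow> u X w"
      unfolding u_def using summable_LIMSEQ[OF summable_u[OF X(2)]] .
    ultimately show ?thesis unfolding U(2)[OF X] closure_sequential by (intro exI) auto
  qed
  then have "U X ` closure (\<iota> ` W) \<subseteq> closure (\<iota> ` W)"
    by (intro image_closure_subset linear_continuous_on U(1)[OF X]) auto
  then show ?thesis using x by blast
qed

text \<open>Meant for T = multiplication by a complex scalar: the real linear operators U X are
  thereby complex linear.\<close>

lemma U_commute:
  assumes T: "bounded_linear T" and T': "\<And>w. T (\<iota> w) = \<iota> (T' w)" and com: "\<And>w. T' (\<rho> X w) = \<rho> X (T' w)"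
    and X: "star X = - X" "R * norm X < 1"
  shows "T (U X x) = U X (T x)"
proof (rule eq_on_dense[OF bounded_linear_compose[OF T U(1)[OF X]] bounded_linear_compose[OF U(1)[OF X] T]])
  fix w
  have "T' ((\<rho> X ^^ m) w) = (\<rho> X ^^ m) (T' w)" for m by (induction m) (auto simp: com)
  then have "T (u X w) = u X (T' w)" unfolding u_def by (subst bounded_linear.suminf[OF T summable_u[OF X(2)]])
      (simp add: linear_scale[OF bounded_linear.linear[OF T]] T')
  then show "T (U X (\<iota> w)) = U X (T (\<iota> w))" by (simp add: U(2)[OF X] T')
qed

end

section \<open>Holonomy along paths\<close>

context star_algebra
begin

lemma uniform_close:
  fixes h :: "'z::metric_space \<Rightarrow> 'a"
  assumes e: "e > 0" and K: "compact K" and h: "continuous_on K h" "h ` K \<subseteq> \<Gamma>"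
  shows "\<exists>d>0. \<forall>x\<in>K. \<forall>y\<in>K. dist x y < d \<longrightarrow> norm (star (h x) * h y - 1) \<le> e"
proof -
  have "continuous_on K (\<lambda>x. star (h x))" by (rule bounded_linear.continuous_on[OF bl_star h(1)])
  then have "bounded ((\<lambda>x. star (h x)) ` K)" by (intro compact_imp_bounded compact_continuous_image K)
  then obtain B where B: "B > 0" "\<And>x. x \<in> K \<Longrightarrow> norm (star (h x)) \<le> B"
    unfolding bounded_pos by blast
  have "uniformly_continuous_on K h" by (rule compact_uniformly_continuous[OF h(1) K])
  moreover have "e / B > 0" using e B by simp
  ultimately obtain d where d: "d > 0" "\<And>x y. x \<in> K \<Longrightarrow> y \<in> K \<Longrightarrow> dist y x < d \<Longrightarrow> dist (h y) (h x) < e / B"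
    unfolding uniformly_continuous_on_def by metis
  show ?thesis
  proof (intro exI[of _ d] conjI ballI impI d(1))
    fix x y assume xy: "x \<in> K" "y \<in> K" "dist x y < d"
    have "star (h x) * h y - 1 = star (h x) * (h y - h x)"
      using h(2) xy by (auto simp: right_diff_distrib \<Gamma>_def)
    then have "norm (star (h x) * h y - 1) \<le> norm (star (h x)) * norm (h y - h x)" by (simp add: norm_mult_ineq)
    also have "\<dots> \<le> B * (e / B)"
      using B xy d(2)[of x y] by (intro mult_mono) (auto simp: dist_commute dist_norm norm_minus_commute)
    finally show "norm (star (h x) * h y - 1) \<le> e" using B by simp
  qed
qed

lemma homotopic_paths_mult:
  assumes "homotopic_paths \<Gamma> p p'" "homotopic_paths \<Gamma> q q'"
  shows "homotopic_paths \<Gamma> (\<lambda>t. p t * q t) (\<lambda>t. p' t * q' t)"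
proof -
  obtain h where h: "continuous_on ({0..1} \<times> {0..1}) h" "h ` ({0..1} \<times> {0..1}) \<subseteq> \<Gamma>"
     "\<And>x. x \<in> {0..1} \<Longrightarrow> h (0, x) = p x" "\<And>x. x \<in> {0..1} \<Longrightarrow> h (1, x) = p' x"
     "\<And>t. t \<in> {0..1::real} \<Longrightarrow> pathstart (h \<circ> Pair t) = pathstart p \<and> pathfinish (h \<circ> Pair t) = pathfinish p"
    using assms(1) unfolding homotopic_paths by blast
  obtain k where k: "continuous_on ({0..1} \<times> {0..1}) k" "k ` ({0..1} \<times> {0..1}) \<subseteq> \<Gamma>"
     "\<And>x. x \<in> {0..1} \<Longrightarrow> k (0, x) = q x" "\<And>x. x \<in> {0..1} \<Longrightarrow> k (1, x) = q' x"
     "\<And>t. t \<in> {0..1::real} \<Longrightarrow> pathstart (k \<circ> Pair t) = pathstart q \<and> pathfinish (k \<circ> Pair t) = pathfinish q"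
    using assms(2) unfolding homotopic_paths by blast
  show ?thesis unfolding homotopic_paths
    by (rule exI[of _ "\<lambda>z. h z * k z"])
      (use h k in \<open>auto intro!: continuous_on_mult mult_in_\<Gamma> simp: image_subset_iff pathstart_def pathfinish_def\<close>)
qed

end

context unitary_analytic_rep
begin

definition near :: "'a \<Rightarrow> 'a \<Rightarrow> bool" where "near g h \<longleftrightarrow> norm (star g * h - 1) \<le> \<epsilon>"

definition step :: "'a \<Rightarrow> 'a \<Rightarrow> 'h \<Rightarrow> 'h" where "step g h = L (star g * h)"

lemma step_refl: "g \<in> \<Gamma> \<Longrightarrow> step g g = id" by (auto simp: step_def \<Gamma>_def L_one)

lemma star_times_in_\<Gamma>: "g \<in> \<Gamma> \<Longrightarrow> h \<in> \<Gamma> \<Longrightarrow> star g * h \<in> \<Gamma>"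
  by (intro mult_in_\<Gamma> star_in_\<Gamma>)

text \<open>The cocycle identity (g^-1 h)(h^-1 k) = g^-1 k, carried to operators by the local
  multiplicativity of L. Independence of subdivision and of homotopy both rest on it.\<close>

lemma step_step:
  assumes "g \<in> \<Gamma>" "h \<in> \<Gamma>" "k \<in> \<Gamma>" "near g h" "near h k"
  shows "step g h \<circ> step h k = step g k"
proof -
  have "star g * k = (star g * h) * (star h * k)"
  proof -
    have "(star g * h) * (star h * k) = star g * (h * star h) * k" by (simp only: mult.assoc)
    then show ?thesis using assms(2) by (simp add: \<Gamma>_def)
  qed
  then show ?thesis
    using L_mult[OF star_times_in_\<Gamma>[OF assms(1,2)] _ star_times_in_\<Gamma>[OF assms(2,3)]] assms(4,5)
    by (auto simp: step_def near_def fun_eq_iff)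
qed

primrec holseq :: "(nat \<Rightarrow> 'a) \<Rightarrow> nat \<Rightarrow> 'h \<Rightarrow> 'h" where
  "holseq s 0 = id"
| "holseq s (Suc n) = holseq s n \<circ> step (s n) (s (Suc n))"

lemma holseq_cong: "(\<And>i. i \<le> n \<Longrightarrow> s i = s' i) \<Longrightarrow> holseq s n = holseq s' n"
  by (induction n) auto

lemma holseq_add: "holseq s (a + b) = holseq s a \<circ> holseq (\<lambda>i. s (a + i)) b"
  by (induction b) (auto simp: o_assoc)

text \<open>Each cell between the two rows is a commuting square, since both ways around it equal
  the diagonal step from s n to s' (n + 1).\<close>

lemma ladder:
  assumes "\<And>i. i \<le> n \<Longrightarrow> s i \<in> \<Gamma>" "\<And>i. i \<le> n \<Longrightarrow> s' i \<in> \<Gamma>" "\<And>i. i \<le> n \<Longrightarrow> near (s i) (s' i)"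
    "\<And>i. i < n \<Longrightarrow> near (s i) (s (Suc i))" "\<And>i. i < n \<Longrightarrow> near (s' i) (s' (Suc i))"
  shows "holseq s n \<circ> step (s n) (s' n) = step (s 0) (s' 0) \<circ> holseq s' n" using assms
proof (induction n)
  case (Suc n)
  have "holseq s (Suc n) \<circ> step (s (Suc n)) (s' (Suc n)) = holseq s n \<circ> (step (s n) (s (Suc n)) \<circ> step (s (Suc n)) (s' (Suc n)))"
    by (simp add: o_assoc)
  also have "step (s n) (s (Suc n)) \<circ> step (s (Suc n)) (s' (Suc n)) = step (s n) (s' (Suc n))"
    by (rule step_step) (use Suc.prems in auto)
  also have "\<dots> = step (s n) (s' n) \<circ> step (s' n) (s' (Suc n))"
    by (rule step_step[symmetric]) (use Suc.prems in auto)
  also have "holseq s n \<circ> \<dots> = (holseq s n \<circ> step (s n) (s' n)) \<circ> step (s' n) (s' (Suc n))" by (simp add: o_assoc)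
  also have "holseq s n \<circ> step (s n) (s' n) = step (s 0) (s' 0) \<circ> holseq s' n"
    by (rule Suc.IH) (use Suc.prems in auto)
  finally show ?case by (simp add: o_assoc)
qed simp

lemma holseq_short:
  assumes "\<And>i. i \<le> n \<Longrightarrow> s i \<in> \<Gamma>" "\<And>i. i \<le> n \<Longrightarrow> near (s 0) (s i)" "\<And>i. i < n \<Longrightarrow> near (s i) (s (Suc i))"
  shows "holseq s n = step (s 0) (s n)" using assms
proof (induction n)
  case 0 then show ?case by (simp add: step_refl)
next
  case (Suc n)
  have "holseq s n = step (s 0) (s n)" by (rule Suc.IH) (use Suc.prems in auto)
  then show ?case using step_step[of "s 0" "s n" "s (Suc n)"] Suc.prems by auto
qed

lemma holseq_refine:
  assumes \<Gamma>: "\<And>i. i \<le> n * m \<Longrightarrow> s i \<in> \<Gamma>"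
    and near: "\<And>i j. i < n \<Longrightarrow> j \<le> m \<Longrightarrow> near (s (i * m)) (s (i * m + j))" "\<And>i. i < n * m \<Longrightarrow> near (s i) (s (Suc i))"
  shows "holseq s (n * m) = holseq (\<lambda>i. s (i * m)) n" using assms
proof (induction n)
  case (Suc n)
  have "holseq s (n * m) = holseq (\<lambda>i. s (i * m)) n" by (rule Suc.IH) (use Suc.prems in auto)
  moreover have "holseq (\<lambda>i. s (n * m + i)) m = step (s (n * m + 0)) (s (n * m + m))"
    by (rule holseq_short) (use Suc.prems(1) Suc.prems(2)[of n] Suc.prems(3) in \<open>auto simp: add.commute\<close>)
  ultimately show ?case
    using holseq_add[of s "n * m" m] by (simp add: add.commute)
qed simp

text \<open>Closeness is demanded for all parameters at distance at most 1 / N, not only for grid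
  points, so that it survives refinement.\<close>

definition meshed :: "nat \<Rightarrow> (real \<Rightarrow> 'a) \<Rightarrow> bool" where
  "meshed N p \<longleftrightarrow> N > 0 \<and> (\<forall>s\<in>{0..1}. \<forall>t\<in>{0..1}. \<bar>s - t\<bar> \<le> 1 / N \<longrightarrow> near (p s) (p t))"

lemma meshedD: "meshed N p \<Longrightarrow> s \<in> {0..1} \<Longrightarrow> t \<in> {0..1} \<Longrightarrow> \<bar>s - t\<bar> \<le> 1 / N \<Longrightarrow> near (p s) (p t)"
  by (simp add: meshed_def)

lemma meshed_mono: assumes "meshed N p" "N \<le> M" shows "meshed M p"
proof -
  have "1 / real M \<le> 1 / real N" using assms by (intro divide_left_mono) (auto simp: meshed_def)
  then show ?thesis using assms by (force simp: meshed_def)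
qed

definition hol :: "nat \<Rightarrow> (real \<Rightarrow> 'a) \<Rightarrow> 'h \<Rightarrow> 'h" where
  "hol N p = holseq (\<lambda>i. p (real i / real N)) N"

lemma hol_refine:
  assumes p: "path_image p \<subseteq> \<Gamma>" and N: "meshed N p" and M: "M > 0"
  shows "hol (N * M) p = hol N p"
proof -
  have N0: "N > 0" using N by (simp add: meshed_def)
  have p': "p t \<in> \<Gamma>" if "0 \<le> t" "t \<le> 1" for t using p that by (auto simp: path_image_def)
  have "hol (N * M) p = holseq (\<lambda>i. p (real (i * M) / real (N * M))) N" unfolding hol_def
  proof (rule holseq_refine)
    show "p (real i / real (N * M)) \<in> \<Gamma>" if "i \<le> N * M" for i
      by (rule p') (use that N0 M in \<open>auto simp: divide_simps simp flip: of_nat_mult\<close>)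
    show "near (p (real (i * M) / real (N * M))) (p (real (i * M + j) / real (N * M)))" if "i < N" "j \<le> M" for i j
    proof -
      have "i * M + j \<le> N * M" using that
        by (metis add_le_cancel_left add.commute less_eq_Suc_le mult_Suc mult_le_mono1 order_trans)
      then have "real (i * M + j) \<le> real (N * M)" by (simp only: of_nat_le_iff)
      moreover have "\<bar>real (i * M) / real (N * M) - real (i * M + j) / real (N * M)\<bar> \<le> 1 / real N"
        using that N0 M by (simp add: field_simps)
      ultimately show ?thesis using that N0 M by (intro meshedD[OF N]) (auto simp: divide_simps simp del: of_nat_Suc of_nat_add of_nat_mult)
    qed
    show "near (p (real i / real (N * M))) (p (real (Suc i) / real (N * M)))" if "i < N * M" for i
    proof -
      have "real (Suc i) \<le> real (N * M)" using that by (simp only: of_nat_le_iff Suc_le_eq)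
      moreover have "\<bar>real i / real (N * M) - real (Suc i) / real (N * M)\<bar> \<le> 1 / real N"
        using N0 M by (simp add: field_simps)
      ultimately show ?thesis using that N0 M by (intro meshedD[OF N]) (auto simp: divide_simps simp del: of_nat_Suc of_nat_add of_nat_mult)
    qed
  qed
  also have "\<dots> = hol N p" using M by (simp add: hol_def)
  finally show ?thesis .
qed

text \<open>Two meshes are compared through their common refinement N M.\<close>

lemma hol_eq: "path_image p \<subseteq> \<Gamma> \<Longrightarrow> meshed N p \<Longrightarrow> meshed M p \<Longrightarrow> hol N p = hol M p"
  using hol_refine[of p N M] hol_refine[of p M N] by (simp add: mult.commute meshed_def)

definition Hol :: "(real \<Rightarrow> 'a) \<Rightarrow> 'h \<Rightarrow> 'h" where "Hol p = hol (SOME N. meshed N p) p"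

lemma Hol_eq: "path_image p \<subseteq> \<Gamma> \<Longrightarrow> meshed N p \<Longrightarrow> Hol p = hol N p"
  unfolding Hol_def by (rule hol_eq) (auto intro: someI)

lemma uniform_near:
  fixes h :: "'z::metric_space \<Rightarrow> 'a"
  assumes K: "compact K" and h: "continuous_on K h" "h ` K \<subseteq> \<Gamma>"
  shows "\<exists>d>0. \<forall>x\<in>K. \<forall>y\<in>K. dist x y < d \<longrightarrow> near (h x) (h y)"
  unfolding near_def by (rule uniform_close[OF eps(1) K h])

lemma ex_meshed:
  assumes p: "path p" "path_image p \<subseteq> \<Gamma>" shows "\<exists>N0. \<forall>N\<ge>N0. meshed N p"
proof -
  obtain d where d: "d > 0" "\<And>s t. s \<in> {0..1} \<Longrightarrow> t \<in> {0..1} \<Longrightarrow> dist s t < d \<Longrightarrow> near (p s) (p t)"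
    using uniform_near[of "{0..1}" p] p by (auto simp: path_def path_image_def)
  obtain N where N: "inverse (real (Suc N)) < d" using reals_Archimedean[OF d(1)] by blast
  have "meshed (Suc N) p"
    unfolding meshed_def using N d(2) by (auto simp: dist_real_def inverse_eq_divide simp del: of_nat_Suc intro!: d(2))
  then show ?thesis using meshed_mono by blast
qed

text \<open>On a grid finer than the modulus of uniform closeness, neighbouring rows of the homotopy
  form a ladder. The end points are fixed, so both outer rungs are the identity and the rows have
  equal holonomy.\<close>

lemma Hol_homotopic:
  assumes "homotopic_paths \<Gamma> p q" shows "Hol p = Hol q"
proof -
  obtain h where h: "continuous_on ({0..1} \<times> {0..1}) h" "h ` ({0..1} \<times> {0..1}) \<subseteq> \<Gamma>"
     "\<And>x. x \<in> {0..1} \<Longrightarrow> h (0, x) = p x" "\<And>x. x \<in> {0..1} \<Longrightarrow> h (1, x) = q x"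
     "\<And>t. t \<in> {0..1::real} \<Longrightarrow> pathstart (h \<circ> Pair t) = pathstart p \<and> pathfinish (h \<circ> Pair t) = pathfinish p"
    using assms unfolding homotopic_paths by blast
  obtain d where d: "d > 0" "\<And>x y. x \<in> {0..1} \<times> {0..1} \<Longrightarrow> y \<in> {0..1} \<times> {0..1} \<Longrightarrow> dist x y < d \<Longrightarrow> near (h x) (h y)"
    using uniform_near[OF compact_Times[OF compact_Icc compact_Icc] h(1,2)] by blast
  obtain N1 where N1: "inverse (real (Suc N1)) < d" using reals_Archimedean[OF d(1)] by blast
  obtain N2 where N2: "\<forall>N\<ge>N2. meshed N p" using ex_meshed homotopic_paths_imp_path[OF assms] homotopic_paths_imp_subset[OF assms] by blast
  obtain N3 where N3: "\<forall>N\<ge>N3. meshed N q" using ex_meshed homotopic_paths_imp_path[OF assms] homotopic_paths_imp_subset[OF assms] by blast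
  define N where "N = Suc N1 + N2 + N3"
  have N: "meshed N p" "meshed N q" "N > 0" using N2 N3 by (auto simp: N_def)
  have "1 / real N \<le> inverse (real (Suc N1))" by (auto simp: N_def divide_simps)
  then have Nd: "1 / real N < d" using N1 by simp
  have unit: "real i / real N \<in> {0..1}" if "i \<le> N" for i using that N by auto
  have row: "hol N (\<lambda>x. h (real i / real N, x)) = hol N (\<lambda>x. h (real (Suc i) / real N, x))" if i: "i < N" for i
  proof -
    have diff: "\<bar>real i / real N - real (Suc i) / real N\<bar> = 1 / real N" for i using N by (simp add: field_simps)
    have e: "h (real i / real N, 0) = p 0" "h (real i / real N, 1) = p 1" if "i \<le> N" for i
      using h(5)[OF unit[OF that]] by (auto simp: pathstart_def pathfinish_def)
    have p01: "p 0 \<in> \<Gamma>" "p 1 \<in> \<Gamma>" using h(2) by (auto simp: image_subset_iff h(3)[symmetric])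
    have "holseq (\<lambda>j. h (real i / real N, real j / real N)) N \<circ> step (h (real i / real N, real N / real N)) (h (real (Suc i) / real N, real N / real N))
       = step (h (real i / real N, real 0 / real N)) (h (real (Suc i) / real N, real 0 / real N)) \<circ> holseq (\<lambda>j. h (real (Suc i) / real N, real j / real N)) N"
    proof (rule ladder)
      show "h (real i / real N, real j / real N) \<in> \<Gamma>" "h (real (Suc i) / real N, real j / real N) \<in> \<Gamma>" if "j \<le> N" for j
        using h(2) unit[OF that] unit[of i] unit[of "Suc i"] i by (auto simp: image_subset_iff simp del: of_nat_Suc)
      show "near (h (real i / real N, real j / real N)) (h (real (Suc i) / real N, real j / real N))" if "j \<le> N" for j
        using unit[OF that] unit[of i] unit[of "Suc i"] i diff[of i] Nd
        by (intro d(2)) (auto simp: dist_prod_def dist_real_def simp del: of_nat_Suc)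
      show "near (h (real i / real N, real j / real N)) (h (real i / real N, real (Suc j) / real N))" if "j < N" for j
        using unit[of j] unit[of "Suc j"] that unit[of i] i diff[of j] Nd
        by (intro d(2)) (auto simp: dist_prod_def dist_real_def simp del: of_nat_Suc)
      show "near (h (real (Suc i) / real N, real j / real N)) (h (real (Suc i) / real N, real (Suc j) / real N))" if "j < N" for j
        using unit[of j] unit[of "Suc j"] that unit[of "Suc i"] i diff[of j] Nd
        by (intro d(2)) (auto simp: dist_prod_def dist_real_def simp del: of_nat_Suc)
    qed
    then show ?thesis using e[of i] e[of "Suc i"] i p01 N by (simp add: hol_def step_refl del: of_nat_Suc)
  qed
  have "hol N (\<lambda>x. h (real 0 / real N, x)) = hol N (\<lambda>x. h (real i / real N, x))" if "i \<le> N" for i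
    using that by (induction i) (use row in \<open>auto simp del: of_nat_Suc\<close>)
  from this[of N] have "hol N (\<lambda>x. h (0, x)) = hol N (\<lambda>x. h (1, x))" using N by simp
  moreover have "hol N (\<lambda>x. h (0, x)) = hol N p" "hol N (\<lambda>x. h (1, x)) = hol N q"
    unfolding hol_def using h(3,4) unit by (auto intro!: holseq_cong)
  ultimately show ?thesis
    using Hol_eq[OF _ N(1)] Hol_eq[OF _ N(2)] homotopic_paths_imp_subset[OF assms] by simp
qed

lemma Hol_join:
  assumes p: "path p" "path_image p \<subseteq> \<Gamma>" and q: "path q" "path_image q \<subseteq> \<Gamma>" and pq: "pathfinish p = pathstart q"
  shows "Hol (p +++ q) = Hol p \<circ> Hol q"
proof -
  have j: "path (p +++ q)" "path_image (p +++ q) \<subseteq> \<Gamma>" using p q pq by (auto simp: path_image_join)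
  obtain N1 N2 N3 where N123: "\<forall>N\<ge>N1. meshed N p" "\<forall>N\<ge>N2. meshed N q" "\<forall>N\<ge>N3. meshed N (p +++ q)"
    using ex_meshed p q j by metis
  define N where "N = N1 + N2 + N3"
  have N: "meshed N p" "meshed N q" "meshed (N + N) (p +++ q)" using N123 by (auto simp: N_def)
  have N0: "N > 0" using N by (auto simp: meshed_def)
  have "hol (N + N) (p +++ q) = hol N p \<circ> hol N q" unfolding hol_def holseq_add
  proof (rule arg_cong2[where f="(\<circ>)"]; rule holseq_cong)
    show "(p +++ q) (real i / real (N + N)) = p (real i / real N)" if "i \<le> N" for i
      using that N0 by (auto simp: joinpaths_def divide_simps)
    show "(p +++ q) (real (N + i) / real (N + N)) = q (real i / real N)" if "i \<le> N" for i
    \<comment> \<open>For i = 0 the parameter is 1/2, which the concatenation assigns to the first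
      path; the two paths agree there.\<close>
    proof (cases "i = 0")
      case True then show ?thesis using N0 pq by (simp add: joinpaths_def pathstart_def pathfinish_def)
    next
      case False
      have "2 * (real (N + i) / real (N + N)) - 1 = real i / real N" using N0 by (simp add: field_simps)
      moreover have "\<not> real (N + i) / real (N + N) \<le> 1 / 2" using False N0 by (simp add: field_simps)
      ultimately show ?thesis by (simp add: joinpaths_def)
    qed
  qed
  then show ?thesis using Hol_eq N p q j by simp
qed

text \<open>Every step depends on a quotient g^-1 h only, and left translation leaves quotients
  unchanged.\<close>

lemma Hol_translate:
  assumes "path p" "path_image p \<subseteq> \<Gamma>" "g \<in> \<Gamma>"
  shows "Hol (\<lambda>t. g * p t) = Hol p"
proof -
  obtain N where N: "meshed N p" using ex_meshed assms by blast
  have e: "star (g * a) * (g * b) = star a * b" for a b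
  proof -
    have "star (g * a) * (g * b) = star a * (star g * g) * b" by (simp only: star_mult mult.assoc)
    then show ?thesis using assms(3) by (simp add: \<Gamma>_def)
  qed
  have N': "meshed N (\<lambda>t. g * p t)" using N by (simp add: meshed_def near_def e)
  have "path_image (\<lambda>t. g * p t) \<subseteq> \<Gamma>" using assms by (auto simp: path_image_def intro!: mult_in_\<Gamma>)
  from Hol_eq[OF this N'] Hol_eq[OF assms(2) N] show ?thesis
  proof -
    have "holseq (\<lambda>i. g * s i) n = holseq s n" for s n by (induction n) (auto simp: step_def e)
    then show ?thesis using Hol_eq[OF \<open>path_image (\<lambda>t. g * p t) \<subseteq> \<Gamma>\<close> N'] Hol_eq[OF assms(2) N] by (simp add: hol_def)
  qed
qed

lemma Hol_short:
  assumes p: "path p" "path_image p \<subseteq> \<Gamma>" and near: "\<And>t. t \<in> {0..1} \<Longrightarrow> near (p 0) (p t)"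
  shows "Hol p = L (star (p 0) * p 1)"
proof -
  obtain N where N: "meshed N p" using ex_meshed p by blast
  have N0: "N > 0" using N by (auto simp: meshed_def)
  have unit: "real i / real N \<in> {0..1}" if "i \<le> N" for i using that N0 by auto
  have diff: "\<bar>real i / real N - real (Suc i) / real N\<bar> \<le> 1 / real N" for i using N0 by (simp add: field_simps)
  have "holseq (\<lambda>i. p (real i / real N)) N = step (p (real 0 / real N)) (p (real N / real N))"
    by (rule holseq_short)
      (use p near unit N diff in \<open>auto simp: path_image_def meshed_def image_subset_iff simp del: of_nat_Suc\<close>)
  then show ?thesis using Hol_eq[OF p(2) N] N0 by (simp add: hol_def step_def)
qed

lemma Hol_induct:
  assumes p: "path p" "path_image p \<subseteq> \<Gamma>"
    and id: "P id" and comp: "\<And>f g. P f \<Longrightarrow> P g \<Longrightarrow> P (f \<circ> g)"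
    and L: "\<And>g. g \<in> \<Gamma> \<Longrightarrow> norm (g - 1) \<le> \<epsilon> \<Longrightarrow> P (L g)"
  shows "P (Hol p)"
proof -
  obtain N where N: "meshed N p" using ex_meshed p by blast
  have N0: "N > 0" using N by (auto simp: meshed_def)
  have unit: "real i / real N \<in> {0..1}" if "i \<le> N" for i using that N0 by auto
  have diff: "\<bar>real i / real N - real (Suc i) / real N\<bar> \<le> 1 / real N" for i using N0 by (simp add: field_simps)
  have "P (holseq (\<lambda>i. p (real i / real N)) n)" if "n \<le> N" for n using that
  proof (induction n)
    case (Suc n)
    have "p (real n / real N) \<in> \<Gamma>" "p (real (Suc n) / real N) \<in> \<Gamma>"
      using unit[of n] unit[of "Suc n"] Suc.prems p by (auto simp: path_image_def image_subset_iff simp del: of_nat_Suc)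
    moreover have "near (p (real n / real N)) (p (real (Suc n) / real N))"
      using unit[of n] unit[of "Suc n"] Suc.prems N diff[of n] by (auto simp: meshed_def simp del: of_nat_Suc)
    ultimately have "P (step (p (real n / real N)) (p (real (Suc n) / real N)))"
      unfolding step_def near_def by (intro L star_times_in_\<Gamma>)
    then show ?case unfolding holseq.simps by (intro comp Suc.IH) (use Suc.prems in auto)
  qed (simp add: id)
  then show ?thesis using Hol_eq[OF p(2) N] by (simp add: hol_def)
qed

text \<open>Up to homotopy q waits while p runs and p waits while q runs. The product then becomes p
  followed by the left translate of q by the end point of p.\<close>

lemma Hol_mult:
  assumes p: "path p" "path_image p \<subseteq> \<Gamma>" "pathstart p = 1" and q: "path q" "path_image q \<subseteq> \<Gamma>" "pathstart q = 1"
  shows "Hol (\<lambda>t. p t * q t) = Hol p \<circ> Hol q"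
proof -
  define g where "g = pathfinish p"
  have g: "g \<in> \<Gamma>" using p by (auto simp: g_def pathfinish_in_path_image)
  let ?p = "p +++ linepath g g" and ?q = "linepath 1 1 +++ q"
  have "homotopic_paths \<Gamma> ?p p" unfolding g_def by (rule homotopic_paths_rid[OF p(1,2)])
  moreover have "homotopic_paths \<Gamma> ?q q" using homotopic_paths_lid[OF q(1,2)] q(3) by simp
  ultimately have "Hol (\<lambda>t. ?p t * ?q t) = Hol (\<lambda>t. p t * q t)"
    by (intro Hol_homotopic homotopic_paths_mult)
  moreover have "(\<lambda>t. ?p t * ?q t) = p +++ (\<lambda>t. g * q t)"
    by (auto simp: joinpaths_def fun_eq_iff linepath_def algebra_simps)
  moreover have "Hol (p +++ (\<lambda>t. g * q t)) = Hol p \<circ> Hol (\<lambda>t. g * q t)"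
  proof (rule Hol_join[OF p(1,2)])
    show "path (\<lambda>t. g * q t)" using q by (auto simp: path_def intro!: continuous_intros)
    show "path_image (\<lambda>t. g * q t) \<subseteq> \<Gamma>" using q g by (auto simp: path_image_def intro!: mult_in_\<Gamma>)
    show "pathfinish p = pathstart (\<lambda>t. g * q t)" using q by (simp add: pathstart_def g_def)
  qed
  ultimately show ?thesis using Hol_translate[OF q(1,2) g] by simp
qed

end

section \<open>The symplectic group inside a Banach algebra\<close>

lemma continuous_on_exp_algebra: "continuous_on UNIV (exp :: 'a::{real_normed_algebra_1,banach} \<Rightarrow> 'a)"
proof -
  have "continuous_on (cball 0 r) (exp :: 'a \<Rightarrow> 'a)" for r :: real
  proof -
    have "uniform_limit (cball 0 r) (\<lambda>n (x::'a). \<Sum>i<n. x ^ i /\<^sub>R fact i) (\<lambda>x. \<Sum>i. x ^ i /\<^sub>R fact i) sequentially"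
    proof (rule Weierstrass_m_test[OF _ summable_exp_generic[of r]])
      fix n and x :: 'a assume x: "x \<in> cball 0 r"
      have "norm (x ^ n) \<le> r ^ n" using x norm_power_ineq[of x n] power_mono[of "norm x" r n] by simp
      then show "norm (x ^ n /\<^sub>R fact n) \<le> r ^ n /\<^sub>R fact n" by (simp add: mult_left_mono)
    qed
    then show ?thesis unfolding exp_def[abs_def]
      by (rule uniform_limit_theorem[rotated]) (auto intro!: continuous_intros always_eventually)
  qed
  then have "continuous_on (ball 0 r) (exp :: 'a \<Rightarrow> 'a)" for r :: real
    using continuous_on_subset[OF _ ball_subset_cball] by blast
  then have "isCont (exp :: 'a \<Rightarrow> 'a) x" for x
    using continuous_on_eq_continuous_at[of "ball (0::'a) (norm x + 1)"] by (metis open_ball mem_ball_0 less_add_one)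
  then show ?thesis by (simp add: continuous_at_imp_continuous_on)
qed

lemmas continuous_on_exp_algebra' [continuous_intros] =
  continuous_on_compose2[OF continuous_on_exp_algebra _ subset_UNIV]

lemma continuous_on_lnp:
  fixes f :: "'b::topological_space \<Rightarrow> 'a::{real_normed_algebra_1,banach}"
  assumes f: "continuous_on S f" and r: "\<And>x. x \<in> S \<Longrightarrow> norm (f x) \<le> r" "r < 1"
  shows "continuous_on S (\<lambda>x. lnp (f x))"
proof (cases "S = {}")
  case False
  then have r0: "0 \<le> r" using r(1) norm_ge_zero order_trans by blast
  have "uniform_limit S (\<lambda>n x. \<Sum>m<n. ((- 1) ^ m / real (Suc m)) *\<^sub>R f x ^ Suc m)
     (\<lambda>x. \<Sum>m. ((- 1) ^ m / real (Suc m)) *\<^sub>R f x ^ Suc m) sequentially"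
  proof (rule Weierstrass_m_test[where M="\<lambda>m. r ^ Suc m"])
    show "summable (\<lambda>m. r ^ Suc m)" using r0 r by (auto intro: summable_mult)
    show "norm (((- 1) ^ m / real (Suc m)) *\<^sub>R f x ^ Suc m) \<le> r ^ Suc m" if "x \<in> S" for m x
      using norm_lnp_term[of m "f x"] power_mono[OF r(1)[OF that] norm_ge_zero, of "Suc m"] by (rule order_trans)
  qed
  then show ?thesis unfolding lnp_def
    by (rule uniform_limit_theorem[rotated])
      (auto intro!: always_eventually continuous_intros f simp del: power_Suc of_nat_Suc)
qed auto

lemma lnp_scalar:
  assumes "\<bar>a\<bar> < 1"
  shows "lnp (a *\<^sub>R (1::'a::{real_normed_algebra_1,banach})) = ln (1 + a) *\<^sub>R 1"
proof -
  have "ln (1 + a) = (\<Sum>n. (- 1) ^ n * (1 / real (n + 1)) * (1 + a - 1) ^ Suc n)"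
    by (rule ln_series) (use assms in auto)
  then have l: "ln (1 + a) = (\<Sum>n. (- 1) ^ n / real (Suc n) * a ^ Suc n)" by simp
  have p: "(a *\<^sub>R (1::'a)) ^ n = (a ^ n) *\<^sub>R 1" for n by (induction n) auto
  have "summable (\<lambda>n. (- 1) ^ n / real (Suc n) * a ^ Suc n)" using summable_lnp[of a] assms by simp
  from suminf_scaleR_left[OF this, of "1::'a"]
  show ?thesis unfolding lnp_def l p by simp
qed

text \<open>Shifting the expansion point of the logarithm series from 1 to a large scalar \<open>c\<close>
  makes it converge at every positive definite element.\<close>

definition lnc :: "real \<Rightarrow> 'a::{real_normed_algebra_1,banach} \<Rightarrow> 'a" where
  "lnc c P = ln c *\<^sub>R 1 + lnp (P /\<^sub>R c - 1)"

lemma exp_lnc: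
  fixes P :: "'a::{real_normed_algebra_1,banach}"
  assumes c: "c > 0" and n: "norm (P /\<^sub>R c - 1) < 1"
  shows "exp (lnc c P) = P"
proof -
  have e1: "exp (ln c *\<^sub>R (1::'a)) = c *\<^sub>R 1"
    using exp_of_real[of "ln c", where 'a='a] c by (simp add: of_real_def)
  have "exp (lnc c P) = exp (ln c *\<^sub>R (1::'a)) * exp (lnp (P /\<^sub>R c - 1))"
    unfolding lnc_def by (rule exp_add_commuting) simp
  also have "\<dots> = P" using c by (simp add: e1 exp_lnp[OF n])
  finally show ?thesis .
qed

lemma lnc_exp:
  fixes Y :: "'a::{real_normed_algebra_1,banach}"
  assumes c: "c > 0" and r: "\<And>t. t \<in> {0..1} \<Longrightarrow> norm (exp (t *\<^sub>R Y) /\<^sub>R c - 1) \<le> r" "r < 1"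
  shows "lnc c (exp Y) = Y"
proof -
  have d: "((\<lambda>t. lnp (exp (t *\<^sub>R Y) /\<^sub>R c - 1)) has_vector_derivative Y) (at t within {0..1})" if t: "t \<in> {0..1}" for t
  proof (rule has_vector_derivative_lnp_commuting[where N'="\<lambda>t. (exp (t *\<^sub>R Y) * Y) /\<^sub>R c" and r=r and c="(r + 1) * norm Y"])
    fix s :: real assume s: "s \<in> {0..1}"
    show "((\<lambda>t. exp (t *\<^sub>R Y) /\<^sub>R c - 1) has_vector_derivative (exp (s *\<^sub>R Y) * Y) /\<^sub>R c) (at s within {0..1})"
      using bounded_linear.has_vector_derivative[OF bounded_linear_scaleR_right exp_scaleR_has_vector_derivative_right[of Y s "{0..1}"], of "inverse c"]
      using has_vector_derivative_diff[OF _ has_vector_derivative_const[of 1]] by fastforce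
    have "norm (exp (s *\<^sub>R Y) /\<^sub>R c) \<le> norm (exp (s *\<^sub>R Y) /\<^sub>R c - 1) + norm (1::'a)"
      by (metis diff_add_cancel norm_triangle_ineq)
    then have "norm (exp (s *\<^sub>R Y) /\<^sub>R c) \<le> r + 1" using r(1)[OF s] by simp
    then show "norm ((exp (s *\<^sub>R Y) * Y) /\<^sub>R c) \<le> (r + 1) * norm Y"
      unfolding mult_scaleR_left[symmetric] by (intro norm_mult_ineq[THEN order_trans] mult_right_mono) auto
  next
    have "Y * exp (t *\<^sub>R Y) = exp (t *\<^sub>R Y) * Y" by (rule exp_times_scaleR_commute[symmetric])
    then show "(exp (t *\<^sub>R Y) /\<^sub>R c - 1) * ((exp (t *\<^sub>R Y) * Y) /\<^sub>R c) = (exp (t *\<^sub>R Y) * Y) /\<^sub>R c * (exp (t *\<^sub>R Y) /\<^sub>R c - 1)"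
      by (simp add: algebra_simps)
  qed (use r t in auto)
  have "lnp (exp (1 *\<^sub>R Y) /\<^sub>R c - 1) - 1 *\<^sub>R Y = lnp (exp (0 *\<^sub>R Y) /\<^sub>R c - 1) - 0 *\<^sub>R Y"
    by (rule has_vector_derivative_zero_eq[where f="\<lambda>t. lnp (exp (t *\<^sub>R Y) /\<^sub>R c - 1) - t *\<^sub>R Y" and a=0 and b=1])
      (use d in \<open>auto intro!: derivative_eq_intros\<close>)
  \<comment> \<open>At t = 0 the curve starts at the scalar 1 / c, whose logarithm is - ln c; this
    offset is what \<open>lnc\<close> adds back.\<close>
  moreover have "lnp (exp (0 *\<^sub>R Y) /\<^sub>R c - 1) = - (ln c *\<^sub>R 1)"
  proof -
    have e: "exp (0 *\<^sub>R Y) /\<^sub>R c - 1 = (inverse c - 1) *\<^sub>R (1::'a)" by (simp add: scaleR_diff_left)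
    have "norm ((inverse c - 1) *\<^sub>R (1::'a)) \<le> r" using r(1)[of 0] unfolding e by simp
    then have "\<bar>inverse c - 1\<bar> < 1" using r(2) by simp
    from lnp_scalar[OF this, where 'a='a] show ?thesis unfolding e using c by (simp add: ln_inverse)
  qed
  ultimately show ?thesis by (simp add: lnc_def algebra_simps)
qed

lemma lnc_1: "1 \<le> c \<Longrightarrow> lnc c (1::'a::{real_normed_algebra_1,banach}) = 0"
proof -
  assume c: "1 \<le> c"
  have "norm (exp (t *\<^sub>R (0::'a)) /\<^sub>R c - 1) \<le> 1 - inverse c" for t
  proof -
    have "exp (t *\<^sub>R (0::'a)) /\<^sub>R c - 1 = (inverse c - 1) *\<^sub>R 1" by (simp add: scaleR_diff_left)
    then show ?thesis using c by (simp add: inverse_le_1_iff)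
  qed
  from lnc_exp[OF _ this] c show ?thesis by simp
qed

context star_algebra
begin

lemma star_scaleR: "star (c *\<^sub>R x) = c *\<^sub>R star x"
  by (rule linear_scale[OF bounded_linear.linear[OF bl_star]])

lemma star_diff: "star (x - y) = star x - star y" by (rule linear_diff[OF bounded_linear.linear[OF bl_star]])

lemma star_add: "star (x + y) = star x + star y" by (rule linear_add[OF bounded_linear.linear[OF bl_star]])

lemma star_lnc:
  assumes "norm (P /\<^sub>R c - 1) < 1" "norm (star P /\<^sub>R c - 1) < 1"
  shows "star (lnc c P) = lnc c (star P)"
  using star_lnp[OF assms(1)] assms(2) by (simp add: lnc_def star_add star_scaleR star_diff)

text \<open>The path is lifted to its logarithm. Convex combinations of the lift with the straight
  segment to its end stay skew, so exponentiating them is a homotopy inside the group that fixes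
  both ends.\<close>

lemma short_path_exp:
  assumes c: "path c" "path_image c \<subseteq> \<Gamma>" "pathstart c = 1" and n: "\<And>t. t \<in> {0..1} \<Longrightarrow> norm (c t - 1) \<le> 1/4"
  shows "homotopic_paths \<Gamma> c (\<lambda>t. exp (t *\<^sub>R lnp (c 1 - 1)))"
proof -
  define l where "l t = lnp (c t - 1)" for t
  have cl: "continuous_on {0..1} l"
    unfolding l_def using c n by (intro continuous_on_lnp[where r="1/4"]) (auto simp: path_def intro!: continuous_intros)
  have sk: "star (l t) = - l t" if "t \<in> {0..1}" for t
    unfolding l_def by (rule lnp_skew) (use c n that in \<open>auto simp: path_image_def image_subset_iff\<close>)
  have el: "exp (l t) = c t" if "t \<in> {0..1}" for t using exp_lnp[of "c t - 1"] n[OF that] by (simp add: l_def)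
  have l0: "l 0 = 0" using c(3) by (simp add: l_def pathstart_def)
  show ?thesis unfolding homotopic_paths l_def[symmetric]
  proof (rule exI[of _ "\<lambda>z. exp ((1 - fst z) *\<^sub>R l (snd z) + fst z *\<^sub>R (snd z *\<^sub>R l 1))"], intro conjI ballI)
    show "continuous_on ({0..1} \<times> {0..1}) (\<lambda>z::real \<times> real. exp ((1 - fst z) *\<^sub>R l (snd z) + fst z *\<^sub>R (snd z *\<^sub>R l 1)))"
      by (intro continuous_intros continuous_on_compose2[OF cl]) auto
    show "(\<lambda>z::real \<times> real. exp ((1 - fst z) *\<^sub>R l (snd z) + fst z *\<^sub>R (snd z *\<^sub>R l 1))) \<in> ({0..1} \<times> {0..1}) \<rightarrow> \<Gamma>"
      by (auto intro!: exp_in_\<Gamma> simp: star_add star_scaleR sk)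
    show "pathstart ((\<lambda>z::real \<times> real. exp ((1 - fst z) *\<^sub>R l (snd z) + fst z *\<^sub>R (snd z *\<^sub>R l 1))) \<circ> Pair t) = pathstart c"
      "pathfinish ((\<lambda>z::real \<times> real. exp ((1 - fst z) *\<^sub>R l (snd z) + fst z *\<^sub>R (snd z *\<^sub>R l 1))) \<circ> Pair t) = pathfinish c" if "t \<in> {0..1}" for t
      using l0 c(3) el[of 1] by (auto simp: pathstart_def pathfinish_def scaleR_left_distrib[symmetric])
  qed (auto simp: el)
qed

end

section \<open>Real square matrices as a Banach algebra\<close>

typedef 'm sqmat = "UNIV :: ((real, 'm::finite) vec \<Rightarrow>\<^sub>L (real, 'm) vec) set" by simp

instantiation sqmat :: (finite) real_vector
begin
definition "0 = Abs_sqmat 0"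
definition "A + B = Abs_sqmat (Rep_sqmat A + Rep_sqmat B)"
definition "- A = Abs_sqmat (- Rep_sqmat A)"
definition "A - B = Abs_sqmat (Rep_sqmat A - Rep_sqmat B)"
definition "c *\<^sub>R A = Abs_sqmat (c *\<^sub>R Rep_sqmat A)"
instance
  by standard
    (simp_all add: zero_sqmat_def plus_sqmat_def uminus_sqmat_def minus_sqmat_def scaleR_sqmat_def
      Abs_sqmat_inverse Abs_sqmat_inject Rep_sqmat_inverse algebra_simps)
end

instantiation sqmat :: (finite) real_normed_vector
begin
definition "norm A = norm (Rep_sqmat A)"
definition "dist A B = norm (A - B :: 'a sqmat)"
definition "sgn A = A /\<^sub>R norm (A :: 'a sqmat)"
definition "uniformity = (INF e\<in>{0 <..}. principal {(x, y :: 'a sqmat). dist x y < e})"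
definition "open U = (\<forall>x\<in>U. eventually (\<lambda>(x', y). x' = x \<longrightarrow> y \<in> U) (uniformity :: ('a sqmat \<times> 'a sqmat) filter))"
instance
proof
  show "norm A = 0 \<longleftrightarrow> A = 0" for A :: "'a sqmat"
    by (metis Abs_sqmat_inverse Rep_sqmat_inverse UNIV_I norm_eq_zero norm_sqmat_def zero_sqmat_def)
qed (simp_all add: dist_sqmat_def sgn_sqmat_def uniformity_sqmat_def open_sqmat_def
    norm_sqmat_def plus_sqmat_def scaleR_sqmat_def Abs_sqmat_inverse norm_triangle_ineq)
end

text \<open>On nested vectors the product \<open>*\<close> is entrywise and the norm is Euclidean,
  so the identity matrix does not have norm 1 in general. Composition with the operator norm gives
  the structure in which the power series above apply to matrices.\<close>

instantiation sqmat :: (finite) real_normed_algebra_1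
begin
definition "A * B = Abs_sqmat (Rep_sqmat A o\<^sub>L Rep_sqmat B)"
definition "1 = Abs_sqmat id_blinfun"
instance
proof
  show "A * B * C = A * (B * C)" for A B C :: "'a sqmat"
    by (simp add: times_sqmat_def Abs_sqmat_inverse Abs_sqmat_inject) (rule blinfun_eqI, simp)
  show "1 * A = A" "A * 1 = A" for A :: "'a sqmat"
  proof -
    have "id_blinfun o\<^sub>L Rep_sqmat A = Rep_sqmat A" "Rep_sqmat A o\<^sub>L id_blinfun = Rep_sqmat A"
      by (rule blinfun_eqI, simp)+
    then show "1 * A = A" "A * 1 = A" by (simp_all add: times_sqmat_def one_sqmat_def Abs_sqmat_inverse Rep_sqmat_inverse)
  qed
  show "norm (A * B) \<le> norm A * norm B" for A B :: "'a sqmat"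
    by (simp add: norm_sqmat_def times_sqmat_def Abs_sqmat_inverse norm_blinfun_compose)
  show "(0::'a sqmat) \<noteq> 1" by (auto simp: zero_sqmat_def one_sqmat_def Abs_sqmat_inject dest: arg_cong[where f=norm])
  show "norm (1::'a sqmat) = 1" by (simp add: norm_sqmat_def one_sqmat_def Abs_sqmat_inverse)
qed (simp_all add: times_sqmat_def one_sqmat_def plus_sqmat_def scaleR_sqmat_def Abs_sqmat_inverse Abs_sqmat_inject
  bounded_bilinear.add_left[OF bounded_bilinear_blinfun_compose]
  bounded_bilinear.add_right[OF bounded_bilinear_blinfun_compose] bounded_bilinear.scaleR_left[OF bounded_bilinear_blinfun_compose]
  bounded_bilinear.scaleR_right[OF bounded_bilinear_blinfun_compose] Rep_sqmat_inverse)
end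

instance sqmat :: (finite) banach
proof
  fix X :: "nat \<Rightarrow> 'a sqmat" assume "Cauchy X"
  have d: "dist A B = dist (Rep_sqmat A) (Rep_sqmat B)" for A B :: "'a sqmat"
    by (simp add: dist_norm norm_sqmat_def minus_sqmat_def Abs_sqmat_inverse)
  have "Cauchy (\<lambda>n. Rep_sqmat (X n))" using \<open>Cauchy X\<close> by (simp add: Cauchy_def d)
  then obtain l where "(\<lambda>n. Rep_sqmat (X n)) \<longlonglongrightarrow> l" by (auto simp: Cauchy_convergent_iff convergent_def)
  then have "X \<longlonglongrightarrow> Abs_sqmat l" by (simp add: lim_sequentially d Abs_sqmat_inverse)
  then show "convergent X" by (auto simp: convergent_def)
qed

definition of_mat :: "real ^ 'm ^ 'm \<Rightarrow> 'm::finite sqmat" where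
  "of_mat A = Abs_sqmat (Blinfun (\<lambda>x. A *v x))"

definition to_mat :: "'m::finite sqmat \<Rightarrow> real ^ 'm ^ 'm" where
  "to_mat B = matrix (blinfun_apply (Rep_sqmat B))"

lemma app_of_mat [simp]: "blinfun_apply (Rep_sqmat (of_mat A)) x = A *v x"
  by (simp add: of_mat_def Abs_sqmat_inverse bounded_linear_Blinfun_apply matrix_vector_mul_bounded_linear)

lemma to_mat_of_mat [simp]: "to_mat (of_mat A) = A"
  by (simp add: to_mat_def app_of_mat[abs_def] matrix_of_matrix_vector_mul)

lemma sqmat_eqI: "(\<And>x. blinfun_apply (Rep_sqmat A) x = blinfun_apply (Rep_sqmat B) x) \<Longrightarrow> A = B"
  by (metis Rep_sqmat_inject blinfun_eqI)

lemma of_mat_to_mat [simp]: "of_mat (to_mat B) = B"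
  by (rule sqmat_eqI) (simp add: to_mat_def matrix_works bounded_linear.linear[OF blinfun.bounded_linear_right])

lemma of_mat_mult: "of_mat (A ** B) = of_mat A * of_mat B"
  by (rule sqmat_eqI) (simp add: times_sqmat_def Abs_sqmat_inverse matrix_vector_mul_assoc)

lemma of_mat_one: "of_mat (mat 1) = 1" by (rule sqmat_eqI) (simp add: one_sqmat_def Abs_sqmat_inverse)

lemma linear_of_mat: "linear of_mat" by (rule linearI; rule sqmat_eqI)
    (simp_all add: plus_sqmat_def scaleR_sqmat_def Abs_sqmat_inverse matrix_vector_mult_add_rdistrib blinfun.add_left blinfun.scaleR_left scaleR_matrix_vector_assoc)

lemma bounded_linear_of_mat: "bounded_linear of_mat" using linear_of_mat by (simp add: linear_conv_bounded_linear)

lemma linear_to_mat: "linear to_mat"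
proof (rule linearI)
  show "to_mat (A + B) = to_mat A + to_mat B" for A B :: "'m::finite sqmat"
    by (metis linear_add[OF linear_of_mat] of_mat_to_mat to_mat_of_mat)
  show "to_mat (c *\<^sub>R A) = c *\<^sub>R to_mat A" for c and A :: "'m::finite sqmat"
    by (metis linear_scale[OF linear_of_mat] of_mat_to_mat to_mat_of_mat)
qed

lemma to_mat_mult: "to_mat (A * B) = to_mat A ** to_mat B" by (metis of_mat_mult of_mat_to_mat to_mat_of_mat)

lemma to_mat_one: "to_mat 1 = mat 1" by (metis of_mat_one to_mat_of_mat)

lemma norm_to_mat_component: "\<bar>to_mat B $ i $ j\<bar> \<le> norm B"
proof -
  have "to_mat B $ i $ j = (blinfun_apply (Rep_sqmat B) (axis j 1)) $ i" by (simp add: to_mat_def matrix_def)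
  also have "\<bar>\<dots>\<bar> \<le> norm (blinfun_apply (Rep_sqmat B) (axis j 1))" by (rule component_le_norm_cart)
  also have "\<dots> \<le> norm B * norm (axis j (1::real))" unfolding norm_sqmat_def by (rule norm_blinfun)
  finally show ?thesis by simp
qed

lemma bounded_linear_to_mat: "bounded_linear (to_mat :: 'm::finite sqmat \<Rightarrow> _)"
proof -
  have "norm (to_mat B) \<le> norm B * (real CARD('m) * real CARD('m))" for B :: "'m sqmat"
  proof -
    have "norm (to_mat B) \<le> (\<Sum>i\<in>UNIV. norm (to_mat B $ i))" unfolding norm_vec_def by (rule L2_set_le_sum) simp
    also have "\<dots> \<le> (\<Sum>i\<in>(UNIV::'m set). \<Sum>j\<in>(UNIV::'m set). norm B)"
    proof (rule sum_mono)
      fix i :: 'm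
      have "norm (to_mat B $ i) \<le> (\<Sum>j\<in>UNIV. \<bar>to_mat B $ i $ j\<bar>)" by (rule norm_le_l1_cart)
      also have "\<dots> \<le> (\<Sum>j\<in>(UNIV::'m set). norm B)" by (intro sum_mono norm_to_mat_component)
      finally show "norm (to_mat B $ i) \<le> (\<Sum>j\<in>(UNIV::'m set). norm B)" .
    qed
    finally show ?thesis by (simp add: mult_ac)
  qed
  then show ?thesis
    by (intro bounded_linear_intro[where K="real CARD('m) * real CARD('m)"])
      (auto simp: linear_add[OF linear_to_mat] linear_scale[OF linear_to_mat])
qed

definition tr :: "'m::finite sqmat \<Rightarrow> 'm sqmat" where "tr A = of_mat (transpose (to_mat A))"

definition symp :: "('n::finite + 'n) sqmat" where "symp = of_mat symp_form"

text \<open>With J = \<open>symp\<close> and J^-1 = - J this is J^-1 A^T J, the adjoint of A for the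
  symplectic form.\<close>

definition symp_star :: "('n::finite + 'n) sqmat \<Rightarrow> ('n + 'n) sqmat" where "symp_star A = - (symp * tr A * symp)"

lemma transpose_scaleR: "transpose (c *\<^sub>R A) = c *\<^sub>R transpose (A :: real ^ 'm ^ 'k)"
  by (simp add: transpose_def vec_eq_iff)

lemma transpose_add: "transpose (A + B) = transpose A + transpose (B :: real ^ 'm ^ 'k)"
  by (simp add: transpose_def vec_eq_iff)

interpretation tr: star_algebra "tr :: 'm::finite sqmat \<Rightarrow> 'm sqmat"
proof (rule star_algebra.intro)
  have "linear (tr :: 'm sqmat \<Rightarrow> 'm sqmat)" by (rule linearI)
      (simp_all add: tr_def linear_add[OF linear_to_mat] linear_scale[OF linear_to_mat] transpose_add transpose_scaleR
        linear_add[OF linear_of_mat] linear_scale[OF linear_of_mat])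
  have "linear (\<lambda>A. transpose A :: real ^ 'm ^ 'm)"
    by (rule linearI) (simp_all add: transpose_add transpose_scaleR)
  then have "bounded_linear (\<lambda>A. transpose A :: real ^ 'm ^ 'm)" by (simp add: linear_conv_bounded_linear)
  then show "bounded_linear (tr :: 'm sqmat \<Rightarrow> 'm sqmat)" unfolding tr_def[abs_def]
    by (intro bounded_linear_compose[OF bounded_linear_of_mat] bounded_linear_compose[OF _ bounded_linear_to_mat])
qed (simp_all add: tr_def to_mat_mult matrix_transpose_mul of_mat_mult to_mat_one transpose_mat of_mat_one transpose_transpose)

lemma sum_UNIV_sum_type:
  fixes f :: "'a::finite + 'b::finite \<Rightarrow> 'c::comm_monoid_add"
  shows "sum f UNIV = (\<Sum>a\<in>UNIV. f (Inl a)) + (\<Sum>b\<in>UNIV. f (Inr b))"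
  by (subst UNIV_Plus_UNIV[symmetric], subst sum.Plus) auto

lemma symp_form_entries [simp]:
  "symp_form $ Inl a $ Inl b = 0" "symp_form $ Inl a $ Inr b = (if a = b then 1 else 0)"
  "symp_form $ Inr a $ Inl b = (if a = b then - 1 else 0)" "symp_form $ Inr a $ Inr b = 0"
  by (simp_all add: symp_form_def)

lemma sum_if_mult:
  fixes f :: "'n::finite \<Rightarrow> 'a::comm_ring_1"
  shows "(\<Sum>k\<in>UNIV. (if a = k then c else 0) * f k) = c * f a" "(\<Sum>k\<in>UNIV. f k * (if k = a then c else 0)) = f a * c"
proof -
  have "(\<Sum>k\<in>UNIV. (if a = k then c else 0) * f k) = (\<Sum>k\<in>UNIV. if a = k then c * f k else 0)"
    by (intro sum.cong) auto
  then show "(\<Sum>k\<in>UNIV. (if a = k then c else 0) * f k) = c * f a" by simp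
  have "(\<Sum>k\<in>UNIV. f k * (if k = a then c else 0)) = (\<Sum>k\<in>UNIV. if k = a then f k * c else 0)"
    by (intro sum.cong) auto
  then show "(\<Sum>k\<in>UNIV. f k * (if k = a then c else 0)) = f a * c" by simp
qed

lemma symp_form_mult_self: "symp_form ** symp_form = (- mat 1 :: ('a::comm_ring_1, 'n::finite) mat2)"
proof -
  have "(\<Sum>k\<in>UNIV. symp_form $ i $ k * symp_form $ k $ j) = - (if i = j then 1 else (0::'a))" for i j :: "'n + 'n"
    by (cases i; cases j) (simp_all add: sum_UNIV_sum_type sum_if_mult)
  then show ?thesis by (simp add: matrix_matrix_mult_def vec_eq_iff mat_def)
qed

lemma transpose_symp_form: "transpose symp_form = - (symp_form :: ('a::comm_ring_1, 'n::finite) mat2)"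
proof -
  have "symp_form $ j $ i = - (symp_form $ i $ j :: 'a)" for i j :: "'n + 'n" by (cases i; cases j) auto
  note e = this
  show ?thesis unfolding vec_eq_iff transpose_def
    by (intro allI, simp only: vec_lambda_beta vector_uminus_component, rule e)
qed

lemma symp_symp: "symp * symp = - 1"
  by (simp add: symp_def of_mat_mult[symmetric] symp_form_mult_self linear_neg[OF linear_of_mat] of_mat_one)

lemma tr_symp: "tr symp = - symp" by (simp add: symp_def tr_def transpose_symp_form linear_neg[OF linear_of_mat])

lemma tr_minus: "tr (- A) = - tr A" by (rule tr.star_minus)

lemma symp_cancel: "symp * (symp * A) = - A" by (simp add: mult.assoc[symmetric] symp_symp)

lemma symp_mult_cancel: "symp * A = symp * B \<longleftrightarrow> A = B"
proof
  assume "symp * A = symp * B"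
  then have "symp * (symp * A) = symp * (symp * B)" by simp
  then show "A = B" by (simp add: symp_cancel)
qed simp

interpretation sp: star_algebra "symp_star :: ('n::finite + 'n) sqmat \<Rightarrow> ('n + 'n) sqmat"
proof (rule star_algebra.intro)
  show "bounded_linear (symp_star :: ('n + 'n) sqmat \<Rightarrow> ('n + 'n) sqmat)" unfolding symp_star_def[abs_def]
    by (intro bounded_linear_minus bounded_linear_compose[OF bounded_linear_mult_left]
      bounded_linear_compose[OF bounded_linear_mult_right] tr.bl_star)
qed (simp_all add: symp_star_def tr.star_mult mult.assoc symp_cancel symp_symp tr_symp tr_minus)

lemma tr_symp_star: "tr (symp_star A) = symp_star (tr A)"
  by (simp add: symp_star_def tr.star_mult tr_symp tr_minus mult.assoc)

lemma sp_alg_iff: "X \<in> sp_alg \<longleftrightarrow> symp_star (of_mat X) = - of_mat X"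
proof -
  have "X \<in> sp_alg \<longleftrightarrow> tr (of_mat X) * symp + symp * of_mat X = 0"
    unfolding sp_alg_def symp_def tr_def to_mat_of_mat of_mat_mult[symmetric] linear_add[OF linear_of_mat, symmetric]
    by (metis (mono_tags, lifting) linear_0[OF linear_of_mat] mem_Collect_eq to_mat_of_mat)
  also have "\<dots> \<longleftrightarrow> symp * (tr (of_mat X) * symp + symp * of_mat X) = 0"
    using symp_mult_cancel[of "tr (of_mat X) * symp + symp * of_mat X" 0] by (simp only: mult_zero_right)
  also have "\<dots> \<longleftrightarrow> symp_star (of_mat X) = - of_mat X"
    by (auto simp: symp_star_def distrib_left symp_cancel mult.assoc)
  finally show ?thesis .
qed

lemma sqmat_inverse_commute: assumes "A * B = (1::'m::finite sqmat)" shows "B * A = 1"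
proof -
  have "to_mat A ** to_mat B = mat 1" using assms by (metis to_mat_mult to_mat_one)
  then have "to_mat B ** to_mat A = mat 1" by (simp add: matrix_left_right_inverse)
  then show ?thesis by (metis of_mat_mult of_mat_one of_mat_to_mat)
qed

lemma Sp_group_iff: "g \<in> Sp_group \<longleftrightarrow> of_mat g \<in> sp.\<Gamma>"
proof -
  have "g \<in> Sp_group \<longleftrightarrow> tr (of_mat g) * symp * of_mat g = symp"
    unfolding Sp_group_def symp_def tr_def to_mat_of_mat of_mat_mult[symmetric]
    by (metis (mono_tags, lifting) mem_Collect_eq to_mat_of_mat)
  also have "\<dots> \<longleftrightarrow> symp * (tr (of_mat g) * symp * of_mat g) = symp * symp"
    by (rule symp_mult_cancel[symmetric])
  also have "\<dots> \<longleftrightarrow> symp_star (of_mat g) * of_mat g = 1"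
    by (simp only: symp_star_def symp_symp mult_minus_left mult.assoc) (metis minus_minus)
  also have "\<dots> \<longleftrightarrow> of_mat g \<in> sp.\<Gamma>"
    by (auto simp: sp.\<Gamma>_def dest: sqmat_inverse_commute)
  finally show ?thesis .
qed

section \<open>Generation of the compact subgroup\<close>

lemma inner_tr: "inner (blinfun_apply (Rep_sqmat A) x) y = inner x (blinfun_apply (Rep_sqmat (tr A)) y)"
proof -
  have "blinfun_apply (Rep_sqmat A) x = to_mat A *v x" using app_of_mat[of "to_mat A" x] by simp
  moreover have "blinfun_apply (Rep_sqmat (tr A)) y = transpose (to_mat A) *v y" by (simp add: tr_def)
  ultimately show ?thesis
    using dot_lmul_matrix[of y "to_mat A" x] by (simp add: inner_commute)
qed

lemma app_mult: "blinfun_apply (Rep_sqmat (A * B)) x = blinfun_apply (Rep_sqmat A) (blinfun_apply (Rep_sqmat B) x)"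
  by (simp add: times_sqmat_def Abs_sqmat_inverse)

lemma norm_app_le: "norm (blinfun_apply (Rep_sqmat A) x) \<le> norm A * norm x"
  unfolding norm_sqmat_def by (rule norm_blinfun)

text \<open>A spectral estimate for P = Q^T Q obtained from inner products alone. Expanding |P x / c
  - x|^2 and using |P x|^2 \<le> c |Q x|^2 leaves at most |x|^2 - |Q x|^2 / c, and |x| \<le> B |Q x|
  because A inverts Q. So P lies in the domain of the shifted logarithm
  \<open>lnc c\<close>.\<close>

lemma norm_positive_contraction:
  fixes Q :: "'m::finite sqmat"
  assumes A: "A * Q = 1" and c: "norm Q ^ 2 \<le> c" "norm (tr Q) ^ 2 \<le> c" "c > 0" and B: "norm A \<le> B" "B > 0"
  shows "norm ((tr Q * Q) /\<^sub>R c - 1) \<le> sqrt (1 - 1 / (c * B ^ 2))"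
proof -
  have "1 \<le> norm A * norm Q" using norm_mult_ineq[of A Q] by (simp add: A)
  also have "\<dots> \<le> B * norm Q" using B by (intro mult_right_mono) auto
  finally have "1 \<le> (B * norm Q) ^ 2" by (simp add: one_le_power)
  also have "\<dots> \<le> B ^ 2 * c" unfolding power_mult_distrib by (intro mult_left_mono c) auto
  finally have cB: "1 \<le> c * B ^ 2" by (simp add: mult.commute)
  have "norm (blinfun_apply (Rep_sqmat ((tr Q * Q) /\<^sub>R c - 1)) x) \<le> sqrt (1 - 1 / (c * B ^ 2)) * norm x" for x
  proof -
    let ?a = "\<lambda>A. blinfun_apply (Rep_sqmat A)"
    have e: "?a ((tr Q * Q) /\<^sub>R c - 1) x = (?a (tr Q) (?a Q x)) /\<^sub>R c - x"
      by (simp add: minus_sqmat_def scaleR_sqmat_def Abs_sqmat_inverse blinfun.diff_left blinfun.scaleR_left app_mult one_sqmat_def)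
    have i: "inner (?a (tr Q) (?a Q x)) x = (norm (?a Q x))\<^sup>2"
      using inner_tr[of Q x "?a Q x"] by (simp add: inner_commute power2_norm_eq_inner)
    have "(norm (?a (tr Q) (?a Q x)))\<^sup>2 \<le> (norm (tr Q) * norm (?a Q x))\<^sup>2"
      by (intro power_mono norm_app_le) auto
    also have "\<dots> \<le> c * (norm (?a Q x))\<^sup>2" unfolding power_mult_distrib by (intro mult_right_mono c) auto
    finally have n2: "(norm (?a (tr Q) (?a Q x)))\<^sup>2 \<le> c * (norm (?a Q x))\<^sup>2" .
    have "norm x = norm (?a A (?a Q x))" using app_mult[of A Q x] by (simp add: A one_sqmat_def Abs_sqmat_inverse)
    also have "\<dots> \<le> norm A * norm (?a Q x)" by (rule norm_app_le)
    also have "\<dots> \<le> B * norm (?a Q x)" using B by (intro mult_right_mono) auto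
    finally have "(norm x)\<^sup>2 \<le> (B * norm (?a Q x))\<^sup>2" by (intro power_mono) auto
    then have nx: "(norm x)\<^sup>2 / (c * B\<^sup>2) \<le> (norm (?a Q x))\<^sup>2 / c" using B c by (simp add: field_simps power_mult_distrib)
    have "(norm ((?a (tr Q) (?a Q x)) /\<^sub>R c - x))\<^sup>2 =
       (norm (?a (tr Q) (?a Q x)))\<^sup>2 / c\<^sup>2 - 2 * (norm (?a Q x))\<^sup>2 / c + (norm x)\<^sup>2"
    proof -
      have sq: "(norm (y - x))\<^sup>2 = (norm y)\<^sup>2 - 2 * inner y x + (norm x)\<^sup>2" for y :: "real ^ 'm"
        unfolding power2_norm_eq_inner by (simp add: inner_diff inner_commute)
      show ?thesis unfolding sq using i c by (simp add: power_divide divide_inverse power_mult_distrib power_inverse)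
    qed
    also have "(norm (?a (tr Q) (?a Q x)))\<^sup>2 / c\<^sup>2 \<le> c * (norm (?a Q x))\<^sup>2 / c\<^sup>2"
      by (intro divide_right_mono n2) auto
    also have "c * (norm (?a Q x))\<^sup>2 / c\<^sup>2 = (norm (?a Q x))\<^sup>2 / c" using c by (simp add: power2_eq_square)
    finally have "(norm ((?a (tr Q) (?a Q x)) /\<^sub>R c - x))\<^sup>2 \<le> (1 - 1 / (c * B\<^sup>2)) * (norm x)\<^sup>2"
      using nx by (simp add: algebra_simps)
    then have "norm ((?a (tr Q) (?a Q x)) /\<^sub>R c - x) \<le> sqrt ((1 - 1 / (c * B\<^sup>2)) * (norm x)\<^sup>2)"
      by (rule real_le_rsqrt)
    then show ?thesis unfolding e by (simp add: real_sqrt_mult)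
  qed
  then show ?thesis unfolding norm_sqmat_def
    by (intro norm_blinfun_bound) (use cB in \<open>auto simp: field_simps\<close>)
qed

text \<open>For symmetric Y the elements exp (s Y) are positive definite, so one shifted logarithm
  recovers both Y and - Y from their exponentials. The star passes through that series, and by
  hypothesis it exchanges the two exponentials.\<close>

lemma symp_star_symmetric_log:
  fixes Y :: "('n::finite + 'n) sqmat"
  assumes Y: "tr Y = Y" and e: "symp_star (exp Y) = exp (- Y)"
  shows "symp_star Y = - Y"
proof -
  define c where "c = exp (norm Y)"
  define \<rho> where "\<rho> = sqrt (1 - 1 / (c * (exp (norm Y)) ^ 2))"
  have c: "c > 0" by (simp add: c_def)
  have \<rho>: "\<rho> < 1" unfolding \<rho>_def using c by simp
  have b: "norm (exp (s *\<^sub>R Y) /\<^sub>R c - 1) \<le> \<rho>" if s: "\<bar>s\<bar> \<le> 1" for s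
  proof -
    \<comment> \<open>The symmetric square root of exp (s Y), which exhibits it as Q^T Q.\<close>
    define Q where "Q = exp ((s/2) *\<^sub>R Y)"
    have trQ: "tr Q = Q" by (simp add: Q_def tr.star_exp tr.star_scaleR Y)
    have QQ: "Q * Q = exp (s *\<^sub>R Y)"
      unfolding Q_def by (subst exp_add_commuting[symmetric]) (simp_all add: scaleR_left_distrib[symmetric])
    have n: "norm ((r/2) *\<^sub>R Y) \<le> norm Y / 2" if "\<bar>r\<bar> \<le> 1" for r
      using that by (simp add: mult_left_le_one_le)
    have nq: "norm (exp ((r/2) *\<^sub>R Y)) \<le> exp (norm Y / 2)" if "\<bar>r\<bar> \<le> 1" for r
      using norm_exp[of "(r/2) *\<^sub>R Y"] n[OF that] by (meson exp_le_cancel_iff order_trans)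
    have "norm Q ^ 2 \<le> (exp (norm Y / 2)) ^ 2" unfolding Q_def using nq[OF s] by (intro power_mono) auto
    also have "\<dots> = c" by (simp add: c_def exp_double[symmetric] power2_eq_square exp_add[symmetric])
    finally have nQ: "norm Q ^ 2 \<le> c" .
    have "norm ((tr Q * Q) /\<^sub>R c - 1) \<le> sqrt (1 - 1 / (c * (exp (norm Y)) ^ 2))"
    proof (rule norm_positive_contraction[OF _ nQ _ c])
      show "exp ((- s/2) *\<^sub>R Y) * Q = 1"
        unfolding Q_def using exp_minus_inverse[of "(- s/2) *\<^sub>R Y"] by simp
      have "norm (exp ((- s/2) *\<^sub>R Y)) \<le> exp (norm Y / 2)" using nq[of "- s"] s by simp
      also have "\<dots> \<le> exp (norm Y)" by simp
      finally show "norm (exp ((- s/2) *\<^sub>R Y)) \<le> exp (norm Y)" .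
    qed (use nQ trQ in auto)
    then show ?thesis by (simp add: trQ QQ \<rho>_def)
  qed
  have 1: "lnc c (exp Y) = Y" by (rule lnc_exp[OF c b \<rho>]) auto
  have 2: "lnc c (exp (- Y)) = - Y" by (rule lnc_exp[OF c _ \<rho>]) (use b[of "- _"] in auto)
  have "symp_star (lnc c (exp Y)) = lnc c (symp_star (exp Y))"
    by (rule sp.star_lnc) (use b[of 1] b[of "- 1"] \<rho> e in auto)
  then show ?thesis by (simp add: 1 2 e)
qed

text \<open>Polar decomposition along the path: with Y = log (p^T p) the homotopy p exp (- s Y / 2)
  shrinks the positive factor. Y is skew for the symplectic star, so the homotopy stays in the
  group; it vanishes at both ends because these are orthogonal, so the ends stay fixed.\<close>

lemma deform_to_compact:
  fixes p :: "real \<Rightarrow> ('n::finite + 'n) sqmat"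
  assumes p: "path p" "path_image p \<subseteq> sp.\<Gamma>" "pathstart p = 1" and fin: "tr (p 1) * p 1 = 1"
  shows "\<exists>k. homotopic_paths sp.\<Gamma> p k \<and> (\<forall>t\<in>{0..1}. tr (k t) * k t = 1)"
proof -
  have pc: "continuous_on {0..1} p" using p by (simp add: path_def)
  have p\<Gamma>: "p t \<in> sp.\<Gamma>" if "t \<in> {0..1}" for t using p that by (auto simp: path_image_def)
  have cont_tr: "continuous_on {0..1} (\<lambda>t. tr (p t))" by (rule bounded_linear.continuous_on[OF tr.bl_star pc])
  have cont_st: "continuous_on {0..1} (\<lambda>t. symp_star (p t))" by (rule bounded_linear.continuous_on[OF sp.bl_star pc])
  have "bounded (p ` {0..1} \<union> (\<lambda>t. tr (p t)) ` {0..1} \<union> (\<lambda>t. symp_star (p t)) ` {0..1})"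
    by (intro bounded_Un[THEN iffD2] conjI compact_imp_bounded compact_continuous_image pc cont_tr cont_st) auto
  then obtain B0 where B0: "\<And>t. t \<in> {0..1} \<Longrightarrow> norm (p t) \<le> B0 \<and> norm (tr (p t)) \<le> B0 \<and> norm (symp_star (p t)) \<le> B0"
    unfolding bounded_iff by (metis UnCI imageI)
  define B where "B = max 1 B0"
  have B: "B \<ge> 1" "\<And>t. t \<in> {0..1} \<Longrightarrow> norm (p t) \<le> B \<and> norm (tr (p t)) \<le> B \<and> norm (symp_star (p t)) \<le> B"
    using B0 by (auto simp: B_def le_max_iff_disj simp del: atLeastAtMost_iff)
  \<comment> \<open>B bounds the norms of p, its transpose and its inverse
    \<open>symp_star (p t)\<close> for all t at once, by compactness. A single c then puts every p^T
    p into the domain of one logarithm, which makes Y continuous.\<close>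
  define c where "c = B\<^sup>2"
  have c: "c \<ge> 1" using B(1) by (simp add: c_def one_le_power)
  define P where "P t = tr (p t) * p t" for t
  define \<rho> where "\<rho> = sqrt (1 - 1 / (c * B ^ 2))"
  have \<rho>: "\<rho> < 1" unfolding \<rho>_def using c B by simp
  have nP: "norm (P t /\<^sub>R c - 1) \<le> \<rho>" if t: "t \<in> {0..1}" for t unfolding P_def \<rho>_def
  proof (rule norm_positive_contraction)
    show "symp_star (p t) * p t = 1" using p\<Gamma>[OF t] by (simp add: sp.\<Gamma>_def)
  qed (use B t c in \<open>auto simp: c_def intro!: power_mono\<close>)
  have nP1: "norm (P t /\<^sub>R c - 1) < 1" if "t \<in> {0..1}" for t using nP[OF that] \<rho> by simp
  define Y where "Y t = lnc c (P t)" for t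
  have eY: "exp (Y t) = P t" if "t \<in> {0..1}" for t unfolding Y_def by (rule exp_lnc) (use c nP1[OF that] in auto)
  have contY: "continuous_on {0..1} Y" unfolding Y_def lnc_def P_def
    by (intro continuous_on_add continuous_on_const continuous_on_lnp[where r=\<rho>])
      (use nP \<rho> in \<open>auto simp: P_def intro!: continuous_intros pc cont_tr\<close>)
  have trP: "tr (P t) = P t" for t by (simp add: P_def tr.star_mult)
  have trY: "tr (Y t) = Y t" if "t \<in> {0..1}" for t
    unfolding Y_def using tr.star_lnc[of c "P t"] nP1[OF that] by (simp add: trP)
  have starP: "symp_star (P t) * P t = 1" if "t \<in> {0..1}" for t
  proof -
    have g: "symp_star (p t) * p t = 1" "p t * symp_star (p t) = 1" using p\<Gamma>[OF that] by (auto simp: sp.\<Gamma>_def)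
    have "tr (p t * symp_star (p t)) = 1" by (simp add: g)
    then have g2: "symp_star (tr (p t)) * tr (p t) = 1" by (simp add: tr.star_mult tr_symp_star)
    have "symp_star (P t) * P t = symp_star (p t) * (symp_star (tr (p t)) * tr (p t)) * p t"
      by (simp add: P_def sp.star_mult mult.assoc)
    then show ?thesis by (simp add: g g2)
  qed
  have sY: "symp_star (Y t) = - Y t" if t: "t \<in> {0..1}" for t
  proof (rule symp_star_symmetric_log[OF trY[OF t]])
    have "symp_star (P t) * P t * exp (- Y t) = exp (- Y t)" by (simp add: starP[OF t])
    then show "symp_star (exp (Y t)) = exp (- Y t)" by (simp add: eY[OF t, symmetric] mult.assoc exp_minus_inverse)
  qed
  have Y01: "Y 0 = 0" "Y 1 = 0"
    using p(3) fin lnc_1[OF c, where 'a="('n + 'n) sqmat"] by (auto simp: Y_def P_def pathstart_def)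
  define k where "k t = p t * exp (- (1/2) *\<^sub>R Y t)" for t
  have "homotopic_paths sp.\<Gamma> p k" unfolding homotopic_paths
  proof (rule exI[of _ "\<lambda>z. p (snd z) * exp ((- fst z / 2) *\<^sub>R Y (snd z))"], intro conjI ballI)
    show "continuous_on ({0..1} \<times> {0..1}) (\<lambda>z::real \<times> real. p (snd z) * exp ((- fst z / 2) *\<^sub>R Y (snd z)))"
      by (intro continuous_intros continuous_on_compose2[OF pc] continuous_on_compose2[OF contY]) auto
    show "(\<lambda>z::real \<times> real. p (snd z) * exp ((- fst z / 2) *\<^sub>R Y (snd z))) \<in> ({0..1} \<times> {0..1}) \<rightarrow> sp.\<Gamma>"
      by (auto intro!: sp.mult_in_\<Gamma> sp.exp_in_\<Gamma> p\<Gamma> simp: sp.star_scaleR sY sp.star_minus)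
    show "pathstart ((\<lambda>z::real \<times> real. p (snd z) * exp ((- fst z / 2) *\<^sub>R Y (snd z))) \<circ> Pair t) = pathstart p"
      "pathfinish ((\<lambda>z::real \<times> real. p (snd z) * exp ((- fst z / 2) *\<^sub>R Y (snd z))) \<circ> Pair t) = pathfinish p" for t
      by (auto simp: pathstart_def pathfinish_def Y01)
  qed (auto simp: k_def)
  moreover have "tr (k t) * k t = 1" if t: "t \<in> {0..1}" for t
  proof -
    define E where "E = exp (- (1/2) *\<^sub>R Y t)"
    have trE: "tr E = E" by (simp add: E_def tr.star_exp tr.star_scaleR tr.star_minus trY[OF t])
    have "tr (k t) * k t = E * P t * E" unfolding k_def E_def[symmetric] tr.star_mult trE P_def by (simp only: mult.assoc)
    also have "\<dots> = E * (exp (Y t) * E)" by (simp add: eY[OF t] mult.assoc)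
    also have "exp (Y t) * E = exp ((1/2) *\<^sub>R Y t)"
    proof -
      have "Y t + - (1/2) *\<^sub>R Y t = (1 + - (1/2)) *\<^sub>R Y t" by (simp only: scaleR_left_distrib scaleR_one)
      then have "exp (Y t + - (1/2) *\<^sub>R Y t) = exp ((1/2) *\<^sub>R Y t)" by simp
      moreover have "exp (Y t + - (1/2) *\<^sub>R Y t) = exp (Y t) * exp (- (1/2) *\<^sub>R Y t)"
        by (rule exp_add_commuting) simp
      ultimately show ?thesis by (simp only: E_def)
    qed
    also have "E * exp ((1/2) *\<^sub>R Y t) = 1"
      unfolding E_def using exp_minus_inverse[of "- (1/2) *\<^sub>R Y t"] by simp
    finally show ?thesis .
  qed
  ultimately show ?thesis by blast
qed

text \<open>The path is reached through its initial pieces, each reparametrised to the unit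
  interval. The pointwise quotient of two consecutive pieces stays close to 1, hence is homotopic to
  a one-parameter path, and multiplying by it extends the piece.\<close>

lemma compact_path_induct:
  fixes k :: "real \<Rightarrow> ('n::finite + 'n) sqmat"
  assumes k: "path k" "path_image k \<subseteq> sp.\<Gamma>" "pathstart k = 1" "\<And>t. t \<in> {0..1} \<Longrightarrow> tr (k t) * k t = 1"
    and base: "P (\<lambda>_. 1)"
    and step: "\<And>p Z. path p \<Longrightarrow> path_image p \<subseteq> sp.\<Gamma> \<Longrightarrow> pathstart p = 1 \<Longrightarrow> P p \<Longrightarrow> symp_star Z = - Z \<Longrightarrow> tr Z = - Z
       \<Longrightarrow> P (\<lambda>t. p t * exp (t *\<^sub>R Z))"
    and hom: "\<And>p q. P p \<Longrightarrow> homotopic_paths sp.\<Gamma> p q \<Longrightarrow> pathstart p = 1 \<Longrightarrow> P q"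
  shows "P k"
proof -
  have kc: "continuous_on {0..1} k" using k by (simp add: path_def)
  have k\<Gamma>: "k t \<in> sp.\<Gamma>" if "t \<in> {0..1}" for t using k that by (auto simp: path_image_def)
  have trk: "tr (k t) * k t = 1 \<and> k t * tr (k t) = 1" if "t \<in> {0..1}" for t
    using k(4)[OF that] sqmat_inverse_commute by blast
  obtain d where d: "d > 0" "\<And>s t. s \<in> {0..1} \<Longrightarrow> t \<in> {0..1} \<Longrightarrow> dist s t < d \<Longrightarrow> norm (symp_star (k s) * k t - 1) \<le> 1/4"
    using sp.uniform_close[of "1/4" "{0..1}" k] kc k by (auto simp: path_image_def)
  obtain M where M: "inverse (real (Suc M)) < d" using reals_Archimedean[OF d(1)] by blast
  define N where "N = Suc M"
  have N: "N > 0" "1 / real N < d" using M by (auto simp: N_def inverse_eq_divide)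
  define r where "r i t = k (t * (real i / real N))" for i t
  have unit: "t * (real i / real N) \<in> {0..1}" if "i \<le> N" "t \<in> {0..1}" for i t
    using that N by (auto simp: mult_le_one divide_simps intro: mult_mono[of t 1 "real i" "real N", simplified])
  have r: "path (r i)" "path_image (r i) \<subseteq> sp.\<Gamma>" "pathstart (r i) = 1" if i: "i \<le> N" for i
  proof -
    show "path (r i)" unfolding path_def r_def[abs_def]
      by (intro continuous_on_compose2[OF kc] continuous_intros) (use unit[OF i] in auto)
    show "path_image (r i) \<subseteq> sp.\<Gamma>" using k\<Gamma> unit[OF i] by (auto simp: path_image_def r_def)
    show "pathstart (r i) = 1" using k(3) by (simp add: pathstart_def r_def)
  qed
  have "P (r i)" if "i \<le> N" for i using that
  proof (induction i)
    case 0
    have "r 0 = (\<lambda>_. 1)" using k(3) by (auto simp: r_def pathstart_def)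
    then show ?case using base by simp
  next
    case (Suc i)
    then have i: "i \<le> N" "Suc i \<le> N" and IH: "P (r i)" by auto
    define c where "c t = symp_star (r i t) * r (Suc i) t" for t
    have c_path: "path c" unfolding path_def c_def[abs_def]
      using r(1)[OF i(1)] r(1)[OF i(2)] by (intro continuous_intros bounded_linear.continuous_on[OF sp.bl_star]) (auto simp: path_def)
    have c_im: "path_image c \<subseteq> sp.\<Gamma>"
      using r(2)[OF i(1)] r(2)[OF i(2)] by (auto simp: c_def path_image_def intro!: sp.mult_in_\<Gamma> sp.star_in_\<Gamma>)
    have c0: "pathstart c = 1" using r(3)[OF i(1)] r(3)[OF i(2)] by (simp add: c_def pathstart_def)
    have cn: "norm (c t - 1) \<le> 1/4" if t: "t \<in> {0..1}" for t unfolding c_def r_def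
    proof (rule d(2)[OF unit[OF i(1) t] unit[OF i(2) t]])
      have "\<bar>t * (real i / real N) - t * (real (Suc i) / real N)\<bar> = \<bar>t\<bar> * (1 / real N)"
        unfolding right_diff_distrib[symmetric] abs_mult using N by (simp add: field_simps)
      also have "\<dots> \<le> 1 / real N" using t by (simp add: divide_right_mono)
      finally show "dist (t * (real i / real N)) (t * (real (Suc i) / real N)) < d" using N by (simp add: dist_real_def)
    qed
    define Z where "Z = lnp (c 1 - 1)"
    have c1: "c 1 \<in> sp.\<Gamma>" using c_im by (auto simp: path_image_def)
    have Z1: "symp_star Z = - Z" unfolding Z_def by (rule sp.lnp_skew[OF c1]) (use cn in auto)
    \<comment> \<open>On the given path transpose and symplectic star both invert. The quotient c 1
      is therefore orthogonal as well as symplectic, and its logarithm is skew for both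
      involutions.\<close>
    have Z2: "tr Z = - Z" unfolding Z_def
    proof (rule tr.lnp_skew)
      let ?a = "k (1 * (real i / real N))" and ?b = "k (1 * (real (Suc i) / real N))"
      have ab: "tr ?a * ?a = 1" "?a * tr ?a = 1" "tr ?b * ?b = 1" "?b * tr ?b = 1"
        using trk[OF unit[OF i(1), of 1]] trk[OF unit[OF i(2), of 1]] by simp_all
      have "?a \<in> sp.\<Gamma>" using k\<Gamma>[OF unit[OF i(1), of 1]] by simp
      then have "symp_star ?a * (?a * tr ?a) = tr ?a" by (simp only: mult.assoc[symmetric] sp.\<Gamma>_def mem_Collect_eq mult_1_left)
      then have "symp_star ?a = tr ?a" by (simp only: ab mult_1_right)
      then have c1: "c 1 = tr ?a * ?b" by (simp add: c_def r_def)
      have "tr (c 1) * c 1 = tr ?b * (?a * tr ?a) * ?b" unfolding c1 tr.star_mult tr.star_star by (simp only: mult.assoc)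
      moreover have "c 1 * tr (c 1) = tr ?a * (?b * tr ?b) * ?a" unfolding c1 tr.star_mult tr.star_star by (simp only: mult.assoc)
      ultimately show "c 1 \<in> tr.\<Gamma>" using ab by (simp add: tr.\<Gamma>_def)
    qed (use cn in auto)
    have "homotopic_paths sp.\<Gamma> (\<lambda>t. exp (t *\<^sub>R Z)) c"
      unfolding Z_def by (rule homotopic_paths_sym[OF sp.short_path_exp[OF c_path c_im c0 cn]])
    then have h: "homotopic_paths sp.\<Gamma> (\<lambda>t. r i t * exp (t *\<^sub>R Z)) (\<lambda>t. r i t * c t)"
      using r[OF i(1)] by (intro sp.homotopic_paths_mult) auto
    have e: "r i t * c t = r (Suc i) t" if "t \<in> {0..1}" for t
    proof -
      have "r i t * symp_star (r i t) = 1" using k\<Gamma>[OF unit[OF i(1) that]] by (simp add: r_def sp.\<Gamma>_def)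
      then show ?thesis by (simp add: c_def mult.assoc[symmetric])
    qed
    have "homotopic_paths sp.\<Gamma> (\<lambda>t. r i t * c t) (r (Suc i))"
    proof (rule homotopic_paths_eq)
      show "path (\<lambda>t. r i t * c t)" using homotopic_paths_imp_path[OF h] by simp
      show "path_image (\<lambda>t. r i t * c t) \<subseteq> sp.\<Gamma>" using homotopic_paths_imp_subset[OF h] by simp
    qed (use e in auto)
    with h have "homotopic_paths sp.\<Gamma> (\<lambda>t. r i t * exp (t *\<^sub>R Z)) (r (Suc i))" by (rule homotopic_paths_trans)
    then show ?case
      by (rule hom[OF step[OF r[OF i(1)] IH Z1 Z2]]) (use r(3)[OF i(1)] in \<open>auto simp: pathstart_def\<close>)
  qed
  moreover have "r N = k" using N by (auto simp: r_def fun_eq_iff)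
  ultimately show "P k" by auto
qed

section \<open>Path classes of the symplectic group and the subgroup K\<close>

lemma Sp_paths_iff:
  "p \<in> Sp_paths \<longleftrightarrow> path (of_mat \<circ> p) \<and> path_image (of_mat \<circ> p) \<subseteq> sp.\<Gamma> \<and> pathstart (of_mat \<circ> p) = 1"
proof -
  have "path (of_mat \<circ> p) \<longleftrightarrow> path p"
  proof
    assume "path (of_mat \<circ> p)"
    then have "path (to_mat \<circ> (of_mat \<circ> p))"
      by (rule path_continuous_image[OF _ linear_continuous_on[OF bounded_linear_to_mat]])
    then show "path p" by (simp add: o_def)
  next
    assume "path p" then show "path (of_mat \<circ> p)"
      by (rule path_continuous_image[OF _ linear_continuous_on[OF bounded_linear_of_mat]])
  qed
  moreover have "path_image (of_mat \<circ> p) \<subseteq> sp.\<Gamma> \<longleftrightarrow> path_image p \<subseteq> Sp_group"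
    by (auto simp: path_image_def Sp_group_iff image_subset_iff)
  moreover have "pathstart (of_mat \<circ> p) = 1 \<longleftrightarrow> pathstart p = mat 1"
    unfolding pathstart_def o_def of_mat_one[symmetric] by (metis to_mat_of_mat)
  ultimately show ?thesis by (simp add: Sp_paths_def)
qed

lemma homotopic_of_mat:
  "homotopic_paths Sp_group p q \<longleftrightarrow> homotopic_paths sp.\<Gamma> (of_mat \<circ> p) (of_mat \<circ> q)"
proof
  assume "homotopic_paths Sp_group p q"
  then show "homotopic_paths sp.\<Gamma> (of_mat \<circ> p) (of_mat \<circ> q)"
    by (rule homotopic_paths_continuous_image)
      (auto simp: Sp_group_iff intro: linear_continuous_on bounded_linear_of_mat)
next
  assume "homotopic_paths sp.\<Gamma> (of_mat \<circ> p) (of_mat \<circ> q)"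
  then have "homotopic_paths Sp_group (to_mat \<circ> (of_mat \<circ> p)) (to_mat \<circ> (of_mat \<circ> q))"
    by (rule homotopic_paths_continuous_image)
      (auto simp: Sp_group_iff intro: linear_continuous_on bounded_linear_to_mat)
  then show "homotopic_paths Sp_group p q" by (simp add: o_def)
qed

lemma pclass_self: "p \<in> Sp_paths \<Longrightarrow> p \<in> pclass p" by (simp add: pclass_def Sp_paths_def)

lemma pclass_eq: "homotopic_paths Sp_group p q \<Longrightarrow> pclass p = pclass q"
  unfolding pclass_def using homotopic_paths_trans homotopic_paths_sym by blast

lemma mem_pclass: "q \<in> pclass p \<longleftrightarrow> homotopic_paths Sp_group p q" by (simp add: pclass_def)

lemma Sp_paths_homotopic:
  assumes p: "p \<in> Sp_paths" and h: "homotopic_paths Sp_group p q" shows "q \<in> Sp_paths"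
  using p homotopic_paths_imp_path[OF h] homotopic_paths_imp_subset[OF h] homotopic_paths_imp_pathstart[OF h]
  by (simp add: Sp_paths_def)

lemma Sp_paths_mult: "p \<in> Sp_paths \<Longrightarrow> q \<in> Sp_paths \<Longrightarrow> (\<lambda>t. p t ** q t) \<in> Sp_paths"
  unfolding Sp_paths_iff o_def of_mat_mult
  by (auto simp: path_def path_image_def pathstart_def image_subset_iff intro!: continuous_on_mult sp.mult_in_\<Gamma>)

lemma G_mult_pclass:
  assumes "p \<in> Sp_paths" "q \<in> Sp_paths"
  shows "G_mult (pclass p) (pclass q) = pclass (\<lambda>t. p t ** q t)"
proof -
  have "pclass (\<lambda>t. p' t ** q' t) = pclass (\<lambda>t. p t ** q t)"
    if "homotopic_paths Sp_group p p'" "homotopic_paths Sp_group q q'" for p' q'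
  proof (rule pclass_eq[symmetric])
    show "homotopic_paths Sp_group (\<lambda>t. p t ** q t) (\<lambda>t. p' t ** q' t)"
      using sp.homotopic_paths_mult[of "of_mat \<circ> p" "of_mat \<circ> p'" "of_mat \<circ> q" "of_mat \<circ> q'"] that
      unfolding homotopic_of_mat o_def of_mat_mult by blast
  qed
  note e = this
  have "G_mult (pclass p) (pclass q) = (\<Union>p'\<in>pclass p. \<Union>q'\<in>pclass q. pclass (\<lambda>t. p t ** q t))"
    unfolding G_mult_def by (intro SUP_cong refl e) (simp_all add: mem_pclass)
  then show ?thesis using pclass_self[OF assms(1)] pclass_self[OF assms(2)] by auto
qed

lemma matrix_inv_Sp:
  assumes "g \<in> Sp_group" shows "of_mat (matrix_inv g) = symp_star (of_mat g)"
proof -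
  have g: "symp_star (of_mat g) * of_mat g = 1" "of_mat g * symp_star (of_mat g) = 1"
    using assms by (auto simp: Sp_group_iff sp.\<Gamma>_def)
  have 1: "g ** to_mat (symp_star (of_mat g)) = mat 1" "to_mat (symp_star (of_mat g)) ** g = mat 1"
    using arg_cong[OF g(1), of to_mat] arg_cong[OF g(2), of to_mat] by (simp_all add: to_mat_mult to_mat_one)
  then have "g ** matrix_inv g = mat 1"
    using someI[of "\<lambda>A'. g ** A' = mat 1 \<and> A' ** g = mat 1", OF conjI] by (simp add: matrix_inv_def)
  then have "matrix_inv g = to_mat (symp_star (of_mat g))"
    using 1(2) by (metis matrix_mul_assoc matrix_mul_lid matrix_mul_rid)
  then show ?thesis by simp
qed

text \<open>The Cartan involution applied pointwise to a path; inside the Banach algebra it becomes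
  tr (symp_star g).\<close>

definition \<theta> :: "(real \<Rightarrow> (real, 'n::finite) mat2) \<Rightarrow> real \<Rightarrow> (real, 'n) mat2" where
  "\<theta> p t = transpose (matrix_inv (p t))"

lemma of_mat_\<theta>: "p t \<in> Sp_group \<Longrightarrow> of_mat (\<theta> p t) = tr (symp_star (of_mat (p t)))"
  by (simp add: \<theta>_def matrix_inv_Sp[symmetric] tr_def)

lemma symp_tr_in_\<Gamma>: "g \<in> sp.\<Gamma> \<Longrightarrow> tr (symp_star g) \<in> sp.\<Gamma>"
proof -
  assume "g \<in> sp.\<Gamma>"
  then have g: "symp_star g * g = 1" "g * symp_star g = 1" by (auto simp: sp.\<Gamma>_def)
  have "tr (g * symp_star g) = 1" "tr (symp_star g * g) = 1" by (simp_all add: g)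
  then show ?thesis
    by (simp add: sp.\<Gamma>_def tr.star_mult tr_symp_star[symmetric])
qed

lemma homotopic_\<theta>:
  assumes "homotopic_paths Sp_group p q" shows "homotopic_paths Sp_group (\<theta> p) (\<theta> q)"
proof -
  have h: "homotopic_paths sp.\<Gamma> ((\<lambda>g. tr (symp_star g)) \<circ> (of_mat \<circ> p)) ((\<lambda>g. tr (symp_star g)) \<circ> (of_mat \<circ> q))"
    using assms unfolding homotopic_of_mat by (rule homotopic_paths_continuous_image)
      (auto intro!: symp_tr_in_\<Gamma> linear_continuous_on bounded_linear_compose[OF tr.bl_star sp.bl_star])
  have "homotopic_paths sp.\<Gamma> (of_mat \<circ> \<theta> r) ((\<lambda>g. tr (symp_star g)) \<circ> (of_mat \<circ> r))"
    if "path r" "path_image r \<subseteq> Sp_group" for r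
  proof (rule homotopic_paths_sym[OF homotopic_paths_eq])
    show "path ((\<lambda>g. tr (symp_star g)) \<circ> (of_mat \<circ> r))"
      using that by (intro path_continuous_image linear_continuous_on bounded_linear_compose[OF tr.bl_star sp.bl_star] bounded_linear_of_mat)
    show "path_image ((\<lambda>g. tr (symp_star g)) \<circ> (of_mat \<circ> r)) \<subseteq> sp.\<Gamma>"
      using that by (auto simp: path_image_def Sp_group_iff image_subset_iff intro!: symp_tr_in_\<Gamma>)
    show "((\<lambda>g. tr (symp_star g)) \<circ> (of_mat \<circ> r)) t = (of_mat \<circ> \<theta> r) t" if "t \<in> {0..1}" for t
      using \<open>path_image r \<subseteq> Sp_group\<close> that by (auto simp: of_mat_\<theta> path_image_def image_subset_iff)
  qed
  note e = this
  have "homotopic_paths sp.\<Gamma> (of_mat \<circ> \<theta> p) ((\<lambda>g. tr (symp_star g)) \<circ> (of_mat \<circ> q))"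
    by (rule homotopic_paths_trans[OF e h])
      (use homotopic_paths_imp_path[OF assms] homotopic_paths_imp_subset[OF assms] in auto)
  moreover have "homotopic_paths sp.\<Gamma> ((\<lambda>g. tr (symp_star g)) \<circ> (of_mat \<circ> q)) (of_mat \<circ> \<theta> q)"
    by (rule homotopic_paths_sym[OF e])
      (use homotopic_paths_imp_path[OF assms] homotopic_paths_imp_subset[OF assms] in auto)
  ultimately show ?thesis unfolding homotopic_of_mat by (rule homotopic_paths_trans)
qed

lemma G_cartan_inv_pclass:
  assumes "p \<in> Sp_paths" shows "G_cartan_inv (pclass p) = pclass (\<theta> p)"
proof -
  have "G_cartan_inv (pclass p) = (\<Union>q\<in>pclass p. pclass (\<theta> q))"
    by (simp add: G_cartan_inv_def \<theta>_def[abs_def])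
  also have "\<dots> = (\<Union>q\<in>pclass p. pclass (\<theta> p))"
    by (intro SUP_cong refl pclass_eq[symmetric] homotopic_\<theta>) (simp add: mem_pclass)
  finally show ?thesis using pclass_self[OF assms] by auto
qed

lemma K_group_pclass:
  assumes "p \<in> Sp_paths"
  shows "pclass p \<in> K_group \<longleftrightarrow> homotopic_paths Sp_group (\<theta> p) p"
proof -
  have "pclass p \<in> G_group" using assms by (simp add: G_group_def)
  moreover have "homotopic_paths Sp_group (\<theta> p) p" if "pclass (\<theta> p) = pclass p"
    using pclass_self[OF assms] that by (metis mem_pclass)
  ultimately show ?thesis unfolding K_group_def mem_Collect_eq G_cartan_inv_pclass[OF assms] using pclass_eq by blast
qed

lemma compact_path_in_K:
  assumes p: "p \<in> Sp_paths" and c: "\<And>t. t \<in> {0..1} \<Longrightarrow> tr (of_mat (p t)) * of_mat (p t) = 1"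
  shows "pclass p \<in> K_group"
proof -
  have pS: "p t \<in> Sp_group" if "t \<in> {0..1}" for t using p that by (auto simp: Sp_paths_def path_image_def)
  have e: "\<theta> p t = p t" if t: "t \<in> {0..1}" for t
  proof -
    let ?g = "of_mat (p t)"
    have g: "symp_star ?g * ?g = 1" "?g * symp_star ?g = 1" using pS[OF t] by (auto simp: Sp_group_iff sp.\<Gamma>_def)
    have "symp_star ?g = tr ?g * (?g * symp_star ?g)" using c[OF t] by (simp add: mult.assoc[symmetric])
    then have "tr (symp_star ?g) = ?g" by (simp add: g)
    then have "of_mat (\<theta> p t) = of_mat (p t)" using of_mat_\<theta>[of p t, OF pS[OF t]] by simp
    then show ?thesis by (metis to_mat_of_mat)
  qed
  have "homotopic_paths Sp_group p (\<theta> p)"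
    by (rule homotopic_paths_eq) (use p e in \<open>auto simp: Sp_paths_def\<close>)
  then show ?thesis using K_group_pclass[OF p] homotopic_paths_sym by blast
qed

lemma of_mat_exp: "of_mat (mat_exp X) = exp (of_mat X)"
proof -
  have p: "of_mat (((**) X ^^ k) (mat 1)) = of_mat X ^ k" for k
    by (induction k) (simp_all add: of_mat_one of_mat_mult)
  have q: "to_mat ((of_mat X) ^ k /\<^sub>R fact k) = (1 / fact k) *\<^sub>R (((**) X ^^ k) (mat 1))" for k
    by (metis divide_inverse linear_scale[OF linear_to_mat] mult_1 p to_mat_of_mat)
  have "to_mat (exp (of_mat X)) = (\<Sum>k. to_mat ((of_mat X) ^ k /\<^sub>R fact k))"
    unfolding exp_def by (rule bounded_linear.suminf[OF bounded_linear_to_mat summable_exp_generic])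
  then show ?thesis unfolding q mat_exp_def[symmetric] by (metis of_mat_to_mat)
qed

lemma exp_path:
  assumes "X \<in> sp_alg" shows "(\<lambda>t. mat_exp (t *\<^sub>R X)) \<in> Sp_paths"
proof -
  have "of_mat \<circ> (\<lambda>t. mat_exp (t *\<^sub>R X)) = (\<lambda>t. exp (t *\<^sub>R of_mat X))"
    by (auto simp: of_mat_exp linear_scale[OF linear_of_mat])
  then show ?thesis unfolding Sp_paths_iff
    using assms by (auto simp: path_def path_image_def pathstart_def sp_alg_iff sp.star_scaleR intro!: continuous_intros sp.exp_in_\<Gamma>)
qed

lemma sp_compact_iff: "X \<in> sp_compact \<longleftrightarrow> X \<in> sp_alg \<and> tr (of_mat X) = - of_mat X" for X :: "(real, 'n::finite) mat2"
proof -
  have "- transpose X = X \<longleftrightarrow> of_mat (- transpose X) = of_mat X" by (metis to_mat_of_mat)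
  also have "\<dots> \<longleftrightarrow> tr (of_mat X) = - of_mat X"
    by (auto simp: tr_def linear_neg[OF linear_of_mat]) (metis minus_minus)
  finally show ?thesis by (simp add: sp_compact_def)
qed

lemma G_exp_in_K: "X \<in> sp_compact \<Longrightarrow> G_exp X \<in> K_group" unfolding G_exp_def
proof (rule compact_path_in_K[OF exp_path])
  assume X: "X \<in> sp_compact"
  then show "X \<in> sp_alg" by (simp add: sp_compact_iff)
  show "tr (of_mat (mat_exp (t *\<^sub>R X))) * of_mat (mat_exp (t *\<^sub>R X)) = 1" for t
    using X exp_minus_inverse[of "- (t *\<^sub>R of_mat X)"]
    by (simp add: of_mat_exp sp_compact_iff tr.star_exp linear_scale[OF linear_of_mat] tr.star_scaleR)
qed

lemma K_mult_in_K:
  assumes "a \<in> K_group" "b \<in> K_group" shows "G_mult a b \<in> K_group"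
proof -
  obtain p q where p: "p \<in> Sp_paths" "a = pclass p" and q: "q \<in> Sp_paths" "b = pclass q"
    using assms by (auto simp: K_group_def G_group_def)
  have h: "homotopic_paths Sp_group (\<theta> p) p" "homotopic_paths Sp_group (\<theta> q) q"
    using assms p q K_group_pclass by blast+
  let ?r = "\<lambda>t. p t ** q t"
  have r: "?r \<in> Sp_paths" by (rule Sp_paths_mult[OF p(1) q(1)])
  have "homotopic_paths Sp_group (\<lambda>t. \<theta> p t ** \<theta> q t) ?r"
    using sp.homotopic_paths_mult[of "of_mat \<circ> \<theta> p" "of_mat \<circ> p" "of_mat \<circ> \<theta> q" "of_mat \<circ> q"] h
    unfolding homotopic_of_mat o_def of_mat_mult by blast
  moreover have "homotopic_paths Sp_group (\<lambda>t. \<theta> p t ** \<theta> q t) (\<theta> ?r)"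
  proof (rule homotopic_paths_eq)
    show "path (\<lambda>t. \<theta> p t ** \<theta> q t)" "path_image (\<lambda>t. \<theta> p t ** \<theta> q t) \<subseteq> Sp_group"
      using homotopic_paths_imp_path[OF calculation] homotopic_paths_imp_subset[OF calculation] by auto
    fix t :: real assume t: "t \<in> {0..1}"
    have S: "p t \<in> Sp_group" "q t \<in> Sp_group" "?r t \<in> Sp_group"
      using p(1) q(1) r t by (auto simp: Sp_paths_def path_image_def)
    have "of_mat (\<theta> p t ** \<theta> q t) = of_mat (\<theta> ?r t)"
      using S by (simp add: of_mat_\<theta> of_mat_mult sp.star_mult tr.star_mult)
    then show "\<theta> p t ** \<theta> q t = \<theta> ?r t" by (metis to_mat_of_mat)
  qed
  ultimately have "homotopic_paths Sp_group (\<theta> ?r) ?r" using homotopic_paths_sym homotopic_paths_trans by blast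
  then show ?thesis using K_group_pclass[OF r] G_mult_pclass[OF p(1) q(1)] p q by simp
qed

text \<open>\<open>K\<close> is generated by one-parameter subgroups because \<open>Sp_group\<close> retracts onto its maximal compact subgroup.\<close>

lemma K_group_induct:
  fixes a :: "'n::finite Gelem"
  assumes a: "a \<in> K_group" and base: "P (G_exp 0)"
    and step: "\<And>b (X :: (real, 'n) mat2). b \<in> K_group \<Longrightarrow> P b \<Longrightarrow> X \<in> sp_compact \<Longrightarrow> P (G_mult b (G_exp X))"
  shows "P a"
proof -
  obtain p where p: "p \<in> Sp_paths" "a = pclass p" using a by (auto simp: K_group_def G_group_def)
  define p' where "p' = of_mat \<circ> p"
  have p': "path p'" "path_image p' \<subseteq> sp.\<Gamma>" "pathstart p' = 1" using p(1) by (auto simp: Sp_paths_iff p'_def)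
  \<comment> \<open>A homotopy of paths fixes end points, so membership in K makes p 1 orthogonal.
    This is the end condition of the polar deformation.\<close>
  have "homotopic_paths Sp_group (\<theta> p) p" using a p K_group_pclass by blast
  then have "\<theta> p 1 = p 1" by (metis homotopic_paths_imp_pathfinish pathfinish_def)
  moreover have "p 1 \<in> Sp_group" using p(1) by (auto simp: Sp_paths_def path_image_def)
  ultimately have "tr (symp_star (p' 1)) = p' 1" using of_mat_\<theta>[of p 1] by (simp add: p'_def)
  then have "tr (p' 1) = symp_star (p' 1)" by (metis tr.star_star)
  moreover have "p' 1 \<in> sp.\<Gamma>" using p'(2) by (auto simp: path_image_def)
  ultimately have "tr (p' 1) * p' 1 = 1" by (simp add: sp.\<Gamma>_def)
  then obtain k where k: "homotopic_paths sp.\<Gamma> p' k" "\<And>t. t \<in> {0..1} \<Longrightarrow> tr (k t) * k t = 1"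
    using deform_to_compact[OF p'] by blast
  have kp: "path k" "path_image k \<subseteq> sp.\<Gamma>" "pathstart k = 1"
    using homotopic_paths_imp_path[OF k(1)] homotopic_paths_imp_subset[OF k(1)] homotopic_paths_imp_pathstart[OF k(1)] p'(3) by auto
  \<comment> \<open>The property is transported to paths in the Banach algebra, where the induction
    takes place. Membership in K is carried along because \<open>step\<close> asks for it.\<close>
  define Q where "Q r \<longleftrightarrow> (\<exists>q. q \<in> Sp_paths \<and> of_mat \<circ> q = r \<and> pclass q \<in> K_group \<and> P (pclass q))" for r
  have "Q k"
  proof (rule compact_path_induct[OF kp k(2)])
    have e: "G_exp 0 = pclass (\<lambda>_. mat 1)" unfolding G_exp_def by (rule arg_cong[where f=pclass])
        (auto simp: fun_eq_iff, metis exp_zero linear_0[OF linear_of_mat] of_mat_exp of_mat_one to_mat_of_mat)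
    have z: "(0 :: (real, 'n) mat2) \<in> sp_compact"
      by (simp add: sp_compact_iff sp_alg_iff linear_0[OF linear_of_mat] linear_0[OF bounded_linear.linear[OF tr.bl_star]] linear_0[OF bounded_linear.linear[OF sp.bl_star]])
    have "(\<lambda>_. mat 1) \<in> Sp_paths" by (auto simp: Sp_paths_iff path_def path_image_def pathstart_def of_mat_one sp.\<Gamma>_def)
    then show "Q (\<lambda>_. 1)" unfolding Q_def
      using base G_exp_in_K[OF z] by (intro exI[of _ "\<lambda>_. mat 1"]) (auto simp: e of_mat_one)
  next
    fix r and Z :: "('n + 'n) sqmat" assume r: "path r" "path_image r \<subseteq> sp.\<Gamma>" "pathstart r = 1" "Q r" and Z: "symp_star Z = - Z" "tr Z = - Z"
    from r(4) obtain q where q: "q \<in> Sp_paths" "of_mat \<circ> q = r" "pclass q \<in> K_group" "P (pclass q)" by (auto simp: Q_def)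
    have X: "to_mat Z \<in> sp_compact" using Z by (simp add: sp_compact_iff sp_alg_iff)
    then have X': "to_mat Z \<in> sp_alg" by (simp add: sp_compact_iff)
    let ?q = "\<lambda>t. q t ** mat_exp (t *\<^sub>R to_mat Z)"
    have e: "G_mult (pclass q) (G_exp (to_mat Z)) = pclass ?q"
      unfolding G_exp_def by (rule G_mult_pclass[OF q(1) exp_path[OF X']])
    show "Q (\<lambda>t. r t * exp (t *\<^sub>R Z))" unfolding Q_def
    proof (intro exI[of _ ?q] conjI)
      show "?q \<in> Sp_paths" by (rule Sp_paths_mult[OF q(1) exp_path[OF X']])
      show "of_mat \<circ> ?q = (\<lambda>t. r t * exp (t *\<^sub>R Z))"
        using q(2) by (auto simp: of_mat_mult of_mat_exp linear_scale[OF linear_of_mat])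
    qed (use step[OF q(3,4) X] K_mult_in_K[OF q(3) G_exp_in_K[OF X]] e in auto)
  next
    fix r s assume r: "Q r" "homotopic_paths sp.\<Gamma> r s" "pathstart r = 1"
    then obtain q where q: "q \<in> Sp_paths" "of_mat \<circ> q = r" "pclass q \<in> K_group" "P (pclass q)" by (auto simp: Q_def)
    have s: "of_mat \<circ> (to_mat \<circ> s) = s" by (auto simp: o_def)
    have h: "homotopic_paths Sp_group q (to_mat \<circ> s)" unfolding homotopic_of_mat q(2) s by (rule r(2))
    show "Q s" unfolding Q_def
      by (rule exI[of _ "to_mat \<circ> s"]) (use s q pclass_eq[OF h] Sp_paths_homotopic[OF q(1) h] in auto)
  qed
  then obtain q where q: "q \<in> Sp_paths" "of_mat \<circ> q = k" "P (pclass q)" by (auto simp: Q_def)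
  have "homotopic_paths Sp_group p q" unfolding homotopic_of_mat q(2) using k(1) by (simp add: p'_def)
  then show ?thesis using q(3) p(2) pclass_eq by metis
qed

section \<open>From the Banach algebra to the universal cover\<close>

lemma sqmat_coordinates:
  "finite (of_mat ` (Basis :: (real ^ 'm ^ 'm) set))"
  "bounded_linear (\<lambda>x. inner (to_mat x) (to_mat b))"
  "(\<Sum>b\<in>of_mat ` (Basis :: (real ^ 'm ^ 'm) set). inner (to_mat x) (to_mat b) *\<^sub>R b) = (x :: 'm::finite sqmat)"
proof -
  show "finite (of_mat ` (Basis :: (real ^ 'm ^ 'm) set))" by simp
  show "bounded_linear (\<lambda>x. inner (to_mat x) (to_mat b))"
    by (rule bounded_linear_compose[OF bounded_linear_inner_left bounded_linear_to_mat])
  have "inj_on of_mat (Basis :: (real ^ 'm ^ 'm) set)" by (rule inj_on_inverseI[of _ to_mat]) simp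
  then have "(\<Sum>b\<in>of_mat ` (Basis :: (real ^ 'm ^ 'm) set). inner (to_mat x) (to_mat b) *\<^sub>R b)
     = of_mat (\<Sum>b\<in>Basis. inner (to_mat x) b *\<^sub>R b)"
    by (simp add: sum.reindex linear_sum[OF linear_of_mat] linear_scale[OF linear_of_mat])
  then show "(\<Sum>b\<in>of_mat ` (Basis :: (real ^ 'm ^ 'm) set). inner (to_mat x) (to_mat b) *\<^sub>R b) = x"
    by (simp add: euclidean_representation)
qed

locale Sp_rep = unitary_analytic_rep "of_mat ` (Basis :: (real ^ ('n + 'n) ^ ('n + 'n)) set)" "\<lambda>b x. inner (to_mat x) (to_mat b)" \<iota> \<rho> R symp_star
  for \<iota> :: "'f::real_vector \<Rightarrow> 'h::{real_inner,banach}" and \<rho> :: "('n::finite + 'n) sqmat \<Rightarrow> 'f \<Rightarrow> 'f" and R :: real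
begin

definition \<pi> :: "'n Gelem \<Rightarrow> 'h \<Rightarrow> 'h" where "\<pi> a = Hol (of_mat \<circ> (SOME p. p \<in> a))"

lemma \<pi>_pclass: assumes "p \<in> Sp_paths" shows "\<pi> (pclass p) = Hol (of_mat \<circ> p)"
proof -
  have "(SOME q. q \<in> pclass p) \<in> pclass p" by (rule someI[of "\<lambda>q. q \<in> pclass p", OF pclass_self[OF assms]])
  then have "homotopic_paths \<Gamma> (of_mat \<circ> p) (of_mat \<circ> (SOME q. q \<in> pclass p))"
    by (simp add: mem_pclass homotopic_of_mat)
  then show ?thesis unfolding \<pi>_def by (rule Hol_homotopic[symmetric])
qed

lemma \<pi>_mult:
  assumes "a \<in> G_group" "b \<in> G_group" shows "\<pi> (G_mult a b) = \<pi> a \<circ> \<pi> b"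
proof -
  obtain p q where p: "p \<in> Sp_paths" "a = pclass p" and q: "q \<in> Sp_paths" "b = pclass q"
    using assms by (auto simp: G_group_def)
  have "Hol (\<lambda>t. (of_mat \<circ> p) t * (of_mat \<circ> q) t) = Hol (of_mat \<circ> p) \<circ> Hol (of_mat \<circ> q)"
    using p(1) q(1) unfolding Sp_paths_iff by (intro Hol_mult[of "of_mat \<circ> p" "of_mat \<circ> q"]) blast+
  then show ?thesis
    unfolding p(2) q(2) G_mult_pclass[OF p(1) q(1)] \<pi>_pclass[OF p(1)] \<pi>_pclass[OF q(1)] \<pi>_pclass[OF Sp_paths_mult[OF p(1) q(1)]]
    by (simp add: o_def of_mat_mult)
qed

text \<open>Subdividing a path writes its holonomy as a product of operators U X, so a property
  closed under composition need only be checked on these.\<close>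

lemma \<pi>_induct:
  assumes a: "a \<in> G_group" and id: "P id" and comp: "\<And>f g. P f \<Longrightarrow> P g \<Longrightarrow> P (f \<circ> g)"
    and L: "\<And>X. symp_star X = - X \<Longrightarrow> R * norm X < 1 \<Longrightarrow> P (U X)"
  shows "P (\<pi> a)"
proof -
  obtain p where p: "p \<in> Sp_paths" "a = pclass p" using a by (auto simp: G_group_def)
  show ?thesis unfolding p(2) \<pi>_pclass[OF p(1)]
  proof (rule Hol_induct[OF _ _ id comp])
    fix g assume g: "g \<in> \<Gamma>" "norm (g - 1) \<le> \<epsilon>"
    have "norm (g - 1) \<le> 4 * \<epsilon>" using g eps by simp
    note f = lnp_facts[OF g(1) this]
    show "P (L g)" unfolding L_def by (rule L[OF f(1)]) (use f(2) in simp)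
  qed (use p in \<open>auto simp: Sp_paths_iff\<close>)
qed

lemma \<pi>_props:
  assumes "a \<in> G_group"
  shows "bounded_linear (\<pi> a)" "norm (\<pi> a x) = norm x" "inner (\<pi> a x) (\<pi> a y) = inner x y" "surj (\<pi> a)"
proof -
  have "bounded_linear (\<pi> a) \<and> (\<forall>x. norm (\<pi> a x) = norm x) \<and> (\<forall>x y. inner (\<pi> a x) (\<pi> a y) = inner x y) \<and> surj (\<pi> a)"
  proof (rule \<pi>_induct[OF assms, where P="\<lambda>f. bounded_linear f \<and> (\<forall>x. norm (f x) = norm x) \<and> (\<forall>x y. inner (f x) (f y) = inner x y) \<and> surj f"])
    fix X :: "('n + 'n) sqmat" assume X: "symp_star X = - X" "R * norm X < 1"
    have X': "symp_star (- X) = - (- X)" "R * norm (- X) < 1" using X by (simp_all only: sp.star_minus norm_minus_cancel)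
    have "surj (U X)" unfolding surj_def using U_inverse[OF X'] by (metis minus_minus)
    then show "bounded_linear (U X) \<and> (\<forall>x. norm (U X x) = norm x) \<and> (\<forall>x y. inner (U X x) (U X y) = inner x y) \<and> surj (U X)"
      using U[OF X] inner_U[OF X] by auto
  next
    fix f g :: "'h \<Rightarrow> 'h"
    assume f: "bounded_linear f \<and> (\<forall>x. norm (f x) = norm x) \<and> (\<forall>x y. inner (f x) (f y) = inner x y) \<and> surj f"
      and g: "bounded_linear g \<and> (\<forall>x. norm (g x) = norm x) \<and> (\<forall>x y. inner (g x) (g y) = inner x y) \<and> surj g"
    have "surj (f \<circ> g)" using f g comp_surj by blast
    moreover have "bounded_linear (f \<circ> g)" using f g bounded_linear_compose[of f g] by (simp add: o_def)
    ultimately show "bounded_linear (f \<circ> g) \<and> (\<forall>x. norm ((f \<circ> g) x) = norm x) \<and> (\<forall>x y. inner ((f \<circ> g) x) ((f \<circ> g) y) = inner x y) \<and> surj (f \<circ> g)"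
      using f g by simp
  qed (auto simp: id_def bounded_linear_ident)
  then show "bounded_linear (\<pi> a)" "norm (\<pi> a x) = norm x" "inner (\<pi> a x) (\<pi> a y) = inner x y" "surj (\<pi> a)" by auto
qed

lemma \<pi>_commute:
  assumes a: "a \<in> G_group" and T: "bounded_linear T" and T': "\<And>w. T (\<iota> w) = \<iota> (T' w)" and com: "\<And>X w. T' (\<rho> X w) = \<rho> X (T' w)"
  shows "T (\<pi> a x) = \<pi> a (T x)"
proof -
  have "\<forall>x. T (\<pi> a x) = \<pi> a (T x)" by (rule \<pi>_induct[OF a]) (use U_commute[OF T T' com] in auto)
  then show ?thesis by blast
qed

lemma \<pi>_exp_small:
  assumes X: "X \<in> sp_alg" and n: "norm (of_mat X) \<le> \<epsilon> / 2"
  shows "\<pi> (G_exp X) = U (of_mat X)"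
proof -
  have sX: "symp_star (of_mat X) = - of_mat X" using X by (simp add: sp_alg_iff)
  have n8: "norm (of_mat X) \<le> 1/8" using n eps by simp
  have e: "of_mat \<circ> (\<lambda>t. mat_exp (t *\<^sub>R X)) = (\<lambda>t. exp (t *\<^sub>R of_mat X))"
    by (auto simp: of_mat_exp linear_scale[OF linear_of_mat])
  have "Hol (\<lambda>t. exp (t *\<^sub>R of_mat X)) = L (symp_star (exp (0 *\<^sub>R of_mat X)) * exp (1 *\<^sub>R of_mat X))"
  proof (rule Hol_short)
    show "path (\<lambda>t. exp (t *\<^sub>R of_mat X))" "path_image (\<lambda>t. exp (t *\<^sub>R of_mat X)) \<subseteq> \<Gamma>"
      using exp_path[OF X] unfolding Sp_paths_iff e by auto
    fix t :: real assume "t \<in> {0..1}"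
    then have t: "norm (t *\<^sub>R of_mat X) \<le> \<epsilon> / 2" using n mult_left_le_one_le[of "norm (of_mat X)" t] by simp
    then have "norm (exp (t *\<^sub>R of_mat X) - 1) \<le> \<epsilon>" using norm_exp_minus_1_le'[of "t *\<^sub>R of_mat X"] eps by simp
    then show "near (exp (0 *\<^sub>R of_mat X)) (exp (t *\<^sub>R of_mat X))" by (simp add: near_def)
  qed
  also have "\<dots> = U (of_mat X)" using L_exp[OF sX n8] by simp
  finally show ?thesis unfolding G_exp_def \<pi>_pclass[OF exp_path[OF X]] e .
qed

lemma \<pi>_exp_deriv:
  assumes X: "X \<in> sp_alg"
  shows "((\<lambda>t. \<pi> (G_exp (t *\<^sub>R X)) (\<iota> w)) has_vector_derivative \<iota> (\<rho> (of_mat X) w)) (at 0)"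
proof -
  have sX: "symp_star (of_mat X) = - of_mat X" using X by (simp add: sp_alg_iff)
  \<comment> \<open>For |t| < d one has norm (t X) \<le> \<epsilon> / 2. The whole path exp (s t X)
    is then short, and its holonomy is the exponential series itself.\<close>
  define d where "d = \<epsilon> / (2 * (norm (of_mat X) + 1))"
  have d: "d > 0" using eps by (auto simp: d_def intro!: divide_pos_pos mult_pos_pos add_nonneg_pos)
  have e: "u (t *\<^sub>R of_mat X) w = \<pi> (G_exp (t *\<^sub>R X)) (\<iota> w)" if t: "t \<in> {-d<..<d}" for t
  proof -
    have "norm (of_mat (t *\<^sub>R X)) \<le> d * norm (of_mat X)"
      using t by (auto simp: linear_scale[OF linear_of_mat] intro!: mult_right_mono)
    also have "\<dots> \<le> d * (norm (of_mat X) + 1)" using d by (intro mult_left_mono) auto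
    also have "\<dots> = \<epsilon> / 2"
    proof -
      have "norm (of_mat X) + 1 \<noteq> 0" by (smt (verit) norm_ge_zero)
      then show ?thesis unfolding d_def by (simp add: field_simps)
    qed
    finally have n: "norm (of_mat (t *\<^sub>R X)) \<le> \<epsilon> / 2" .
    have tX: "t *\<^sub>R X \<in> sp_alg" using sX by (simp add: sp_alg_iff linear_scale[OF linear_of_mat] star_scaleR)
    have "R * norm (of_mat (t *\<^sub>R X)) \<le> R * (\<epsilon> / 2)" using n R1 by (intro mult_left_mono) auto
    then have "R * norm (of_mat (t *\<^sub>R X)) < 1" using eps(3) by simp
    then show ?thesis
      using \<pi>_exp_small[OF tX n] U(2)[of "of_mat (t *\<^sub>R X)" w] tX by (simp add: sp_alg_iff linear_scale[OF linear_of_mat])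
  qed
  show ?thesis
    by (rule has_vector_derivative_transform_within_open[where S="{-d<..<d}", OF u_deriv_0[OF sX] _ _ e]) (use d in auto)
qed

text \<open>A basic neighbourhood of a consists of classes p followed by a short q. Holonomy splits
  off the isometry \<pi> a and leaves L of an element close to 1.\<close>

lemma \<pi>_continuous:
  assumes a: "a \<in> G_group" and e: "e > 0"
  shows "\<exists>N. openin G_topology N \<and> a \<in> N \<and> (\<forall>b\<in>N. norm (\<pi> b x - \<pi> a x) < e)"
proof -
  obtain p where p: "p \<in> Sp_paths" "a = pclass p" using a by (auto simp: G_group_def)
  note p' = p(1)[unfolded Sp_paths_iff]
  obtain d where d: "d > 0" "\<And>g. g \<in> \<Gamma> \<Longrightarrow> norm (g - 1) < d \<Longrightarrow> norm (L g x - x) < e"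
    using L_continuous[OF e, of x] by blast
  define g where "g = of_mat (pathfinish p)"
  have pf: "pathfinish p \<in> Sp_group" using p(1) by (auto simp: Sp_paths_def path_image_def pathfinish_def)
  have g: "g \<in> \<Gamma>" using pf by (simp add: g_def Sp_group_iff)
  define V where "V = {h. norm (symp_star g * of_mat h - 1) < min d \<epsilon>}"
  have oV: "open V" unfolding V_def
    by (intro open_Collect_less continuous_intros linear_continuous_on bounded_linear_of_mat)
  have pV: "pathfinish p \<in> V" using g d eps by (simp add: V_def g_def[symmetric] \<Gamma>_def)
  define N where "N = {pclass (p +++ q) | q. path q \<and> path_image q \<subseteq> Sp_group \<inter> V \<and> pathstart q = pathfinish p}"
  have "openin G_topology N"
    unfolding G_topology_def by (rule topology_generated_by_Basis) (use p(1) oV pV in \<open>auto simp: N_def\<close>)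
  moreover have "a \<in> N"
  proof -
    have "homotopic_paths Sp_group (p +++ linepath (pathfinish p) (pathfinish p)) p"
      by (rule homotopic_paths_rid) (use p(1) in \<open>auto simp: Sp_paths_def\<close>)
    then have "pclass (p +++ linepath (pathfinish p) (pathfinish p)) = a" unfolding p(2) by (rule pclass_eq)
    then show ?thesis unfolding N_def using pf pV by (force intro!: exI[of _ "linepath (pathfinish p) (pathfinish p)"])
  qed
  moreover have "norm (\<pi> b x - \<pi> a x) < e" if "b \<in> N" for b
  proof -
    obtain q where q: "path q" "path_image q \<subseteq> Sp_group \<inter> V" "pathstart q = pathfinish p" "b = pclass (p +++ q)"
      using \<open>b \<in> N\<close> by (auto simp: N_def)
    define q' where "q' = of_mat \<circ> q"
    have q': "path q'" "path_image q' \<subseteq> \<Gamma>" "q' 0 = g" using q unfolding q'_def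
      by (auto simp: path_image_def image_subset_iff Sp_group_iff pathstart_def g_def
        intro!: path_continuous_image linear_continuous_on bounded_linear_of_mat)
    have j: "of_mat \<circ> (p +++ q) = (of_mat \<circ> p) +++ q'" by (auto simp: joinpaths_def q'_def)
    have jS: "p +++ q \<in> Sp_paths" using p(1) q by (auto simp: Sp_paths_def path_image_join)
    have nV: "norm (symp_star (q' 0) * q' t - 1) < min d \<epsilon>" if "t \<in> {0..1}" for t
    proof -
      have "q t \<in> V" using q(2) that by (auto simp: path_image_def)
      then show ?thesis unfolding V_def mem_Collect_eq q'(3) by (simp add: q'_def)
    qed
    have "Hol ((of_mat \<circ> p) +++ q') = Hol (of_mat \<circ> p) \<circ> Hol q'"
      by (rule Hol_join) (use p' q' in \<open>auto simp: pathfinish_def pathstart_def g_def\<close>)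
    also have "Hol q' = L (symp_star (q' 0) * q' 1)"
      by (rule Hol_short[OF q'(1,2)]) (use nV in \<open>auto simp: near_def intro: less_imp_le\<close>)
    finally have b: "\<pi> b = \<pi> a \<circ> L (symp_star (q' 0) * q' 1)"
      unfolding q(4) p(2) \<pi>_pclass[OF jS] \<pi>_pclass[OF p(1)] j .
    interpret bounded_linear "\<pi> a" by (rule \<pi>_props[OF a])
    have "q' 0 \<in> \<Gamma>" "q' 1 \<in> \<Gamma>" using q'(2) by (auto simp: path_image_def)
    then have "norm (L (symp_star (q' 0) * q' 1) x - x) < e"
      using nV[of 1] by (intro d(2) star_times_in_\<Gamma>) auto
    then show ?thesis by (simp add: b diff[symmetric] \<pi>_props(2)[OF a])
  qed
  ultimately show ?thesis by blast
qed

end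

section \<open>The Fock space\<close>

text \<open>Square summable sequences indexed by naturals, so that representatives already live in
  the type over which \<open>unitary_gK_module\<close> quantifies. As a type it is a real inner
  product space, matching the locales above; the complex structure is the separate operation
  \<open>cscale\<close>.\<close>

typedef ell2 = "{x :: nat \<Rightarrow> complex. summable (\<lambda>n. (cmod (x n))\<^sup>2)}"
  by (rule exI[of _ "\<lambda>_. 0"]) simp

lemma summable_Rep_ell2: "summable (\<lambda>n. (cmod (Rep_ell2 x n))\<^sup>2)" using Rep_ell2[of x] by simp

lemma summable_square_add:
  fixes x y :: "nat \<Rightarrow> complex"
  assumes "summable (\<lambda>n. (cmod (x n))\<^sup>2)" "summable (\<lambda>n. (cmod (y n))\<^sup>2)"
  shows "summable (\<lambda>n. (cmod (x n + y n))\<^sup>2)"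
proof (rule summable_comparison_test'[where N=0])
  show "summable (\<lambda>n. 2 * (cmod (x n))\<^sup>2 + 2 * (cmod (y n))\<^sup>2)"
    using assms by (intro summable_add summable_mult)
  fix n
  have "(cmod (x n + y n))\<^sup>2 \<le> (cmod (x n) + cmod (y n))\<^sup>2"
    by (intro power_mono norm_triangle_ineq) auto
  also have "\<dots> \<le> 2 * (cmod (x n))\<^sup>2 + 2 * (cmod (y n))\<^sup>2"
    using zero_le_power2[of "cmod (x n) - cmod (y n)"] by (simp add: power2_eq_square algebra_simps)
  finally show "norm ((cmod (x n + y n))\<^sup>2) \<le> 2 * (cmod (x n))\<^sup>2 + 2 * (cmod (y n))\<^sup>2" by simp
qed

lemma summable_square_scale:
  fixes x :: "nat \<Rightarrow> complex"
  assumes "summable (\<lambda>n. (cmod (x n))\<^sup>2)"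
  shows "summable (\<lambda>n. (cmod (c * x n))\<^sup>2)"
  using summable_mult[OF assms, of "(cmod c)\<^sup>2"] by (simp add: norm_mult power_mult_distrib)

lemma summable_square_mult:
  fixes x y :: "nat \<Rightarrow> complex"
  assumes "summable (\<lambda>n. (cmod (x n))\<^sup>2)" "summable (\<lambda>n. (cmod (y n))\<^sup>2)"
  shows "summable (\<lambda>n. x n * cnj (y n))"
proof (rule summable_comparison_test'[where N=0])
  show "summable (\<lambda>n. (cmod (x n))\<^sup>2 + (cmod (y n))\<^sup>2)" using assms by (rule summable_add)
  fix n
  have "2 * (cmod (x n) * cmod (y n)) \<le> (cmod (x n))\<^sup>2 + (cmod (y n))\<^sup>2"
    using zero_le_power2[of "cmod (x n) - cmod (y n)"] by (simp add: power2_eq_square algebra_simps)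
  then show "norm (x n * cnj (y n)) \<le> (cmod (x n))\<^sup>2 + (cmod (y n))\<^sup>2"
    using mult_nonneg_nonneg[OF norm_ge_zero norm_ge_zero, of "x n" "y n"] unfolding norm_mult complex_mod_cnj by linarith
qed

instantiation ell2 :: real_vector
begin
definition "0 = Abs_ell2 (\<lambda>_. 0)"
definition "x + y = Abs_ell2 (\<lambda>n. Rep_ell2 x n + Rep_ell2 y n)"
definition "- x = Abs_ell2 (\<lambda>n. - Rep_ell2 x n)"
definition "x - y = Abs_ell2 (\<lambda>n. Rep_ell2 x n - Rep_ell2 y n)"
definition "c *\<^sub>R x = Abs_ell2 (\<lambda>n. of_real c * Rep_ell2 x n)"

lemma Rep_ell2_simps [simp]:
  "Rep_ell2 0 n = 0" "Rep_ell2 (x + y) n = Rep_ell2 x n + Rep_ell2 y n"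
  "Rep_ell2 (- x) n = - Rep_ell2 x n" "Rep_ell2 (x - y) n = Rep_ell2 x n - Rep_ell2 y n"
  "Rep_ell2 (c *\<^sub>R x) n = of_real c * Rep_ell2 x n"
proof -
  have m: "summable (\<lambda>n. (cmod (- Rep_ell2 x n))\<^sup>2)" for x using summable_Rep_ell2[of x] by simp
  show "Rep_ell2 0 n = 0" by (simp add: zero_ell2_def Abs_ell2_inverse)
  show "Rep_ell2 (x + y) n = Rep_ell2 x n + Rep_ell2 y n"
    unfolding plus_ell2_def by (subst Abs_ell2_inverse) (auto intro: summable_square_add summable_Rep_ell2)
  show "Rep_ell2 (- x) n = - Rep_ell2 x n" unfolding uminus_ell2_def by (subst Abs_ell2_inverse) (use m in auto)
  show "Rep_ell2 (x - y) n = Rep_ell2 x n - Rep_ell2 y n" unfolding minus_ell2_def by (subst Abs_ell2_inverse)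
      (use summable_square_add[OF summable_Rep_ell2[of x] m[of y]] in auto)
  show "Rep_ell2 (c *\<^sub>R x) n = of_real c * Rep_ell2 x n"
    unfolding scaleR_ell2_def by (subst Abs_ell2_inverse) (auto intro: summable_square_scale summable_Rep_ell2)
qed

lemma ell2_eqI: "(\<And>n. Rep_ell2 x n = Rep_ell2 y n) \<Longrightarrow> x = y" by (metis Rep_ell2_inject ext)

instance by standard (auto intro!: ell2_eqI simp: algebra_simps)
end

definition cip :: "(nat \<Rightarrow> complex) \<Rightarrow> (nat \<Rightarrow> complex) \<Rightarrow> complex" where
  "cip x y = (\<Sum>n. x n * cnj (y n))"

lemma summable_cip: "summable (\<lambda>n. Rep_ell2 x n * cnj (Rep_ell2 y n))"
  by (rule summable_square_mult[OF summable_Rep_ell2 summable_Rep_ell2])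

instantiation ell2 :: real_inner
begin
definition "inner x y = Re (cip (Rep_ell2 x) (Rep_ell2 y))"
definition "norm (x::ell2) = sqrt (inner x x)"
definition "dist (x::ell2) y = norm (x - y)"
definition "sgn (x::ell2) = x /\<^sub>R norm x"
definition "uniformity = (INF e\<in>{0 <..}. principal {(x, y :: ell2). dist x y < e})"
definition "open U = (\<forall>x\<in>U. eventually (\<lambda>(x', y). x' = x \<longrightarrow> y \<in> U) (uniformity :: (ell2 \<times> ell2) filter))"

lemma inner_ell2_sum: "inner x y = (\<Sum>n. Re (Rep_ell2 x n * cnj (Rep_ell2 y n)))"
  unfolding inner_ell2_def cip_def by (rule bounded_linear.suminf[OF bounded_linear_Re summable_cip])

lemma summable_inner_ell2: "summable (\<lambda>n. Re (Rep_ell2 x n * cnj (Rep_ell2 y n)))"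
  by (rule bounded_linear.summable[OF bounded_linear_Re summable_cip])

lemma inner_ell2_self: "inner x x = (\<Sum>n. (cmod (Rep_ell2 x n))\<^sup>2)"
  unfolding inner_ell2_sum by (simp add: complex_mult_cnj cmod_power2)

instance
proof
  fix x y z :: ell2 and r :: real
  show "inner x y = inner y x" unfolding inner_ell2_sum by (simp add: mult.commute)
  show "inner (x + y) z = inner x z + inner y z" unfolding inner_ell2_sum
    by (subst suminf_add[OF summable_inner_ell2 summable_inner_ell2]) (simp add: algebra_simps)
  show "inner (r *\<^sub>R x) y = r * inner x y" unfolding inner_ell2_sum
    by (subst suminf_mult[OF summable_inner_ell2, symmetric]) (simp add: algebra_simps)
  show "0 \<le> inner x x" unfolding inner_ell2_self by (intro suminf_nonneg summable_Rep_ell2) auto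
  show "inner x x = 0 \<longleftrightarrow> x = 0"
  proof
    assume "inner x x = 0"
    then have "(cmod (Rep_ell2 x n))\<^sup>2 = 0" for n
      using suminf_eq_zero_iff[OF summable_Rep_ell2[of x]] by (simp add: inner_ell2_self)
    then show "x = 0" by (intro ell2_eqI) simp
  qed (simp add: inner_ell2_self)
qed (simp_all add: norm_ell2_def dist_ell2_def sgn_ell2_def uniformity_ell2_def open_ell2_def)
end

lemma norm_ell2_sq: "(norm x)\<^sup>2 = (\<Sum>n. (cmod (Rep_ell2 x n))\<^sup>2)"
  by (simp add: power2_norm_eq_inner inner_ell2_self)

lemma sum_le_norm_ell2: "(\<Sum>n<m. (cmod (Rep_ell2 x n))\<^sup>2) \<le> (norm x)\<^sup>2"
  unfolding norm_ell2_sq by (rule sum_le_suminf[OF summable_Rep_ell2]) auto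

lemma cmod_Rep_ell2_le: "cmod (Rep_ell2 x n) \<le> norm x"
proof -
  have "(cmod (Rep_ell2 x n))\<^sup>2 \<le> (\<Sum>k<Suc n. (cmod (Rep_ell2 x k))\<^sup>2)" by (simp add: sum_nonneg)
  also have "\<dots> \<le> (norm x)\<^sup>2" by (rule sum_le_norm_ell2)
  finally show ?thesis by (rule power2_le_imp_le) simp
qed

instance ell2 :: banach
proof
  fix X :: "nat \<Rightarrow> ell2" assume X: "Cauchy X"
  have "Cauchy (\<lambda>k. Rep_ell2 (X k) n)" for n
  proof (rule metric_CauchyI)
    fix e :: real assume "e > 0"
    then obtain M where M: "\<forall>k\<ge>M. \<forall>l\<ge>M. dist (X k) (X l) < e" using metric_CauchyD[OF X] by blast
    have "dist (Rep_ell2 (X k) n) (Rep_ell2 (X l) n) \<le> dist (X k) (X l)" for k l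
      using cmod_Rep_ell2_le[of "X k - X l" n] by (simp add: dist_norm)
    with M show "\<exists>M. \<forall>k\<ge>M. \<forall>l\<ge>M. dist (Rep_ell2 (X k) n) (Rep_ell2 (X l) n) < e"
      using order_le_less_trans by blast
  qed
  then have "\<exists>l. (\<lambda>k. Rep_ell2 (X k) n) \<longlonglongrightarrow> l" for n by (simp add: Cauchy_convergent_iff convergent_def)
  then obtain x where x: "\<And>n. (\<lambda>k. Rep_ell2 (X k) n) \<longlonglongrightarrow> x n"
    using choice[of "\<lambda>n l. (\<lambda>k. Rep_ell2 (X k) n) \<longlonglongrightarrow> l"] by blast
  have key: "\<exists>M. \<forall>k\<ge>M. \<forall>m. (\<Sum>n<m. (cmod (Rep_ell2 (X k) n - x n))\<^sup>2) \<le> e\<^sup>2" if "e > 0" for e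
  proof -
    obtain M where M: "\<And>k l. k \<ge> M \<Longrightarrow> l \<ge> M \<Longrightarrow> dist (X k) (X l) < e" using metric_CauchyD[OF X \<open>e > 0\<close>] by blast
    have "(\<Sum>n<m. (cmod (Rep_ell2 (X k) n - x n))\<^sup>2) \<le> e\<^sup>2" if k: "k \<ge> M" for k m
    proof (rule LIMSEQ_le_const2)
      show "(\<lambda>l. \<Sum>n<m. (cmod (Rep_ell2 (X k) n - Rep_ell2 (X l) n))\<^sup>2) \<longlonglongrightarrow> (\<Sum>n<m. (cmod (Rep_ell2 (X k) n - x n))\<^sup>2)"
        by (intro tendsto_intros x)
      show "\<exists>N. \<forall>l\<ge>N. (\<Sum>n<m. (cmod (Rep_ell2 (X k) n - Rep_ell2 (X l) n))\<^sup>2) \<le> e\<^sup>2"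
      proof (intro exI allI impI)
        fix l assume "M \<le> l"
        have "(\<Sum>n<m. (cmod (Rep_ell2 (X k) n - Rep_ell2 (X l) n))\<^sup>2) \<le> (norm (X k - X l))\<^sup>2"
          using sum_le_norm_ell2[of "X k - X l" m] by simp
        also have "\<dots> \<le> e\<^sup>2" using M[OF k \<open>M \<le> l\<close>] by (intro power_mono) (auto simp: dist_norm)
        finally show "(\<Sum>n<m. (cmod (Rep_ell2 (X k) n - Rep_ell2 (X l) n))\<^sup>2) \<le> e\<^sup>2" .
      qed
    qed
    then show ?thesis by blast
  qed
  have bs: "summable (\<lambda>n. (cmod (y n))\<^sup>2)" if "\<And>m. (\<Sum>n<m. (cmod (y n))\<^sup>2) \<le> c" for y :: "nat \<Rightarrow> complex" and c
    using that by (intro summableI_nonneg_bounded[where x=c]) auto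
  obtain M1 where "\<forall>m. (\<Sum>n<m. (cmod (Rep_ell2 (X M1) n - x n))\<^sup>2) \<le> 1\<^sup>2" using key[of 1] by auto
  then have "summable (\<lambda>n. (cmod (Rep_ell2 (X M1) n - x n))\<^sup>2)" by (intro bs) auto
  then have "summable (\<lambda>n. (cmod (- 1 * (Rep_ell2 (X M1) n - x n)))\<^sup>2)" by (rule summable_square_scale)
  from summable_square_add[OF this summable_Rep_ell2[of "X M1"]] have sx: "summable (\<lambda>n. (cmod (x n))\<^sup>2)" by simp
  define l where "l = Abs_ell2 x"
  have l: "Rep_ell2 l n = x n" for n unfolding l_def using sx by (subst Abs_ell2_inverse) auto
  have "X \<longlonglongrightarrow> l"
  proof (rule metric_LIMSEQ_I)
    fix e :: real assume e: "e > 0"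
    obtain M where M: "\<And>k m. k \<ge> M \<Longrightarrow> (\<Sum>n<m. (cmod (Rep_ell2 (X k) n - x n))\<^sup>2) \<le> (e/2)\<^sup>2"
      using key[of "e/2"] e by auto
    have "dist (X k) l < e" if "k \<ge> M" for k
    proof -
      have "(norm (X k - l))\<^sup>2 \<le> (e/2)\<^sup>2"
        unfolding norm_ell2_sq by (rule suminf_le_const[OF summable_Rep_ell2]) (use M[OF that] in \<open>simp add: l\<close>)
      then have "norm (X k - l) \<le> e/2" by (rule power2_le_imp_le) (use e in simp)
      then show ?thesis using e by (simp add: dist_norm)
    qed
    then show "\<exists>M. \<forall>k\<ge>M. dist (X k) l < e" by blast
  qed
  then show "convergent X" by (auto simp: convergent_def)
qed

definition cscale :: "complex \<Rightarrow> ell2 \<Rightarrow> ell2" where "cscale c x = Abs_ell2 (\<lambda>n. c * Rep_ell2 x n)"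

lemma Rep_cscale [simp]: "Rep_ell2 (cscale c x) n = c * Rep_ell2 x n"
  unfolding cscale_def by (subst Abs_ell2_inverse) (auto intro: summable_square_scale summable_Rep_ell2)

lemma norm_cscale: "norm (cscale c x) = cmod c * norm x"
proof -
  have "(norm (cscale c x))\<^sup>2 = (cmod c * norm x)\<^sup>2" unfolding power_mult_distrib norm_ell2_sq
    by (subst suminf_mult[OF summable_Rep_ell2, symmetric]) (simp add: norm_mult power_mult_distrib)
  then show ?thesis by (simp add: power2_eq_iff_nonneg)
qed

lemma bounded_linear_cscale: "bounded_linear (cscale c)" by (rule bounded_linear_intro[where K="cmod c"])
    (auto intro!: ell2_eqI simp: norm_cscale algebra_simps)

text \<open>The Hermitian product is recovered from its real part and multiplication by i. A real
  isometry that commutes with \<open>cscale\<close> is therefore unitary.\<close>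

lemma cip_inner: "cip (Rep_ell2 x) (Rep_ell2 y) = Complex (inner x y) (inner x (cscale \<i> y))"
proof (rule complex_eqI)
  have "inner x (cscale \<i> y) = (\<Sum>n. Im (Rep_ell2 x n * cnj (Rep_ell2 y n)))"
    unfolding inner_ell2_sum by (simp add: algebra_simps)
  also have "\<dots> = Im (cip (Rep_ell2 x) (Rep_ell2 y))"
    unfolding cip_def by (rule bounded_linear.suminf[OF bounded_linear_Im summable_cip, symmetric])
  finally show "Im (cip (Rep_ell2 x) (Rep_ell2 y)) = Im (Complex (inner x y) (inner x (cscale \<i> y)))" by simp
qed (simp add: inner_ell2_def)

section \<open>Polynomials and the Fischer inner product\<close>

type_synonym mono = "nat \<Rightarrow>\<^sub>0 nat"
type_synonym fock = "mono \<Rightarrow>\<^sub>0 complex"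

abbreviation "lk \<equiv> Poly_Mapping.lookup"
abbreviation "sg \<equiv> Poly_Mapping.single"
abbreviation "ks \<equiv> Poly_Mapping.keys"

definition zv :: "nat \<Rightarrow> fock" where "zv v = sg (sg v 1) 1"
definition C :: "complex \<Rightarrow> fock" where "C c = sg 0 c"

lemma lk_C_mult [simp]: "lk (C c * f) \<alpha> = c * lk f \<alpha>"
proof -
  have "C c * f = Poly_Mapping.map ((*) c) f" by (simp add: C_def Poly_Mapping.mult_map_scale_conv_mult)
  then show ?thesis by (simp add: Poly_Mapping.map.rep_eq when_def)
qed

lemma lk_mult_C [simp]: "lk (f * C c) \<alpha> = c * lk f \<alpha>"
  using lk_C_mult[of c f \<alpha>] by (simp add: mult.commute)

lemma C_1 [simp]: "C 1 = 1" by (simp add: C_def)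
lemma C_0 [simp]: "C 0 = 0" by (simp add: C_def)
lemma C_add: "C (a + b) = C a + C b" by (simp add: C_def single_add)
lemma C_minus: "C (- a) = - C a" by (simp add: C_def single_uminus)
lemma C_mult: "C (a * b) = C a * C b" by (simp add: C_def mult_single)
lemma C_sum: "C (sum f A) = (\<Sum>a\<in>A. C (f a))" by (induction A rule: infinite_finite_induct) (auto simp: C_add)

lemma poly_eq_sum_single: "f = (\<Sum>\<alpha>\<in>ks f. sg \<alpha> (lk f \<alpha>))" for f :: "'a \<Rightarrow>\<^sub>0 'b::comm_monoid_add"
proof (rule poly_mapping_eqI)
  fix \<beta>
  have "lk (\<Sum>\<alpha>\<in>ks f. sg \<alpha> (lk f \<alpha>)) \<beta> = (\<Sum>\<alpha>\<in>ks f. if \<alpha> = \<beta> then lk f \<beta> else 0)"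
    unfolding Poly_Mapping.lookup_sum by (intro sum.cong) (auto simp: lookup_single when_def)
  also have "\<dots> = lk f \<beta>" by (simp add: in_keys_iff)
  finally show "lk f \<beta> = lk (\<Sum>\<alpha>\<in>ks f. sg \<alpha> (lk f \<alpha>)) \<beta>" by simp
qed

lemma poly_induct [case_names single add]:
  fixes P :: "('a \<Rightarrow>\<^sub>0 'b::comm_monoid_add) \<Rightarrow> bool"
  assumes s: "\<And>\<alpha> c. P (sg \<alpha> c)" and a: "\<And>f g. P f \<Longrightarrow> P g \<Longrightarrow> P (f + g)"
  shows "P f"
proof -
  have "P (\<Sum>\<alpha>\<in>A. sg \<alpha> (lk f \<alpha>))" for A
    by (induction A rule: infinite_finite_induct) (use s[of _ 0] s a in auto)
  then show ?thesis by (subst poly_eq_sum_single)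
qed

instantiation poly_mapping :: (type, real_vector) real_vector
begin
definition scaleR_poly_mapping :: "real \<Rightarrow> ('a \<Rightarrow>\<^sub>0 'b) \<Rightarrow> 'a \<Rightarrow>\<^sub>0 'b" where
  "scaleR_poly_mapping r f = Poly_Mapping.map ((*\<^sub>R) r) f"
lemma lookup_scaleR: "lk (r *\<^sub>R f) k = r *\<^sub>R lk f k"
  by (simp add: scaleR_poly_mapping_def Poly_Mapping.map.rep_eq when_def)
instance
  by standard (auto intro!: poly_mapping_eqI simp: lookup_scaleR lookup_add algebra_simps)
end

lemma scaleR_fock: "r *\<^sub>R f = C (of_real r) * f" for f :: fock
  by (rule poly_mapping_eqI) (simp add: lookup_scaleR scaleR_conv_of_real)

definition dv :: "nat \<Rightarrow> fock \<Rightarrow> fock" where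
  "dv v f = Abs_poly_mapping (\<lambda>\<beta>. of_nat (Suc (lk \<beta> v)) * lk f (\<beta> + sg v 1))"

lemma lk_dv: "lk (dv v f) \<beta> = of_nat (Suc (lk \<beta> v)) * lk f (\<beta> + sg v 1)"
proof -
  have "{\<beta>. of_nat (Suc (lk \<beta> v)) * lk f (\<beta> + sg v 1) \<noteq> 0} \<subseteq> (\<lambda>\<beta>. \<beta> + sg v 1) -` ks f"
    by (auto simp: in_keys_iff)
  moreover have "finite ((\<lambda>\<beta>. \<beta> + sg v 1) -` ks f)" by (intro finite_vimageI) (auto simp: inj_def)
  ultimately show ?thesis
    unfolding dv_def by (subst Abs_poly_mapping_inverse) (auto dest: finite_subset)
qed

lemma dv_add: "dv v (f + g) = dv v f + dv v g" by (rule poly_mapping_eqI) (simp add: lk_dv lookup_add algebra_simps)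

lemma dv_0 [simp]: "dv v 0 = 0" by (rule poly_mapping_eqI) (simp add: lk_dv)

lemma dv_sum: "dv v (sum f A) = (\<Sum>a\<in>A. dv v (f a))"
  by (induction A rule: infinite_finite_induct) (auto simp: dv_add)

lemma dv_C_mult: "dv v (C c * f) = C c * dv v f" by (rule poly_mapping_eqI) (simp add: lk_dv)

lemma dv_minus: "dv v (- f) = - dv v f" using dv_C_mult[of v "- 1" f] by (simp add: C_minus)

lemma dv_diff: "dv v (f - g) = dv v f - dv v g" using dv_add[of v f "- g"] by (simp add: dv_minus)

lemma dv_single: "dv v (sg \<alpha> c) = sg (\<alpha> - sg v 1) (of_nat (lk \<alpha> v) * c)"
proof (rule poly_mapping_eqI)
  fix \<beta>
  show "lk (dv v (sg \<alpha> c)) \<beta> = lk (sg (\<alpha> - sg v 1) (of_nat (lk \<alpha> v) * c)) \<beta>"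
  proof (cases "\<alpha> = \<beta> + sg v 1")
    case True
    then have "\<alpha> - sg v 1 = \<beta>" "lk \<alpha> v = Suc (lk \<beta> v)" by (simp_all add: lookup_add)
    then show ?thesis using True by (simp add: lk_dv del: of_nat_Suc)
  next
    case False
    have "\<alpha> - sg v 1 \<noteq> \<beta> \<or> lk \<alpha> v = 0"
    proof (rule ccontr)
      assume a: "\<not> ?thesis"
      have "lk \<alpha> k = lk (\<beta> + sg v 1) k" for k
        using a by (auto simp: lookup_add lookup_minus lookup_single when_def)
      then show False using False poly_mapping_eqI by blast
    qed
    then show ?thesis using False by (auto simp: lk_dv lookup_single when_def)
  qed
qed

lemma dv_mult: "dv v (f * g) = dv v f * g + f * dv v g"
proof (induction f rule: poly_induct)
  case (single \<alpha> a)
  show ?case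
  proof (induction g rule: poly_induct)
    case (single \<beta> b)
    have 1: "lk \<alpha> v \<noteq> 0 \<Longrightarrow> \<alpha> + \<beta> - sg v 1 = \<alpha> - sg v 1 + \<beta>"
      by (rule poly_mapping_eqI) (auto simp: lookup_add lookup_minus lookup_single when_def)
    have 2: "lk \<beta> v \<noteq> 0 \<Longrightarrow> \<alpha> + \<beta> - sg v 1 = \<alpha> + (\<beta> - sg v 1)"
      by (rule poly_mapping_eqI) (auto simp: lookup_add lookup_minus lookup_single when_def)
    have "sg (\<alpha> - sg v 1 + \<beta>) (of_nat (lk \<alpha> v) * a * b) = sg (\<alpha> + \<beta> - sg v 1) (of_nat (lk \<alpha> v) * a * b)"
      using 1 by (cases "lk \<alpha> v = 0") auto
    moreover have "sg (\<alpha> + (\<beta> - sg v 1)) (a * (of_nat (lk \<beta> v) * b)) = sg (\<alpha> + \<beta> - sg v 1) (a * (of_nat (lk \<beta> v) * b))"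
      using 2 by (cases "lk \<beta> v = 0") auto
    ultimately show ?case
      by (simp add: mult_single dv_single lookup_add single_add[symmetric] algebra_simps)
  qed (simp add: dv_add algebra_simps)
qed (simp add: dv_add algebra_simps)

lemma dv_X: "dv v (zv w) = (if v = w then 1 else 0)" by (auto simp: zv_def dv_single lookup_single when_def)

lemma dv_C [simp]: "dv v (C c) = 0" by (simp add: C_def dv_single)

lemma dv_1 [simp]: "dv v 1 = 0" using dv_C[of v 1] by simp

lemma dv_comm: "dv v (dv w f) = dv w (dv v f)"
  by (rule poly_mapping_eqI) (auto simp: lk_dv lookup_add lookup_single when_def add_ac)

lemma dv_X_mult: "dv v (zv w * f) = zv w * dv v f + (if v = w then f else 0)" by (simp add: dv_mult dv_X)

lemma lk_X_mult: "lk (zv v * f) \<beta> = (if lk \<beta> v = 0 then 0 else lk f (\<beta> - sg v 1))"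
proof (induction f rule: poly_induct)
  case (single \<alpha> c)
  have "sg v 1 + \<alpha> = \<beta> \<longleftrightarrow> lk \<beta> v \<noteq> 0 \<and> \<alpha> = \<beta> - sg v 1"
  proof
    assume a: "lk \<beta> v \<noteq> 0 \<and> \<alpha> = \<beta> - sg v 1"
    have "lk (sg v 1 + \<alpha>) k = lk \<beta> k" for k
      using a by (auto simp: lookup_add lookup_minus lookup_single when_def)
    then show "sg v 1 + \<alpha> = \<beta>" by (rule poly_mapping_eqI)
  qed (auto simp: lookup_add)
  then show ?case by (auto simp: zv_def mult_single lookup_single when_def)
qed (simp add: lookup_add algebra_simps)

lemma lk_X_dv: "lk (zv v * dv v f) \<beta> = of_nat (lk \<beta> v) * lk f \<beta>"
proof (cases "lk \<beta> v = 0")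
  case False
  then have "\<beta> - sg v 1 + sg v 1 = \<beta>"
    by (intro poly_mapping_eqI) (auto simp: lookup_add lookup_minus lookup_single when_def)
  then show ?thesis using False by (simp add: lk_X_mult lk_dv lookup_minus)
qed (simp add: lk_X_mult)

text \<open>The multi-index factorial, which is the squared Fischer norm of the monomial
  \<alpha>.\<close>

definition mfact :: "mono \<Rightarrow> real" where "mfact \<alpha> = (\<Prod>v\<in>ks \<alpha>. fact (lk \<alpha> v))"

lemma mfact_pos: "mfact \<alpha> > 0" by (simp add: mfact_def prod_pos)

lemma mfact_superset: "finite A \<Longrightarrow> ks \<alpha> \<subseteq> A \<Longrightarrow> mfact \<alpha> = (\<Prod>v\<in>A. fact (lk \<alpha> v))"
  unfolding mfact_def by (rule prod.mono_neutral_left) (auto simp: in_keys_iff)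

lemma mfact_add_single: "mfact (\<alpha> + sg v 1) = real (Suc (lk \<alpha> v)) * mfact \<alpha>"
proof -
  let ?A = "insert v (ks \<alpha>)"
  have "mfact (\<alpha> + sg v 1) = (\<Prod>w\<in>?A. fact (lk (\<alpha> + sg v 1) w))"
    by (rule mfact_superset) (auto simp: in_keys_iff lookup_add lookup_single when_def split: if_splits)
  also have "\<dots> = fact (Suc (lk \<alpha> v)) * (\<Prod>w\<in>?A - {v}. fact (lk (\<alpha> + sg v 1) w))"
    by (subst prod.remove[of _ v]) (auto simp: lookup_add)
  also have "(\<Prod>w\<in>?A - {v}. fact (lk (\<alpha> + sg v 1) w)) = (\<Prod>w\<in>?A - {v}. fact (lk \<alpha> w) :: real)"
    by (intro prod.cong) (auto simp: lookup_add lookup_single when_def)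
  also have "fact (Suc (lk \<alpha> v)) * \<dots> = real (Suc (lk \<alpha> v)) * (\<Prod>w\<in>?A. fact (lk \<alpha> w))"
    by (subst (2) prod.remove[of _ v]) auto
  also have "(\<Prod>w\<in>?A. fact (lk \<alpha> w)) = mfact \<alpha>" by (rule mfact_superset[symmetric]) auto
  finally show ?thesis .
qed

text \<open>The real part of the Fischer inner product, for which \<open>dv v\<close> is adjoint to multiplication by \<open>zv v\<close>.\<close>

definition hr :: "fock \<Rightarrow> fock \<Rightarrow> real" where
  "hr f g = (\<Sum>\<alpha>\<in>ks f. mfact \<alpha> * Re (lk f \<alpha> * cnj (lk g \<alpha>)))"

lemma hr_superset: "finite A \<Longrightarrow> ks f \<subseteq> A \<Longrightarrow> hr f g = (\<Sum>\<alpha>\<in>A. mfact \<alpha> * Re (lk f \<alpha> * cnj (lk g \<alpha>)))"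
  unfolding hr_def by (rule sum.mono_neutral_left) (auto simp: in_keys_iff)

lemma hr_commute: "hr f g = hr g f"
proof -
  have "hr f g = (\<Sum>\<alpha>\<in>ks f \<union> ks g. mfact \<alpha> * Re (lk f \<alpha> * cnj (lk g \<alpha>)))" by (rule hr_superset) auto
  also have "\<dots> = (\<Sum>\<alpha>\<in>ks f \<union> ks g. mfact \<alpha> * Re (lk g \<alpha> * cnj (lk f \<alpha>)))" by (intro sum.cong) auto
  also have "\<dots> = hr g f" by (rule hr_superset[symmetric]) auto
  finally show ?thesis .
qed

lemma hr_add_left: "hr (f + g) h = hr f h + hr g h"
proof -
  let ?A = "ks f \<union> ks g"
  have "ks (f + g) \<subseteq> ?A" by (auto simp: in_keys_iff lookup_add)
  then show ?thesis
    using hr_superset[of ?A "f + g" h] hr_superset[of ?A f h] hr_superset[of ?A g h]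
    by (simp add: lookup_add sum.distrib[symmetric] algebra_simps)
qed

lemma hr_add_right: "hr h (f + g) = hr h f + hr h g" using hr_add_left[of f g h] by (simp add: hr_commute)

lemma hr_single: "hr (sg \<alpha> a) (sg \<beta> b) = (if \<alpha> = \<beta> then mfact \<alpha> * Re (a * cnj b) else 0)"
  by (subst hr_superset[of "{\<alpha>}"]) (auto simp: lookup_single when_def)

lemma hr_0_left [simp]: "hr 0 g = 0" by (simp add: hr_def)
lemma hr_0_right [simp]: "hr g 0 = 0" by (simp add: hr_commute[of g])

lemma hr_C: "hr (C c * f) g = hr f (C (cnj c) * g)"
proof -
  have "hr (C c * f) g = (\<Sum>\<alpha>\<in>ks f. mfact \<alpha> * Re (lk (C c * f) \<alpha> * cnj (lk g \<alpha>)))"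
    by (rule hr_superset) (auto simp: in_keys_iff)
  also have "\<dots> = (\<Sum>\<alpha>\<in>ks f. mfact \<alpha> * Re (lk f \<alpha> * cnj (lk (C (cnj c) * g) \<alpha>)))"
    by (intro sum.cong refl) (simp only: lk_C_mult lk_mult_C complex_cnj_mult complex_cnj_cnj mult_ac)
  finally show ?thesis by (simp add: hr_def)
qed

lemma hr_minus_left: "hr (- f) g = - hr f g" using hr_add_left[of "- f" f g] by simp

lemma hr_minus_right: "hr f (- g) = - hr f g" by (metis hr_commute hr_minus_left)

lemma hr_sum_left: "hr (sum f A) g = (\<Sum>a\<in>A. hr (f a) g)"
  by (induction A rule: infinite_finite_induct) (auto simp: hr_add_left)

lemma hr_sum_right: "hr g (sum f A) = (\<Sum>a\<in>A. hr g (f a))"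
  by (induction A rule: infinite_finite_induct) (auto simp: hr_add_right)

lemma hr_X: "hr (zv v * f) g = hr f (dv v g)"
proof (induction f rule: poly_induct)
  case (single \<alpha> a)
  show ?case
  proof (induction g rule: poly_induct)
    case (single \<beta> b)
    have "\<alpha> = \<beta> - sg v 1 \<and> lk \<beta> v \<noteq> 0 \<longleftrightarrow> sg v 1 + \<alpha> = \<beta>"
    proof
      assume a: "\<alpha> = \<beta> - sg v 1 \<and> lk \<beta> v \<noteq> 0"
      have "lk (sg v 1 + \<alpha>) k = lk \<beta> k" for k
        using a by (auto simp: lookup_add lookup_minus lookup_single when_def)
      then show "sg v 1 + \<alpha> = \<beta>" by (rule poly_mapping_eqI)
    qed (auto simp: lookup_add)
    then show ?case
      using mfact_add_single[of \<alpha> v]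
      by (auto simp: zv_def mult_single dv_single hr_single add.commute lookup_add algebra_simps)
  qed (simp add: dv_add hr_add_right)
qed (simp add: hr_add_left algebra_simps)

lemma hr_self_nonneg: "0 \<le> hr f f"
  unfolding hr_def by (intro sum_nonneg mult_nonneg_nonneg) (auto simp: less_imp_le[OF mfact_pos] complex_mult_cnj)

lemma hr_self_zero: "hr f f = 0 \<longleftrightarrow> f = 0"
proof
  assume a: "hr f f = 0"
  have "\<forall>\<alpha>\<in>ks f. mfact \<alpha> * Re (lk f \<alpha> * cnj (lk f \<alpha>)) = 0"
    using a unfolding hr_def
    by (subst (asm) sum_nonneg_eq_0_iff) (auto intro!: mult_nonneg_nonneg simp: less_imp_le[OF mfact_pos] complex_mult_cnj)
  then have "\<forall>\<alpha>\<in>ks f. lk f \<alpha> = 0"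
    using mfact_pos by (auto simp: complex_mult_cnj sum_power2_eq_zero_iff complex_eq_iff less_le)
  then show "f = 0" by (intro poly_mapping_eqI) (auto simp: in_keys_iff)
qed simp

definition mdeg :: "mono \<Rightarrow> nat" where "mdeg \<alpha> = (\<Sum>v\<in>ks \<alpha>. lk \<alpha> v)"

lemma mdeg_superset: "finite A \<Longrightarrow> ks \<alpha> \<subseteq> A \<Longrightarrow> mdeg \<alpha> = (\<Sum>v\<in>A. lk \<alpha> v)"
  unfolding mdeg_def by (rule sum.mono_neutral_left) (auto simp: in_keys_iff)

lemma mdeg_add: "mdeg (\<alpha> + \<beta>) = mdeg \<alpha> + mdeg \<beta>"
proof -
  let ?A = "ks \<alpha> \<union> ks \<beta>"
  have "ks (\<alpha> + \<beta>) \<subseteq> ?A" by (auto simp: in_keys_iff lookup_add)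
  then show ?thesis
    using mdeg_superset[of ?A "\<alpha> + \<beta>"] mdeg_superset[of ?A \<alpha>] mdeg_superset[of ?A \<beta>]
    by (simp add: lookup_add sum.distrib)
qed

lemma mdeg_single [simp]: "mdeg (sg v n) = n" by (cases "n = 0") (auto simp: mdeg_def)

lemma lk_le_mdeg: "lk \<alpha> v \<le> mdeg \<alpha>"
proof (cases "v \<in> ks \<alpha>")
  case True then show ?thesis unfolding mdeg_def by (intro member_le_sum) auto
qed (simp add: in_keys_iff)

definition degle :: "nat \<Rightarrow> fock \<Rightarrow> bool" where "degle d f \<longleftrightarrow> (\<forall>\<alpha>\<in>ks f. mdeg \<alpha> \<le> d)"

lemma ex_degle: "\<exists>d. degle d f" unfolding degle_def by (rule exI[of _ "Max (mdeg ` ks f)"]) auto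

lemma degle_add: "degle d f \<Longrightarrow> degle d g \<Longrightarrow> degle d (f + g)"
  by (auto simp: degle_def in_keys_iff lookup_add)

lemma degle_C: "degle d f \<Longrightarrow> degle d (C c * f)" by (auto simp: degle_def in_keys_iff)

lemma degle_0 [simp]: "degle d 0" by (simp add: degle_def)

lemma degle_sum: "(\<And>a. a \<in> A \<Longrightarrow> degle d (f a)) \<Longrightarrow> degle d (sum f A)"
  by (induction A rule: infinite_finite_induct) (auto intro: degle_add)

lemma degle_X: "degle d f \<Longrightarrow> degle (Suc d) (zv v * f)"
proof -
  assume a: "degle d f"
  have "mdeg \<beta> \<le> Suc d" if "lk (zv v * f) \<beta> \<noteq> 0" for \<beta>
  proof -
    from that have b: "lk \<beta> v \<noteq> 0" "lk f (\<beta> - sg v 1) \<noteq> 0" by (auto simp: lk_X_mult split: if_splits)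
    have "\<beta> = (\<beta> - sg v 1) + sg v 1"
      using b by (intro poly_mapping_eqI) (auto simp: lookup_add lookup_minus lookup_single when_def)
    then have "mdeg \<beta> = mdeg (\<beta> - sg v 1) + 1" by (metis mdeg_add mdeg_single)
    then show ?thesis using a b by (auto simp: degle_def in_keys_iff)
  qed
  then show ?thesis by (auto simp: degle_def in_keys_iff)
qed

lemma degle_dv: assumes "degle d f" shows "degle d (dv v f)" unfolding degle_def
proof
  fix \<beta> assume "\<beta> \<in> ks (dv v f)"
  then have "\<beta> + sg v 1 \<in> ks f" by (auto simp: in_keys_iff lk_dv)
  then have "mdeg (\<beta> + sg v 1) \<le> d" using assms by (auto simp: degle_def)
  then show "mdeg \<beta> \<le> d" by (simp add: mdeg_add)
qed

definition fnorm :: "fock \<Rightarrow> real" where "fnorm f = sqrt (hr f f)"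

lemma fnorm_weighted_le:
  assumes e: "hr g g = (\<Sum>\<alpha>\<in>ks f. mfact \<alpha> * Re (lk f \<alpha> * cnj (lk f \<alpha>)) * w \<alpha>)" and w: "\<And>\<alpha>. \<alpha> \<in> ks f \<Longrightarrow> w \<alpha> \<le> c"
  shows "fnorm g \<le> sqrt c * fnorm f"
proof -
  have "hr g g \<le> (\<Sum>\<alpha>\<in>ks f. mfact \<alpha> * Re (lk f \<alpha> * cnj (lk f \<alpha>)) * c)"
    unfolding e by (intro sum_mono mult_left_mono w) (auto intro!: mult_nonneg_nonneg simp: less_imp_le[OF mfact_pos] complex_mult_cnj)
  also have "\<dots> = c * hr f f" unfolding hr_def by (simp add: sum_distrib_left mult_ac)
  finally show ?thesis unfolding fnorm_def real_sqrt_mult[symmetric] by (rule real_sqrt_le_mono)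
qed

text \<open>Multiplication and differentiation cost only the square root of the degree. Quadratic
  operators therefore cost a factor linear in the degree, and words of length m grow like m!: this
  is the growth that the exponential series tolerates.\<close>

lemma fnorm_X_le: assumes "degle d f" shows "fnorm (zv v * f) \<le> sqrt (real (Suc d)) * fnorm f"
proof (rule fnorm_weighted_le)
  have "hr (zv v * f) (zv v * f) = hr f (dv v (zv v * f))" by (rule hr_X)
  also have "\<dots> = (\<Sum>\<alpha>\<in>ks f. mfact \<alpha> * Re (lk f \<alpha> * cnj (lk f \<alpha>)) * real (Suc (lk \<alpha> v)))"
    unfolding hr_def
  proof (intro sum.cong refl)
    fix \<alpha>
    have e: "lk (dv v (zv v * f)) \<alpha> = of_nat (Suc (lk \<alpha> v)) * lk f \<alpha>"
      by (simp add: dv_X_mult lookup_add lk_X_dv distrib_right)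
    show "mfact \<alpha> * Re (lk f \<alpha> * cnj (lk (dv v (zv v * f)) \<alpha>)) = mfact \<alpha> * Re (lk f \<alpha> * cnj (lk f \<alpha>)) * real (Suc (lk \<alpha> v))"
      unfolding e by (simp add: algebra_simps)
  qed
  finally show "hr (zv v * f) (zv v * f) = \<dots>" .
  show "real (Suc (lk \<alpha> v)) \<le> real (Suc d)" if "\<alpha> \<in> ks f" for \<alpha>
    using assms lk_le_mdeg[of \<alpha> v] that by (auto simp: degle_def)
qed

lemma fnorm_dv_le: assumes "degle d f" shows "fnorm (dv v f) \<le> sqrt (real (Suc d)) * fnorm f"
proof (rule fnorm_weighted_le)
  have "hr (dv v f) (dv v f) = hr (zv v * dv v f) f" by (simp add: hr_X)
  also have "\<dots> = hr f (zv v * dv v f)" by (rule hr_commute)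
  also have "\<dots> = (\<Sum>\<alpha>\<in>ks f. mfact \<alpha> * Re (lk f \<alpha> * cnj (lk f \<alpha>)) * real (lk \<alpha> v))"
    unfolding hr_def by (intro sum.cong) (auto simp: lk_X_dv algebra_simps)
  finally show "hr (dv v f) (dv v f) = \<dots>" .
  show "real (lk \<alpha> v) \<le> real (Suc d)" if "\<alpha> \<in> ks f" for \<alpha>
    using assms lk_le_mdeg[of \<alpha> v] that by (force simp: degle_def)
qed

text \<open>A monomial is coded by the finite set of its pairs of variable and exponent, and a
  countable set has countably many finite subsets.\<close>

lemma ex_mono_enum: "\<exists>en :: nat \<Rightarrow> mono. bij en"
proof -
  have inj: "inj (\<lambda>\<alpha>::mono. {(v, lk \<alpha> v) | v. v \<in> ks \<alpha>})"
  proof (rule injI, rule poly_mapping_eqI)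
    fix \<alpha> \<beta> :: mono and v assume e: "{(v, lk \<alpha> v) | v. v \<in> ks \<alpha>} = {(v, lk \<beta> v) | v. v \<in> ks \<beta>}"
    have "lk \<alpha> v = lk \<beta> v" if "v \<in> ks \<alpha>"
    proof -
      have "(v, lk \<alpha> v) \<in> {(v, lk \<beta> v) | v. v \<in> ks \<beta>}" unfolding e[symmetric] using that by blast
      then show ?thesis by blast
    qed
    moreover have "lk \<alpha> v = lk \<beta> v" if "v \<in> ks \<beta>"
    proof -
      have "(v, lk \<beta> v) \<in> {(v, lk \<alpha> v) | v. v \<in> ks \<alpha>}" unfolding e using that by blast
      then show ?thesis by auto
    qed
    ultimately show "lk \<alpha> v = lk \<beta> v" by (cases "v \<in> ks \<alpha> \<union> ks \<beta>") (auto simp: in_keys_iff)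
  qed
  have "range (\<lambda>\<alpha>::mono. {(v, lk \<alpha> v) | v. v \<in> ks \<alpha>}) \<subseteq> Collect finite" by auto
  then have "countable (range (\<lambda>\<alpha>::mono. {(v, lk \<alpha> v) | v. v \<in> ks \<alpha>}))"
    using countable_Collect_finite countable_subset by blast
  then have c: "countable (UNIV :: mono set)" using inj by (simp add: countable_image_inj_eq)
  have "infinite (UNIV :: mono set)"
  proof
    assume "finite (UNIV :: mono set)"
    moreover have "inj (\<lambda>n::nat. sg 0 n :: mono)" by (rule injI) (metis lookup_single_eq)
    ultimately have "finite (UNIV :: nat set)" by (metis finite_imageD finite_subset subset_UNIV)
    then show False by simp
  qed
  with c have "bij_betw (from_nat_into (UNIV :: mono set)) UNIV UNIV" by (rule bij_betw_from_nat_into)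
  then show ?thesis by blast
qed

definition en :: "nat \<Rightarrow> mono" where "en = (SOME e. bij e)"

lemma bij_en: "bij en" unfolding en_def by (rule someI_ex[OF ex_mono_enum])

text \<open>Coordinates in the orthonormal basis of monomials divided by the square root of
  \<alpha>!, listed by \<open>en\<close>.\<close>

definition iota :: "fock \<Rightarrow> ell2" where
  "iota f = Abs_ell2 (\<lambda>n. of_real (sqrt (mfact (en n))) * lk f (en n))"

lemma finite_en_keys: "finite {n. en n \<in> ks f}"
  using finite_vimageI[OF finite_keys bij_is_inj[OF bij_en], of f] by (simp add: vimage_def)

lemma Rep_iota [simp]: "Rep_ell2 (iota f) n = of_real (sqrt (mfact (en n))) * lk f (en n)"
proof -
  have "summable (\<lambda>n. (cmod (of_real (sqrt (mfact (en n))) * lk f (en n)))\<^sup>2)"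
    by (rule summable_finite[OF finite_en_keys]) (auto simp: in_keys_iff)
  then show ?thesis unfolding iota_def by (subst Abs_ell2_inverse) auto
qed

lemma Re_of_real_mult: "Re (of_real r * z) = r * Re z" by simp

lemma inner_iota: "inner (iota f) (iota g) = hr f g"
proof -
  have "inner (iota f) (iota g) = (\<Sum>n\<in>{n. en n \<in> ks f}. Re (Rep_ell2 (iota f) n * cnj (Rep_ell2 (iota g) n)))"
    unfolding inner_ell2_sum by (rule suminf_finite[OF finite_en_keys]) (auto simp: in_keys_iff)
  also have "\<dots> = (\<Sum>n\<in>{n. en n \<in> ks f}. mfact (en n) * Re (lk f (en n) * cnj (lk g (en n))))"
  proof (intro sum.cong refl)
    fix n
    have "Rep_ell2 (iota f) n * cnj (Rep_ell2 (iota g) n) =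
       of_real (sqrt (mfact (en n)) * sqrt (mfact (en n))) * (lk f (en n) * cnj (lk g (en n)))"
      by (simp only: Rep_iota complex_cnj_mult complex_cnj_complex_of_real of_real_mult mult_ac)
    also have "sqrt (mfact (en n)) * sqrt (mfact (en n)) = mfact (en n)" using less_imp_le[OF mfact_pos] by simp
    finally show "Re (Rep_ell2 (iota f) n * cnj (Rep_ell2 (iota g) n)) = mfact (en n) * Re (lk f (en n) * cnj (lk g (en n)))"
      by (simp only: Re_of_real_mult)
  qed
  also have "\<dots> = hr f g" unfolding hr_def
  proof (rule sum.reindex_bij_betw)
    show "bij_betw en {n. en n \<in> ks f} (ks f)" using bij_en by (auto simp: bij_betw_def inj_on_def bij_def)
  qed
  finally show ?thesis .
qed

lemma norm_iota: "norm (iota f) = fnorm f" by (simp add: fnorm_def norm_eq_sqrt_inner inner_iota)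

lemma linear_iota: "linear iota"
  by (rule linearI; rule ell2_eqI) (simp_all add: lookup_add lookup_scaleR algebra_simps scaleR_conv_of_real)

lemma iota_C: "iota (C c * f) = cscale c (iota f)" by (rule ell2_eqI) simp

lemma iota_eq_0: "iota f = 0 \<longleftrightarrow> f = 0"
  using inner_iota[of f f] hr_self_zero[of f] by (metis inner_eq_zero_iff)

lemma dense_iota: "closure (range iota) = UNIV"
proof -
  have "x \<in> closure (range iota)" for x unfolding closure_approachable
  proof (intro allI impI)
    fix e :: real assume e: "e > 0"
    obtain N where N: "\<And>n. n \<ge> N \<Longrightarrow> norm (\<Sum>i. (cmod (Rep_ell2 x (i + n)))\<^sup>2) < e\<^sup>2"
      using suminf_exist_split[OF _ summable_Rep_ell2[of x], of "e\<^sup>2"] e by auto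
    define f where "f = (\<Sum>n<N. sg (en n) (Rep_ell2 x n / of_real (sqrt (mfact (en n)))))"
    have lkf: "lk f (en n) = (if n < N then Rep_ell2 x n / of_real (sqrt (mfact (en n))) else 0)" for n
    proof -
      have "lk f (en n) = (\<Sum>k<N. if k = n then Rep_ell2 x n / of_real (sqrt (mfact (en n))) else 0)"
        unfolding f_def Poly_Mapping.lookup_sum
        by (intro sum.cong) (auto simp: lookup_single when_def inj_eq[OF bij_is_inj[OF bij_en]])
      then show ?thesis by simp
    qed
    have r: "Rep_ell2 (x - iota f) n = (if n < N then 0 else Rep_ell2 x n)" for n
      using mfact_pos[of "en n"] by (simp add: lkf)
    have "(norm (x - iota f))\<^sup>2 = (\<Sum>n. (cmod (Rep_ell2 (x - iota f) (n + N)))\<^sup>2) + (\<Sum>n<N. (cmod (Rep_ell2 (x - iota f) n))\<^sup>2)"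
      unfolding norm_ell2_sq by (rule suminf_split_initial_segment[OF summable_Rep_ell2])
    also have "\<dots> = (\<Sum>i. (cmod (Rep_ell2 x (i + N)))\<^sup>2)" unfolding r by simp
    also have "\<dots> < e\<^sup>2" using N[of N] by simp
    finally have "norm (x - iota f) < e" using e by (simp add: power_less_imp_less_base)
    then show "\<exists>y\<in>range iota. dist y x < e" by (auto simp: dist_norm norm_minus_commute)
  qed
  then show ?thesis by auto
qed

section \<open>The oscillator representation\<close>

lemma sp_alg_entries:
  fixes X :: "('a::comm_ring_1, 'n::finite) mat2"
  shows "X \<in> sp_alg \<longleftrightarrow> (\<forall>i j. X $ Inr i $ Inr j = - X $ Inl j $ Inl i \<and> X $ Inl i $ Inr j = X $ Inl j $ Inr i \<and> X $ Inr i $ Inl j = X $ Inr j $ Inl i)"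
proof -
  have "X \<in> sp_alg \<longleftrightarrow> (\<forall>s t. (\<Sum>k\<in>UNIV. X $ k $ s * symp_form $ k $ t) + (\<Sum>k\<in>UNIV. symp_form $ s $ k * X $ k $ t) = 0)"
    by (simp add: sp_alg_def vec_eq_iff matrix_matrix_mult_def transpose_def)
  also have "\<dots> \<longleftrightarrow> (\<forall>s t. (case t of Inl j \<Rightarrow> - X $ Inr j $ s | Inr j \<Rightarrow> X $ Inl j $ s) + (case s of Inl i \<Rightarrow> X $ Inr i $ t | Inr i \<Rightarrow> - X $ Inl i $ t) = 0)"
    by (intro all_cong1) (simp add: sum_UNIV_sum_type sum_if_mult split: sum.split)
  also have "\<dots> \<longleftrightarrow> (\<forall>i j. X $ Inr i $ Inr j = - X $ Inl j $ Inl i \<and> X $ Inl i $ Inr j = X $ Inl j $ Inr i \<and> X $ Inr i $ Inl j = X $ Inr j $ Inl i)"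
    (is "?L \<longleftrightarrow> ?R")
  proof
    assume L: ?L
    show ?R
    proof (intro allI conjI)
      fix i j
      show "X $ Inr i $ Inr j = - X $ Inl j $ Inl i" using L[rule_format, of "Inl i" "Inr j"] by (simp add: eq_neg_iff_add_eq_0 add.commute)
      show "X $ Inl i $ Inr j = X $ Inl j $ Inr i" using L[rule_format, of "Inr j" "Inr i"] by simp
      show "X $ Inr i $ Inl j = X $ Inr j $ Inl i" using L[rule_format, of "Inl i" "Inl j"] by simp
    qed
  next
    assume R: ?R
    have r: "X $ Inr i $ Inr j = - X $ Inl j $ Inl i" "X $ Inl i $ Inr j = X $ Inl j $ Inr i" "X $ Inr i $ Inl j = X $ Inr j $ Inl i" for i j
      using R by blast+
    show ?L
    proof (intro allI)
      fix s t
      show "(case t of Inl j \<Rightarrow> - X $ Inr j $ s | Inr j \<Rightarrow> X $ Inl j $ s) + (case s of Inl i \<Rightarrow> X $ Inr i $ t | Inr i \<Rightarrow> - X $ Inl i $ t) = 0"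
        by (cases s; cases t) (simp_all add: r)
    qed
  qed
  finally show ?thesis .
qed

definition cnj_mat :: "(complex, 'n::finite) mat2 \<Rightarrow> (complex, 'n) mat2" where
  "cnj_mat X = (\<chi> s t. cnj (X $ s $ t))"

lemma cnj_mat_sp: "X \<in> sp_alg \<Longrightarrow> cnj_mat X \<in> sp_alg" by (simp add: sp_alg_entries cnj_mat_def)

lemma cnj_complexify: "cnj_mat (complexify X) = complexify X" by (simp add: cnj_mat_def vec_eq_iff map_matrix_def)

lemma complexify_sp: "complexify X \<in> sp_alg \<longleftrightarrow> X \<in> sp_alg"
proof -
  have e: "complexify X $ s $ t = of_real (X $ s $ t)" for s t by (simp add: map_matrix_def)
  have "of_real x = - (of_real y :: complex) \<longleftrightarrow> x = - y" for x y :: real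
    by (metis of_real_eq_iff of_real_minus)
  then show ?thesis by (simp add: sp_alg_entries e)
qed

lemma matrix_mult_entry: "(A ** B) $ i $ j = (\<Sum>k\<in>UNIV. A $ i $ k * B $ k $ j)"
  by (simp add: matrix_matrix_mult_def)

lemma mult_symp_form_entries:
  "(X ** symp_form) $ s $ Inl j = - X $ s $ Inr j" "(X ** symp_form) $ s $ Inr j = X $ s $ Inl j"
  by (simp_all add: matrix_matrix_mult_def sum_UNIV_sum_type sum_if_mult)

lemma inj_pos: "pos i = pos j \<Longrightarrow> i = (j :: 'n::{finite,linorder})"
proof -
  assume e: "pos i = pos j"
  have *: "a = b" if "a \<le> b" "pos a = pos b" for a b :: 'n
  proof -
    have "{j. j \<le> a} \<subseteq> {j. j \<le> b}" using that by auto
    then have "{j. j \<le> a} = {j. j \<le> b}" using that(2) by (intro card_subset_eq) (auto simp: pos_def)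
    then show ?thesis by (metis antisym mem_Collect_eq order_refl)
  qed
  show ?thesis using *[of i j] *[of j i] e linear[of i j] by metis
qed

text \<open>The variable in row i and column a of the matrix of indeterminates, coded as a natural
  number.\<close>

definition var :: "'n::{finite,linorder} \<Rightarrow> nat \<Rightarrow> nat" where "var i a = prod_encode (pos i, a)"

lemma var_eq [simp]: "var i a = var j b \<longleftrightarrow> i = j \<and> a = b"
  by (auto simp: var_def dest: inj_pos)

lemma fnorm_add: "fnorm (f + g) \<le> fnorm f + fnorm g"
  using norm_triangle_ineq[of "iota f" "iota g"] by (simp add: norm_iota[symmetric] linear_add[OF linear_iota])

lemma fnorm_C: "fnorm (C c * f) = cmod c * fnorm f" by (simp add: norm_iota[symmetric] iota_C norm_cscale)

lemma fnorm_minus: "fnorm (- f) = fnorm f" using fnorm_C[of "- 1" f] by (simp add: C_minus)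

lemma fnorm_diff: "fnorm (f - g) \<le> fnorm f + fnorm g" using fnorm_add[of f "- g"] by (simp add: fnorm_minus)

lemma fnorm_nonneg: "0 \<le> fnorm f" by (simp add: fnorm_def hr_self_nonneg)

lemma fnorm_sum: "fnorm (sum f A) \<le> (\<Sum>a\<in>A. fnorm (f a))"
proof (induction A rule: infinite_finite_induct)
  case (insert x F)
  then show ?case using fnorm_add[of "f x" "sum f F"] by simp
qed (auto simp: fnorm_def)

locale oscillator =
  fixes k m :: nat and ty :: "'n::{finite,linorder} itself"
  assumes km: "2 * m \<le> k"
begin

text \<open>The quadratic form preserved by \<open>O(k)\<close> is \<open>\<Sum>a<k. x\<^sub>a x\<^bsub>\<tau> a\<^esub>\<close>, which has the first \<open>m\<close> coordinate vectors as an isotropic family.\<close>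

definition \<tau> :: "nat \<Rightarrow> nat" where "\<tau> a = (if a < m \<or> k - m \<le> a then k - 1 - a else a)"

lemma \<tau>_less [simp]: "a < k \<Longrightarrow> \<tau> a < k" by (auto simp: \<tau>_def)
lemma \<tau>_\<tau> [simp]: "a < k \<Longrightarrow> \<tau> (\<tau> a) = a" using km by (auto simp: \<tau>_def)
lemma \<tau>_eq: "a < k \<Longrightarrow> b < k \<Longrightarrow> \<tau> a = b \<longleftrightarrow> a = \<tau> b" by auto

lemma sum_\<tau>: "(\<Sum>a<k. g (\<tau> a)) = (\<Sum>a<k. g a)"
  by (rule sum.reindex_bij_witness[of _ \<tau> \<tau>]) auto

text \<open>Generators of the Weyl algebra, scaled by \<open>sqrt 2\<close> to avoid square roots; this accounts for the factor \<open>1/4\<close> in \<open>\<rho>F\<close>.\<close>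

definition W :: "'n + 'n \<Rightarrow> nat \<Rightarrow> fock \<Rightarrow> fock" where
  "W s a f = (case s of Inl i \<Rightarrow> zv (var i a) * f + dv (var i (\<tau> a)) f
     | Inr i \<Rightarrow> C \<i> * (zv (var i a) * f - dv (var i (\<tau> a)) f))"

lemma W_add: "W s a (f + g) = W s a f + W s a g" by (cases s) (simp_all add: W_def dv_add algebra_simps)

lemma W_C: "W s a (C c * f) = C c * W s a f" by (cases s) (simp_all add: W_def dv_mult algebra_simps)

lemma W_0 [simp]: "W s a 0 = 0" by (cases s) (simp_all add: W_def)

lemma W_sum: "W s a (sum f A) = (\<Sum>x\<in>A. W s a (f x))"
  by (induction A rule: infinite_finite_induct) (auto simp: W_add)

lemma C_i_i: "C \<i> * (C \<i> * f) = - f" by (simp add: mult.assoc[symmetric] C_mult[symmetric] C_minus)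

text \<open>Canonical commutation relations: the index s carries the symplectic form and the column
  carries the quadratic form through \<tau>. Contracting the columns with the quadratic form leaves
  quadratic operators that close up to sp(2n).\<close>

lemma W_commute:
  assumes "a < k" "b < k"
  shows "W s a (W t b f) = W t b (W s a f) + (if b = \<tau> a then C (2 * \<i> * symp_form $ s $ t) * f else 0)"
proof -
  have C2: "C 2 = 2" using C_add[of 1 1] by simp
  show ?thesis
  proof (cases "b = \<tau> a")
    case True
    then show ?thesis using assms(1)
      by (cases s; cases t)
        (simp_all add: W_def dv_add dv_diff dv_mult dv_X dv_comm algebra_simps C2 C_minus C_mult)
  next
    case False
    then have "a \<noteq> \<tau> b" "\<tau> b \<noteq> a" "\<tau> a \<noteq> b" using \<tau>_eq[of a b] assms by metis+
    then show ?thesis using False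
      by (cases s; cases t)
        (simp_all add: W_def dv_add dv_diff dv_mult dv_X dv_comm algebra_simps)
  qed
qed

lemma WW_commute:
  assumes b: "b < k"
  shows "(\<Sum>a<k. W s a (W t (\<tau> a) (W u b f))) = W u b (\<Sum>a<k. W s a (W t (\<tau> a) f))
     + C (2 * \<i> * symp_form $ t $ u) * W s b f + C (2 * \<i> * symp_form $ s $ u) * W t b f"
proof -
  have "W s a (W t (\<tau> a) (W u b f)) = W u b (W s a (W t (\<tau> a) f))
      + (if a = b then C (2 * \<i> * symp_form $ t $ u) * W s b f else 0) + (if a = \<tau> b then C (2 * \<i> * symp_form $ s $ u) * W t b f else 0)"
    if a: "a < k" for a
  proof -
    have "W t (\<tau> a) (W u b f) = W u b (W t (\<tau> a) f) + (if a = b then C (2 * \<i> * symp_form $ t $ u) * f else 0)"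
      using W_commute[of "\<tau> a" b t u f] a b by auto
    then have "W s a (W t (\<tau> a) (W u b f)) = W s a (W u b (W t (\<tau> a) f)) + (if a = b then C (2 * \<i> * symp_form $ t $ u) * W s b f else 0)"
      by (simp add: W_add W_C)
    also have "W s a (W u b (W t (\<tau> a) f)) = W u b (W s a (W t (\<tau> a) f)) + (if a = \<tau> b then C (2 * \<i> * symp_form $ s $ u) * W t b f else 0)"
      using W_commute[of a b s u "W t (\<tau> a) f"] a b by auto
    finally show ?thesis by (simp add: algebra_simps)
  qed
  then have "(\<Sum>a<k. W s a (W t (\<tau> a) (W u b f))) = (\<Sum>a<k. W u b (W s a (W t (\<tau> a) f))
      + (if a = b then C (2 * \<i> * symp_form $ t $ u) * W s b f else 0) + (if a = \<tau> b then C (2 * \<i> * symp_form $ s $ u) * W t b f else 0))"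
    by (intro sum.cong) auto
  then show ?thesis using b by (simp add: sum.distrib W_sum)
qed

definition G :: "('n + 'n \<Rightarrow> 'n + 'n \<Rightarrow> complex) \<Rightarrow> fock \<Rightarrow> fock" where
  "G S f = (\<Sum>s\<in>UNIV. \<Sum>t\<in>UNIV. C (S s t) * (\<Sum>a<k. W s a (W t (\<tau> a) f)))"

text \<open>Y \<mapsto> Y J identifies sp(2n) with symmetric matrices, the coefficient matrices of
  quadratic forms. The factor i, the 2 i of the commutation relations and J^2 = - 1 combine to
  return Y in \<open>\<rho>F_W\<close>.\<close>

definition SX :: "(complex, 'n) mat2 \<Rightarrow> 'n + 'n \<Rightarrow> 'n + 'n \<Rightarrow> complex" where
  "SX Y s t = \<i> * (Y ** symp_form) $ s $ t"

definition \<rho>F :: "(complex, 'n) mat2 \<Rightarrow> fock \<Rightarrow> fock" where "\<rho>F Y f = C (1/4) * G (SX Y) f"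

lemma G_add: "G S (f + g) = G S f + G S g" by (simp add: G_def W_add sum.distrib algebra_simps)

lemma G_C: "G S (C c * f) = C c * G S f" by (simp only: G_def W_C sum_distrib_left mult.left_commute[of _ "C c"])

lemma G_add_S: "G (\<lambda>s t. S s t + S' s t) f = G S f + G S' f"
  by (simp add: G_def C_add sum.distrib algebra_simps)

lemma G_scale_S: "G (\<lambda>s t. c * S s t) f = C c * G S f" by (simp add: G_def C_mult sum_distrib_left mult_ac)

lemma SX_add: "SX (Y + Z) s t = SX Y s t + SX Z s t"
  by (cases t) (simp_all add: SX_def mult_symp_form_entries algebra_simps)

lemma SX_scale: "SX (mscale c Y) s t = c * SX Y s t"
  by (cases t) (simp_all add: SX_def mult_symp_form_entries map_matrix_def)

lemma SX_sym: "Y \<in> sp_alg \<Longrightarrow> SX Y s t = SX Y t s"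
  by (cases s; cases t) (simp_all add: SX_def mult_symp_form_entries sp_alg_entries)

lemma \<rho>F_add: "\<rho>F Y (f + g) = \<rho>F Y f + \<rho>F Y g" by (simp add: \<rho>F_def G_add algebra_simps)
lemma \<rho>F_C: "\<rho>F Y (C c * f) = C c * \<rho>F Y f" by (simp only: \<rho>F_def G_C mult.left_commute[of _ "C c"])
lemma \<rho>F_0 [simp]: "\<rho>F Y 0 = 0" using \<rho>F_C[of Y 0 0] by simp
lemma \<rho>F_sum: "\<rho>F Y (sum f A) = (\<Sum>x\<in>A. \<rho>F Y (f x))"
  by (induction A rule: infinite_finite_induct) (auto simp: \<rho>F_add)
lemma \<rho>F_add_mat: "\<rho>F (Y + Z) f = \<rho>F Y f + \<rho>F Z f"
  by (simp add: \<rho>F_def SX_add[abs_def] G_add_S algebra_simps)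
lemma \<rho>F_scale_mat: "\<rho>F (mscale c Y) f = C c * \<rho>F Y f"
  by (simp add: \<rho>F_def SX_scale[abs_def] G_scale_S mult_ac)

text \<open>The commutator with \<rho>F Y acts on the linear generators by the standard
  representation. Each of the two factors of the quadratic operator contributes the same amount, by
  symmetry of SX Y, and this consumes the factor 1/4.\<close>

lemma \<rho>F_W:
  assumes Y: "Y \<in> sp_alg" and b: "b < k"
  shows "\<rho>F Y (W u b f) = W u b (\<rho>F Y f) + (\<Sum>s\<in>UNIV. C (Y $ s $ u) * W s b f)"
proof -
  let ?S = "SX Y"
  have "G ?S (W u b f) = (\<Sum>s\<in>UNIV. \<Sum>t\<in>UNIV. C (?S s t) * (W u b (\<Sum>a<k. W s a (W t (\<tau> a) f))
     + C (2 * \<i> * symp_form $ t $ u) * W s b f + C (2 * \<i> * symp_form $ s $ u) * W t b f))"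
    by (simp add: G_def WW_commute[OF b])
  also have "\<dots> = W u b (G ?S f) + (\<Sum>s\<in>UNIV. \<Sum>t\<in>UNIV. C (?S s t * (2 * \<i> * symp_form $ t $ u)) * W s b f)
      + (\<Sum>s\<in>UNIV. \<Sum>t\<in>UNIV. C (?S s t * (2 * \<i> * symp_form $ s $ u)) * W t b f)"
    by (simp only: G_def W_sum W_C distrib_left sum.distrib C_mult mult.assoc)
  also have "(\<Sum>s\<in>UNIV. \<Sum>t\<in>UNIV. C (?S s t * (2 * \<i> * symp_form $ s $ u)) * W t b f)
     = (\<Sum>s\<in>UNIV. \<Sum>t\<in>UNIV. C (?S s t * (2 * \<i> * symp_form $ t $ u)) * W s b f)"
    by (subst sum.swap) (simp add: SX_sym[OF Y])
  also have "(\<Sum>s\<in>UNIV. \<Sum>t\<in>UNIV. C (?S s t * (2 * \<i> * symp_form $ t $ u)) * W s b f)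
     = (\<Sum>s\<in>UNIV. C (2 * Y $ s $ u) * W s b f)"
  proof (intro sum.cong refl)
    fix s
    have "(\<Sum>t\<in>UNIV. C (?S s t * (2 * \<i> * symp_form $ t $ u)) * W s b f) = C (\<Sum>t\<in>UNIV. ?S s t * (2 * \<i> * symp_form $ t $ u)) * W s b f"
      by (simp add: C_sum sum_distrib_right)
    also have "(\<Sum>t\<in>UNIV. ?S s t * (2 * \<i> * symp_form $ t $ u)) = 2 * \<i> * \<i> * (\<Sum>t\<in>UNIV. (Y ** symp_form) $ s $ t * symp_form $ t $ u)"
      by (simp add: SX_def sum_distrib_left mult_ac)
    also have "(\<Sum>t\<in>UNIV. (Y ** symp_form) $ s $ t * symp_form $ t $ u) = (Y ** symp_form ** symp_form) $ s $ u"
      by (simp only: matrix_mult_entry)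
    also have "Y ** symp_form ** symp_form = Y ** (- mat 1)"
      by (simp add: matrix_mul_assoc[symmetric] symp_form_mult_self)
    also have "(Y ** (- mat 1)) $ s $ u = - Y $ s $ u"
      by (simp add: matrix_matrix_mult_def mat_def if_distrib sum_negf cong: if_cong)
    finally show "(\<Sum>t\<in>UNIV. C (?S s t * (2 * \<i> * symp_form $ t $ u)) * W s b f) = C (2 * Y $ s $ u) * W s b f" by (simp add: mult.assoc)
  qed
  finally have e: "G ?S (W u b f) = W u b (G ?S f) + ((\<Sum>s\<in>UNIV. C (2 * Y $ s $ u) * W s b f) + (\<Sum>s\<in>UNIV. C (2 * Y $ s $ u) * W s b f))"
    by simp
  have "C (1/4) * ((\<Sum>s\<in>UNIV. C (2 * Y $ s $ u) * W s b f) + (\<Sum>s\<in>UNIV. C (2 * Y $ s $ u) * W s b f)) = (\<Sum>s\<in>UNIV. C (Y $ s $ u) * W s b f)"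
  proof -
    have "C (1/4) * (C (2 * y) * w + C (2 * y) * w) = C y * w" for y w
    proof -
      have "C (1/4) * (C (2 * y) * w + C (2 * y) * w) = C (1/4 * (2 * y + 2 * y)) * w" by (simp only: C_mult C_add algebra_simps)
      then show ?thesis by simp
    qed
    note q = this
    show ?thesis unfolding sum.distrib[symmetric] sum_distrib_left by (intro sum.cong refl q)
  qed
  then show ?thesis unfolding \<rho>F_def e distrib_left by (simp add: W_C)
qed

text \<open>By \<open>\<rho>F_W\<close>, the commutator with \<rho>F Y changes the coefficient
  matrix S of a quadratic operator into Y S + S Y^T. For S = i Z J the relation J Y^T = - Y J turns
  this into i (Y Z - Z Y) J.\<close>

lemma \<rho>F_bracket:
  assumes Y: "Y \<in> sp_alg" and Z: "Z \<in> sp_alg"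
  shows "\<rho>F (bracket Y Z) f = \<rho>F Y (\<rho>F Z f) - \<rho>F Z (\<rho>F Y f)"
proof -
  let ?S = "SX Z"
  let ?R = "\<lambda>u s. \<Sum>v\<in>UNIV. ?S u v * Y $ s $ v" and ?T = "\<lambda>s v. \<Sum>u\<in>UNIV. Y $ s $ u * ?S u v"
  let ?P = "\<lambda>u v. \<Sum>b<k. \<Sum>s\<in>UNIV. C (Y $ s $ v) * W u b (W s (\<tau> b) f)" and ?Q = "\<lambda>u v. \<Sum>b<k. \<Sum>s\<in>UNIV. C (Y $ s $ u) * W s b (W v (\<tau> b) f)"
  have WW: "\<rho>F Y (W u b (W v (\<tau> b) f)) = W u b (W v (\<tau> b) (\<rho>F Y f)) + (\<Sum>s\<in>UNIV. C (Y $ s $ v) * W u b (W s (\<tau> b) f))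
       + (\<Sum>s\<in>UNIV. C (Y $ s $ u) * W s b (W v (\<tau> b) f))" if b: "b < k" for u v b
    using b by (simp add: \<rho>F_W[OF Y] W_add W_sum W_C)
  have "\<rho>F Y (G ?S f) = (\<Sum>u\<in>UNIV. \<Sum>v\<in>UNIV. C (?S u v) * (\<Sum>b<k. W u b (W v (\<tau> b) (\<rho>F Y f)) + (\<Sum>s\<in>UNIV. C (Y $ s $ v) * W u b (W s (\<tau> b) f))
       + (\<Sum>s\<in>UNIV. C (Y $ s $ u) * W s b (W v (\<tau> b) f))))"
    unfolding G_def \<rho>F_sum \<rho>F_C by (simp add: WW)
  also have "\<dots> = G ?S (\<rho>F Y f)
     + (\<Sum>u\<in>UNIV. \<Sum>v\<in>UNIV. C (?S u v) * ?P u v)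
     + (\<Sum>u\<in>UNIV. \<Sum>v\<in>UNIV. C (?S u v) * ?Q u v)"
    by (simp only: sum.distrib distrib_left G_def)
  also have "(\<Sum>u\<in>UNIV. \<Sum>v\<in>UNIV. C (?S u v) * ?P u v)
     = G ?R f"
  proof -
    have "(\<Sum>v\<in>UNIV. C (?S u v) * ?P u v)
       = (\<Sum>s\<in>UNIV. C (?R u s) * (\<Sum>b<k. W u b (W s (\<tau> b) f)))" for u
    proof -
      have "(\<Sum>v\<in>UNIV. C (?S u v) * ?P u v)
        = (\<Sum>v\<in>UNIV. \<Sum>s\<in>UNIV. C (?S u v * Y $ s $ v) * (\<Sum>b<k. W u b (W s (\<tau> b) f)))"
        by (subst sum.swap[of _ _ "{..<k}"]) (simp add: sum_distrib_left C_mult mult.assoc)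
      then show ?thesis by (subst (asm) sum.swap) (simp add: C_sum sum_distrib_right)
    qed
    then show ?thesis unfolding G_def by simp
  qed
  also have "(\<Sum>u\<in>UNIV. \<Sum>v\<in>UNIV. C (?S u v) * ?Q u v)
     = G ?T f"
  proof -
    have "(\<Sum>u\<in>UNIV. C (?S u v) * ?Q u v)
       = (\<Sum>s\<in>UNIV. C (?T s v) * (\<Sum>b<k. W s b (W v (\<tau> b) f)))" for v
    proof -
      have "(\<Sum>u\<in>UNIV. C (?S u v) * ?Q u v)
        = (\<Sum>u\<in>UNIV. \<Sum>s\<in>UNIV. C (Y $ s $ u * ?S u v) * (\<Sum>b<k. W s b (W v (\<tau> b) f)))"
        by (subst sum.swap[of _ _ "{..<k}"]) (simp add: sum_distrib_left C_mult mult_ac)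
      then show ?thesis by (subst (asm) sum.swap) (simp add: C_sum sum_distrib_right)
    qed
    note e = this
    show ?thesis unfolding G_def by (subst sum.swap, simp only: e, subst sum.swap, rule refl)
  qed
  finally have "\<rho>F Y (G ?S f) - G ?S (\<rho>F Y f) = G ?R f + G ?T f" by simp
  also have "\<dots> = G (SX (bracket Y Z)) f"
  proof -
    have 1: "?T s v = \<i> * (Y ** Z ** symp_form) $ s $ v" for s v
      unfolding SX_def matrix_mul_assoc[symmetric] matrix_mult_entry[of Y] by (simp add: sum_distrib_left mult_ac)
    have 2: "?R u s = - \<i> * (Z ** Y ** symp_form) $ u $ s" for u s
    proof -
      have tr: "symp_form ** transpose Y = - (Y ** symp_form)"
      proof -
        have "(symp_form ** transpose Y) $ a $ b = - (Y ** symp_form) $ a $ b" for a b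
          using Y by (cases a; cases b) (simp_all add: mult_symp_form_entries sp_alg_entries matrix_mult_entry[of symp_form] transpose_def sum_UNIV_sum_type sum_if_mult sum_negf)
        then show ?thesis by (simp add: vec_eq_iff)
      qed
      have "?R u s = \<i> * ((Z ** symp_form) ** transpose Y) $ u $ s"
        unfolding SX_def matrix_mult_entry[of "Z ** symp_form"] by (simp add: transpose_def sum_distrib_left mult_ac)
      also have "(Z ** symp_form) ** transpose Y = Z ** (- (Y ** symp_form))"
        by (simp only: matrix_mul_assoc[symmetric] tr)
      also have "\<i> * (Z ** (- (Y ** symp_form))) $ u $ s = - \<i> * (Z ** Y ** symp_form) $ u $ s"
        unfolding matrix_mul_assoc[symmetric] by (simp add: matrix_mult_entry[of Z] sum_negf)
      finally show ?thesis .
    qed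
    have "SX (bracket Y Z) s t = (\<Sum>v\<in>UNIV. ?S s v * Y $ t $ v) + (\<Sum>u\<in>UNIV. Y $ s $ u * ?S u t)" for s t
      unfolding 1 2 unfolding SX_def bracket_def by (cases t) (simp_all add: mult_symp_form_entries algebra_simps)
    then have "SX (bracket Y Z) = (\<lambda>s t. (\<Sum>v\<in>UNIV. ?S s v * Y $ t $ v) + (\<Sum>u\<in>UNIV. Y $ s $ u * ?S u t))"
      by (intro ext)
    then show ?thesis by (simp only: G_add_S)
  qed
  finally have "\<rho>F Y (G ?S f) - G ?S (\<rho>F Y f) = G (SX (bracket Y Z)) f" .
  then have "C (1/4) * (\<rho>F Y (G ?S f) - G ?S (\<rho>F Y f)) = C (1/4) * G (SX (bracket Y Z)) f" by simp
  then show ?thesis unfolding \<rho>F_def[of Z] \<rho>F_def[of "bracket Y Z"] by (simp add: \<rho>F_C right_diff_distrib)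
qed

lemma hr_dv: "hr (dv v f) g = hr f (zv v * g)" by (rule trans[OF hr_commute trans[OF hr_X[symmetric] hr_commute]])

lemma hr_W: "a < k \<Longrightarrow> hr (W s a f) g = hr f (W s (\<tau> a) g)"
proof (cases s)
  case (Inl i)
  then show "a < k \<Longrightarrow> ?thesis" by (simp add: W_def hr_add_left hr_add_right hr_dv hr_X)
next
  case (Inr i)
  have d1: "hr (f - g) h = hr f h - hr g h" for f g h :: fock using hr_add_left[of "f - g" g h] by simp
  have d2: "hr h (f - g) = hr h f - hr h g" for f g h :: fock using hr_add_right[of h "f - g" g] by simp
  have "hr (C \<i> * (zv (var i a) * f - dv (var i (\<tau> a)) f)) g = hr f (C (- \<i>) * dv (var i a) g - zv (var i (\<tau> a)) * (C (- \<i>) * g))"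
    unfolding hr_C d1 d2 hr_X hr_dv dv_C_mult by simp
  also have "C (- \<i>) * dv (var i a) g - zv (var i (\<tau> a)) * (C (- \<i>) * g) = C \<i> * (zv (var i (\<tau> a)) * g - dv (var i a) g)"
    by (simp add: C_minus right_diff_distrib mult.left_commute[of _ "C \<i>"])
  finally show "a < k \<Longrightarrow> ?thesis" using Inr by (simp add: W_def)
qed

text \<open>The adjoint of W s a is W s (\<tau> a), so taking adjoints reverses the two factors and
  conjugates the coefficients. Symmetry of SX absorbs the reversal, and conjugating its factor i
  produces the minus sign.\<close>

lemma hr_\<rho>F:
  assumes Y: "Y \<in> sp_alg" shows "hr (\<rho>F Y f) g = - hr f (\<rho>F (cnj_mat Y) g)"
proof -
  have e: "hr (C c * (\<Sum>a<k. W s a (W t (\<tau> a) f))) g = hr f (C (cnj c) * (\<Sum>a<k. W t a (W s (\<tau> a) g)))" for c s t g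
  proof -
    have "hr (C c * (\<Sum>a<k. W s a (W t (\<tau> a) f))) g = (\<Sum>a<k. hr f (W t a (W s (\<tau> a) (C (cnj c) * g))))"
      unfolding hr_C hr_sum_left by (intro sum.cong refl) (simp add: hr_W)
    then show ?thesis by (simp only: W_C hr_sum_right sum_distrib_left)
  qed
  have main: "hr (G (SX Y) f) g = - hr f (G (SX (cnj_mat Y)) g)" for g
  proof -
    have "hr (G (SX Y) f) g = (\<Sum>s\<in>UNIV. \<Sum>t\<in>UNIV. hr f (C (cnj (SX Y s t)) * (\<Sum>a<k. W t a (W s (\<tau> a) g))))"
      by (simp only: G_def hr_sum_left e)
    also have "\<dots> = hr f (G (\<lambda>s t. cnj (SX Y t s)) g)"
      unfolding G_def by (subst sum.swap) (simp only: hr_sum_right)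
    also have "(\<lambda>s t. cnj (SX Y t s)) = (\<lambda>s t. (- 1) * SX (cnj_mat Y) s t)"
    proof (intro ext)
      fix s t show "cnj (SX Y t s) = (- 1) * SX (cnj_mat Y) s t"
        unfolding SX_sym[OF Y, of t s] by (cases t) (simp_all add: SX_def mult_symp_form_entries cnj_mat_def)
    qed
    finally show ?thesis
      unfolding G_scale_S by (simp add: C_minus hr_minus_right)
  qed
  have "hr (\<rho>F Y f) g = hr (G (SX Y) f) (C (1/4) * g)" by (simp add: \<rho>F_def hr_C)
  also have "\<dots> = - hr f (G (SX (cnj_mat Y)) (C (1/4) * g))" by (rule main)
  also have "G (SX (cnj_mat Y)) (C (1/4) * g) = \<rho>F (cnj_mat Y) g" by (simp only: G_C \<rho>F_def)
  finally show ?thesis .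
qed

end

section \<open>Growth of words in the quadratic operators\<close>

context oscillator
begin

lemma W_bound:
  assumes "degle d f"
  shows "fnorm (W s a f) \<le> 2 * sqrt (Suc d) * fnorm f" "degle (Suc d) (W s a f)"
proof -
  have 1: "fnorm (zv v * f) + fnorm (dv w f) \<le> 2 * sqrt (Suc d) * fnorm f" for v w
    using fnorm_X_le[OF assms, of v] fnorm_dv_le[OF assms, of w] by simp
  have d: "degle (Suc d) (zv v * f)" "degle (Suc d) (dv w f)" for v w
    using degle_X[OF assms, of v] degle_dv[OF assms, of w] by (auto simp: degle_def)
  have m: "degle (Suc d) (zv v * f - dv w f)" for v w
    using degle_add[OF d(1)[of v] degle_C[OF d(2)[of w], of "- 1"]] by (simp add: C_minus)
  show "fnorm (W s a f) \<le> 2 * sqrt (Suc d) * fnorm f"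
  proof (cases s)
    case (Inl i)
    then show ?thesis unfolding W_def using order_trans[OF fnorm_add 1] by simp
  next
    case (Inr i)
    then show ?thesis unfolding W_def using order_trans[OF fnorm_diff 1] by (simp add: fnorm_C)
  qed
  show "degle (Suc d) (W s a f)" by (cases s) (auto simp: W_def intro!: degle_add degle_C d m)
qed

lemma WW_bound:
  assumes "degle d f"
  shows "fnorm (W s a (W t b f)) \<le> 4 * (real d + 2) * fnorm f" "degle (d + 2) (W s a (W t b f))"
proof -
  note 1 = W_bound[OF assms, of t b]
  note 2 = W_bound[OF 1(2), of s a]
  have "fnorm (W s a (W t b f)) \<le> 2 * sqrt (Suc (Suc d)) * (2 * sqrt (Suc (Suc d)) * fnorm f)"
  proof (rule order_trans[OF 2(1)], intro mult_left_mono order_trans[OF 1(1)] mult_right_mono)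
    show "0 \<le> fnorm f" by (rule fnorm_nonneg)
  qed auto
  also have "\<dots> = 4 * (sqrt (Suc (Suc d)) * sqrt (Suc (Suc d))) * fnorm f" by (simp only: mult_ac)
  also have "sqrt (Suc (Suc d)) * sqrt (Suc (Suc d)) = real d + 2" by simp
  finally show "fnorm (W s a (W t b f)) \<le> 4 * (real d + 2) * fnorm f" .
  show "degle (d + 2) (W s a (W t b f))" using 2(2) by simp
qed

text \<open>The number of terms in the triple sum G. The factor 4 from two generators cancels the
  1/4 of \<rho>F.\<close>

definition c0 :: real where "c0 = real k * (real CARD('n + 'n))\<^sup>2"

lemma \<rho>F_bound:
  assumes d: "degle d f" and M: "\<And>s t. cmod (SX Y s t) \<le> M"
  shows "fnorm (\<rho>F Y f) \<le> M * c0 * (real d + 2) * fnorm f" "degle (d + 2) (\<rho>F Y f)"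
proof -
  let ?B = "4 * (real d + 2) * fnorm f"
  have M0: "0 \<le> M" using M order_trans norm_ge_zero by blast
  have "fnorm (G (SX Y) f) \<le> (\<Sum>s\<in>(UNIV::('n+'n) set). \<Sum>t\<in>(UNIV::('n+'n) set). M * (real k * ?B))"
    unfolding G_def
  proof (intro order_trans[OF fnorm_sum] sum_mono)
    fix s t
    have "fnorm (\<Sum>a<k. W s a (W t (\<tau> a) f)) \<le> (\<Sum>a<k. ?B)"
      by (intro order_trans[OF fnorm_sum] sum_mono WW_bound[OF d])
    then show "fnorm (C (SX Y s t) * (\<Sum>a<k. W s a (W t (\<tau> a) f))) \<le> M * (real k * ?B)"
      unfolding fnorm_C by (intro mult_mono M M0 fnorm_nonneg) simp
  qed
  also have "\<dots> = 4 * (M * c0 * (real d + 2) * fnorm f)" by (simp add: c0_def power2_eq_square mult_ac)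
  finally show "fnorm (\<rho>F Y f) \<le> M * c0 * (real d + 2) * fnorm f" by (simp add: \<rho>F_def fnorm_C)
  show "degle (d + 2) (\<rho>F Y f)" unfolding \<rho>F_def G_def by (intro degle_C degle_sum WW_bound[OF d])
qed

definition \<rho>A :: "('n + 'n) sqmat \<Rightarrow> fock \<Rightarrow> fock" where "\<rho>A X = \<rho>F (complexify (to_mat X))"

text \<open>After l factors the degree is at most d + 2 l, so the next factor costs c0 norm X (d + 2
  l + 2), at most 2 c0 norm X (d + l + 1). The numbers d + l + 1 multiply up to (d + l)! / d!,
  written here without the quotient.\<close>

lemma \<rho>A_word_bound:
  assumes "degle d w"
  shows "fact d * fnorm (foldr \<rho>A Xs w) \<le> fact (d + length Xs) * (\<Prod>X\<leftarrow>Xs. 2 * c0 * norm X) * fnorm w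
    \<and> degle (d + 2 * length Xs) (foldr \<rho>A Xs w)"
proof (induction Xs)
  case (Cons X Xs)
  let ?f = "foldr \<rho>A Xs w" and ?l = "length Xs" and ?P = "\<Prod>X\<leftarrow>Xs. 2 * c0 * norm X"
  have c0: "0 \<le> c0" by (simp add: c0_def)
  have SX: "cmod (SX (complexify (to_mat X)) s t) \<le> norm X" for s t using norm_to_mat_component[of X]
    by (cases t) (simp_all add: SX_def mult_symp_form_entries map_matrix_def norm_mult)
  note b = \<rho>F_bound[OF conjunct2[OF Cons] SX]
  have "fact d * fnorm (\<rho>A X ?f) \<le> fact d * (norm X * c0 * (real (d + 2 * ?l) + 2) * fnorm ?f)"
    by (rule mult_left_mono[OF b(1)[folded \<rho>A_def]]) simp
  also have "\<dots> = norm X * c0 * (real (d + 2 * ?l) + 2) * (fact d * fnorm ?f)" by (simp only: mult_ac)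
  also have "\<dots> \<le> norm X * c0 * (2 * real (Suc (d + ?l))) * (fact (d + ?l) * ?P * fnorm w)"
  proof (rule mult_mono)
    show "norm X * c0 * (real (d + 2 * ?l) + 2) \<le> norm X * c0 * (2 * real (Suc (d + ?l)))"
      using c0 by (intro mult_left_mono) auto
  qed (use c0 Cons fnorm_nonneg in auto)
  also have "\<dots> = fact (d + length (X # Xs)) * (\<Prod>X\<leftarrow>X # Xs. 2 * c0 * norm X) * fnorm w"
    by (simp add: mult_ac del: of_nat_Suc)
  finally have 1: "fact d * fnorm (\<rho>A X ?f) \<le> \<dots>" .
  have 2: "degle (d + 2 * length (X # Xs)) (\<rho>A X ?f)" using b(2)[folded \<rho>A_def] by simp
  show ?case using 1 2 by simp
qed (use assms in simp)

lemma prod_list_map_mult: "(\<Prod>X\<leftarrow>Xs. c * f X) = c ^ length Xs * (\<Prod>X\<leftarrow>Xs. f X)" for c :: real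
  by (induction Xs) (auto simp: mult_ac)

text \<open>The bound (d + l)! \<le> d! l! 2^(d + l) doubles the constant 2 c0 of each letter and
  puts 2^d into the constant of the vector. The summand 1 keeps the radius constant at least 1 even
  for k = 0.\<close>

lemma Sp_rep_\<rho>A: "Sp_rep iota \<rho>A (4 * c0 + 1)"
proof (intro Sp_rep.intro unitary_analytic_rep.intro analytic_rep.intro unitary_analytic_rep_axioms.intro)
  have c0: "0 \<le> c0" by (simp add: c0_def)
  show "star_algebra (symp_star :: ('n + 'n) sqmat \<Rightarrow> ('n + 'n) sqmat)" by (rule sp.star_algebra_axioms)
  show "closure (range iota) = UNIV" by (rule dense_iota)
  show "linear iota" by (rule linear_iota)
  show "linear (\<rho>A X)" for X by (rule linearI) (simp_all add: \<rho>A_def \<rho>F_add \<rho>F_C scaleR_fock)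
  have cm: "complexify (A + B) = complexify A + complexify B" "complexify (r *\<^sub>R A) = mscale (of_real r) (complexify A)"
     "complexify (A - B) = complexify A - complexify B" for A B :: "(real, 'n) mat2" and r
    by (simp_all add: map_matrix_def vec_eq_iff)
  show "linear (\<lambda>X. \<rho>A X w)" for w by (rule linearI)
      (simp_all add: \<rho>A_def linear_add[OF linear_to_mat] linear_scale[OF linear_to_mat] cm \<rho>F_add_mat \<rho>F_scale_mat scaleR_fock)
  show "1 \<le> 4 * c0 + 1" using c0 by simp
  show "\<exists>M. \<forall>Xs. norm (iota (foldr \<rho>A Xs w)) \<le> M * fact (length Xs) * (\<Prod>X\<leftarrow>Xs. (4 * c0 + 1) * norm X)" for w
  proof -
    obtain d where d: "degle d w" using ex_degle by blast
    have "fnorm (foldr \<rho>A Xs w) \<le> (2 ^ d * fnorm w) * fact (length Xs) * (\<Prod>X\<leftarrow>Xs. (4 * c0 + 1) * norm X)" for Xs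
    proof -
      let ?l = "length Xs" and ?P = "\<Prod>X\<leftarrow>Xs. norm X"
      have P0: "0 \<le> ?P" by (induction Xs) auto
      have "fact (d + ?l) = (fact d * fact ?l * real (d + ?l choose d))"
        using binomial_fact_lemma[of d "d + ?l"] by (metis add_diff_cancel_left' le_add1 of_nat_fact of_nat_mult)
      also have "\<dots> \<le> fact d * fact ?l * real (2 ^ (d + ?l))"
        by (intro mult_left_mono of_nat_mono binomial_le_pow2) simp
      finally have f: "fact (d + ?l) \<le> fact d * (fact ?l * (2 ^ d * 2 ^ ?l) :: real)" by (simp add: power_add mult_ac)
      have "fact d * fnorm (foldr \<rho>A Xs w) \<le> fact (d + ?l) * ((2 * c0) ^ ?l * ?P) * fnorm w"
        using \<rho>A_word_bound[OF d, of Xs] by (simp only: prod_list_map_mult)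
      also have "\<dots> \<le> fact d * (fact ?l * (2 ^ d * 2 ^ ?l)) * ((2 * c0) ^ ?l * ?P) * fnorm w"
        using c0 P0 fnorm_nonneg by (intro mult_right_mono f mult_nonneg_nonneg) auto
      also have "\<dots> = fact d * (fact ?l * 2 ^ d * ((2 * (2 * c0)) ^ ?l * ?P) * fnorm w)"
        by (simp only: power_mult_distrib mult_ac)
      finally have "fnorm (foldr \<rho>A Xs w) \<le> fact ?l * 2 ^ d * ((2 * (2 * c0)) ^ ?l * ?P) * fnorm w"
        by (simp only: mult_le_cancel_left_pos[OF fact_gt_zero])
      also have "\<dots> \<le> fact ?l * 2 ^ d * ((4 * c0 + 1) ^ ?l * ?P) * fnorm w"
        using c0 P0 fnorm_nonneg by (intro mult_right_mono mult_left_mono power_mono) auto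
      finally show ?thesis unfolding prod_list_map_mult by (simp only: mult_ac)
    qed
    then show ?thesis unfolding norm_iota by blast
  qed
  fix X :: "('n + 'n) sqmat" assume sX: "symp_star X = - X"
  then have X: "complexify (to_mat X) \<in> sp_alg" by (simp add: complexify_sp sp_alg_iff)
  show "inner (iota (\<rho>A X v)) (iota w) = - inner (iota v) (iota (\<rho>A X w))" for v w
    unfolding inner_iota \<rho>A_def using hr_\<rho>F[OF X, of v w] by (simp only: cnj_complexify)
  fix Y :: "('n + 'n) sqmat" assume sY: "symp_star Y = - Y"
  then have Y: "complexify (to_mat Y) \<in> sp_alg" by (simp add: complexify_sp sp_alg_iff)
  have "complexify (A ** B) = complexify A ** complexify B" for A B :: "(real, 'n) mat2"
    by (simp add: map_matrix_def vec_eq_iff matrix_mult_entry)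
  then have e: "complexify (to_mat (X * Y - Y * X)) = bracket (complexify (to_mat X)) (complexify (to_mat Y))"
    by (simp only: bracket_def linear_diff[OF linear_to_mat] cm to_mat_mult)
  show "\<rho>A (X * Y - Y * X) w = \<rho>A X (\<rho>A Y w) - \<rho>A Y (\<rho>A X w)" for w
    unfolding \<rho>A_def e by (rule \<rho>F_bracket[OF X Y])
qed (use sqmat_coordinates in auto)

end

section \<open>Root vectors and the operators by which they act\<close>

definition blk :: "('n \<Rightarrow> 'n \<Rightarrow> complex) \<Rightarrow> ('n \<Rightarrow> 'n \<Rightarrow> complex) \<Rightarrow> ('n \<Rightarrow> 'n \<Rightarrow> complex) \<Rightarrow> ('n \<Rightarrow> 'n \<Rightarrow> complex) \<Rightarrow> (complex, 'n::finite) mat2" where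
  "blk A B E D = (\<chi> s t. case s of Inl p \<Rightarrow> (case t of Inl q \<Rightarrow> A p q | Inr q \<Rightarrow> B p q)
     | Inr p \<Rightarrow> (case t of Inl q \<Rightarrow> E p q | Inr q \<Rightarrow> D p q))"

lemma blk_entries [simp]:
  "blk A B E D $ Inl p $ Inl q = A p q" "blk A B E D $ Inl p $ Inr q = B p q"
  "blk A B E D $ Inr p $ Inl q = E p q" "blk A B E D $ Inr p $ Inr q = D p q" by (simp_all add: blk_def)

definition dl :: "'n \<Rightarrow> 'n \<Rightarrow> 'n \<Rightarrow> 'n \<Rightarrow> complex" where
  "dl i j p q = (if p = i \<and> q = j then 1 else 0)"

text \<open>Rm, Rp and Rk lie in p^-, p^+ and k. They are normalised so that the expansion
  \<open>sp_decomposition\<close> has the plain coefficients \<open>al\<close>, \<open>ga\<close>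
  and \<open>be\<close>.\<close>

definition Rm :: "'n \<Rightarrow> 'n \<Rightarrow> (complex, 'n::finite) mat2" where
  "Rm i j = (let S = \<lambda>p q. (dl i j p q + dl j i p q) / 8 in blk (\<lambda>p q. - S p q) (\<lambda>p q. \<i> * S p q) (\<lambda>p q. \<i> * S p q) S)"

definition Rp :: "'n \<Rightarrow> 'n \<Rightarrow> (complex, 'n::finite) mat2" where
  "Rp i j = (let S = \<lambda>p q. (dl i j p q + dl j i p q) / 8 in blk S (\<lambda>p q. \<i> * S p q) (\<lambda>p q. \<i> * S p q) (\<lambda>p q. - S p q))"

definition Rk :: "'n \<Rightarrow> 'n \<Rightarrow> (complex, 'n::finite) mat2" where
  "Rk i j = (let A = \<lambda>p q. (dl i j p q - dl j i p q) / 4; S = \<lambda>p q. \<i> * (dl i j p q + dl j i p q) / 4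
     in blk A S (\<lambda>p q. - S p q) A)"

text \<open>\<open>al\<close>, \<open>be\<close> and \<open>ga\<close> are read off from the normal
  ordering in \<open>\<rho>F_expand\<close>: they are the coefficients there of products of two
  variables, of a variable times a derivative (doubled), and of two derivatives.\<close>

definition al :: "(complex, 'n::finite) mat2 \<Rightarrow> 'n \<Rightarrow> 'n \<Rightarrow> complex" where
  "al X p q = - \<i> * X $ Inl p $ Inr q - X $ Inl p $ Inl q + X $ Inr p $ Inr q - \<i> * X $ Inr p $ Inl q"
definition be :: "(complex, 'n::finite) mat2 \<Rightarrow> 'n \<Rightarrow> 'n \<Rightarrow> complex" where
  "be X p q = - \<i> * X $ Inl p $ Inr q + X $ Inl p $ Inl q + X $ Inr p $ Inr q + \<i> * X $ Inr p $ Inl q"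
definition ga :: "(complex, 'n::finite) mat2 \<Rightarrow> 'n \<Rightarrow> 'n \<Rightarrow> complex" where
  "ga X p q = - \<i> * X $ Inl p $ Inr q + X $ Inl p $ Inl q - X $ Inr p $ Inr q - \<i> * X $ Inr p $ Inl q"

lemma dl_swap: "dl i j p q = dl j i q p" by (auto simp: dl_def)

lemma R_sp: fixes i j :: "'n::finite" shows "Rm i j \<in> sp_alg" "Rp i j \<in> sp_alg" "Rk i j \<in> sp_alg"
proof -
  have d: "dl j i q p = dl i j p q" for p q by (rule dl_swap)
  show "Rm i j \<in> sp_alg" unfolding sp_alg_entries Rm_def Let_def blk_entries by (simp add: d add.commute)
  show "Rp i j \<in> sp_alg" unfolding sp_alg_entries Rp_def Let_def blk_entries by (simp add: d add.commute)
  show "Rk i j \<in> sp_alg" unfolding sp_alg_entries Rk_def Let_def blk_entries by (simp add: d add.commute field_simps)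
qed

lemma Rk_compact: fixes i j :: "'n::finite" shows "Rk i j \<in> sp_compact"
proof -
  have d: "dl j i q p = dl i j p q" for p q by (rule dl_swap)
  have "- transpose (Rk i j) = Rk i j" unfolding vec_eq_iff
  proof (intro allI)
    fix s t show "(- transpose (Rk i j)) $ s $ t = Rk i j $ s $ t"
      by (cases s; cases t) (simp_all add: transpose_def Rk_def Let_def d field_simps)
  qed
  then show ?thesis by (simp add: sp_compact_def R_sp)
qed

lemma sum_if_pair: "(\<Sum>i\<in>UNIV. \<Sum>j\<in>UNIV. if i = p \<and> j = q then F i j else 0) = (F p q :: 'b::comm_monoid_add)"
  for p q :: "'n::finite"
proof -
  have "(\<Sum>j\<in>UNIV. if i = p \<and> j = q then F i j else 0) = (if i = p then F i q else 0)" for i by simp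
  then show ?thesis by simp
qed

lemma sum_dl:
  fixes p q :: "'n::finite"
  shows "(\<Sum>i\<in>UNIV. \<Sum>j\<in>UNIV. c i j * dl i j p q) = c p q" "(\<Sum>i\<in>UNIV. \<Sum>j\<in>UNIV. c i j * dl j i p q) = c q p"
proof -
  have 1: "(\<Sum>i\<in>UNIV. \<Sum>j\<in>UNIV. c i j * dl i j p q) = c p q" for c :: "'n \<Rightarrow> 'n \<Rightarrow> complex" and p q
    by (subst sum_if_pair[symmetric], intro sum.cong refl) (auto simp: dl_def)
  show "(\<Sum>i\<in>UNIV. \<Sum>j\<in>UNIV. c i j * dl i j p q) = c p q" by (rule 1)
  show "(\<Sum>i\<in>UNIV. \<Sum>j\<in>UNIV. c i j * dl j i p q) = c q p" using 1[of c q p] by (simp add: dl_swap[of _ _ p q])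
qed

lemma sum_mscale_entry:
  "(\<Sum>i\<in>UNIV. \<Sum>j\<in>UNIV. mscale (a i j) (A i j) + mscale (b i j) (B i j) + mscale (c i j) (D i j)) $ s $ t
    = (\<Sum>i\<in>UNIV. \<Sum>j\<in>UNIV. a i j * A i j $ s $ t) + (\<Sum>i\<in>UNIV. \<Sum>j\<in>UNIV. b i j * B i j $ s $ t) + (\<Sum>i\<in>UNIV. \<Sum>j\<in>UNIV. c i j * D i j $ s $ t)"
  by (simp add: sum_component map_matrix_def sum.distrib)

lemma sp_decomposition:
  fixes X :: "(complex, 'n::finite) mat2"
  assumes X: "X \<in> sp_alg"
  shows "X = (\<Sum>i\<in>UNIV. \<Sum>j\<in>UNIV. mscale (al X i j) (Rm i j) + mscale (be X i j) (Rk i j) + mscale (ga X i j) (Rp i j))"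
proof -
  have *: "(\<Sum>i\<in>UNIV. \<Sum>j\<in>UNIV. c i j * (x * (dl i j p q + y * dl j i p q))) = x * (c p q + y * c q p)" for c :: "'n \<Rightarrow> 'n \<Rightarrow> complex" and x y p q
  proof -
    have "(\<Sum>i\<in>UNIV. \<Sum>j\<in>UNIV. c i j * (x * (dl i j p q + y * dl j i p q))) = x * ((\<Sum>i\<in>UNIV. \<Sum>j\<in>UNIV. c i j * dl i j p q) + y * (\<Sum>i\<in>UNIV. \<Sum>j\<in>UNIV. c i j * dl j i p q))"
      by (simp add: sum.distrib sum_distrib_left algebra_simps)
    then show ?thesis unfolding sum_dl .
  qed
  have r: "X $ Inr i $ Inr j = - X $ Inl j $ Inl i" "X $ Inl i $ Inr j = X $ Inl j $ Inr i" "X $ Inr i $ Inl j = X $ Inr j $ Inl i" for i j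
    using X unfolding sp_alg_entries by blast+
  have RM: "Rm i j $ Inl p $ Inl q = (- 1/8) * (dl i j p q + 1 * dl j i p q)" "Rm i j $ Inl p $ Inr q = (\<i>/8) * (dl i j p q + 1 * dl j i p q)"
    "Rm i j $ Inr p $ Inl q = (\<i>/8) * (dl i j p q + 1 * dl j i p q)" "Rm i j $ Inr p $ Inr q = (1/8) * (dl i j p q + 1 * dl j i p q)"
    "Rp i j $ Inl p $ Inl q = (1/8) * (dl i j p q + 1 * dl j i p q)" "Rp i j $ Inl p $ Inr q = (\<i>/8) * (dl i j p q + 1 * dl j i p q)"
    "Rp i j $ Inr p $ Inl q = (\<i>/8) * (dl i j p q + 1 * dl j i p q)" "Rp i j $ Inr p $ Inr q = (- 1/8) * (dl i j p q + 1 * dl j i p q)"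
    "Rk i j $ Inl p $ Inl q = (1/4) * (dl i j p q + (- 1) * dl j i p q)" "Rk i j $ Inl p $ Inr q = (\<i>/4) * (dl i j p q + 1 * dl j i p q)"
    "Rk i j $ Inr p $ Inl q = (- \<i>/4) * (dl i j p q + 1 * dl j i p q)" "Rk i j $ Inr p $ Inr q = (1/4) * (dl i j p q + (- 1) * dl j i p q)"
    for i j p q :: 'n
    by (simp_all add: Rm_def Rp_def Rk_def Let_def field_simps)
  show ?thesis
  proof (subst vec_eq_iff, intro allI, subst vec_eq_iff, intro allI)
    fix s t
    show "X $ s $ t = (\<Sum>i\<in>UNIV. \<Sum>j\<in>UNIV. mscale (al X i j) (Rm i j) + mscale (be X i j) (Rk i j) + mscale (ga X i j) (Rp i j)) $ s $ t"
    proof (cases s; cases t)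
      fix p q assume "s = Inl p" "t = Inl q"
      then show ?thesis by (simp only: sum_mscale_entry RM *) (simp add: al_def be_def ga_def r(1) r(2,3)[of q p] field_simps)
    next
      fix p q assume "s = Inl p" "t = Inr q"
      then show ?thesis by (simp only: sum_mscale_entry RM *) (simp add: al_def be_def ga_def r(1) r(2,3)[of q p] field_simps)
    next
      fix p q assume "s = Inr p" "t = Inl q"
      then show ?thesis by (simp only: sum_mscale_entry RM *) (simp add: al_def be_def ga_def r(1) r(2,3)[of q p] field_simps)
    next
      fix p q assume "s = Inr p" "t = Inr q"
      then show ?thesis by (simp only: sum_mscale_entry RM *) (simp add: al_def be_def ga_def r(1) r(2,3)[of q p] field_simps)
    qed
  qed
qed

lemma cartan_entries [simp]:
  "cartan h $ Inl p $ Inl q = 0" "cartan h $ Inl p $ Inr q = (if p = q then - \<i> * h $ p else 0)"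
  "cartan h $ Inr p $ Inl q = (if p = q then \<i> * h $ p else 0)" "cartan h $ Inr p $ Inr q = 0"
  by (simp_all add: cartan_def)

lemma cartan_mult:
  "(cartan h ** X) $ Inl p $ t = - \<i> * h $ p * X $ Inr p $ t" "(cartan h ** X) $ Inr p $ t = \<i> * h $ p * X $ Inl p $ t"
  "(X ** cartan h) $ s $ Inl q = \<i> * h $ q * X $ s $ Inr q" "(X ** cartan h) $ s $ Inr q = - \<i> * h $ q * X $ s $ Inl q"
  by (simp_all add: matrix_mult_entry sum_UNIV_sum_type if_distrib[of "\<lambda>x. x * _"] if_distrib[of "\<lambda>x. _ * x"] mult_ac cong: if_cong)

lemma cartan_compact: "cartan h \<in> sp_compact"
proof -
  have "cartan h \<in> sp_alg" by (auto simp: sp_alg_entries)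
  moreover have "- transpose (cartan h) = cartan h" unfolding vec_eq_iff
  proof (intro allI)
    fix s t show "(- transpose (cartan h)) $ s $ t = cartan h $ s $ t"
      by (cases s; cases t) (auto simp: transpose_def)
  qed
  ultimately show ?thesis by (simp add: sp_compact_def)
qed

lemma cartan_sp: "cartan h \<in> sp_alg" using cartan_compact by (auto simp: sp_compact_def)

text \<open>The order of indices matters for Rk: its root is \<epsilon>_j - \<epsilon>_i, so the
  raising operators of k are the Rk i j with j < i.\<close>

lemma R_roots:
  fixes i j :: "'n::finite"
  shows
  "Rm i j \<in> root_space (\<lambda>h. - (h $ i + h $ j))" "Rp i j \<in> root_space (\<lambda>h. h $ i + h $ j)" "Rk i j \<in> root_space (\<lambda>h. h $ j - h $ i)"
proof -
  have *: "X \<in> root_space a" if "X \<in> sp_alg" "\<And>h s t. (cartan h ** X) $ s $ t - (X ** cartan h) $ s $ t = a h * X $ s $ t" for X :: "(complex, 'n) mat2" and a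
    using that by (simp add: root_space_def bracket_def vec_eq_iff map_matrix_def)
  have d: P if "dl i j p q = 0 \<Longrightarrow> dl j i p q = 0 \<Longrightarrow> P" "p = i \<Longrightarrow> q = j \<Longrightarrow> P" "p = j \<Longrightarrow> q = i \<Longrightarrow> P" for P p q
    using that unfolding dl_def by metis
  have pq: "\<exists>p. s = Inl p \<or> s = Inr p" for s :: "'n + 'n" by (cases s) auto
  show "Rm i j \<in> root_space (\<lambda>h. - (h $ i + h $ j))"
  proof (rule *)
    fix h s t show "(cartan h ** Rm i j) $ s $ t - (Rm i j ** cartan h) $ s $ t = - (h $ i + h $ j) * Rm i j $ s $ t"
      using pq[of s] pq[of t]
      by (elim exE disjE; hypsubst; simp only: cartan_mult Rm_def Let_def blk_entries; rule_tac p=p and q=pa in d; simp add: field_simps; auto simp: dl_def)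
  qed (rule R_sp)
  show "Rp i j \<in> root_space (\<lambda>h. h $ i + h $ j)"
  proof (rule *)
    fix h s t show "(cartan h ** Rp i j) $ s $ t - (Rp i j ** cartan h) $ s $ t = (h $ i + h $ j) * Rp i j $ s $ t"
      using pq[of s] pq[of t]
      by (elim exE disjE; hypsubst; simp only: cartan_mult Rp_def Let_def blk_entries; rule_tac p=p and q=pa in d; simp add: field_simps; auto simp: dl_def)
  qed (rule R_sp)
  show "Rk i j \<in> root_space (\<lambda>h. h $ j - h $ i)"
  proof (rule *)
    fix h s t show "(cartan h ** Rk i j) $ s $ t - (Rk i j ** cartan h) $ s $ t = (h $ j - h $ i) * Rk i j $ s $ t"
      using pq[of s] pq[of t]
      by (elim exE disjE; hypsubst; simp only: cartan_mult Rk_def Let_def blk_entries; rule_tac p=p and q=pa in d; (simp; fail | cases "i = j"; simp add: dl_def field_simps))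
  qed (rule R_sp)
qed

lemma vector_space_mscale: "vector_space (mscale :: complex \<Rightarrow> (complex, 'n::finite) mat2 \<Rightarrow> _)"
  by unfold_locales (simp_all add: map_matrix_def vec_eq_iff algebra_simps)

lemma Rp_plus: fixes i j :: "'n::{finite,linorder}" shows "Rp i j \<in> sp_plus"
proof -
  interpret vector_space "mscale :: complex \<Rightarrow> (complex, 'n) mat2 \<Rightarrow> _" by (rule vector_space_mscale)
  have *: "Rp i j \<in> sp_plus" if "i \<le> j" for i j :: 'n
    unfolding sp_plus_def by (rule span_base) (use that R_roots(2)[of i j] in auto)
  have "Rp i j = Rp j i" by (simp add: Rp_def add.commute)
  then show ?thesis using *[of i j] *[of j i] linear[of i j] by auto
qed

context oscillator
begin

text \<open>Normal ordering: moving a derivative to the right of the matching variable leaves one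
  copy of f for each of the k columns. This is the origin of the shift by k / 2 in all
  weights.\<close>

lemma \<rho>F_expand:
  assumes Y: "Y \<in> sp_alg"
  shows "\<rho>F Y f = C (1/4) * ((\<Sum>i\<in>UNIV. \<Sum>j\<in>UNIV. C (al Y i j) * (\<Sum>a<k. zv (var i a) * (zv (var j (\<tau> a)) * f)))
     + (\<Sum>i\<in>UNIV. \<Sum>j\<in>UNIV. C (ga Y i j) * (\<Sum>a<k. dv (var i (\<tau> a)) (dv (var j a) f)))
     + (\<Sum>i\<in>UNIV. \<Sum>j\<in>UNIV. C (2 * be Y i j) * (\<Sum>a<k. zv (var i a) * dv (var j a) f))
     + (\<Sum>i\<in>UNIV. C (of_nat k * be Y i i) * f))"
proof -
  define ZZ ZD DD DZ where "ZZ i j = (\<Sum>a<k. zv (var i a) * (zv (var j (\<tau> a)) * f))"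
    and "ZD i j = (\<Sum>a<k. zv (var i a) * dv (var j a) f)"
    and "DD i j = (\<Sum>a<k. dv (var i (\<tau> a)) (dv (var j a) f))"
    and "DZ i j = (\<Sum>a<k. dv (var i (\<tau> a)) (zv (var j (\<tau> a)) * f))" for i j :: 'n
  have r: "Y $ Inr i $ Inr j = - Y $ Inl j $ Inl i" "Y $ Inl i $ Inr j = Y $ Inl j $ Inr i" "Y $ Inr i $ Inl j = Y $ Inr j $ Inl i" for i j
    using Y unfolding sp_alg_entries by blast+
  have DZ: "DZ i j = ZD j i + (if i = j then C (of_nat k) * f else 0)" for i j
  proof -
    have "DZ i j = (\<Sum>a<k. dv (var i a) (zv (var j a) * f))" unfolding DZ_def by (rule sum_\<tau>)
    also have "\<dots> = ZD j i + (\<Sum>a<k. if i = j then f else 0)"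
      unfolding ZD_def sum.distrib[symmetric] by (intro sum.cong refl) (simp add: dv_X_mult)
    also have "(\<Sum>a<k. if i = j then f else 0) = (if i = j then C (of_nat k) * f else 0)"
      using C_sum[of "\<lambda>_. 1" "{..<k}"] by simp
    finally show ?thesis .
  qed
  have WL: "W (Inl i) a g = zv (var i a) * g + dv (var i (\<tau> a)) g" and WR: "W (Inr i) a g = C \<i> * (zv (var i a) * g - dv (var i (\<tau> a)) g)" for i a g
    by (simp_all add: W_def)
  have WW: "(\<Sum>a<k. W (Inl i) a (W (Inl j) (\<tau> a) f)) = ZZ i j + ZD i j + DZ i j + DD i j"
    "(\<Sum>a<k. W (Inl i) a (W (Inr j) (\<tau> a) f)) = C \<i> * (ZZ i j - ZD i j + DZ i j - DD i j)"
    "(\<Sum>a<k. W (Inr i) a (W (Inl j) (\<tau> a) f)) = C \<i> * (ZZ i j + ZD i j - DZ i j - DD i j)"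
    "(\<Sum>a<k. W (Inr i) a (W (Inr j) (\<tau> a) f)) = - (ZZ i j - ZD i j - DZ i j + DD i j)" for i j
    unfolding ZZ_def ZD_def DZ_def DD_def sum.distrib[symmetric] sum_subtractf[symmetric] sum_distrib_left sum_negf[symmetric]
    by (intro sum.cong refl, simp only: lessThan_iff WL WR \<tau>_\<tau> dv_C_mult mult.left_commute[of "zv _" "C \<i>"] C_i_i distrib_left right_diff_distrib dv_add dv_diff minus_diff_eq minus_add_distrib, simp only: diff_conv_add_uminus minus_add_distrib minus_minus add_ac)+
  have S: "SX Y (Inl i) (Inl j) = - \<i> * Y $ Inl i $ Inr j" "SX Y (Inl i) (Inr j) = \<i> * Y $ Inl i $ Inl j"
    "SX Y (Inr i) (Inl j) = - \<i> * Y $ Inr i $ Inr j" "SX Y (Inr i) (Inr j) = \<i> * Y $ Inr i $ Inl j" for i j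
    by (simp_all add: SX_def mult_symp_form_entries)
  have be': "- \<i> * Y $ Inl i $ Inr j - Y $ Inl i $ Inl j - Y $ Inr i $ Inr j + \<i> * Y $ Inr i $ Inl j = be Y j i" for i j
    by (simp add: be_def r(1) r(2,3)[of i j])
  have e: "C (- \<i> * B) * (z + zd + dz + dd) + C (\<i> * A) * (C \<i> * (z - zd + dz - dd)) + (C (- \<i> * D) * (C \<i> * (z + zd - dz - dd)) + C (\<i> * E) * (- (z - zd - dz + dd)))
     = C (- \<i> * B - A + D - \<i> * E) * z + C (- \<i> * B + A - D - \<i> * E) * dd + (C (- \<i> * B + A + D + \<i> * E) * zd + C (- \<i> * B - A - D + \<i> * E) * dz)"
     (is "?l = ?r") for A B D E and z zd dz dd :: fock
  proof (rule poly_mapping_eqI)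
    fix \<alpha>
    have i: "(\<i> * x) * (\<i> * y) = - (x * y)" "(- \<i> * x) * (\<i> * y) = x * y" for x y by (simp_all add: complex_eq_iff algebra_simps)
    show "lk ?l \<alpha> = lk ?r \<alpha>"
      unfolding lookup_add lk_C_mult lookup_minus lookup_uminus i by (simp add: algebra_simps)
  qed
  have "G (SX Y) f = (\<Sum>i\<in>UNIV. \<Sum>j\<in>UNIV. C (al Y i j) * ZZ i j + C (ga Y i j) * DD i j + (C (be Y i j) * ZD i j + C (be Y j i) * DZ i j))"
  proof -
    have "G (SX Y) f = (\<Sum>i\<in>UNIV. \<Sum>j\<in>UNIV. C (- \<i> * Y $ Inl i $ Inr j) * (ZZ i j + ZD i j + DZ i j + DD i j)
      + C (\<i> * Y $ Inl i $ Inl j) * (C \<i> * (ZZ i j - ZD i j + DZ i j - DD i j)) + (C (- \<i> * Y $ Inr i $ Inr j) * (C \<i> * (ZZ i j + ZD i j - DZ i j - DD i j)) + C (\<i> * Y $ Inr i $ Inl j) * (- (ZZ i j - ZD i j - DZ i j + DD i j))))"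
      unfolding G_def sum_UNIV_sum_type WW S by (simp only: sum.distrib add_ac)
    then show ?thesis unfolding e be' al_def[symmetric] be_def[symmetric] ga_def[symmetric] .
  qed
  also have "\<dots> = (\<Sum>i\<in>UNIV. \<Sum>j\<in>UNIV. C (al Y i j) * ZZ i j) + (\<Sum>i\<in>UNIV. \<Sum>j\<in>UNIV. C (ga Y i j) * DD i j)
     + ((\<Sum>i\<in>UNIV. \<Sum>j\<in>UNIV. C (be Y i j) * ZD i j) + (\<Sum>i\<in>UNIV. \<Sum>j\<in>UNIV. C (be Y j i) * DZ i j))"
    by (simp only: sum.distrib)
  also have "(\<Sum>i\<in>UNIV. \<Sum>j\<in>UNIV. C (be Y j i) * DZ i j) = (\<Sum>i\<in>UNIV. \<Sum>j\<in>UNIV. C (be Y i j) * ZD i j) + (\<Sum>i\<in>UNIV. C (of_nat k * be Y i i) * f)"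
  proof -
    have "(\<Sum>i\<in>UNIV. \<Sum>j\<in>UNIV. C (be Y j i) * DZ i j) = (\<Sum>i\<in>UNIV. \<Sum>j\<in>UNIV. C (be Y j i) * ZD j i) + (\<Sum>i\<in>UNIV. \<Sum>j\<in>UNIV. if i = j then C (of_nat k * be Y i i) * f else 0)"
      unfolding sum.distrib[symmetric] DZ by (intro sum.cong refl) (auto simp: distrib_left C_mult mult_ac)
    also have "(\<Sum>i\<in>UNIV. \<Sum>j\<in>UNIV. C (be Y j i) * ZD j i) = (\<Sum>i\<in>UNIV. \<Sum>j\<in>UNIV. C (be Y i j) * ZD i j)" by (rule sum.swap)
    finally show ?thesis by simp
  qed
  finally have "G (SX Y) f = (\<Sum>i\<in>UNIV. \<Sum>j\<in>UNIV. C (al Y i j) * ZZ i j) + (\<Sum>i\<in>UNIV. \<Sum>j\<in>UNIV. C (ga Y i j) * DD i j)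
     + (\<Sum>i\<in>UNIV. \<Sum>j\<in>UNIV. C (2 * be Y i j) * ZD i j) + (\<Sum>i\<in>UNIV. C (of_nat k * be Y i i) * f)"
    by (simp only: mult_2 C_add distrib_right sum.distrib add.assoc)
  then show ?thesis unfolding \<rho>F_def ZZ_def ZD_def DD_def by simp
qed

lemma sum_sum_dl: "(\<Sum>i\<in>UNIV. \<Sum>j\<in>UNIV. C (c * dl p q i j) * F i j) = C c * F p (q::'n)"
  by (subst sum_if_pair[where F="\<lambda>i j. C c * F i j", symmetric], intro sum.cong refl) (auto simp: dl_def)

lemma \<rho>F_Rp: "\<rho>F (Rp i j) f = C (1/8) * ((\<Sum>a<k. dv (var i (\<tau> a)) (dv (var j a) f)) + (\<Sum>a<k. dv (var j (\<tau> a)) (dv (var i a) f)))"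
proof -
  have "al (Rp i j) p q = 0" "be (Rp i j) p q = 0" "ga (Rp i j) p q = 1/2 * dl i j p q + 1/2 * dl j i p q" for p q
    by (simp_all add: al_def be_def ga_def Rp_def Let_def field_simps)
  then have "\<rho>F (Rp i j) f = C (1/4) * (\<Sum>p\<in>UNIV. \<Sum>q\<in>UNIV. C (1/2 * dl i j p q + 1/2 * dl j i p q) * (\<Sum>a<k. dv (var p (\<tau> a)) (dv (var q a) f)))"
    by (simp add: \<rho>F_expand[OF R_sp(2)])
  also have "\<dots> = C (1/4) * (C (1/2) * (\<Sum>a<k. dv (var i (\<tau> a)) (dv (var j a) f)) + C (1/2) * (\<Sum>a<k. dv (var j (\<tau> a)) (dv (var i a) f)))"
    by (simp only: C_add distrib_right sum.distrib sum_sum_dl)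
  also have "\<dots> = C (1/8) * ((\<Sum>a<k. dv (var i (\<tau> a)) (dv (var j a) f)) + (\<Sum>a<k. dv (var j (\<tau> a)) (dv (var i a) f)))"
    unfolding distrib_left mult.assoc[symmetric] C_mult[symmetric] by simp
  finally show ?thesis .
qed

lemma \<rho>F_Rk: assumes "i \<noteq> j" shows "\<rho>F (Rk i j) f = C (1/2) * (\<Sum>a<k. zv (var i a) * dv (var j a) f)"
proof -
  have "al (Rk i j) p q = 0" "ga (Rk i j) p q = 0" "be (Rk i j) p q = dl i j p q" for p q
    by (simp_all add: al_def be_def ga_def Rk_def Let_def field_simps)
  moreover have "dl i j p p = 0" for p using assms by (simp add: dl_def)
  ultimately have "\<rho>F (Rk i j) f = C (1/4) * (\<Sum>p\<in>UNIV. \<Sum>q\<in>UNIV. C (2 * dl i j p q) * (\<Sum>a<k. zv (var p a) * dv (var q a) f))"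
    by (simp add: \<rho>F_expand[OF R_sp(3)])
  also have "\<dots> = C (1/4) * (C 2 * (\<Sum>a<k. zv (var i a) * dv (var j a) f))" by (simp only: sum_sum_dl)
  finally show ?thesis by (simp add: mult.assoc[symmetric] C_mult[symmetric])
qed

text \<open>Weights are the negatives of the row degrees shifted by k / 2. Raising the weight thus
  lowers the degree, in accordance with p^+ acting by second derivatives.\<close>

lemma \<rho>F_cartan: "\<rho>F (cartan h) f = - (\<Sum>i\<in>UNIV. C (h $ i) * ((\<Sum>a<k. zv (var i a) * dv (var i a) f) + C (of_nat k / 2) * f))"
proof -
  have "al (cartan h) p q = 0" "ga (cartan h) p q = 0" "be (cartan h) p q = (if p = q then - 2 * h $ p else 0)" for p q
    by (simp_all add: al_def be_def ga_def)
  then have "\<rho>F (cartan h) f = C (1/4) * ((\<Sum>p\<in>UNIV. \<Sum>q\<in>UNIV. C (2 * (if p = q then - 2 * h $ p else 0)) * (\<Sum>a<k. zv (var p a) * dv (var q a) f))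
     + (\<Sum>i\<in>UNIV. C (of_nat k * (- 2 * h $ i)) * f))"
    by (simp add: \<rho>F_expand[OF cartan_sp])
  also have "(\<Sum>p\<in>UNIV. \<Sum>q\<in>UNIV. C (2 * (if p = q then - 2 * h $ p else 0)) * (\<Sum>a<k. zv (var p a) * dv (var q a) f))
     = (\<Sum>p\<in>UNIV. C (- 4 * h $ p) * (\<Sum>a<k. zv (var p a) * dv (var p a) f))"
  proof (intro sum.cong refl)
    fix p
    have "(\<Sum>q\<in>UNIV. C (2 * (if p = q then - 2 * h $ p else 0)) * (\<Sum>a<k. zv (var p a) * dv (var q a) f))
      = (\<Sum>q\<in>UNIV. if p = q then C (- 4 * h $ p) * (\<Sum>a<k. zv (var p a) * dv (var q a) f) else 0)"
      by (intro sum.cong refl) auto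
    then show "(\<Sum>q\<in>UNIV. C (2 * (if p = q then - 2 * h $ p else 0)) * (\<Sum>a<k. zv (var p a) * dv (var q a) f)) = C (- 4 * h $ p) * (\<Sum>a<k. zv (var p a) * dv (var p a) f)"
      by simp
  qed
  also have "C (1/4) * ((\<Sum>p\<in>UNIV. C (- 4 * h $ p) * F p) + (\<Sum>i\<in>UNIV. C (of_nat k * (- 2 * h $ i)) * f))
     = - (\<Sum>i\<in>UNIV. C (h $ i) * (F i + C (of_nat k / 2) * f))" for F :: "'n \<Rightarrow> fock"
    unfolding sum.distrib[symmetric] sum_distrib_left sum_negf[symmetric]
  proof (intro sum.cong refl)
    fix i
    show "C (1/4) * (C (- 4 * h $ i) * F i + C (of_nat k * (- 2 * h $ i)) * f) = - (C (h $ i) * (F i + C (of_nat k / 2) * f))"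
      by (rule poly_mapping_eqI) (simp only: lookup_add lookup_uminus lk_C_mult, simp add: algebra_simps)
  qed
  finally show ?thesis .
qed

end

section \<open>The highest weight vector\<close>

definition derivation :: "('a::comm_ring_1 \<Rightarrow> 'a) \<Rightarrow> bool" where
  "derivation D \<longleftrightarrow> (\<forall>f g. D (f + g) = D f + D g) \<and> (\<forall>f g. D (f * g) = D f * g + f * D g)"

lemma derivation_dv: "derivation (dv v)" by (simp add: derivation_def dv_add dv_mult)

lemma derivation_scaled_sum:
  assumes "\<And>a. a \<in> A \<Longrightarrow> derivation (D a)"
  shows "derivation (\<lambda>f. \<Sum>a\<in>A. c a * D a f)"
proof -
  have "(\<Sum>a\<in>A. c a * D a (f + g)) = (\<Sum>a\<in>A. c a * D a f) + (\<Sum>a\<in>A. c a * D a g)" for f g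
    using assms by (simp add: derivation_def sum.distrib[symmetric] algebra_simps)
  moreover have "(\<Sum>a\<in>A. c a * D a (f * g)) = (\<Sum>a\<in>A. c a * D a f) * g + f * (\<Sum>a\<in>A. c a * D a g)" for f g
  proof -
    have "(\<Sum>a\<in>A. c a * D a (f * g)) = (\<Sum>a\<in>A. c a * D a f * g + f * (c a * D a g))"
      using assms by (intro sum.cong) (auto simp: derivation_def algebra_simps)
    then show ?thesis by (simp add: sum.distrib sum_distrib_left sum_distrib_right)
  qed
  ultimately show ?thesis by (simp add: derivation_def)
qed

lemma derivation_0:
  assumes "derivation D" shows "D 0 = 0" using assms unfolding derivation_def by (metis add_cancel_right_right)

lemma derivation_1:
  assumes "derivation D" shows "D 1 = 0"
  using assms unfolding derivation_def by (metis add_cancel_right_right mult_1 mult_1_right)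

lemma derivation_sum:
  assumes "derivation D" shows "D (sum f A) = (\<Sum>a\<in>A. D (f a))" using assms derivation_0[OF assms]
  by (induction A rule: infinite_finite_induct) (auto simp: derivation_def)

lemma derivation_minus:
  assumes "derivation D" shows "D (- f) = - D f"
proof -
  have "D (- f) + D f = D (- f + f)" using assms by (simp only: derivation_def)
  then show ?thesis by (simp add: derivation_0[OF assms] eq_neg_iff_add_eq_0)
qed

lemma derivation_prod_0:
  assumes "derivation D" "\<And>a. a \<in> A \<Longrightarrow> D (f a) = 0" shows "D (prod f A) = 0"
  using assms derivation_1[OF assms(1)] by (induction A rule: infinite_finite_induct) (auto simp: derivation_def)

lemma derivation_power:
  assumes "derivation D" "D f = c * f" shows "D (f ^ e) = (of_nat e * c) * f ^ e"
  using assms derivation_1[OF assms(1)] by (induction e) (auto simp: derivation_def algebra_simps)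

lemma derivation_prod_eigen:
  assumes D: "derivation D" and f: "\<And>a. a \<in> A \<Longrightarrow> D (f a) = c a * f a" and A: "finite A"
  shows "D (prod f A) = sum c A * prod f A" using A f
proof (induction A rule: finite_induct)
  case empty then show ?case using derivation_1[OF D] by simp
next
  case (insert x F)
  then show ?case using D by (simp add: derivation_def algebra_simps)
qed

text \<open>Each derivation used here differentiates in the variables of one row only, so the
  product rule leaves a single determinant.\<close>

lemma derivation_det_row:
  fixes A :: "'a::comm_ring_1 ^ 'n ^ 'n"
  assumes D: "derivation D" and z: "\<And>p q. p \<noteq> i \<Longrightarrow> D (A $ p $ q) = 0"
  shows "D (det A) = det (\<chi> p. if p = i then (\<chi> q. D (A $ i $ q)) else A $ p)"
proof -
  have s: "D (of_int (sign p) * f) = of_int (sign p) * D f" for p :: "'n \<Rightarrow> 'n" and f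
    by (simp add: sign_def derivation_minus[OF D])
  have "D (\<Prod>q\<in>UNIV. A $ q $ p q) = (\<Prod>q\<in>UNIV. (\<chi> p. if p = i then (\<chi> q. D (A $ i $ q)) else A $ p) $ q $ p q)" for p
  proof -
    have "D (\<Prod>q\<in>UNIV. A $ q $ p q) = D (A $ i $ p i * (\<Prod>q\<in>UNIV - {i}. A $ q $ p q))"
      by (simp add: prod.remove[of UNIV i])
    also have "\<dots> = D (A $ i $ p i) * (\<Prod>q\<in>UNIV - {i}. A $ q $ p q)"
      using D derivation_prod_0[OF D, of "UNIV - {i}" "\<lambda>q. A $ q $ p q"] z by (simp add: derivation_def)
    also have "\<dots> = (\<Prod>q\<in>UNIV. (\<chi> p. if p = i then (\<chi> q. D (A $ i $ q)) else A $ p) $ q $ p q)"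
      by (simp add: prod.remove[of UNIV i])
    finally show ?thesis .
  qed
  then show ?thesis unfolding det_def derivation_sum[OF D] s by simp
qed

lemma pos_bounds: "1 \<le> pos (i :: 'n::{finite,linorder})" "pos (i :: 'n) \<le> CARD('n)"
proof -
  have "{i} \<subseteq> {j. j \<le> i}" by auto
  then have "card {i} \<le> card {j. j \<le> i}" by (intro card_mono) auto
  then show "1 \<le> pos i" by (simp add: pos_def)
  show "pos i \<le> CARD('n)" unfolding pos_def by (intro card_mono) auto
qed

lemma pos_less: "i < j \<Longrightarrow> pos i < pos (j :: 'n::{finite,linorder})"
proof -
  assume l: "i < j"
  then have "j \<notin> {j. j \<le> i}" "j \<in> {i. i \<le> j}" by auto
  then show ?thesis unfolding pos_def using l by (intro psubset_card_mono) (auto intro: order_trans less_imp_le)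
qed

text \<open>Rows are counted from the last one, starting with 0, so that the leading minors are highest weight vectors.\<close>

definition corow :: "'n::{finite,linorder} \<Rightarrow> nat" where "corow i = CARD('n) - pos i"

lemma corow_eq [simp]: "corow i = corow j \<longleftrightarrow> i = (j :: 'n::{finite,linorder})"
  using pos_bounds[of i] pos_bounds[of j] inj_pos[of i j] by (auto simp: corow_def)

lemma corow_less: "i < j \<Longrightarrow> corow j < corow (i :: 'n::{finite,linorder})"
  using pos_bounds[of i] pos_bounds[of j] pos_less[of i j] by (auto simp: corow_def)

context oscillator
begin

text \<open>The block formed by the last c rows and first c columns of the variables, padded with
  the identity. All minors become determinants over the same index type.\<close>

definition Mx :: "nat \<Rightarrow> ((fock, 'n) vec, 'n) vec" where
  "Mx c = (\<chi> i j. if corow i < c \<and> corow j < c then zv (var i (corow j)) else if i = j then 1 else 0)"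

definition minor :: "nat \<Rightarrow> fock" where "minor c = det (Mx c)"

definition E :: "'n \<Rightarrow> 'n \<Rightarrow> fock \<Rightarrow> fock" where "E i j f = (\<Sum>a<k. zv (var i a) * dv (var j a) f)"

lemma derivation_E: "derivation (E i j)" unfolding E_def[abs_def] by (intro derivation_scaled_sum derivation_dv)

lemma dv_var: "dv (var i a) (zv (var j b)) = (if i = j \<and> a = b then 1 else 0)" by (simp add: dv_X)

lemma E_Mx: "c \<le> k \<Longrightarrow> E i j (Mx c $ p $ q) = (if p = j \<and> corow j < c \<and> corow q < c then zv (var i (corow q)) else 0)"
proof -
  assume c: "c \<le> k"
  have "E i j (zv (var p (corow q))) = (\<Sum>a<k. if a = corow q then (if p = j then zv (var i (corow q)) else 0) else 0)"
    unfolding E_def by (intro sum.cong refl) (auto simp: dv_var)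
  then show ?thesis using c derivation_0[OF derivation_E] derivation_1[OF derivation_E]
    by (auto simp: Mx_def)
qed

text \<open>E i j writes row i into row j. For j < i the block contains row i whenever it contains
  row j, and then two rows coincide; otherwise a zero row appears.\<close>

lemma E_minor_lower:
  assumes "j < i" "c \<le> k" shows "E i j (minor c) = 0"
proof -
  let ?B = "\<chi> p::'n. if p = j then (\<chi> q::'n. E i j (Mx c $ j $ q)) else Mx c $ p"
  have B: "E i j (minor c) = det ?B"
    unfolding minor_def by (rule derivation_det_row[OF derivation_E]) (simp add: E_Mx[OF assms(2)])
  show ?thesis
  proof (cases "corow j < c")
    case True
    have i: "corow i < c" using True corow_less[OF assms(1)] by simp
    have "row i ?B = row j ?B"
      unfolding E_Mx[OF assms(2)] using assms(1) True i by (auto simp: row_def vec_eq_iff Mx_def)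
    then show ?thesis unfolding B using assms(1) by (intro det_identical_rows[of i j]) auto
  next
    case False
    then have "?B = (\<chi> p::'n. if p = j then 0 else Mx c $ p)" by (auto simp: vec_eq_iff E_Mx[OF assms(2)])
    then show ?thesis unfolding B by (simp only: det_row_0)
  qed
qed

lemma E_minor_diag:
  assumes "c \<le> k" shows "E i i (minor c) = (if corow i < c then 1 else 0) * minor c"
proof -
  let ?B = "\<chi> p::'n. if p = i then (\<chi> q::'n. E i i (Mx c $ i $ q)) else Mx c $ p"
  have B: "E i i (minor c) = det ?B"
    unfolding minor_def by (rule derivation_det_row[OF derivation_E]) (simp add: E_Mx[OF assms])
  show ?thesis
  proof (cases "corow i < c")
    case True
    have "?B = Mx c" unfolding E_Mx[OF assms] using True by (auto simp: vec_eq_iff Mx_def)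
    then show ?thesis using True B by (simp add: minor_def)
  next
    case False
    then have "?B = (\<chi> p::'n. if p = i then 0 else Mx c $ p)" by (auto simp: vec_eq_iff E_Mx[OF assms])
    then show ?thesis unfolding B using False by (simp only: det_row_0) simp
  qed
qed

lemma dv_Mx: "dv (var i a) (Mx c $ p $ q) = (if p = i \<and> corow i < c \<and> corow q < c \<and> a = corow q then 1 else 0)"
  by (auto simp: Mx_def dv_var)

lemma dv_minor: "dv (var i a) (minor c) = det (\<chi> p::'n. if p = i then (\<chi> q::'n. if corow i < c \<and> corow q < c \<and> a = corow q then 1 else 0) else Mx c $ p)"
proof -
  have "dv (var i a) (minor c) = det (\<chi> p::'n. if p = i then (\<chi> q::'n. dv (var i a) (Mx c $ i $ q)) else Mx c $ p)"
    unfolding minor_def by (rule derivation_det_row[OF derivation_dv]) (simp add: dv_Mx)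
  then show ?thesis by (simp only: dv_Mx simp_thms)
qed

lemma dv_minor_0: "c \<le> a \<Longrightarrow> dv (var (i::'n) a) (minor c) = 0"
proof -
  assume "c \<le> a"
  then have "(\<chi> p::'n. if p = i then (\<chi> q::'n. if corow i < c \<and> corow q < c \<and> a = corow q then 1 else 0) else Mx c $ p) = (\<chi> p::'n. if p = i then 0 else Mx c $ p)"
    by (auto simp: vec_eq_iff)
  then show ?thesis unfolding dv_minor by (simp only: det_row_0)
qed

text \<open>A minor is linear in each column. In terms of rows, both differentiated rows turn into
  the same unit row, or one of them becomes zero.\<close>

lemma dv_dv_minor: "dv (var (i::'n) a) (dv (var (j::'n) a) (minor c)) = 0"
proof -
  define u :: "(fock, 'n) vec" where "u = (\<chi> q::'n. if corow j < c \<and> corow q < c \<and> a = corow q then 1 else 0)"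
  let ?A = "\<chi> p::'n. if p = j then u else Mx c $ p"
  let ?B = "\<chi> p::'n. if p = i then (\<chi> q::'n. dv (var i a) (?A $ i $ q)) else ?A $ p"
  have "dv (var i a) (dv (var j a) (minor c)) = dv (var i a) (det ?A)" unfolding dv_minor u_def ..
  also have "\<dots> = det ?B" by (rule derivation_det_row[OF derivation_dv]) (auto simp: u_def dv_Mx)
  also have "det ?B = 0"
  proof (cases "i \<noteq> j \<and> corow i < c \<and> corow j < c")
    case True
    have "row i ?B = row j ?B" using True by (auto simp: row_def vec_eq_iff u_def dv_Mx)
    then show ?thesis using True by (intro det_identical_rows[of i j]) auto
  next
    case False
    show ?thesis
    proof (cases "i = j \<or> corow i \<ge> c")
      case True
      then have "?B = (\<chi> p::'n. if p = i then 0 else ?A $ p)" by (auto simp: vec_eq_iff u_def dv_Mx)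
      then show ?thesis by (simp only: det_row_0)
    next
      case 2: False
      then have "?B = (\<chi> p::'n. if p = j then 0 else ?B $ p)" using False by (auto simp: vec_eq_iff u_def)
      then show ?thesis using det_row_0[of j "\<lambda>p. ?B $ p"] by (simp only:)
    qed
  qed
  finally show ?thesis .
qed

text \<open>Differentiating successively in the diagonal variables replaces the rows of the block by
  unit rows. If the minor were 0, all these derivatives would be 0, yet the last one is det 1 =
  1.\<close>

lemma minor_nonzero: "minor c \<noteq> 0"
proof
  assume z: "minor c = 0"
  define B :: "'n set \<Rightarrow> ((fock, 'n) vec, 'n) vec" where "B S = (\<chi> p::'n. if p \<in> S then axis p 1 else Mx c $ p)" for S
  have "det (B S) = 0" if "finite S" for S using that
  proof (induction S rule: finite_induct)
    case empty
    have "B {} = Mx c" by (simp add: B_def vec_eq_iff)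
    then show ?case using z by (simp add: minor_def)
  next
    case (insert i S)
    show ?case
    proof (cases "corow i < c")
      case True
      have "dv (var i (corow i)) (det (B S)) = det (\<chi> p::'n. if p = i then (\<chi> q::'n. dv (var i (corow i)) (B S $ i $ q)) else B S $ p)"
        by (rule derivation_det_row[OF derivation_dv]) (auto simp: B_def dv_Mx axis_def)
      also have "(\<chi> p::'n. if p = i then (\<chi> q::'n. dv (var i (corow i)) (B S $ i $ q)) else B S $ p) = B (insert i S)"
        using True insert(2) by (auto simp: vec_eq_iff B_def dv_Mx axis_def)
      finally show ?thesis using insert by simp
    next
      case False
      then have "B (insert i S) = B S" using insert(2) by (auto simp: vec_eq_iff B_def Mx_def axis_def)
      then show ?thesis using insert by simp
    qed
  qed
  moreover have "B UNIV = mat 1" by (auto simp: B_def mat_def vec_eq_iff axis_def)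
  ultimately show False using finite[of "UNIV :: 'n set"] by (metis det_I zero_neq_one)
qed

text \<open>The exponent e c counts columns of length c in the Young diagram of the corresponding
  type of O(k). The factor \<open>minor M\<close> stands apart because M may exceed k / 2, while
  only the first m coordinate vectors form the isotropic family.\<close>

definition hwv :: "nat \<Rightarrow> (nat \<Rightarrow> nat) \<Rightarrow> fock" where
  "hwv M e = minor M * (\<Prod>c\<in>{1..m}. minor c ^ e c)"

lemma hwv_nonzero: "hwv M e \<noteq> 0" by (simp add: hwv_def minor_nonzero)

lemma derivation_hwv:
  assumes D: "derivation D" and c: "\<And>c. c \<in> insert M {1..m} \<Longrightarrow> D (minor c) = w c * minor c"
  shows "D (hwv M e) = (w M + (\<Sum>c\<in>{1..m}. of_nat (e c) * w c)) * hwv M e"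
proof -
  have "D (\<Prod>c\<in>{1..m}. minor c ^ e c) = (\<Sum>c\<in>{1..m}. of_nat (e c) * w c) * (\<Prod>c\<in>{1..m}. minor c ^ e c)"
    by (rule derivation_prod_eigen[OF D]) (use c derivation_power[OF D] in auto)
  then show ?thesis using D c[of M] unfolding hwv_def by (simp add: derivation_def algebra_simps)
qed

lemma hwv_lower:
  assumes "j < i" "M \<le> k" shows "E i j (hwv M e) = 0"
proof -
  have "E i j (minor c) = 0 * minor c" if "c \<in> insert M {1..m}" for c
    using E_minor_lower[OF assms(1), of c] that assms(2) km by auto
  from derivation_hwv[OF derivation_E this] show ?thesis by simp
qed

lemma hwv_weight:
  assumes "M \<le> k"
  shows "E i i (hwv M e) = C (of_nat ((if corow i < M then 1 else 0) + (\<Sum>c\<in>{1..m}. if corow i < c then e c else 0))) * hwv M e"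
proof -
  have C: "C (of_nat x) = of_nat x" for x by (induction x) (auto simp: C_add)
  have "E i i (hwv M e) = ((if corow i < M then 1 else 0) + (\<Sum>c\<in>{1..m}. of_nat (e c) * (if corow i < c then 1 else 0))) * hwv M e"
    by (rule derivation_hwv[OF derivation_E E_minor_diag]) (use assms km in auto)
  then show ?thesis unfolding C by (simp add: if_distrib[of "(*) _"] if_distrib[of of_nat] cong: if_cong)
qed

text \<open>Every summand vanishes by itself. Columns from M on do not occur in the polynomial, and
  a column a < m is paired with k - 1 - a, which is at least M. A column with m \<le> a < M and
  \<tau> a < M is paired with itself and occurs only in the factor \<open>minor M\<close>, which is
  linear in it.\<close>

lemma hwv_harmonic:
  assumes "m \<le> M" "M + m \<le> k"
  shows "(\<Sum>a<k. dv (var (i::'n) (\<tau> a)) (dv (var (j::'n) a) (hwv M e))) = 0"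
proof (rule sum.neutral, rule ballI)
  fix a assume "a \<in> {..<k}"
  then have a: "a < k" by simp
  have z: "dv (var p b) (hwv M e) = 0" if "M \<le> b" for p :: 'n and b
  proof -
    have "dv (var p b) (minor c) = 0 * minor c" if "c \<in> insert M {1..m}" for c
      using dv_minor_0[of c b p] that \<open>M \<le> b\<close> assms(1) by auto
    from derivation_hwv[OF derivation_dv this] show ?thesis by simp
  qed
  show "dv (var i (\<tau> a)) (dv (var j a) (hwv M e)) = 0"
  proof (cases "M \<le> a \<or> M \<le> \<tau> a")
    case True
    then show ?thesis
    proof
      assume "M \<le> \<tau> a"
      then show ?thesis using z by (subst dv_comm) simp
    qed (simp add: z)
  next
    case False
    have "m \<le> a"
    proof (rule ccontr)
      assume "\<not> m \<le> a"
      then have "\<tau> a = k - 1 - a" "M \<le> k - 1 - a" using assms by (auto simp: \<tau>_def)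
      then show False using False by simp
    qed
    moreover have "\<not> k - m \<le> a" using False assms by linarith
    ultimately have "m \<le> a" "\<tau> a = a" by (auto simp: \<tau>_def)
    let ?P = "\<Prod>c\<in>{1..m}. minor c ^ e c"
    have P: "dv (var p a) ?P = 0" for p :: 'n
      using derivation_power[OF derivation_dv, of "var p a" _ 0] dv_minor_0[of _ a p] \<open>m \<le> a\<close>
      by (intro derivation_prod_0[OF derivation_dv]) auto
    show ?thesis unfolding \<open>\<tau> a = a\<close> hwv_def by (simp only: dv_mult dv_add P dv_dv_minor mult_zero_left mult_zero_right add_0 dv_0)
  qed
qed

end

section \<open>Highest weight modules\<close>

lemma bracket_sp:
  fixes X :: "('a::comm_ring_1, 'n::finite) mat2"
  assumes "X \<in> sp_alg" "Y \<in> sp_alg"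
  shows "bracket X Y \<in> sp_alg"
proof -
  have *: "transpose A ** symp_form = - (symp_form ** A)" if "A \<in> sp_alg" for A :: "('a::comm_ring_1, 'n::finite) mat2"
    using that by (simp add: sp_alg_def eq_neg_iff_add_eq_0)
  have neg: "A ** (- B) = - (A ** B)" "(- A) ** B = - (A ** B)" for A B :: "('a::comm_ring_1, 'n::finite) mat2"
    by (simp_all add: vec_eq_iff matrix_mult_entry sum_negf)
  have sub: "A ** (B - D) = A ** B - A ** D" "(B - D) ** A = B ** A - D ** A" for A B D :: "('a::comm_ring_1, 'n::finite) mat2"
    by (simp_all add: vec_eq_iff matrix_mult_entry sum_subtractf algebra_simps)
  have tr: "transpose (A ** B - B ** A) = transpose B ** transpose A - transpose A ** transpose B" for A B :: "('a::comm_ring_1, 'n::finite) mat2"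
    unfolding matrix_transpose_mul[symmetric] by (simp add: vec_eq_iff transpose_def)
  have "transpose (bracket X Y) ** symp_form = transpose Y ** (transpose X ** symp_form) - transpose X ** (transpose Y ** symp_form)"
    by (simp only: bracket_def tr sub matrix_mul_assoc)
  also have "\<dots> = transpose X ** symp_form ** Y - transpose Y ** symp_form ** X"
    by (simp only: *[OF assms(1)] *[OF assms(2)] neg matrix_mul_assoc) simp
  also have "\<dots> = - (symp_form ** bracket X Y)"
    by (simp only: *[OF assms(1)] *[OF assms(2)] neg bracket_def sub matrix_mul_assoc) simp
  finally show ?thesis by (simp add: sp_alg_def)
qed

lemma sp_alg_closed:
  fixes X :: "(complex, 'n::finite) mat2"
  shows "X \<in> sp_alg \<Longrightarrow> Y \<in> sp_alg \<Longrightarrow> X + Y \<in> sp_alg" "X \<in> sp_alg \<Longrightarrow> mscale c X \<in> sp_alg" "0 \<in> (sp_alg :: (complex, 'n) mat2 set)"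
  by (simp_all add: sp_alg_entries map_matrix_def)

locale sp_module =
  fixes s :: "complex \<Rightarrow> 'w \<Rightarrow> 'w::ab_group_add" and \<rho> :: "(complex, 'n::{finite,linorder}) mat2 \<Rightarrow> 'w \<Rightarrow> 'w"
  assumes lm: "lie_module sp_alg s \<rho>"
begin

sublocale vector_space s using lm by (simp add: lie_module_def)

lemma lin: "X \<in> sp_alg \<Longrightarrow> Vector_Spaces.linear s s (\<rho> X)" using lm by (simp add: lie_module_def)

lemma hom: "X \<in> sp_alg \<Longrightarrow> module_hom s s (\<rho> X)" by (rule Vector_Spaces.linear.axioms(3)[OF lin])

lemma \<rho>_add: "X \<in> sp_alg \<Longrightarrow> \<rho> X (v + w) = \<rho> X v + \<rho> X w" by (rule module_hom.add[OF hom])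
lemma \<rho>_scale: "X \<in> sp_alg \<Longrightarrow> \<rho> X (s c v) = s c (\<rho> X v)" by (rule module_hom.scale[OF hom])
lemma \<rho>_0: "X \<in> sp_alg \<Longrightarrow> \<rho> X 0 = 0" by (rule module_hom.zero[OF hom])
lemma \<rho>_add_mat: "X \<in> sp_alg \<Longrightarrow> Y \<in> sp_alg \<Longrightarrow> \<rho> (X + Y) v = \<rho> X v + \<rho> Y v" using lm by (simp add: lie_module_def)
lemma \<rho>_scale_mat: "X \<in> sp_alg \<Longrightarrow> \<rho> (mscale c X) v = s c (\<rho> X v)" using lm by (simp add: lie_module_def)
lemma \<rho>_bracket: "X \<in> sp_alg \<Longrightarrow> Y \<in> sp_alg \<Longrightarrow> \<rho> (bracket X Y) v = \<rho> X (\<rho> Y v) - \<rho> Y (\<rho> X v)" using lm by (simp add: lie_module_def)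

lemma \<rho>_0_mat: "\<rho> 0 v = 0"
proof -
  have "mscale 0 (0 :: (complex, 'n) mat2) = 0" by (simp add: vec_eq_iff map_matrix_def)
  then show ?thesis using \<rho>_scale_mat[of 0 0 v] sp_alg_closed(3) by simp
qed

text \<open>Comparing \<rho> X v with \<mu>_j v eliminates the summand x_j, so the induction runs
  over scaled eigenvectors and concludes by \<mu>_j \<noteq> \<mu>0.\<close>

lemma sum_scaled_eigenvectors:
  assumes "finite I" "X \<in> sp_alg" "\<And>i. i \<in> I \<Longrightarrow> \<rho> X (x i) = s (\<mu> i) (x i)" "\<And>i. i \<in> I \<Longrightarrow> \<mu> i \<noteq> \<mu>0"
    "\<rho> X v = s \<mu>0 v" "v = (\<Sum>i\<in>I. x i)"
  shows "v = 0" using assms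
proof (induction I arbitrary: x v rule: finite_induct)
  case (insert j I)
  have "\<rho> X v = s (\<mu> j) (x j) + (\<Sum>i\<in>I. s (\<mu> i) (x i))"
  proof -
    have "\<rho> X (sum x I) = (\<Sum>i\<in>I. \<rho> X (x i))" by (rule module_hom.sum[OF hom[OF insert.prems(1)]])
    then show ?thesis using insert by (simp add: \<rho>_add)
  qed
  moreover have "s (\<mu> j) v = s (\<mu> j) (x j) + (\<Sum>i\<in>I. s (\<mu> j) (x i))"
    using insert.hyps insert.prems(5) by (simp add: scale_right_distrib scale_sum_right)
  ultimately have "s (\<mu>0 - \<mu> j) v = (\<Sum>i\<in>I. s (\<mu> i - \<mu> j) (x i))"
    using insert.prems(4) by (simp add: scale_left_diff_distrib sum_subtractf)
  then have "s (\<mu>0 - \<mu> j) v = 0"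
  proof (intro insert.IH[OF insert.prems(1)])
    show "\<rho> X (s (\<mu> i - \<mu> j) (x i)) = s (\<mu> i) (s (\<mu> i - \<mu> j) (x i))" if "i \<in> I" for i
      using insert.prems(2)[of i] that by (simp add: \<rho>_scale[OF insert.prems(1)] mult.commute)
    show "\<rho> X (s (\<mu>0 - \<mu> j) v) = s \<mu>0 (s (\<mu>0 - \<mu> j) v)"
      by (simp add: \<rho>_scale[OF insert.prems(1)] insert.prems(4) mult.commute)
  qed (use insert in auto)
  then show ?case using insert.prems(3)[of j] by simp
qed simp

lemma span_other_eigenvectors:
  assumes X: "X \<in> sp_alg" and v: "\<rho> X v = s \<mu>0 v" "v \<in> span {x. \<exists>\<mu>. \<mu> \<noteq> \<mu>0 \<and> \<rho> X x = s \<mu> x}"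
  shows "v = 0"
proof -
  let ?B = "{x. \<exists>\<mu>. \<mu> \<noteq> \<mu>0 \<and> \<rho> X x = s \<mu> x}"
  obtain t r where t: "finite t" "t \<subseteq> ?B" "v = (\<Sum>a\<in>t. s (r a) a)" using v(2) unfolding span_explicit by blast
  have "\<forall>a\<in>t. \<exists>\<mu>. \<mu> \<noteq> \<mu>0 \<and> \<rho> X a = s \<mu> a" using t(2) by blast
  from bchoice[OF this] obtain \<mu> where \<mu>: "\<forall>a\<in>t. \<mu> a \<noteq> \<mu>0 \<and> \<rho> X a = s (\<mu> a) a" by blast
  show ?thesis
    by (rule sum_scaled_eigenvectors[OF t(1) X _ _ v(1) t(3), of \<mu>]) (use \<mu> in \<open>auto simp: \<rho>_scale[OF X] mult.commute\<close>)
qed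

end

text \<open>A dominant regular element: every positive root is positive on it.\<close>

definition h0 :: "complex ^ 'n::{finite,linorder}" where "h0 = (\<chi> i. of_real (real (corow i) + 1))"

text \<open>Only the sign of the eigenvalue on h0 is recorded, so p^- and the negative compact roots
  are treated together.\<close>

definition lowering :: "(complex, 'n::{finite,linorder}) mat2 set" where
  "lowering = {Y \<in> sp_alg. \<exists>c>0. bracket (cartan h0) Y = mscale (of_real (- c)) Y}"

lemma Rm_lowering: fixes i j :: "'n::{finite,linorder}" shows "Rm i j \<in> lowering"
proof -
  have "bracket (cartan h0) (Rm i j) = mscale (of_real (- (real (corow i) + 1 + (real (corow j) + 1)))) (Rm i j)"
    using R_roots(1)[of i j] by (simp add: root_space_def h0_def)
  moreover have "real (corow i) + 1 + (real (corow j) + 1) > 0" by (intro add_nonneg_pos add_pos_nonneg) auto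
  ultimately show ?thesis unfolding lowering_def using R_sp(1)[of i j] by blast
qed

lemma Rk_lowering: fixes i j :: "'n::{finite,linorder}" assumes "i < j" shows "Rk i j \<in> lowering"
proof -
  have "bracket (cartan h0) (Rk i j) = mscale (of_real (- (real (corow i) - real (corow j)))) (Rk i j)"
    using R_roots(3)[of i j] by (simp add: root_space_def h0_def)
  moreover have "real (corow i) - real (corow j) > 0" using corow_less[OF assms] by simp
  ultimately show ?thesis unfolding lowering_def using R_sp(3)[of i j] by blast
qed

text \<open>The vector u need not generate the module. In the application to a direct product it
  does not, and the submodule D that it generates is the object of interest.\<close>

locale hw_module = sp_module s \<rho> for s :: "complex \<Rightarrow> 'w \<Rightarrow> 'w::ab_group_add" and \<rho> :: "(complex, 'n::{finite,linorder}) mat2 \<Rightarrow> 'w \<Rightarrow> 'w" +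
  fixes u :: 'w and \<Lambda> :: "(complex, 'n) vec \<Rightarrow> complex"
  assumes cart: "\<And>h. \<rho> (cartan h) u = s (\<Lambda> h) u" and Rk_u: "\<And>i j. j < i \<Longrightarrow> \<rho> (Rk i j) u = 0" and Rp_u: "\<And>i j. \<rho> (Rp i j) u = 0"
begin

definition D :: "'w set" where "D = span {foldr \<rho> Ys u | Ys. set Ys \<subseteq> lowering}"
definition L :: "'w set" where "L = {foldr \<rho> Ys u | Ys. set Ys \<subseteq> lowering \<and> Ys \<noteq> []}"

lemma lowering_sp: "Y \<in> lowering \<Longrightarrow> Y \<in> sp_alg" by (simp add: lowering_def)

lemma lowering_word_eigen:
  assumes "set Ys \<subseteq> lowering"
  shows "\<exists>c\<ge>0. (Ys \<noteq> [] \<longrightarrow> c > 0) \<and> \<rho> (cartan h0) (foldr \<rho> Ys u) = s (\<Lambda> h0 - of_real c) (foldr \<rho> Ys u)"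
  using assms
proof (induction Ys)
  case Nil then show ?case using cart by (intro exI[of _ 0]) simp
next
  case (Cons Y Ys)
  let ?w = "foldr \<rho> Ys u"
  obtain c where c: "c \<ge> 0" "\<rho> (cartan h0) ?w = s (\<Lambda> h0 - of_real c) ?w" using Cons by auto
  obtain d where d: "d > 0" "bracket (cartan h0) Y = mscale (of_real (- d)) Y" and Y: "Y \<in> sp_alg"
    using Cons.prems by (auto simp: lowering_def)
  have "\<rho> (cartan h0) (\<rho> Y ?w) = \<rho> Y (\<rho> (cartan h0) ?w) + \<rho> (bracket (cartan h0) Y) ?w"
    by (simp add: \<rho>_bracket[OF cartan_sp Y])
  also have "\<dots> = s (\<Lambda> h0 - of_real c) (\<rho> Y ?w) + s (of_real (- d)) (\<rho> Y ?w)"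
    unfolding c(2) d(2) by (simp only: \<rho>_scale[OF Y] \<rho>_scale_mat[OF Y])
  also have "\<dots> = s (\<Lambda> h0 - of_real (c + d)) (\<rho> Y ?w)"
    by (simp only: scale_left_distrib[symmetric]) (simp add: algebra_simps)
  finally show ?case using c(1) d(1) by (intro exI[of _ "c + d"]) simp
qed

lemma D_u: "u \<in> D" unfolding D_def by (rule span_base) (auto intro: exI[of _ "[]"])

lemma D_lowering: assumes Y: "Y \<in> lowering" and w: "w \<in> D" shows "\<rho> Y w \<in> D" using w unfolding D_def
proof (induction rule: span_induct_alt)
  case base then show ?case by (simp add: \<rho>_0[OF lowering_sp[OF Y]] span_zero)
next
  case (step c x y)
  from step(1) obtain Ys where Ys: "x = foldr \<rho> Ys u" "set Ys \<subseteq> lowering" by blast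
  have "\<rho> Y x = foldr \<rho> (Y # Ys) u \<and> set (Y # Ys) \<subseteq> lowering" using Ys Y by simp
  then have "\<rho> Y x \<in> {foldr \<rho> Ys u | Ys. set Ys \<subseteq> lowering}" by blast
  then show ?case using step
    by (simp add: \<rho>_add[OF lowering_sp[OF Y]] \<rho>_scale[OF lowering_sp[OF Y]] span_add span_scale span_base)
qed

lemma D_sp_u: assumes "X \<in> sp_alg" shows "\<rho> X u \<in> D"
proof -
  define Q where "Q X \<longleftrightarrow> X \<in> sp_alg \<and> \<rho> X u \<in> D" for X
  have add: "Q X \<Longrightarrow> Q Y \<Longrightarrow> Q (X + Y)" and scale: "Q X \<Longrightarrow> Q (mscale c X)" for X Y c
    by (auto simp: Q_def sp_alg_closed \<rho>_add_mat \<rho>_scale_mat D_def span_add span_scale)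
  have zero: "Q 0" by (simp add: Q_def sp_alg_closed(3) \<rho>_0_mat D_def span_zero)
  have sum: "Q (sum f A)" if "\<And>a. a \<in> A \<Longrightarrow> Q (f a)" for f and A :: "'n set"
    using that by (induction A rule: infinite_finite_induct) (auto simp: zero intro: add)
  have m: "Q (Rm i j)" for i j using D_lowering[OF Rm_lowering D_u] by (simp add: Q_def R_sp)
  have p: "Q (Rp i j)" for i j by (simp add: Q_def R_sp Rp_u D_def span_zero)
  have kk: "Q (Rk i j)" for i j
  proof (cases i j rule: linorder_cases)
    case less then show ?thesis using D_lowering[OF Rk_lowering D_u] by (simp add: Q_def R_sp)
  next
    case greater then show ?thesis by (simp add: Q_def R_sp Rk_u D_def span_zero)
  next
    case equal
    \<comment> \<open>The diagonal Rk i i is not a root vector but - 1/2 times a coordinate element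
      of the Cartan subalgebra.\<close>
    have "Rk i i = cartan (\<chi> p. if p = i then - 1/2 else 0)"
    proof -
      have "Rk i i $ a $ b = cartan (\<chi> p. if p = i then - 1/2 else 0) $ a $ b" for a b
        by (cases a; cases b) (auto simp: Rk_def Let_def dl_def)
      then show ?thesis by (simp add: vec_eq_iff)
    qed
    then show ?thesis using equal D_u by (simp add: Q_def R_sp cartan_sp cart D_def span_scale)
  qed
  have "Q X" by (subst sp_decomposition[OF assms], intro sum add scale m p kk)
  then show ?thesis by (simp add: Q_def)
qed

text \<open>Words in lowering operators suffice without a Poincare-Birkhoff-Witt theorem: X Y w = Y
  X w + [X, Y] w, and the induction on the length of the word treats all X at once, so it covers the
  bracket.\<close>

lemma D_stable: assumes X: "X \<in> sp_alg" and w: "w \<in> D" shows "\<rho> X w \<in> D"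
proof -
  have *: "\<forall>X\<in>sp_alg. \<rho> X (foldr \<rho> Ys u) \<in> D" if "set Ys \<subseteq> lowering" for Ys
    using that
  proof (induction Ys)
    case Nil then show ?case by (simp add: D_sp_u)
  next
    case (Cons Y Ys)
    let ?w = "foldr \<rho> Ys u"
    have Y: "Y \<in> lowering" using Cons by simp
    show ?case
    proof
      fix X :: "(complex, 'n) mat2" assume X: "X \<in> sp_alg"
      have "\<rho> X (\<rho> Y ?w) = \<rho> Y (\<rho> X ?w) + \<rho> (bracket X Y) ?w"
        by (simp add: \<rho>_bracket[OF X lowering_sp[OF Y]])
      moreover have "\<rho> Y (\<rho> X ?w) \<in> D" using Cons X by (intro D_lowering[OF Y]) auto
      moreover have "\<rho> (bracket X Y) ?w \<in> D" using Cons bracket_sp[OF X lowering_sp[OF Y]] by auto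
      ultimately show "\<rho> X (foldr \<rho> (Y # Ys) u) \<in> D" by (simp add: D_def span_add)
    qed
  qed
  show ?thesis using w unfolding D_def
  proof (induction rule: span_induct_alt)
    case base then show ?case by (simp add: \<rho>_0[OF X] span_zero)
  next
    case (step c x y)
    then show ?case using * X by (auto simp: \<rho>_add[OF X] \<rho>_scale[OF X] D_def intro!: span_add span_scale)
  qed
qed

lemma D_split: assumes "w \<in> D" shows "\<exists>c y. y \<in> span L \<and> w = s c u + y"
proof -
  have "{foldr \<rho> Ys u | Ys. set Ys \<subseteq> lowering} \<subseteq> insert u L" unfolding L_def by force
  then have "w \<in> span (insert u L)" using assms span_mono unfolding D_def by blast
  then obtain c where "w - s c u \<in> span L" unfolding span_insert by blast
  then show ?thesis by (intro exI[of _ c] exI[of _ "w - s c u"]) simp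
qed

lemma span_L_induct:
  assumes "y \<in> span L" "P 0"
    and "\<And>c x y. x \<in> L \<Longrightarrow> \<exists>d>0. \<rho> (cartan h0) x = s (\<Lambda> h0 - of_real d) x \<Longrightarrow> P y \<Longrightarrow> P (s c x + y)"
  shows "P y" using assms(1)
proof (induction rule: span_induct_alt)
  case (step c x y)
  from step(1) obtain Ys where "x = foldr \<rho> Ys u" "set Ys \<subseteq> lowering" "Ys \<noteq> []" unfolding L_def by blast
  then show ?case using lowering_word_eigen[of Ys] step by (intro assms(3)) auto
qed (rule assms(2))

end

lemma hr_scale: "hr (C (of_real r) * f) g = r * hr f g" "hr f (C (of_real r) * g) = r * hr f g"
proof -
  show 1: "hr (C (of_real r) * f) g = r * hr f g" for f g
    by (simp add: inner_iota[symmetric] scaleR_fock[symmetric] linear_scale[OF linear_iota])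
  show "hr f (C (of_real r) * g) = r * hr f g" using 1[of g f] by (simp add: hr_commute)
qed

abbreviation csc :: "complex \<Rightarrow> fock \<Rightarrow> fock" where "csc c f \<equiv> C c * f"

lemma vector_space_csc: "vector_space csc" by unfold_locales (simp_all add: C_add C_mult algebra_simps)

context oscillator
begin

lemma lie_module_\<rho>F: "lie_module sp_alg csc \<rho>F"
proof -
  have "Vector_Spaces.linear csc csc (\<rho>F X)" for X
    unfolding Vector_Spaces.linear_iff by (simp add: vector_space_csc \<rho>F_add \<rho>F_C)
  then show ?thesis
    unfolding lie_module_def by (simp add: vector_space_csc \<rho>F_add_mat \<rho>F_scale_mat \<rho>F_bracket)
qed

text \<open>The entries of h0 are real, so conjugation negates \<open>cartan h0\<close>. Hence this
  element acts by a symmetric operator, and its eigenvectors for different real eigenvalues are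
  orthogonal.\<close>

lemma hr_cartan_h0: "hr (\<rho>F (cartan h0) f) g = hr f (\<rho>F (cartan h0) g)"
proof -
  have "cnj_mat (cartan h0) $ a $ b = mscale (- 1) (cartan h0 :: (complex, 'n) mat2) $ a $ b" for a b
    by (cases a; cases b) (simp_all add: cnj_mat_def map_matrix_def h0_def)
  then have e: "cnj_mat (cartan h0) = mscale (- 1) (cartan h0 :: (complex, 'n) mat2)" by (simp add: vec_eq_iff)
  show ?thesis unfolding hr_\<rho>F[OF cartan_sp] e \<rho>F_scale_mat by (simp add: C_minus hr_minus_right)
qed

lemma hr_eigenvectors:
  assumes "\<rho>F (cartan h0) f = csc (of_real x) f" "\<rho>F (cartan h0) g = csc (of_real y) g" "x \<noteq> y"
  shows "hr (csc d f) g = 0"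
proof -
  have "\<rho>F (cartan h0) (csc d f) = csc (of_real x) (csc d f)"
    unfolding \<rho>F_C assms(1) by (rule mult.left_commute)
  then have "x * hr (csc d f) g = y * hr (csc d f) g"
    using hr_cartan_h0[of "csc d f" g] assms(2) by (simp only: hr_scale)
  then show ?thesis using assms(3) by simp
qed

text \<open>The final clause says that T maps into every submodule containing f0. It later confines
  the image to polynomials in finitely many variables.\<close>

lemma irreducible_embeds:
  fixes sL :: "complex \<Rightarrow> 'v \<Rightarrow> 'v::ab_group_add"
  assumes irr: "irreducible_module sp_alg sL \<rho>" and hwV: "hw_module sL \<rho> v \<Lambda>" and v: "v \<noteq> 0"
    and hwF: "hw_module csc \<rho>F f0 \<Lambda>" and f0: "f0 \<noteq> 0" and \<Lambda>: "\<Lambda> h0 = of_real x0"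
  shows "\<exists>T :: 'v \<Rightarrow> fock. (\<forall>x y. T (x + y) = T x + T y) \<and> (\<forall>c x. T (sL c x) = C c * T x)
     \<and> (\<forall>X\<in>sp_alg. \<forall>x. T (\<rho> X x) = \<rho>F X (T x)) \<and> (\<forall>x. T x = 0 \<longrightarrow> x = 0)
     \<and> (\<forall>S. module.subspace csc S \<and> f0 \<in> S \<and> (\<forall>X\<in>sp_alg. \<rho>F X ` S \<subseteq> S) \<longrightarrow> range T \<subseteq> S)"
proof -
  define s2 where "s2 c p = (sL c (fst p), C c * snd p)" for c and p :: "'v \<times> fock"
  define \<rho>2 where "\<rho>2 X p = (\<rho> X (fst p), \<rho>F X (snd p))" for X and p :: "'v \<times> fock"
  interpret V: hw_module sL \<rho> v \<Lambda> by (rule hwV)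
  have vs2: "vector_space s2"
    by unfold_locales (simp_all add: s2_def V.scale_right_distrib V.scale_left_distrib C_add C_mult distrib_left distrib_right mult.assoc)
  interpret F: hw_module csc \<rho>F f0 \<Lambda> by (rule hwF)
  have "lie_module sp_alg s2 \<rho>2"
  proof -
    have "Vector_Spaces.linear s2 s2 (\<rho>2 X)" if "X \<in> sp_alg" for X
      unfolding Vector_Spaces.linear_iff using that by (simp add: vs2 \<rho>2_def s2_def V.\<rho>_add V.\<rho>_scale \<rho>F_add \<rho>F_C)
    then show ?thesis
      unfolding lie_module_def
      by (auto simp: vs2 \<rho>2_def s2_def V.\<rho>_add_mat V.\<rho>_scale_mat V.\<rho>_bracket \<rho>F_add_mat \<rho>F_scale_mat \<rho>F_bracket)
  qed
  then interpret P: hw_module s2 \<rho>2 "(v, f0)" \<Lambda>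
    by unfold_locales (simp_all add: \<rho>2_def s2_def V.cart F.cart V.Rk_u F.Rk_u V.Rp_u F.Rp_u zero_prod_def)
  let ?eig = "{x. \<exists>\<mu>. \<mu> \<noteq> \<Lambda> h0 \<and> \<rho> (cartan h0) x = sL \<mu> x}"
  have f0e: "\<rho>F (cartan h0) f0 = csc (of_real x0) f0" using F.cart[of h0] \<Lambda> by simp
  \<comment> \<open>Below the top weight the first component is a sum of other eigenvectors and the
    second is orthogonal to f0. All complex multiples appear because \<open>hr\<close> is only the
    real part of the Hermitian product.\<close>
  have low: "fst y \<in> V.span ?eig \<and> (\<forall>d. hr (C d * snd y) f0 = 0)" if "y \<in> P.span P.L" for y
    using that
  proof (induction rule: P.span_L_induct[consumes 1])
    case 1 then show ?case by (simp add: V.span_zero)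
  next
    case (2 c x y)
    then obtain d where d: "d > 0" "\<rho>2 (cartan h0) x = s2 (\<Lambda> h0 - of_real d) x" by blast
    then have x1: "fst x \<in> ?eig" by (auto simp: \<rho>2_def s2_def intro!: exI[of _ "\<Lambda> h0 - of_real d"])
    have "\<rho>F (cartan h0) (snd x) = csc (of_real (x0 - d)) (snd x)"
      using d(2) by (simp add: \<rho>2_def s2_def \<Lambda>)
    then have "hr (C b * snd x) f0 = 0" for b by (rule hr_eigenvectors[OF _ f0e]) (use d(1) in simp)
    note x = V.span_base[OF x1] this
    show ?case
    proof (intro conjI allI)
      show "fst (s2 c x + y) \<in> V.span ?eig" using x(1) 2 by (simp add: s2_def V.span_add V.span_scale)
      have "C b * snd (s2 c x + y) = C (b * c) * snd x + C b * snd y" for b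
        by (simp only: s2_def snd_conv snd_add distrib_left C_mult mult.assoc)
      then show "hr (C b * snd (s2 c x + y)) f0 = 0" for b using x(2) 2 by (simp only: hr_add_left)
    qed
  qed
  have vlow: "v \<notin> V.span ?eig" using V.span_other_eigenvectors[OF cartan_sp V.cart] v by blast
  \<comment> \<open>The y with (0, y) in D form a submodule. Each of them is orthogonal to f0,
    because its component along (v, f0) must vanish in the first factor. Moving lowering operators
    across the inner product makes y orthogonal to all second components of D, and y is one of
    them.\<close>
  have N2: "y = 0" if y: "(0, y) \<in> P.D" for y
  proof -
    have base: "hr y f0 = 0" if y: "(0, y) \<in> P.D" for y
    proof -
      obtain c z where z: "z \<in> P.span P.L" "(0, y) = s2 c (v, f0) + z" using P.D_split[OF y] by blast
      have e1: "0 = sL c v + fst z" and e2: "y = C c * f0 + snd z"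
        using arg_cong[OF z(2), of fst] arg_cong[OF z(2), of snd] by (simp_all only: s2_def fst_add snd_add fst_conv snd_conv)
      have "sL (- c) v = fst z" using minus_unique[OF e1[symmetric]] by (simp only: V.scale_minus_left)
      then have "sL (- c) v \<in> V.span ?eig" using low[OF z(1)] by (simp only:)
      from V.span_scale[OF this, of "inverse (- c)"] have "c = 0" using vlow by (cases "c = 0") simp_all
      then have "y = C 1 * snd z" using e2 by simp
      then show ?thesis using low[OF z(1)] by (simp only:)
    qed
    have word: "hr y (snd (foldr \<rho>2 Ys (v, f0))) = 0" if "(0, y) \<in> P.D" "set Ys \<subseteq> lowering" for y Ys
      using that
    proof (induction Ys arbitrary: y)
      case Nil then show ?case using base by simp
    next
      case (Cons Y Ys)
      have Y: "Y \<in> sp_alg" using Cons.prems by (auto simp: P.lowering_sp)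
      have cc: "cnj_mat (cnj_mat Y) = Y" by (simp add: cnj_mat_def vec_eq_iff)
      have "\<rho>2 (cnj_mat Y) (0, y) \<in> P.D" by (rule P.D_stable[OF cnj_mat_sp[OF Y] Cons.prems(1)])
      then have "(0, \<rho>F (cnj_mat Y) y) \<in> P.D" by (simp add: \<rho>2_def V.\<rho>_0[OF cnj_mat_sp[OF Y]])
      then have "hr (\<rho>F (cnj_mat Y) y) (snd (foldr \<rho>2 Ys (v, f0))) = 0" using Cons by simp
      moreover have "snd (\<rho>2 Y p) = \<rho>F Y (snd p)" for p by (simp add: \<rho>2_def)
      ultimately show ?case unfolding hr_\<rho>F[OF cnj_mat_sp[OF Y]] cc by simp
    qed
    have "\<forall>y. (0, y) \<in> P.D \<longrightarrow> hr y (snd p) = 0" if "p \<in> P.D" for p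
      using that unfolding P.D_def
    proof (induction rule: P.span_induct_alt)
      case base then show ?case by simp
    next
      case (step c x y)
      then obtain Ys where Ys: "x = foldr \<rho>2 Ys (v, f0)" "set Ys \<subseteq> lowering" by blast
      show ?case
      proof (intro allI impI)
        fix z assume z: "(0, z) \<in> P.span {foldr \<rho>2 Ys (v, f0) |Ys. set Ys \<subseteq> lowering}"
        then have "s2 (cnj c) (0, z) \<in> P.D" unfolding P.D_def by (rule P.span_scale)
        then have "hr (C (cnj c) * z) (snd x) = 0" using word[OF _ Ys(2)] by (simp add: s2_def Ys(1))
        then have "hr z (C c * snd x) = 0" by (simp add: hr_C)
        moreover have "hr z (snd y) = 0" using step z by blast
        moreover have "snd (s2 c x + y) = C c * snd x + snd y" by (simp add: s2_def)
        ultimately show "hr z (snd (s2 c x + y)) = 0" by (simp add: hr_add_right)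
      qed
    qed
    then have "hr y y = 0" using y by fastforce
    then show ?thesis by (simp add: hr_self_zero)
  qed
  have sub1: "V.subspace {x. (x, 0) \<in> P.D}" unfolding V.subspace_def P.D_def
    using P.span_zero P.span_add[of "(_, 0)" _ "(_, 0)"] P.span_scale[of "(_, 0)"]
    by (auto simp: zero_prod_def s2_def)
  have "\<rho> X ` {x. (x, 0) \<in> P.D} \<subseteq> {x. (x, 0) \<in> P.D}" if "X \<in> sp_alg" for X
    using P.D_stable[OF that, of "(_, 0)"] by (auto simp: \<rho>2_def)
  then have "{x. (x, 0) \<in> P.D} = {0} \<or> {x. (x, 0) \<in> P.D} = UNIV"
    using irr sub1 unfolding irreducible_module_def by blast
  \<comment> \<open>Otherwise the second component 0 equals c f0 plus something orthogonal to f0,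
    which forces c = 0. Then v would be a sum of vectors of lower weight.\<close>
  moreover have "(v, 0) \<notin> P.D"
  proof
    assume "(v, 0) \<in> P.D"
    then obtain c z where z: "z \<in> P.span P.L" "(v, 0) = s2 c (v, f0) + z" using P.D_split by blast
    have e: "v = sL c v + fst z" "0 = C c * f0 + snd z"
      using arg_cong[OF z(2), of fst] arg_cong[OF z(2), of snd] by (simp_all only: s2_def fst_add snd_add fst_conv snd_conv)
    have "hr (C (cnj c) * (C c * f0 + snd z)) f0 = hr (C (cnj c) * (C c * f0)) f0"
      using low[OF z(1)] by (simp add: distrib_left hr_add_left)
    then have "hr (C (cnj c) * (C c * f0)) f0 = 0" unfolding e(2)[symmetric] by simp
    then have "hr (C c * f0) (C c * f0) = 0" by (simp only: hr_C complex_cnj_cnj)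
    then have "C c * f0 = 0" by (simp add: hr_self_zero)
    then have "c = 0"
    proof -
      obtain \<alpha> where "lk f0 \<alpha> \<noteq> 0" using f0 poly_mapping_eqI[of f0 0] by auto
      then show ?thesis using arg_cong[OF \<open>C c * f0 = 0\<close>, of "\<lambda>f. lk f \<alpha>"] by simp
    qed
    then show False using e(1) vlow low[OF z(1)] by simp
  qed
  ultimately have N1: "x = 0" if "(x, 0) \<in> P.D" for x using that by blast
  have "V.subspace (fst ` P.D)" unfolding V.subspace_def
  proof (intro conjI ballI allI)
    show "0 \<in> fst ` P.D" unfolding P.D_def using P.span_zero by force
    show "x + y \<in> fst ` P.D" if xy: "x \<in> fst ` P.D" "y \<in> fst ` P.D" for x y
    proof -
      obtain p q where pq: "p \<in> P.D" "q \<in> P.D" "x = fst p" "y = fst q" using xy by blast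
      have "p + q \<in> P.D" using pq(1,2) unfolding P.D_def by (rule P.span_add)
      from imageI[OF this, of fst] show ?thesis by (simp only: pq fst_add)
    qed
    show "sL c x \<in> fst ` P.D" if x: "x \<in> fst ` P.D" for c x
    proof -
      obtain p where p: "p \<in> P.D" "x = fst p" using x by blast
      have "s2 c p \<in> P.D" using p(1) unfolding P.D_def by (rule P.span_scale)
      from imageI[OF this, of fst] show ?thesis by (simp only: p s2_def fst_conv)
    qed
  qed
  moreover have "\<rho> X ` fst ` P.D \<subseteq> fst ` P.D" if "X \<in> sp_alg" for X
  proof -
    have "\<rho> X (fst p) \<in> fst ` P.D" if "p \<in> P.D" for p
      using imageI[OF P.D_stable[OF \<open>X \<in> sp_alg\<close> that], of fst] by (simp add: \<rho>2_def)
    then show ?thesis by auto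
  qed
  ultimately have "fst ` P.D = {0} \<or> fst ` P.D = UNIV" using irr unfolding irreducible_module_def by blast
  moreover have "v \<in> fst ` P.D" using imageI[OF P.D_u, of fst] by simp
  ultimately have tot: "fst ` P.D = UNIV" using v by blast
  have uniq: "y = y'" if "(x, y) \<in> P.D" "(x, y') \<in> P.D" for x y y'
  proof -
    have "(x, y) - (x, y') \<in> P.D" using that unfolding P.D_def by (rule P.span_diff)
    then show ?thesis using N2[of "y - y'"] by simp
  qed
  have "\<forall>x. \<exists>y. (x, y) \<in> P.D"
  proof
    fix x
    have "x \<in> fst ` P.D" using tot by simp
    then show "\<exists>y. (x, y) \<in> P.D" by auto
  qed
  from choice[OF this] obtain T where T: "\<And>x. (x, T x) \<in> P.D" by blast
  have T1: "T (x + y) = T x + T y" for x y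
    using P.span_add[of "(x, T x)" _ "(y, T y)"] T unfolding P.D_def by (intro uniq[OF T]) (simp add: P.D_def)
  have T2: "T (sL c x) = C c * T x" for c x
    using P.span_scale[of "(x, T x)" _ c] T unfolding P.D_def by (intro uniq[OF T]) (simp add: P.D_def s2_def)
  have T3: "T (\<rho> X x) = \<rho>F X (T x)" if "X \<in> sp_alg" for X x
    using P.D_stable[OF that T[of x]] by (intro uniq[OF T]) (simp add: \<rho>2_def)
  have T4: "x = 0" if "T x = 0" for x using T[of x] N1 that by simp
  have T5: "range T \<subseteq> S" if S: "F.subspace S" "f0 \<in> S" "\<forall>X\<in>sp_alg. \<rho>F X ` S \<subseteq> S" for S
  proof -
    have w: "snd (foldr \<rho>2 Ys (v, f0)) \<in> S" if "set Ys \<subseteq> lowering" for Ys using that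
    proof (induction Ys)
      case Nil then show ?case using S(2) by simp
    next
      case (Cons Y Ys)
      have "Y \<in> sp_alg" using Cons.prems by (auto intro: P.lowering_sp)
      moreover have "snd (foldr \<rho>2 Ys (v, f0)) \<in> S" using Cons by simp
      ultimately have "\<rho>F Y (snd (foldr \<rho>2 Ys (v, f0))) \<in> S" using S(3) by blast
      moreover have "snd (\<rho>2 Y p) = \<rho>F Y (snd p)" for p by (simp add: \<rho>2_def)
      ultimately show ?case by simp
    qed
    have "snd p \<in> S" if "p \<in> P.D" for p using that unfolding P.D_def
    proof (induction rule: P.span_induct_alt)
      case base then show ?case using F.subspace_0[OF S(1)] by simp
    next
      case (step c x y)
      have "snd x \<in> S" using step(1) w by blast
      moreover have "snd (s2 c x + y) = csc c (snd x) + snd y" by (simp add: s2_def)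
      ultimately show ?case using F.subspace_add[OF S(1) F.subspace_scale[OF S(1)]] step by (simp only:)
    qed
    from this[OF T] show ?thesis by auto
  qed
  show ?thesis
  proof (intro exI[of _ T] conjI allI ballI impI)
    fix S assume "F.subspace S \<and> f0 \<in> S \<and> (\<forall>X\<in>sp_alg. \<rho>F X ` S \<subseteq> S)"
    then show "range T \<subseteq> S" using T5 by (elim conjE)
  qed (rule T1 T2 T3 T4; assumption?)+
qed

lemma hw_module_hwv:
  assumes M: "m \<le> M" "M + m \<le> k"
    and \<Lambda>: "\<And>h. \<Lambda> h = (\<Sum>i\<in>UNIV. of_real (- (real k / 2) - (if corow (i::'n) < M then 1 else 0) - (\<Sum>c\<in>{1..m}. if corow i < c then real (e c) else 0)) * h $ i)"
  shows "hw_module csc \<rho>F (hwv M e) \<Lambda>"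
proof (intro hw_module.intro sp_module.intro lie_module_\<rho>F hw_module_axioms.intro)
  let ?f = "hwv M e"
  show "\<rho>F (Rp i j) ?f = 0" for i j by (simp add: \<rho>F_Rp hwv_harmonic[OF M])
  show "\<rho>F (Rk i j) ?f = 0" if "j < i" for i j
    using hwv_lower[OF that, of M e] M that by (simp add: \<rho>F_Rk E_def)
  show "\<rho>F (cartan h) ?f = csc (\<Lambda> h) ?f" for h
  proof -
    define w where "w i = (if corow i < M then 1 else 0) + (\<Sum>c\<in>{1..m}. if corow i < c then e c else 0)" for i :: 'n
    have "\<rho>F (cartan h) ?f = - (\<Sum>i\<in>UNIV. C (h $ i) * (C (of_nat (w i)) * ?f + C (of_nat k / 2) * ?f))"
      using hwv_weight[of M _ e] M unfolding E_def w_def \<rho>F_cartan by simp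
    also have "\<dots> = C (- (\<Sum>i\<in>UNIV. h $ i * (of_nat (w i) + of_nat k / 2))) * ?f"
      unfolding C_minus C_sum sum_distrib_right minus_mult_left[symmetric] C_mult C_add by (simp add: algebra_simps)
    also have "- (\<Sum>i\<in>UNIV. h $ i * (of_nat (w i) + of_nat k / 2)) = \<Lambda> h"
    proof -
      have w: "of_nat (w i) = (of_real ((if corow i < M then 1 else 0) + (\<Sum>c\<in>{1..m}. if corow i < c then real (e c) else 0)) :: complex)" for i
        unfolding w_def by (simp add: if_distrib[of of_nat] if_distrib[of of_real] cong: if_cong)
      show ?thesis unfolding \<Lambda> w sum_negf[symmetric] by (intro sum.cong refl) (simp add: algebra_simps)
    qed
    finally show ?thesis .
  qed
qed

end

section \<open>The highest weight vector of a quotient of N(\<lambda>)\<close>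

lemma lookup_fscale: "lk (fscale c x) a = c * lk x a" by (simp add: Poly_Mapping.map.rep_eq when_def)

lemma vector_space_fscale: "vector_space (fscale :: complex \<Rightarrow> ('n::finite, 'f) free_words \<Rightarrow> _)"
  by unfold_locales (auto intro!: poly_mapping_eqI simp: lookup_fscale lookup_add algebra_simps)

lemma prepend_word: "prepend X (word u f) = word (X # u) f" by (simp add: prepend_def)

lemma word_in_sp_words: "u \<in> lists sp_alg \<Longrightarrow> word u f \<in> sp_words" by (auto simp: sp_words_def)

lemma sp_words_closed:
  "x \<in> sp_words \<Longrightarrow> y \<in> sp_words \<Longrightarrow> x + y \<in> sp_words" "x \<in> sp_words \<Longrightarrow> fscale c x \<in> sp_words" "0 \<in> sp_words"
proof -
  show "x \<in> sp_words \<Longrightarrow> y \<in> sp_words \<Longrightarrow> x + y \<in> sp_words"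
    using Poly_Mapping.keys_add[of x y] unfolding sp_words_def by blast
  have "ks (fscale c x) \<subseteq> ks x" by (auto simp: in_keys_iff lookup_fscale)
  then show "x \<in> sp_words \<Longrightarrow> fscale c x \<in> sp_words" unfolding sp_words_def by blast
qed (simp add: sp_words_def)

lemma N_class_eq:
  fixes x y :: "('n::{finite,linorder}, 'f::ab_group_add) free_words"
  assumes "x - y \<in> module.span fscale (N_relators s \<sigma>)"
  shows "N_class s \<sigma> x = N_class s \<sigma> y"
proof -
  interpret vector_space "fscale :: complex \<Rightarrow> ('n, 'f) free_words \<Rightarrow> _" by (rule vector_space_fscale)
  have "\<exists>r'. x + r = y + r' \<and> r' \<in> span (N_relators s \<sigma>)" if "r \<in> span (N_relators s \<sigma>)" for r
    using span_add[OF assms that] by (intro exI[of _ "x - y + r"]) simp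
  moreover have "\<exists>r'. y + r = x + r' \<and> r' \<in> span (N_relators s \<sigma>)" if "r \<in> span (N_relators s \<sigma>)" for r
    using span_diff[OF that assms] by (intro exI[of _ "r - (x - y)"]) simp
  ultimately show ?thesis unfolding N_class_def by blast
qed

text \<open>The vector is the image of 1 \<otimes> f0. If it were 0, the map f \<mapsto> image of 1
  \<otimes> f would have a nonzero kernel, which is a k-submodule of the irreducible F and hence
  everything. Then all words would map to 0, although the quotient is nonzero.\<close>

lemma quotient_hw_vector:
  fixes sF :: "complex \<Rightarrow> 'f \<Rightarrow> 'f::ab_group_add" and sL :: "complex \<Rightarrow> 'v \<Rightarrow> 'v::ab_group_add"
    and \<rho> :: "(complex, 'n::{finite,linorder}) mat2 \<Rightarrow> 'v \<Rightarrow> 'v"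
  assumes F: "is_F lam sF \<sigma>" and Q: "irreducible_quotient_of_N sF \<sigma> sL \<rho>"
  shows "\<exists>v. v \<noteq> 0 \<and> hw_module sL \<rho> v (\<lambda>h. \<Sum>i\<in>UNIV. of_real (lam $ i) * h $ i)"
proof -
  have irr: "irreducible_module sp_alg sL \<rho>" using Q by (simp add: irreducible_quotient_of_N_def)
  then interpret V: sp_module sL \<rho> by unfold_locales (simp add: irreducible_module_def)
  obtain \<phi> where \<phi>: "N_epimorphism sF \<sigma> sL \<rho> \<phi>" using Q by (auto simp: irreducible_quotient_of_N_def)
  define \<Phi> where "\<Phi> x = \<phi> (N_class sF \<sigma> x)" for x
  have add: "\<Phi> (x + y) = \<Phi> x + \<Phi> y" if "x \<in> sp_words" "y \<in> sp_words" for x y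
    using \<phi> that by (simp add: N_epimorphism_def \<Phi>_def)
  have scale: "\<Phi> (fscale c x) = sL c (\<Phi> x)" if "x \<in> sp_words" for c x
    using \<phi> that by (simp add: N_epimorphism_def \<Phi>_def)
  have pre: "\<Phi> (prepend X x) = \<rho> X (\<Phi> x)" if "x \<in> sp_words" "X \<in> sp_alg" for x X
    using \<phi> that by (simp add: N_epimorphism_def \<Phi>_def)
  have surj: "\<exists>x\<in>sp_words. \<Phi> x = v" for v
    using \<phi> unfolding N_epimorphism_def N_carrier_def \<Phi>_def by (metis UNIV_I imageE)
  have zero: "\<Phi> 0 = 0" using add[OF sp_words_closed(3,3)] by simp
  interpret W: vector_space "fscale :: complex \<Rightarrow> ('n, 'f) free_words \<Rightarrow> _" by (rule vector_space_fscale)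
  have rel: "\<Phi> x = \<Phi> y" if "x - y \<in> N_relators sF \<sigma>" for x y
    using N_class_eq[OF W.span_base[OF that]] by (simp add: \<Phi>_def)
  define j where "j f = \<Phi> (word [] f)" for f
  have w0: "word [] f \<in> sp_words" for f by (rule word_in_sp_words) simp
  have j_add: "j (f + f') = j f + j f'" for f f'
  proof -
    have "word [] (f + f') - (word [] f + word [] f') \<in> N_relators sF \<sigma>"
      using N_relators.add_F[of "[]" f f' sF \<sigma>] by (simp add: diff_diff_eq)
    then show ?thesis unfolding j_def using rel add[OF w0 w0] by metis
  qed
  have j_scale: "j (sF c f) = sL c (j f)" for c f
  proof -
    have "word [] (sF c f) - fscale c (word [] f) \<in> N_relators sF \<sigma>" by (rule N_relators.scale_F) simp
    then show ?thesis unfolding j_def using rel scale[OF w0] by metis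
  qed
  have j_k: "\<rho> Y (j f) = j (\<sigma> Y f)" if "Y \<in> sp_compact" for Y f
  proof -
    have Y: "Y \<in> sp_alg" using that by (simp add: sp_compact_def)
    have "word ([] @ [Y]) f - word [] (\<sigma> Y f) \<in> N_relators sF \<sigma>"
      by (rule N_relators.balance_k) (use that in simp_all)
    then have "\<Phi> (word [Y] f) = j (\<sigma> Y f)" unfolding j_def using rel by simp
    moreover have "\<Phi> (word [Y] f) = \<rho> Y (j f)"
      unfolding j_def using pre[OF w0 Y, of f] by (simp only: prepend_word)
    ultimately show ?thesis by simp
  qed
  have j_p: "\<rho> Z (j f) = 0" if "Z \<in> sp_plus" "Z \<in> sp_alg" for Z f
  proof -
    have "word ([] @ [Z]) f - 0 \<in> N_relators sF \<sigma>"
      using N_relators.balance_p[of "[]" Z f sF \<sigma>] that by simp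
    then have "\<Phi> (word [Z] f) = 0" using rel[of "word [Z] f" 0] zero by simp
    then show ?thesis unfolding j_def using pre[OF w0 that(2), of f] by (simp only: prepend_word)
  qed
  have irrF: "irreducible_module sp_compact sF \<sigma>" using F by (simp add: is_F_def)
  then have vsF: "vector_space sF" by (simp add: irreducible_module_def lie_module_def)
  interpret F: vector_space sF by (rule vsF)
  obtain f0 where f0: "f0 \<noteq> 0" "\<And>h. \<sigma> (cartan h) f0 = sF (\<Sum>i\<in>UNIV. of_real (lam $ i) * h $ i) f0"
    "\<And>i j X. i < j \<Longrightarrow> X \<in> root_space (\<lambda>h. h $ i - h $ j) \<Longrightarrow> \<sigma> X f0 = 0"
    using F unfolding is_F_def by blast
  have j0: "j 0 = 0" using j_add[of 0 0] by simp
  have "j f0 \<noteq> 0"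
  proof
    assume z: "j f0 = 0"
    have "F.subspace {f. j f = 0}" unfolding F.subspace_def by (simp add: j0 j_add j_scale)
    moreover have "\<sigma> Y ` {f. j f = 0} \<subseteq> {f. j f = 0}" if "Y \<in> sp_compact" for Y
    proof -
      have "Y \<in> sp_alg" using that by (simp add: sp_compact_def)
      then show ?thesis using V.\<rho>_0 by (auto simp: j_k[OF that, symmetric])
    qed
    ultimately have "{f. j f = 0} = {0} \<or> {f. j f = 0} = UNIV" using irrF unfolding irreducible_module_def by blast
    then have "\<And>f. j f = 0" using z f0(1) by blast
    then have "\<Phi> (word u f) = 0" if "u \<in> lists sp_alg" for u f using that
    proof (induction u)
      case Nil then show ?case by (simp add: j_def)
    next
      case (Cons X u)
      then show ?case using pre[of "word u f" X] by (simp add: prepend_word word_in_sp_words V.\<rho>_0)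
    qed
    note \<Phi>0 = this
    have "\<Phi> x = 0" if x: "x \<in> sp_words" for x
    proof -
      have "\<Phi> (\<Sum>p\<in>A. sg p (lk x p)) = 0 \<and> (\<Sum>p\<in>A. sg p (lk x p)) \<in> sp_words" if "finite A" "A \<subseteq> ks x" for A
        using that
      proof (induction A rule: finite_induct)
        case empty then show ?case by (simp add: zero sp_words_closed)
      next
        case (insert p A)
        obtain u f where p: "p = (u, f)" by (cases p)
        have u: "u \<in> lists sp_alg" using insert.prems x unfolding sp_words_def p by force
        have e: "sg p (lk x p) = fscale (lk x p) (word u f)"
          by (rule poly_mapping_eqI) (simp add: lookup_fscale p lookup_single when_def)
        have "\<Phi> (sg p (lk x p)) = 0" unfolding e scale[OF word_in_sp_words[OF u]] \<Phi>0[OF u] by simp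
        moreover have "sg p (lk x p) \<in> sp_words" unfolding e by (intro sp_words_closed word_in_sp_words u)
        ultimately show ?case using insert by (simp add: add sp_words_closed)
      qed
      from this[OF finite_keys order_refl] show ?thesis by (simp only: poly_eq_sum_single[of x, symmetric])
    qed
    then have "v = 0" for v :: 'v using surj[of v] by auto
    then show False using irr unfolding irreducible_module_def by blast
  qed
  moreover have "hw_module sL \<rho> (j f0) (\<lambda>h. \<Sum>i\<in>UNIV. of_real (lam $ i) * h $ i)"
  proof (unfold_locales)
    show "\<rho> (cartan h) (j f0) = sL (\<Sum>i\<in>UNIV. of_real (lam $ i) * h $ i) (j f0)" for h
      by (simp only: j_k[OF cartan_compact] f0(2) j_scale)
    show "\<rho> (Rp i j') (j f0) = 0" for i j' by (rule j_p[OF Rp_plus R_sp(2)])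
    show "\<rho> (Rk i j') (j f0) = 0" if "j' < i" for i j'
      using f0(3)[OF that R_roots(3)[of i j']] by (simp add: j_k[OF Rk_compact] j0)
  qed
  ultimately show ?thesis by blast
qed

section \<open>One-parameter subgroups and invariant subspaces\<close>

lemma G_exp_add:
  assumes "X \<in> sp_alg"
  shows "G_mult (G_exp (s *\<^sub>R X)) (G_exp (t *\<^sub>R X)) = G_exp ((s + t) *\<^sub>R X)"
proof -
  have X: "r *\<^sub>R X \<in> sp_alg" for r
    using assms by (simp add: sp_alg_iff linear_scale[OF linear_of_mat] sp.star_scaleR)
  have "of_mat (mat_exp (r *\<^sub>R s *\<^sub>R X) ** mat_exp (r *\<^sub>R t *\<^sub>R X)) = of_mat (mat_exp (r *\<^sub>R (s + t) *\<^sub>R X))" for r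
  proof -
    have "exp ((r * s) *\<^sub>R of_mat X) * exp ((r * t) *\<^sub>R of_mat X) = exp ((r * s) *\<^sub>R of_mat X + (r * t) *\<^sub>R of_mat X)"
      by (rule exp_add_commuting[symmetric]) simp
    then show ?thesis
      by (simp add: of_mat_mult of_mat_exp linear_scale[OF linear_of_mat] scaleR_add_left[symmetric] distrib_left)
  qed
  then have "mat_exp (r *\<^sub>R s *\<^sub>R X) ** mat_exp (r *\<^sub>R t *\<^sub>R X) = mat_exp (r *\<^sub>R (s + t) *\<^sub>R X)" for r
    by (metis to_mat_of_mat)
  then show ?thesis
    unfolding G_exp_def G_mult_pclass[OF exp_path[OF X] exp_path[OF X]] by simp
qed

lemma G_exp_in_G: "X \<in> sp_alg \<Longrightarrow> G_exp X \<in> G_group"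
  using exp_path by (auto simp: G_group_def G_exp_def)

context Sp_rep
begin

lemma \<pi>_image:
  assumes a: "a \<in> G_group" and W: "subspace W" and inv: "\<And>X w. symp_star X = - X \<Longrightarrow> w \<in> W \<Longrightarrow> \<rho> X w \<in> W"
  shows "\<pi> a ` closure (\<iota> ` W) = closure (\<iota> ` W)"
proof (rule \<pi>_induct[OF a, where P="\<lambda>f. f ` closure (\<iota> ` W) = closure (\<iota> ` W)"])
  fix X :: "('n + 'n) sqmat" assume X: "symp_star X = - X" "R * norm X < 1"
  have X': "symp_star (- X) = - (- X)" "R * norm (- X) < 1" using X by (simp_all only: sp.star_minus norm_minus_cancel)
  show "U X ` closure (\<iota> ` W) = closure (\<iota> ` W)"
  proof (intro equalityI subsetI)
    fix x assume "x \<in> U X ` closure (\<iota> ` W)"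
    then show "x \<in> closure (\<iota> ` W)" using U_invariant[OF W inv[OF X(1)] X] by blast
  next
    fix x assume "x \<in> closure (\<iota> ` W)"
    then have "U (- X) x \<in> closure (\<iota> ` W)" using U_invariant[OF W inv[OF X'(1)] X'] by blast
    then show "x \<in> U X ` closure (\<iota> ` W)" using U_inverse[OF X', of x] by (metis image_eqI minus_minus)
  qed
qed (simp, metis image_comp)

lemma \<pi>_exp_add: "X \<in> sp_alg \<Longrightarrow> \<pi> (G_exp ((s + t) *\<^sub>R X)) x = \<pi> (G_exp (s *\<^sub>R X)) (\<pi> (G_exp (t *\<^sub>R X)) x)"
proof -
  assume X: "X \<in> sp_alg"
  have Y: "r *\<^sub>R X \<in> sp_alg" for r
    using X by (simp add: sp_alg_iff linear_scale[OF linear_of_mat] sp.star_scaleR)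
  show ?thesis by (simp add: G_exp_add[OF X, symmetric] \<pi>_mult G_exp_in_G Y)
qed

lemma \<pi>_exp_0: "\<pi> (G_exp 0) x = x"
proof -
  have X: "0 \<in> (sp_alg :: (real, 'n) mat2 set)" by (simp add: sp_alg_entries)
  interpret bounded_linear "\<pi> (G_exp 0)" by (rule \<pi>_props[OF G_exp_in_G[OF X]])
  have "\<pi> (G_exp 0) (\<pi> (G_exp 0) x) = \<pi> (G_exp 0) x" using \<pi>_exp_add[OF X, of 0 0 x] by simp
  then have "norm (\<pi> (G_exp 0) (\<pi> (G_exp 0) x - x)) = 0" by (simp add: diff)
  then show ?thesis unfolding \<pi>_props(2)[OF G_exp_in_G[OF X]] by simp
qed

text \<open>A curve in \<open>'f\<close> that solves y' = X y is the orbit of its initial value, for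
  all t and not only near 0. Its inner product with the orbit of any \<iota> w is constant, and such
  orbits fill a dense subspace at each t.\<close>

lemma exp_intertwine:
  assumes X: "X \<in> sp_alg"
    and g: "\<And>t. ((\<lambda>s. \<iota> (g (t + s))) has_vector_derivative \<iota> (\<rho> (of_mat X) (g t))) (at 0)"
  shows "\<pi> (G_exp (t *\<^sub>R X)) (\<iota> (g 0)) = \<iota> (g t)"
proof -
  let ?\<pi> = "\<lambda>t. \<pi> (G_exp (t *\<^sub>R X))" and ?X = "of_mat X"
  have tX: "t *\<^sub>R X \<in> sp_alg" for t
    using X by (simp add: sp_alg_iff linear_scale[OF linear_of_mat] sp.star_scaleR)
  note P = \<pi>_props[OF G_exp_in_G[OF tX]]
  have bl: "bounded_linear (?\<pi> t)" for t by (rule P)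
  \<comment> \<open>The orbit of \<iota> w need not stay in the range of \<iota>, where skewness is
    given. The relation is obtained by differentiating the invariance of the inner product
    instead.\<close>
  have skew_orbit: "inner (\<iota> (\<rho> ?X f)) (?\<pi> t (\<iota> w)) = - inner (\<iota> f) (?\<pi> t (\<iota> (\<rho> ?X w)))" for f t w
  proof -
    have "((\<lambda>s. inner (?\<pi> s (\<iota> f)) (?\<pi> t (\<iota> w))) has_vector_derivative inner (\<iota> (\<rho> ?X f)) (?\<pi> t (\<iota> w))) (at 0)"
      by (rule bounded_linear.has_vector_derivative[OF bounded_linear_inner_left \<pi>_exp_deriv[OF X]])
    moreover have "inner (?\<pi> s (\<iota> f)) (?\<pi> t (\<iota> w)) = inner (\<iota> f) (?\<pi> t (\<pi> (G_exp (s *\<^sub>R (- X))) (\<iota> w)))" for s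
    proof -
      have "?\<pi> t (\<iota> w) = ?\<pi> s (?\<pi> t (?\<pi> (- s) (\<iota> w)))"
        using \<pi>_exp_add[OF X, of t "- s" "\<iota> w"] \<pi>_exp_add[OF X, of s "t - s" "\<iota> w"] by simp
      then show ?thesis by (simp add: P(3))
    qed
    moreover have "((\<lambda>s. inner (\<iota> f) (?\<pi> t (\<pi> (G_exp (s *\<^sub>R (- X))) (\<iota> w)))) has_vector_derivative inner (\<iota> f) (?\<pi> t (\<iota> (\<rho> (of_mat (- X)) w)))) (at 0)"
      using tX[of "- 1"]
      by (intro bounded_linear.has_vector_derivative[OF bounded_linear_inner_right] bounded_linear.has_vector_derivative[OF bl] \<pi>_exp_deriv) simp
    ultimately have "inner (\<iota> (\<rho> ?X f)) (?\<pi> t (\<iota> w)) = inner (\<iota> f) (?\<pi> t (\<iota> (\<rho> (of_mat (- X)) w)))"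
      using vector_derivative_unique_at by fastforce
    also have "\<iota> (\<rho> (of_mat (- X)) w) = - \<iota> (\<rho> ?X w)"
      by (simp add: linear_neg[OF linear_of_mat] linear_neg[OF lin_rho'] linear_neg[OF lin_iota])
    finally show ?thesis by (simp add: linear_neg[OF bounded_linear.linear[OF bl]])
  qed
  have const: "inner (\<iota> (g t)) (?\<pi> t (\<iota> w)) = inner (\<iota> (g 0)) (\<iota> w)" for t w
  proof -
    define \<psi> where "\<psi> t = inner (\<iota> (g t)) (?\<pi> t (\<iota> w))" for t
    have "(\<psi> has_real_derivative 0) (at t)" for t
    proof -
      have d2: "((\<lambda>s. ?\<pi> t (?\<pi> s (\<iota> w))) has_vector_derivative ?\<pi> t (\<iota> (\<rho> ?X w))) (at 0)"
        by (rule bounded_linear.has_vector_derivative[OF bl \<pi>_exp_deriv[OF X]])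
      have "((\<lambda>s. inner (\<iota> (g (t + s))) (?\<pi> t (?\<pi> s (\<iota> w)))) has_vector_derivative
          inner (\<iota> (g (t + 0))) (?\<pi> t (\<iota> (\<rho> ?X w))) + inner (\<iota> (\<rho> ?X (g t))) (?\<pi> t (?\<pi> 0 (\<iota> w)))) (at 0)"
        by (rule bounded_bilinear.has_vector_derivative[OF bounded_bilinear_inner g d2])
      then have "((\<lambda>s. \<psi> (t + s)) has_vector_derivative 0) (at 0)"
        by (simp add: \<psi>_def \<pi>_exp_add[OF X] \<pi>_exp_0 skew_orbit)
      then show ?thesis
        using DERIV_shift[of \<psi> 0 0 t] by (simp add: has_real_derivative_iff_has_vector_derivative add.commute)
    qed
    then have "\<psi> t = \<psi> 0" by (metis DERIV_isconst_all)
    then show ?thesis by (simp add: \<psi>_def \<pi>_exp_0)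
  qed
  have "inner (?\<pi> t (\<iota> (g 0)) - \<iota> (g t)) (?\<pi> t z) = 0" for z
  proof -
    have "inner (\<iota> (g t)) (?\<pi> t z) = inner (\<iota> (g 0)) z"
      by (rule bounded_linear_eq_on_dense[of _ _ \<iota>, OF bounded_linear_compose[OF bounded_linear_inner_right bl] bounded_linear_inner_right const dense])
    then show ?thesis by (simp add: inner_diff_left P(3))
  qed
  moreover obtain z where "?\<pi> t (\<iota> (g 0)) - \<iota> (g t) = ?\<pi> t z" using P(4) by blast
  ultimately show ?thesis by (metis inner_eq_zero_iff eq_iff_diff_eq_0)
qed

end

section \<open>The Hilbert space and its K-finite vectors\<close>

abbreviation psc :: "complex \<Rightarrow> (nat \<Rightarrow> complex) \<Rightarrow> nat \<Rightarrow> complex" where "psc \<equiv> \<lambda>c x i. c * x i"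

lemma Rep_ell2_fun:
  "Rep_ell2 (x + y) = Rep_ell2 x + Rep_ell2 y" "Rep_ell2 (x - y) = Rep_ell2 x - Rep_ell2 y"
  "Rep_ell2 0 = 0" "Rep_ell2 (cscale c x) = psc c (Rep_ell2 x)" by (auto simp: plus_fun_def fun_diff_def zero_fun_def)

lemma cscale_simps: "cscale c (x + y) = cscale c x + cscale c y" "cscale (c + d) x = cscale c x + cscale d x"
    "cscale c (cscale d x) = cscale (c * d) x" "cscale (of_real r) x = r *\<^sub>R x" "cscale 1 x = x"
  by (auto intro!: ell2_eqI simp: algebra_simps)

lemma cip_add: "cip (Rep_ell2 x + Rep_ell2 y) (Rep_ell2 z) = cip (Rep_ell2 x) (Rep_ell2 z) + cip (Rep_ell2 y) (Rep_ell2 z)"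
  unfolding cip_def by (subst suminf_add[OF summable_cip summable_cip]) (simp add: distrib_right)

lemma cip_scale: "cip (psc c (Rep_ell2 x)) (Rep_ell2 z) = c * cip (Rep_ell2 x) (Rep_ell2 z)"
  unfolding cip_def by (subst suminf_mult[OF summable_cip, symmetric]) (simp add: mult.assoc)

lemma cip_cnj: "cip (Rep_ell2 y) (Rep_ell2 x) = cnj (cip (Rep_ell2 x) (Rep_ell2 y))"
  unfolding cip_def by (subst bounded_linear.suminf[OF bounded_linear_cnj summable_cip]) (simp add: mult.commute)

lemma vector_space_psc: "vector_space psc" by unfold_locales (auto simp: plus_fun_def algebra_simps)

lemma ip_dist_Rep: "x \<in> S \<Longrightarrow> y \<in> S \<Longrightarrow> ip_dist (Rep_ell2 ` S) cip (Rep_ell2 x) (Rep_ell2 y) = dist x y"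
  by (simp add: ip_dist_def Rep_ell2_fun(2)[symmetric] cip_inner dist_norm norm_eq_sqrt_inner)

lemma Metric_space_ell2: "Metric_space (Rep_ell2 ` S) (ip_dist (Rep_ell2 ` S) cip)"
proof
  show "0 \<le> ip_dist (Rep_ell2 ` S) cip x y" for x y
    by (cases "x \<in> Rep_ell2 ` S \<and> y \<in> Rep_ell2 ` S") (auto simp: ip_dist_Rep, auto simp: ip_dist_def)
  show "ip_dist (Rep_ell2 ` S) cip x y = ip_dist (Rep_ell2 ` S) cip y x" for x y
    by (cases "x \<in> Rep_ell2 ` S \<and> y \<in> Rep_ell2 ` S") (auto simp: ip_dist_Rep dist_commute, auto simp: ip_dist_def)
  show "ip_dist (Rep_ell2 ` S) cip x y = 0 \<longleftrightarrow> x = y" if "x \<in> Rep_ell2 ` S" "y \<in> Rep_ell2 ` S" for x y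
    using that by (auto simp: ip_dist_Rep Rep_ell2_inject)
  show "ip_dist (Rep_ell2 ` S) cip x z \<le> ip_dist (Rep_ell2 ` S) cip x y + ip_dist (Rep_ell2 ` S) cip y z"
    if "x \<in> Rep_ell2 ` S" "y \<in> Rep_ell2 ` S" "z \<in> Rep_ell2 ` S" for x y z
    using that by (auto simp: ip_dist_Rep dist_triangle)
qed

lemma hilbert_space_ell2:
  assumes S: "closed S" "subspace S" and c: "\<And>c x. x \<in> S \<Longrightarrow> cscale c x \<in> S"
  shows "hilbert_space psc (Rep_ell2 ` S) cip"
proof -
  interpret vector_space psc by (rule vector_space_psc)
  interpret M: Metric_space "Rep_ell2 ` S" "ip_dist (Rep_ell2 ` S) cip" by (rule Metric_space_ell2)
  have "subspace (Rep_ell2 ` S)" unfolding subspace_def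
  proof (intro conjI ballI allI)
    show "0 \<in> Rep_ell2 ` S" using Rep_ell2_fun(3) Real_Vector_Spaces.subspace_0[OF S(2)] by (metis imageI)
    show "x + y \<in> Rep_ell2 ` S" if "x \<in> Rep_ell2 ` S" "y \<in> Rep_ell2 ` S" for x y
      using that Real_Vector_Spaces.subspace_add[OF S(2)] by (auto simp: Rep_ell2_fun(1)[symmetric])
    show "psc a x \<in> Rep_ell2 ` S" if "x \<in> Rep_ell2 ` S" for a x
      using that c by (auto simp: Rep_ell2_fun(4)[symmetric])
  qed
  moreover have "M.mcomplete" unfolding M.mcomplete_def
  proof (intro allI impI)
    fix \<sigma> assume \<sigma>: "M.MCauchy \<sigma>"
    then have "\<forall>n. \<exists>x\<in>S. \<sigma> n = Rep_ell2 x" unfolding M.MCauchy_def by blast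
    then obtain x where x: "\<And>n. x n \<in> S" "\<And>n. \<sigma> n = Rep_ell2 (x n)" by metis
    have "Cauchy x" using \<sigma> unfolding M.MCauchy_def Cauchy_def x(2) by (simp add: ip_dist_Rep x(1))
    then obtain l where l: "x \<longlonglongrightarrow> l" by (auto simp: Cauchy_convergent_iff convergent_def)
    then have lS: "l \<in> S" using S(1) x(1) closed_sequentially by blast
    have "limitin M.mtopology \<sigma> (Rep_ell2 l) sequentially"
      using l lS x(1) unfolding M.limit_metric_sequentially x(2) LIMSEQ_def by (simp add: ip_dist_Rep)
    then show "\<exists>l. limitin M.mtopology \<sigma> l sequentially" by blast
  qed
  moreover have "Re (cip x x) > 0" if x: "x \<in> Rep_ell2 ` S" "x \<noteq> 0" for x
  proof -
    obtain y where y: "x = Rep_ell2 y" using x(1) by blast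
    then have "y \<noteq> 0" using x(2) Rep_ell2_fun(3) by blast
    then show ?thesis by (simp add: y cip_inner)
  qed
  ultimately show ?thesis
    unfolding hilbert_space_def
  proof (intro conjI ballI allI impI vector_space_psc)
    show "cip y x = cnj (cip x y)" if "x \<in> Rep_ell2 ` S" "y \<in> Rep_ell2 ` S" for x y
      using that by (elim imageE) (simp only: cip_cnj[symmetric])
  qed (auto simp: cip_add cip_scale)
qed

lemma topspace_G_topology: "topspace G_topology \<subseteq> G_group"
  unfolding G_topology_def topology_generated_by_topspace
proof clarsimp
  fix p q :: "real \<Rightarrow> (real, 'n::finite) mat2"
  assume "p \<in> Sp_paths" "path q" "path_image q \<subseteq> Sp_group" "pathstart q = pathfinish p"
  then have "p +++ q \<in> Sp_paths" by (auto simp: Sp_paths_def path_image_join)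
  then show "pclass (p +++ q) \<in> G_group" by (simp add: G_group_def)
qed

lemma unitary_rep_ell2:
  fixes \<Phi> :: "'n::finite Gelem \<Rightarrow> ell2 \<Rightarrow> ell2"
  assumes S: "closed S" "subspace S" and c: "\<And>c x. x \<in> S \<Longrightarrow> cscale c x \<in> S"
    and im: "\<And>a. a \<in> G_group \<Longrightarrow> \<Phi> a ` S = S" and bl: "\<And>a. a \<in> G_group \<Longrightarrow> bounded_linear (\<Phi> a)"
    and inn: "\<And>a x y. a \<in> G_group \<Longrightarrow> inner (\<Phi> a x) (\<Phi> a y) = inner x y"
    and cs: "\<And>a x c. a \<in> G_group \<Longrightarrow> \<Phi> a (cscale c x) = cscale c (\<Phi> a x)"
    and mult: "\<And>a b x. a \<in> G_group \<Longrightarrow> b \<in> G_group \<Longrightarrow> \<Phi> (G_mult a b) x = \<Phi> a (\<Phi> b x)"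
    and cont: "\<And>a x e. a \<in> G_group \<Longrightarrow> e > 0 \<Longrightarrow> \<exists>N. openin G_topology N \<and> a \<in> N \<and> (\<forall>b\<in>N. norm (\<Phi> b x - \<Phi> a x) < e)"
  shows "unitary_rep psc (Rep_ell2 ` S) cip (\<lambda>g x. Rep_ell2 (\<Phi> g (Abs_ell2 x)))"
proof -
  interpret M: Metric_space "Rep_ell2 ` S" "ip_dist (Rep_ell2 ` S) cip" by (rule Metric_space_ell2)
  have A: "Abs_ell2 (Rep_ell2 x) = x" for x by (rule Rep_ell2_inverse)
  have "(\<lambda>x. Rep_ell2 (\<Phi> g (Abs_ell2 x))) ` Rep_ell2 ` S = Rep_ell2 ` S" if "g \<in> G_group" for g
  proof -
    have "(\<lambda>x. Rep_ell2 (\<Phi> g (Abs_ell2 x))) ` Rep_ell2 ` S = Rep_ell2 ` \<Phi> g ` S"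
      by (simp add: image_image A)
    then show ?thesis by (simp add: im[OF that])
  qed
  moreover have "continuous_map G_topology M.mtopology (\<lambda>g. Rep_ell2 (\<Phi> g (Abs_ell2 x)))" if x: "x \<in> Rep_ell2 ` S" for x
    unfolding M.continuous_map_to_metric
  proof (intro ballI allI impI)
    obtain y where y: "y \<in> S" "x = Rep_ell2 y" using x by blast
    have inS: "\<Phi> a y \<in> S" if "a \<in> G_group" for a using im[OF that] y by blast
    fix a and e :: real assume a: "a \<in> topspace (G_topology :: 'n Gelem topology)" and e: "0 < e"
    have aG: "a \<in> G_group" using a topspace_G_topology by blast
    obtain N where N: "openin G_topology N" "a \<in> N" "\<forall>b\<in>N. norm (\<Phi> b y - \<Phi> a y) < e" using cont[OF aG e] by blast
    have "Rep_ell2 (\<Phi> b (Abs_ell2 x)) \<in> M.mball (Rep_ell2 (\<Phi> a (Abs_ell2 x))) e" if "b \<in> N" for b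
    proof -
      have "b \<in> G_group" using that openin_subset[OF N(1)] topspace_G_topology by blast
      moreover have "dist (\<Phi> a y) (\<Phi> b y) < e" using N(3) that by (subst dist_commute) (simp add: dist_norm)
      ultimately show ?thesis using inS aG by (simp add: y(2) A ip_dist_Rep)
    qed
    then show "\<exists>U. openin G_topology U \<and> a \<in> U \<and> (\<forall>b\<in>U. Rep_ell2 (\<Phi> b (Abs_ell2 x)) \<in> M.mball (Rep_ell2 (\<Phi> a (Abs_ell2 x))) e)"
      using N by blast
  qed
  moreover have "cip (Rep_ell2 (\<Phi> g x)) (Rep_ell2 (\<Phi> g y)) = cip (Rep_ell2 x) (Rep_ell2 y)" if "g \<in> G_group" for g x y
    by (simp add: cip_inner inn[OF that] cs[OF that, symmetric])
  ultimately show ?thesis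
    unfolding unitary_rep_def using hilbert_space_ell2[OF S c]
    by (auto simp: A Rep_ell2_fun[symmetric] cs mult linear_add[OF bounded_linear.linear[OF bl]])
qed

lemma span_family_dependent:
  assumes vs: "vector_space s" and B: "finite B" "\<And>i. i \<le> card B \<Longrightarrow> y i \<in> module.span s B"
  shows "\<exists>c :: nat \<Rightarrow> complex. (\<exists>i\<le>card B. c i \<noteq> 0) \<and> (\<Sum>i\<le>card B. s (c i) (y i)) = 0"
proof -
  interpret vector_space s by (rule vs)
  show ?thesis
  proof (cases "inj_on y {..card B}")
    case True
    then have "card (y ` {..card B}) = Suc (card B)" by (simp add: card_image)
    moreover have "y ` {..card B} \<subseteq> span B" using B(2) by auto
    ultimately have "dependent (y ` {..card B})"
      using independent_span_bound[OF B(1), of "y ` {..card B}"] by fastforce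
    then obtain u where u: "\<exists>v\<in>y ` {..card B}. u v \<noteq> 0" "(\<Sum>v\<in>y ` {..card B}. s (u v) v) = 0"
      by (subst (asm) dependent_finite) auto
    show ?thesis
      using u sum.reindex[OF True, of "\<lambda>v. s (u v) v"] by (intro exI[of _ "\<lambda>i. u (y i)"]) (auto simp: o_def)
  next
    case False
    then obtain i j where ij: "i \<le> card B" "j \<le> card B" "i \<noteq> j" "y i = y j" by (auto simp: inj_on_def)
    have "(\<Sum>l\<le>card B. s (if l = i then 1 else if l = j then - 1 else 0) (y l)) = (\<Sum>l\<le>card B. (if l = i then y i else 0) + (if l = j then - y j else 0))"
      by (intro sum.cong refl) (use ij in auto)
    also have "\<dots> = 0" using ij by (simp add: sum.distrib)
    finally show ?thesis using ij by (intro exI[of _ "\<lambda>l. if l = i then 1 else if l = j then - 1 else 0"]) auto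
  qed
qed

lemma sum_apply: "(\<Sum>i\<in>A. f i) x = (\<Sum>i\<in>A. f i x :: 'b::comm_monoid_add)"
  by (induction A rule: infinite_finite_induct) (simp_all add: plus_fun_def zero_fun_def)

lemma bounded_linear_Rep_ell2: "bounded_linear (\<lambda>x. Rep_ell2 x n)"
  by (rule bounded_linear_intro[where K=1]) (auto simp: cmod_Rep_ell2_le scaleR_conv_of_real)

lemma bounded_linear_cscale_left: "bounded_linear (\<lambda>c. cscale c x)"
  by (rule bounded_linear_intro[where K="norm x"]) (auto intro!: ell2_eqI simp: norm_cscale algebra_simps scaleR_conv_of_real)

text \<open>J spans the centre of k_0, and every coordinate \<epsilon>_i takes the value i on
  it.\<close>

lemma complexify_symp_form: "complexify symp_form = cartan (\<chi> i::'n::finite. \<i>)"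
proof -
  have "complexify symp_form $ s $ t = cartan (\<chi> i::'n. \<i>) $ s $ t" for s t
    by (cases s; cases t) (auto simp: map_matrix_def)
  then show ?thesis by (simp add: vec_eq_iff)
qed

lemma symp_form_compact: "(symp_form :: ('a::comm_ring_1, 'n::finite) mat2) \<in> sp_compact"
proof -
  have "(- transpose symp_form) $ s $ t = (symp_form :: ('a, 'n) mat2) $ s $ t" for s t
    by (cases s; cases t) (auto simp: transpose_def)
  then have "- transpose symp_form = (symp_form :: ('a, 'n) mat2)" by (simp add: vec_eq_iff)
  moreover have "(symp_form :: ('a, 'n) mat2) \<in> sp_alg" by (auto simp: sp_alg_entries)
  ultimately show ?thesis by (simp add: sp_compact_def)
qed

lemma symp_form_sp: "(symp_form :: ('a::comm_ring_1, 'n::finite) mat2) \<in> sp_alg"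
  using symp_form_compact by (auto simp: sp_compact_def)

lemma infinite_nat_subset:
  "infinite (A :: nat set) \<Longrightarrow> \<exists>B. B \<subseteq> A \<and> finite B \<and> card B = m"
  using infinite_arbitrarily_large by metis

lemma prod_list_ones: "(\<And>x. x \<in> set xs \<Longrightarrow> f x = 1) \<Longrightarrow> prod_list (map f xs) = (1 :: 'a::comm_monoid_mult)"
  by (induction xs) auto

section \<open>Degrees of K-finite vectors\<close>

context oscillator
begin

interpretation R: Sp_rep iota \<rho>A "4 * c0 + 1" by (rule Sp_rep_\<rho>A)

definition vars :: "nat set" where "vars = {var (i::'n) a | i a. a < k}"

lemma finite_vars: "finite vars"
proof -
  have "vars = (\<lambda>(i::'n, a). var i a) ` (UNIV \<times> {..<k})" by (auto simp: vars_def)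
  then show ?thesis by simp
qed

text \<open>Only the variables of \<open>vars\<close> are counted, since the Euler operator
  \<open>Nop\<close> involves no others; on polynomials in these variables it is the total
  degree.\<close>

definition wdeg :: "mono \<Rightarrow> nat" where "wdeg \<alpha> = (\<Sum>i\<in>(UNIV::'n set). \<Sum>a<k. lk \<alpha> (var i a))"

definition Nop :: "fock \<Rightarrow> fock" where "Nop f = (\<Sum>i\<in>(UNIV::'n set). \<Sum>a<k. zv (var i a) * dv (var i a) f)"

lemma lk_Nop: "lk (Nop f) \<alpha> = of_nat (wdeg \<alpha>) * lk f \<alpha>"
  by (simp add: Nop_def wdeg_def lookup_sum lk_X_dv sum_distrib_right)

lemma \<rho>F_symp_form: "\<rho>F (complexify symp_form) f = - (C \<i> * (Nop f + C (of_nat (CARD('n) * k) / 2) * f))"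
proof -
  have "\<rho>F (complexify symp_form) f = - (\<Sum>i\<in>(UNIV::'n set). C \<i> * ((\<Sum>a<k. zv (var i a) * dv (var i a) f) + C (of_nat k / 2) * f))"
    unfolding complexify_symp_form \<rho>F_cartan by simp
  also have "\<dots> = - (C \<i> * (Nop f + (\<Sum>i\<in>(UNIV::'n set). C (of_nat k / 2) * f)))"
    unfolding Nop_def by (simp only: sum_distrib_left[symmetric] sum.distrib)
  also have "(\<Sum>i\<in>(UNIV::'n set). C (of_nat k / 2) * f) = C (of_nat (CARD('n) * k) / 2) * f"
  proof -
    have "(\<Sum>i\<in>(UNIV::'n set). C (of_nat k / 2) * f) = C (\<Sum>i\<in>(UNIV::'n set). of_nat k / 2) * f"
      by (simp only: C_sum sum_distrib_right)
    then show ?thesis by simp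
  qed
  finally show ?thesis .
qed

text \<open>The Euler operator is a combination of the identity and the central element J, so every
  submodule is automatically graded by degree.\<close>

lemma Nop_stable:
  assumes Q: "module.subspace csc Q" and st: "\<And>X w. X \<in> sp_alg \<Longrightarrow> w \<in> Q \<Longrightarrow> \<rho>F X w \<in> Q" and f: "f \<in> Q"
  shows "Nop f \<in> Q"
proof -
  interpret vector_space csc by (rule vector_space_csc)
  have "Nop f = C \<i> * \<rho>F (complexify symp_form) f + C (- of_nat (CARD('n) * k) / 2) * f"
    unfolding \<rho>F_symp_form by (rule poly_mapping_eqI) (simp only: lookup_add lookup_uminus lk_C_mult, simp add: algebra_simps)
  then show ?thesis
    using subspace_add[OF Q subspace_scale[OF Q st[OF _ f]] subspace_scale[OF Q f]] symp_form_sp complexify_sp by metis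
qed

text \<open>Monomials move along explicit exponential curves, to which \<open>exp_intertwine\<close>
  applies. A single coordinate of either side is continuous in x, so density of the polynomials
  finishes the argument.\<close>

lemma \<pi>_symp_form:
  "Rep_ell2 (R.\<pi> (G_exp (t *\<^sub>R symp_form)) x) n = exp (- \<i> * of_real t * (of_nat (wdeg (en n)) + of_nat (CARD('n) * k) / 2)) * Rep_ell2 x n"
proof -
  let ?c = "of_nat (CARD('n) * k) / 2 :: complex"
  let ?\<pi> = "R.\<pi> (G_exp (t *\<^sub>R symp_form))"
  have "t *\<^sub>R symp_form \<in> (sp_alg :: (real, 'n) mat2 set)" by (auto simp: sp_alg_entries)
  then have bl: "bounded_linear ?\<pi>" by (rule R.\<pi>_props[OF G_exp_in_G])
  have mono: "?\<pi> (iota (sg \<alpha> z)) = cscale (exp (- \<i> * of_real t * (of_nat (wdeg \<alpha>) + ?c))) (iota (sg \<alpha> z))" for \<alpha> z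
  proof -
    define \<theta> where "\<theta> = of_nat (wdeg \<alpha>) + ?c"
    define g where "g t = C (exp (- \<i> * of_real t * \<theta>)) * sg \<alpha> z" for t
    have e: "\<rho>A (of_mat symp_form) (g t) = C (- \<i> * \<theta> * exp (- \<i> * of_real t * \<theta>)) * sg \<alpha> z" for t
      unfolding \<rho>A_def to_mat_of_mat \<rho>F_symp_form
    proof (rule poly_mapping_eqI)
      fix \<beta>
      show "lk (- (C \<i> * (Nop (g t) + C ?c * g t))) \<beta> = lk (C (- \<i> * \<theta> * exp (- \<i> * of_real t * \<theta>)) * sg \<alpha> z) \<beta>"
        unfolding lookup_uminus lk_C_mult lookup_add lk_Nop g_def
        by (cases "\<beta> = \<alpha>") (simp_all add: lookup_single \<theta>_def algebra_simps)
    qed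
    have "((\<lambda>s. iota (g (t + s))) has_vector_derivative iota (\<rho>A (of_mat symp_form) (g t))) (at 0)" for t
    proof -
      have "((\<lambda>s. exp (- \<i> * of_real (t + s) * \<theta>)) has_vector_derivative - \<i> * \<theta> * exp (- \<i> * of_real t * \<theta>)) (at 0)"
      proof -
        have "((\<lambda>s. exp (- \<i> * (of_real t + s) * \<theta>)) has_field_derivative - \<i> * \<theta> * exp (- \<i> * of_real t * \<theta>)) (at (of_real 0))"
          by (auto intro!: derivative_eq_intros)
        from has_vector_derivative_real_field[OF this] show ?thesis by simp
      qed
      from bounded_linear.has_vector_derivative[OF bounded_linear_cscale_left this, of "iota (sg \<alpha> z)"]
      show ?thesis unfolding e unfolding g_def iota_C .
    qed
    from R.exp_intertwine[OF symp_form_sp this, of t] show ?thesis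
      by (simp add: g_def iota_C \<theta>_def)
  qed
  have "Rep_ell2 (?\<pi> (iota f)) n = exp (- \<i> * of_real t * (of_nat (wdeg (en n)) + ?c)) * Rep_ell2 (iota f) n" for f
  proof (induction f rule: poly_induct)
    case (single \<alpha> z)
    show ?case unfolding mono by (cases "en n = \<alpha>") (simp_all add: lookup_single)
  next
    case (add f g)
    then show ?case
      by (simp only: linear_add[OF linear_iota] linear_add[OF bounded_linear.linear[OF bl]] Rep_ell2_simps distrib_left)
  qed
  then show ?thesis
    by (rule bounded_linear_eq_on_dense[of _ _ iota, OF bounded_linear_compose[OF bounded_linear_Rep_ell2 bl] bounded_linear_const_mult[OF bounded_linear_Rep_ell2] _ dense_iota])
qed

text \<open>In a span of dimension at most card B, the translates of x by the first card B + 1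
  multiples of a step \<tau> are dependent. Read in one coordinate, the relation is a polynomial of
  degree at most card B that vanishes at exp (- i \<tau> (d + b)) for every occurring degree d,
  which is impossible for card B + 1 degrees.\<close>

lemma K_finite_degrees:
  assumes B: "finite B" "\<And>t. Rep_ell2 (R.\<pi> (G_exp (t *\<^sub>R symp_form)) x) \<in> module.span psc B"
  shows "finite {wdeg (en n) | n. Rep_ell2 x n \<noteq> 0}"
proof (rule ccontr)
  assume "infinite {wdeg (en n) | n. Rep_ell2 x n \<noteq> 0}"
  from infinite_nat_subset[OF this, of "Suc (card B)"] obtain S where S: "S \<subseteq> {wdeg (en n) | n. Rep_ell2 x n \<noteq> 0}" "finite S" "card S = Suc (card B)"
    by blast
  define b where "b = real (CARD('n) * k) / 2"
  \<comment> \<open>The step keeps the angles of all selected degrees within 1 of each other, below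
    2 pi, so that distinct degrees give distinct roots.\<close>
  define \<tau> where "\<tau> = 1 / (1 + real (Max S))"
  have \<tau>0: "\<tau> > 0" unfolding \<tau>_def by (intro divide_pos_pos add_pos_nonneg) auto
  define z where "z d = exp (- \<i> * of_real (\<tau> * (real d + b)))" for d :: nat
  have "inj_on z S"
  proof (rule inj_onI)
    fix d d' assume d: "d \<in> S" "d' \<in> S" "z d = z d'"
    have "\<tau> * (real d + b) - \<tau> * (real d' + b) = \<tau> * (real d - real d')" by (simp only: algebra_simps)
    then have "\<bar>\<tau> * (real d + b) - \<tau> * (real d' + b)\<bar> = \<tau> * \<bar>real d - real d'\<bar>"
      using \<tau>0 by (simp only: abs_mult abs_of_pos)
    also have "\<dots> \<le> \<tau> * (1 + real (Max S))"
      using Max_ge[OF S(2) d(1)] Max_ge[OF S(2) d(2)] by (intro mult_left_mono) (auto simp: \<tau>_def)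
    also have "\<dots> = 1"
    proof -
      have "1 + real (Max S) > 0" by (intro add_pos_nonneg) auto
      then show ?thesis by (simp add: \<tau>_def)
    qed
    finally have "\<bar>Im (- \<i> * of_real (\<tau> * (real d + b))) - Im (- \<i> * of_real (\<tau> * (real d' + b)))\<bar> < 2 * pi"
      using pi_gt3 by (simp add: abs_minus_commute)
    then have "- \<i> * of_real (\<tau> * (real d + b)) = - \<i> * of_real (\<tau> * (real d' + b))"
      by (rule exp_complex_eqI[OF _ d(3)[unfolded z_def]])
    from arg_cong[OF this, of Im] have "\<tau> * (real d + b) = \<tau> * (real d' + b)" by simp
    then show "d = d'" using \<tau>0 by simp
  qed
  then have cz: "card (z ` S) = Suc (card B)" using S(3) by (simp add: card_image)
  obtain c where c: "\<exists>i\<le>card B. c i \<noteq> 0"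
    "(\<Sum>i\<le>card B. psc (c i) (Rep_ell2 (R.\<pi> (G_exp ((real i * \<tau>) *\<^sub>R symp_form)) x))) = 0"
    using span_family_dependent[OF vector_space_psc B(1), of "\<lambda>i. Rep_ell2 (R.\<pi> (G_exp ((real i * \<tau>) *\<^sub>R symp_form)) x)"] B(2) by blast
  have "z ` S \<subseteq> {w. (\<Sum>i\<le>card B. c i * w ^ i) = 0}"
  proof clarsimp
    fix d assume "d \<in> S"
    then obtain n where n: "d = wdeg (en n)" "Rep_ell2 x n \<noteq> 0" using S(1) by blast
    have "(\<Sum>i\<le>card B. c i * Rep_ell2 (R.\<pi> (G_exp ((real i * \<tau>) *\<^sub>R symp_form)) x) n) = 0"
      using fun_cong[OF c(2), of n] by (simp add: sum_apply)
    moreover have "Rep_ell2 (R.\<pi> (G_exp ((real i * \<tau>) *\<^sub>R symp_form)) x) n = z d ^ i * Rep_ell2 x n" for i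
      unfolding \<pi>_symp_form z_def exp_of_nat_mult[symmetric] n(1) b_def by (simp add: algebra_simps)
    ultimately have "(\<Sum>i\<le>card B. c i * z d ^ i) * Rep_ell2 x n = 0" by (simp add: sum_distrib_right mult.assoc)
    then show "(\<Sum>i\<le>card B. c i * z d ^ i) = 0" using n(2) by simp
  qed
  note sub = this
  have r: "finite {w. (\<Sum>i\<le>card B. c i * w ^ i) = 0} \<and> card {w. (\<Sum>i\<le>card B. c i * w ^ i) = 0} \<le> card B"
    using c(1) polyfun_rootbound[of "card B" c] by blast
  from card_mono[OF conjunct1[OF r] sub] r show False unfolding cz by simp
qed

lemma lk_not_vars:
  assumes "\<And>v. v \<notin> vars \<Longrightarrow> dv v f = 0" "lk f \<alpha> \<noteq> 0" shows "ks \<alpha> \<subseteq> vars"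
proof (rule subsetI, rule ccontr)
  fix v assume v: "v \<in> ks \<alpha>" "v \<notin> vars"
  have "\<alpha> = (\<alpha> - sg v 1) + sg v 1"
    using v(1) by (intro poly_mapping_eqI) (auto simp: lookup_add lookup_minus lookup_single when_def in_keys_iff)
  then have "of_nat (Suc (lk (\<alpha> - sg v 1) v)) * lk f \<alpha> = 0"
    using lk_dv[of v f "\<alpha> - sg v 1"] assms(1)[OF v(2)] by simp
  then show False using assms(2) by (simp del: of_nat_Suc)
qed

definition lowmonos :: "nat \<Rightarrow> mono set" where "lowmonos D = {\<alpha>. ks \<alpha> \<subseteq> vars \<and> wdeg \<alpha> \<le> D}"

lemma finite_lowmonos: "finite (lowmonos D)"
proof -
  have le: "lk \<alpha> v \<le> wdeg \<alpha>" if v: "v \<in> vars" for \<alpha> v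
  proof -
    obtain i :: 'n and a where ia: "v = var i a" "a < k" using v by (auto simp: vars_def)
    have "lk \<alpha> (var i a) \<le> (\<Sum>a<k. lk \<alpha> (var i a))" by (rule member_le_sum) (use ia in auto)
    also have "\<dots> \<le> wdeg \<alpha>" unfolding wdeg_def by (rule member_le_sum) auto
    finally show ?thesis by (simp add: ia)
  qed
  have "lk ` lowmonos D \<subseteq> {f. \<forall>x. (x \<in> vars \<longrightarrow> f x \<in> {..D}) \<and> (x \<notin> vars \<longrightarrow> f x = 0)}"
  proof clarsimp
    fix \<alpha> v assume "\<alpha> \<in> lowmonos D"
    then show "(v \<in> vars \<longrightarrow> lk \<alpha> v \<le> D) \<and> (v \<notin> vars \<longrightarrow> lk \<alpha> v = 0)"
      using le[of v \<alpha>] unfolding lowmonos_def by (auto simp: in_keys_iff)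
  qed
  then have "finite (lk ` lowmonos D)" by (rule finite_subset) (rule finite_set_of_finite_funs[OF finite_vars], simp)
  then show ?thesis by (rule finite_imageD) (auto intro!: inj_onI poly_mapping_eqI)
qed

text \<open>Lagrange interpolation in the Euler operator: the product of (\<open>Nop\<close> - d) /
  (e - d) over the other degrees d \<le> D' projects f to its component of degree e, and a submodule
  is stable under each factor.\<close>

lemma truncation_in_subspace:
  assumes Q: "module.subspace csc Q" and st: "\<And>X w. X \<in> sp_alg \<Longrightarrow> w \<in> Q \<Longrightarrow> \<rho>F X w \<in> Q"
    and vars: "\<And>w v. w \<in> Q \<Longrightarrow> v \<notin> vars \<Longrightarrow> dv v w = 0" and f: "f \<in> Q"
  shows "(\<Sum>\<alpha>\<in>lowmonos D. sg \<alpha> (lk f \<alpha>)) \<in> Q"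
proof -
  interpret vector_space csc by (rule vector_space_csc)
  obtain D' where D': "\<And>\<alpha>. \<alpha> \<in> ks f \<Longrightarrow> wdeg \<alpha> \<le> D'"
    using Max_ge[of "wdeg ` ks f"] by (metis finite_imageI finite_keys imageI)
  define op where "op e d h = C (1 / (of_nat e - of_nat d)) * (Nop h + C (- of_nat d) * h)" for e d :: nat and h
  define ds where "ds e = filter (\<lambda>d. d \<noteq> e) [0..<Suc D']" for e
  have set_ds: "set (ds e) = {..D'} - {e}" for e by (auto simp: ds_def simp del: upt_Suc)
  have opW: "foldr (op e) xs f \<in> Q" for e xs
  proof (induction xs)
    case (Cons d xs)
    have "op e d h \<in> Q" if "h \<in> Q" for h
      unfolding op_def by (intro subspace_scale[OF Q] subspace_add[OF Q] Nop_stable[OF Q st] that)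
    from this[OF Cons] show ?case by simp
  qed (use f in simp)
  have lk_op: "lk (foldr (op e) xs f) \<alpha> = (\<Prod>d\<leftarrow>xs. (of_nat (wdeg \<alpha>) - of_nat d) / (of_nat e - of_nat d)) * lk f \<alpha>" for e xs \<alpha>
  proof (induction xs)
    case (Cons d xs)
    have "lk (op e d h) \<alpha> = (of_nat (wdeg \<alpha>) - of_nat d) / (of_nat e - of_nat d) * lk h \<alpha>" for h
      unfolding op_def lk_C_mult lookup_add lk_Nop by (simp add: algebra_simps diff_divide_distrib)
    then show ?case using Cons by simp
  qed simp
  have comp: "lk (foldr (op e) (ds e) f) \<alpha> = (if wdeg \<alpha> = e then lk f \<alpha> else 0)" for e \<alpha>
  proof (cases "lk f \<alpha> = 0")
    case False
    then have le: "wdeg \<alpha> \<le> D'" using D' by (simp add: in_keys_iff)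
    show ?thesis
    proof (cases "wdeg \<alpha> = e")
      case True
      have "(\<Prod>d\<leftarrow>ds e. (of_nat (wdeg \<alpha>) - of_nat d) / (of_nat e - of_nat d)) = (1 :: complex)"
        unfolding True by (rule prod_list_ones) (auto simp: set_ds)
      then show ?thesis using True by (simp only: lk_op if_True mult_1 simp_thms)
    next
      case False
      then have "wdeg \<alpha> \<in> set (ds e)" using le by (auto simp: set_ds)
      then have "0 \<in> set (map (\<lambda>d. (of_nat (wdeg \<alpha>) - of_nat d) / (of_nat e - of_nat d)) (ds e) :: complex list)"
        by force
      then have "(\<Prod>d\<leftarrow>ds e. (of_nat (wdeg \<alpha>) - of_nat d) / (of_nat e - of_nat d)) = (0 :: complex)"
        by (simp only: prod_list_zero_iff)
      then show ?thesis using False by (simp add: lk_op)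
    qed
  qed (simp add: lk_op)
  have "(\<Sum>\<alpha>\<in>lowmonos D. sg \<alpha> (lk f \<alpha>)) = (\<Sum>e\<le>D. foldr (op e) (ds e) f)"
  proof (rule poly_mapping_eqI)
    fix \<alpha>
    have "lk (\<Sum>\<alpha>\<in>lowmonos D. sg \<alpha> (lk f \<alpha>)) \<alpha> = (\<Sum>\<beta>\<in>lowmonos D. if \<beta> = \<alpha> then lk f \<alpha> else 0)"
      unfolding lookup_sum by (intro sum.cong) (auto simp: lookup_single when_def)
    also have "\<dots> = (if \<alpha> \<in> lowmonos D then lk f \<alpha> else 0)" using finite_lowmonos by simp
    also have "\<dots> = (if wdeg \<alpha> \<le> D then lk f \<alpha> else 0)"
      using lk_not_vars[OF vars[OF f], of \<alpha>] by (auto simp: lowmonos_def)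
    also have "\<dots> = lk (\<Sum>e\<le>D. foldr (op e) (ds e) f) \<alpha>" unfolding lookup_sum comp by simp
    finally show "lk (\<Sum>\<alpha>\<in>lowmonos D. sg \<alpha> (lk f \<alpha>)) \<alpha> = lk (\<Sum>e\<le>D. foldr (op e) (ds e) f) \<alpha>" .
  qed
  then show ?thesis using opW by (simp add: subspace_sum[OF Q])
qed

text \<open>Only finitely many coordinates matter once the degrees are bounded, and functionals of finitely many coordinates are continuous, so no closure is needed.\<close>

lemma K_finite_in_image:
  assumes Q: "module.subspace csc Q" and st: "\<And>X w. X \<in> sp_alg \<Longrightarrow> w \<in> Q \<Longrightarrow> \<rho>F X w \<in> Q"
    and vars: "\<And>w v. w \<in> Q \<Longrightarrow> v \<notin> vars \<Longrightarrow> dv v w = 0" and x: "x \<in> closure (iota ` Q)"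
    and B: "finite B" "\<And>t. Rep_ell2 (R.\<pi> (G_exp (t *\<^sub>R symp_form)) x) \<in> module.span psc B"
  shows "x \<in> iota ` Q"
proof -
  interpret vector_space csc by (rule vector_space_csc)
  obtain D where D: "\<And>n. Rep_ell2 x n \<noteq> 0 \<Longrightarrow> wdeg (en n) \<le> D"
    using Max_ge[OF K_finite_degrees[OF B]] by blast
  have supp: "en n \<in> lowmonos D" if n: "Rep_ell2 x n \<noteq> 0" for n
  proof -
    have "ks (en n) \<subseteq> vars"
    proof (rule ccontr)
      assume nv: "\<not> ks (en n) \<subseteq> vars"
      have "lk w (en n) = 0" if w: "w \<in> Q" for w using lk_not_vars[OF vars[OF w]] nv by blast
      then have "iota ` Q \<subseteq> {y. Rep_ell2 y n = 0}" by auto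
      moreover have "closed {y. Rep_ell2 y n = 0}"
        by (intro closed_Collect_eq linear_continuous_on bounded_linear_Rep_ell2 continuous_on_const)
      ultimately have "x \<in> {y. Rep_ell2 y n = 0}" using x closure_minimal by blast
      then show False using n by simp
    qed
    then show ?thesis using D[OF n] by (simp add: lowmonos_def)
  qed
  define ne where "ne = inv en"
  have ne: "en (ne \<alpha>) = \<alpha>" for \<alpha> unfolding ne_def by (rule surj_f_inv_f[OF bij_is_surj[OF bij_en]])
  have en_eq: "en n = en n' \<longleftrightarrow> n = n'" for n n' using bij_is_inj[OF bij_en] by (auto dest: injD)
  define g where "g = (\<Sum>\<alpha>\<in>lowmonos D. sg \<alpha> (Rep_ell2 x (ne \<alpha>) / of_real (sqrt (mfact \<alpha>))))"
  have lk_sum: "lk (\<Sum>\<alpha>\<in>lowmonos D. sg \<alpha> (F \<alpha>)) \<beta> = (if \<beta> \<in> lowmonos D then F \<beta> else 0)" for F \<beta>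
  proof -
    have "lk (\<Sum>\<alpha>\<in>lowmonos D. sg \<alpha> (F \<alpha>)) \<beta> = (\<Sum>\<alpha>\<in>lowmonos D. if \<alpha> = \<beta> then F \<beta> else 0)"
      unfolding lookup_sum by (intro sum.cong) (auto simp: lookup_single when_def)
    then show ?thesis using finite_lowmonos by simp
  qed
  have mf: "sqrt (mfact \<alpha>) > 0" for \<alpha> using mfact_pos[of \<alpha>] by simp
  have xg: "x = iota g"
  proof (rule ell2_eqI)
    fix n
    have "ne (en n) = n" using ne[of "en n"] en_eq by blast
    then show "Rep_ell2 x n = Rep_ell2 (iota g) n" using supp[of n] mfact_pos[of "en n"] by (auto simp: g_def lk_sum)
  qed
  have "g \<in> Q"
  proof (rule ccontr)
    assume gW: "g \<notin> Q"
    \<comment> \<open>A basis of Q, enlarged by g and then to the whole space, gives a linear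
      functional F that is 0 on Q and 1 at g.\<close>
    obtain Bs where Bs: "Bs \<subseteq> Q" "independent Bs" "Q \<subseteq> span Bs" using maximal_independent_subset by blast
    have "span Bs \<subseteq> Q" using Bs(1) Q by (rule span_minimal)
    then have gB: "g \<notin> span Bs" using gW by blast
    then have ind: "independent (insert g Bs)" using Bs(2) by (rule independent_insertI)
    define E where "E = extend_basis (insert g Bs)"
    have E: "independent E" "span E = UNIV" "insert g Bs \<subseteq> E"
      unfolding E_def using independent_extend_basis[OF ind] span_extend_basis[OF ind] extend_basis_superset[OF ind] by auto
    define F where "F h = representation E h g" for h
    have F_add: "F (h + h') = F h + F h'" and F_scale: "F (csc c h) = c * F h" for h h' c
      unfolding F_def using E by (simp_all add: representation_add representation_scale)
    have F0: "F 0 = 0" using F_scale[of 0 0] by simp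
    have F_sum: "F (sum h A) = (\<Sum>a\<in>A. F (h a))" for h and A :: "mono set"
      by (induction A rule: infinite_finite_induct) (auto simp: F0 F_add)
    have FW: "F w = 0" if "w \<in> Q" for w
    proof -
      have "representation E w = representation Bs w" by (rule representation_extend) (use E Bs(3) that in auto)
      moreover have "g \<notin> Bs" using gB span_base by blast
      ultimately show ?thesis unfolding F_def using representation_ne_zero by metis
    qed
    have Fg: "F g = 1" unfolding F_def using E representation_basis[of E g] by simp
    define M where "M = (\<Sum>\<alpha>\<in>lowmonos D. cmod (F (sg \<alpha> 1)) / sqrt (mfact \<alpha>))"
    have M: "0 \<le> M" unfolding M_def using mf by (intro sum_nonneg) (simp add: less_imp_le)
    \<comment> \<open>An element w of Q close to x is truncated to the low monomials, which keeps it
      in Q, so F still separates it from g by 1. But only finitely many coefficients remain, each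
      differing from that of g by at most e over the square root of \<alpha>!.\<close>
    have "1 \<le> e * M" if e: "e > 0" for e
    proof -
      obtain w where w: "w \<in> Q" "dist (iota w) x < e" using x e unfolding closure_approachable by blast
      define h where "h = (\<Sum>\<alpha>\<in>lowmonos D. sg \<alpha> (lk w \<alpha>))"
      have "h \<in> Q" unfolding h_def by (rule truncation_in_subspace[OF Q st vars w(1)])
      then have "F (g + csc (- 1) h) = 1" by (simp only: F_add F_scale Fg FW) simp
      moreover have "g + csc (- 1) h = (\<Sum>\<alpha>\<in>lowmonos D. csc (lk g \<alpha> - lk w \<alpha>) (sg \<alpha> 1))"
      proof (rule poly_mapping_eqI)
        fix \<beta>
        have sgm: "csc c (sg \<alpha> 1) = sg \<alpha> c" for c \<alpha>
          by (rule poly_mapping_eqI) (simp add: lookup_single when_def)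
        show "lk (g + csc (- 1) h) \<beta> = lk (\<Sum>\<alpha>\<in>lowmonos D. csc (lk g \<alpha> - lk w \<alpha>) (sg \<alpha> 1)) \<beta>"
          unfolding lookup_add lk_C_mult h_def sgm lk_sum by (simp add: g_def lk_sum)
      qed
      ultimately have "(\<Sum>\<alpha>\<in>lowmonos D. (lk g \<alpha> - lk w \<alpha>) * F (sg \<alpha> 1)) = 1" by (simp only: F_sum F_scale)
      then have "1 = cmod (\<Sum>\<alpha>\<in>lowmonos D. (lk g \<alpha> - lk w \<alpha>) * F (sg \<alpha> 1))" by simp
      also have "\<dots> \<le> (\<Sum>\<alpha>\<in>lowmonos D. cmod ((lk g \<alpha> - lk w \<alpha>) * F (sg \<alpha> 1)))" by (rule norm_sum)
      also have "\<dots> \<le> (\<Sum>\<alpha>\<in>lowmonos D. e * (cmod (F (sg \<alpha> 1)) / sqrt (mfact \<alpha>)))"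
      proof (rule sum_mono)
        fix \<alpha> assume "\<alpha> \<in> lowmonos D"
        have "Rep_ell2 (iota g - iota w) (ne \<alpha>) = of_real (sqrt (mfact \<alpha>)) * (lk g \<alpha> - lk w \<alpha>)"
          by (simp add: ne right_diff_distrib)
        then have "sqrt (mfact \<alpha>) * cmod (lk g \<alpha> - lk w \<alpha>) \<le> norm (iota g - iota w)"
          using cmod_Rep_ell2_le[of "iota g - iota w" "ne \<alpha>"] mf[of \<alpha>] by (simp add: norm_mult)
        also have "\<dots> \<le> e" using w(2) unfolding xg dist_norm by (simp add: norm_minus_commute)
        finally have "cmod (lk g \<alpha> - lk w \<alpha>) \<le> e / sqrt (mfact \<alpha>)" using mf[of \<alpha>] by (simp add: field_simps)
        then have "cmod (lk g \<alpha> - lk w \<alpha>) * cmod (F (sg \<alpha> 1)) \<le> e / sqrt (mfact \<alpha>) * cmod (F (sg \<alpha> 1))"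
          by (rule mult_right_mono) simp
        then show "cmod ((lk g \<alpha> - lk w \<alpha>) * F (sg \<alpha> 1)) \<le> e * (cmod (F (sg \<alpha> 1)) / sqrt (mfact \<alpha>))"
          by (simp add: norm_mult)
      qed
      finally show ?thesis by (simp add: M_def sum_distrib_left)
    qed
    from this[of "1 / (2 * (M + 1))"] M show False by (simp add: field_simps)
  qed
  then show ?thesis using xg by blast
qed

end

lemma vector_space_times: "vector_space ((*) :: complex \<Rightarrow> complex \<Rightarrow> complex)"
  by unfold_locales (simp_all add: algebra_simps)

lemma subspace_closure:
  fixes A :: "'a::real_normed_vector set"
  assumes A: "subspace A" shows "subspace (closure A)" unfolding subspace_def
proof (intro conjI ballI allI)
  show "0 \<in> closure A" using subspace_0[OF A] closure_subset by blast
  show "x + y \<in> closure A" if xy: "x \<in> closure A" "y \<in> closure A" for x y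
  proof -
    obtain f g where "\<And>n. f n \<in> A" "f \<longlonglongrightarrow> x" "\<And>n. g n \<in> A" "g \<longlonglongrightarrow> y"
      using xy unfolding closure_sequential by blast
    then have "(\<forall>n. f n + g n \<in> A) \<and> (\<lambda>n. f n + g n) \<longlonglongrightarrow> x + y"
      using subspace_add[OF A] by (auto intro: tendsto_add)
    then show ?thesis unfolding closure_sequential by (rule exI[of _ "\<lambda>n. f n + g n"])
  qed
  show "c *\<^sub>R x \<in> closure A" if x: "x \<in> closure A" for c x
  proof -
    obtain f where "\<And>n. f n \<in> A" "f \<longlonglongrightarrow> x" using x unfolding closure_sequential by blast
    then have "(\<forall>n. c *\<^sub>R f n \<in> A) \<and> (\<lambda>n. c *\<^sub>R f n) \<longlonglongrightarrow> c *\<^sub>R x"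
      using subspace_scale[OF A] by (auto intro: tendsto_scaleR)
    then show ?thesis unfolding closure_sequential by (rule exI[of _ "\<lambda>n. c *\<^sub>R f n"])
  qed
qed

section \<open>Unitarity of the embedded module\<close>

context oscillator
begin

interpretation R: Sp_rep iota \<rho>A "4 * c0 + 1" by (rule Sp_rep_\<rho>A)

lemma \<pi>_cscale: "a \<in> G_group \<Longrightarrow> R.\<pi> a (cscale c x) = cscale c (R.\<pi> a x)"
  by (rule R.\<pi>_commute[OF _ bounded_linear_cscale, symmetric, of _ _ "\<lambda>f. C c * f"]) (simp_all add: iota_C \<rho>A_def \<rho>F_C)

lemma dv_\<rho>F_vars:
  assumes "v \<notin> vars" "dv v f = 0" shows "dv v (\<rho>F X f) = 0"
proof -
  have W: "dv v (W s a g) = 0" if "a < k" "dv v g = 0" for s a g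
  proof -
    have "v \<noteq> var (i::'n) a" for i using assms(1) that(1) by (auto simp: vars_def)
    moreover have "dv v (dv w g) = 0" for w using that(2) by (simp add: dv_comm[of v])
    ultimately show ?thesis using that(2) by (cases s) (auto simp: W_def dv_add dv_diff dv_C_mult dv_X_mult)
  qed
  then show ?thesis using assms(2) unfolding \<rho>F_def G_def
    by (simp add: dv_C_mult dv_sum)
qed

lemma dv_hwv_vars:
  assumes "v \<notin> vars" "M \<le> k" shows "dv v (hwv M e) = 0"
proof -
  have "dv v (minor c) = 0 * minor c" if "c \<le> k" for c
  proof -
    have "dv v (Mx c $ p $ q) = 0" for p q using assms(1) that by (auto simp: Mx_def dv_X vars_def)
    \<comment> \<open>All entries have derivative 0, so an arbitrary row may play the part of the
      differentiated one.\<close>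
    then have "dv v (minor c) = det (\<chi> p::'n. if p = undefined then 0 else Mx c $ p)"
      unfolding minor_def by (subst derivation_det_row[OF derivation_dv, of undefined]) (auto intro!: arg_cong[of _ _ det] simp: vec_eq_iff)
    then show ?thesis by (simp only: det_row_0) simp
  qed
  then have "dv v (minor c) = 0 * minor c" if "c \<in> insert M {1..m}" for c using that assms(2) km by auto
  from derivation_hwv[OF derivation_dv this] show ?thesis by simp
qed

text \<open>The given action of K and the integrated operators \<pi> meet only through their common
  derivative. They are matched on one-parameter subgroups by \<open>exp_intertwine\<close> and on K
  by generation; the Hilbert space is the closure of the image of T.\<close>

lemma unitarizable:
  fixes sL :: "complex \<Rightarrow> 'v \<Rightarrow> 'v::ab_group_add" and \<rho>L :: "(complex, 'n) mat2 \<Rightarrow> 'v \<Rightarrow> 'v"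
  assumes gK: "gK_module sL \<rho>L \<kappa>"
    and T_add: "\<And>x y. T (x + y) = T x + T y" and T_scale: "\<And>c x. T (sL c x) = C c * T x"
    and T_\<rho>: "\<And>X x. X \<in> sp_alg \<Longrightarrow> T (\<rho>L X x) = \<rho>F X (T x)" and T_inj: "\<And>x. T x = 0 \<Longrightarrow> x = 0"
    and T_vars: "\<And>v x. v \<notin> vars \<Longrightarrow> dv v (T x) = 0"
  shows "unitary_gK_module sL \<rho>L \<kappa>"
proof -
  have "sp_module sL \<rho>L" using gK by (simp add: gK_module_def sp_module_def)
  then interpret V: sp_module sL \<rho>L .
  have \<kappa>_bij: "bij (\<kappa> a)" if "a \<in> K_group" for a using gK that by (simp add: gK_module_def)
  have \<kappa>_mult: "\<kappa> (G_mult a b) = \<kappa> a \<circ> \<kappa> b" if "a \<in> K_group" "b \<in> K_group" for a b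
    using gK that by (simp add: gK_module_def)
  have \<kappa>_fin: "K_finite sL \<kappa> v" for v using gK by (simp add: gK_module_def)
  have \<kappa>_deriv: "((\<lambda>t. f (\<kappa> (G_exp (t *\<^sub>R X)) v)) has_vector_derivative f (\<rho>L (complexify X) v)) (at 0)"
    if "X \<in> sp_compact" "Vector_Spaces.linear sL (*) f" for X v f using gK that by (simp add: gK_module_def)
  have compact_sp: "X \<in> sp_alg" if "X \<in> sp_compact" for X :: "(real, 'n) mat2" using that by (simp add: sp_compact_def)
  have compact_scale: "t *\<^sub>R X \<in> sp_compact" if "X \<in> sp_compact" for X :: "(real, 'n) mat2" and t
    using that by (simp add: sp_compact_iff sp_alg_iff linear_scale[OF linear_of_mat] sp.star_scaleR tr.star_scaleR)
  have \<rho>A: "\<rho>A (of_mat X) = \<rho>F (complexify X)" for X by (simp add: \<rho>A_def)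
  have T_0: "T 0 = 0" using T_add[of 0 0] by simp
  have T_sum: "T (sum f A) = (\<Sum>a\<in>A. T (f a))" for f and A :: "'v set"
    by (induction A rule: infinite_finite_induct) (auto simp: T_add T_0)

  have functional: "Vector_Spaces.linear sL (*) f"
    if "\<And>x y. f (x + y) = f x + f y" "\<And>c x. f (sL c x) = c * f x" for f :: "'v \<Rightarrow> complex"
    unfolding Vector_Spaces.linear_iff using that V.vector_space_axioms vector_space_times by blast

  have orbit_deriv: "((\<lambda>s. iota (T (\<kappa> (G_exp (s *\<^sub>R X)) v))) has_vector_derivative iota (T (\<rho>L (complexify X) v))) (at 0)"
    if X: "X \<in> sp_compact" for X v
  proof -
    \<comment> \<open>Differentiability is given against linear functionals only. The K-orbit of v
      lies in a finite-dimensional span, and the coordinates of a basis of it, extended to the whole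
      module, are functionals that assemble the derivative of the vector.\<close>
    obtain B where B: "finite B" "\<And>a. a \<in> K_group \<Longrightarrow> \<kappa> a v \<in> V.span B" using \<kappa>_fin[of v] unfolding K_finite_def by blast
    obtain B' where B': "B' \<subseteq> B" "V.independent B'" "B \<subseteq> V.span B'" using V.maximal_independent_subset by blast
    have fB': "finite B'" using B(1) B'(1) finite_subset by blast
    have "V.span B \<subseteq> V.span B'" using B'(3) V.span_minimal V.subspace_span by blast
    then have sp: "\<kappa> a v \<in> V.span B'" if "a \<in> K_group" for a using B(2)[OF that] by blast
    define E where "E = V.extend_basis B'"
    have E: "V.independent E" "V.span E = UNIV" "B' \<subseteq> E"
      unfolding E_def using V.independent_extend_basis[OF B'(2)] V.span_extend_basis[OF B'(2)] V.extend_basis_superset[OF B'(2)] by auto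
    define f where "f b x = V.representation E x b" for b x
    have f_lin: "Vector_Spaces.linear sL (*) (f b)" for b
      by (rule functional) (use E in \<open>simp_all add: f_def V.representation_add V.representation_scale\<close>)
    have T_exp: "T x = (\<Sum>b\<in>B'. C (f b x) * T b)" if x: "x \<in> V.span B'" for x
    proof -
      have "V.representation E x = V.representation B' x" by (rule V.representation_extend[OF E(1) x E(3)])
      then have "(\<Sum>b\<in>B'. sL (f b x) b) = x"
        unfolding f_def using V.sum_representation_eq[OF B'(2) x fB' order_refl] by simp
      then have "T x = T (\<Sum>b\<in>B'. sL (f b x) b)" by simp
      then show ?thesis by (simp only: T_sum T_scale)
    qed
    let ?D = "\<Sum>b\<in>B'. cscale (f b (\<rho>L (complexify X) v)) (iota (T b))"
    have "((\<lambda>s. \<Sum>b\<in>B'. cscale (f b (\<kappa> (G_exp (s *\<^sub>R X)) v)) (iota (T b))) has_vector_derivative ?D) (at 0)"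
      by (intro has_vector_derivative_sum bounded_linear.has_vector_derivative[OF bounded_linear_cscale_left] \<kappa>_deriv[OF X f_lin])
    moreover have "(\<Sum>b\<in>B'. cscale (f b (\<kappa> (G_exp (s *\<^sub>R X)) v)) (iota (T b))) = iota (T (\<kappa> (G_exp (s *\<^sub>R X)) v))" for s
      unfolding T_exp[OF sp[OF G_exp_in_K[OF compact_scale[OF X]]]] by (simp add: linear_sum[OF linear_iota] iota_C)
    ultimately have D: "((\<lambda>s. iota (T (\<kappa> (G_exp (s *\<^sub>R X)) v))) has_vector_derivative ?D) (at 0)" by simp
    \<comment> \<open>The vector \<open>\<rho>L (complexify X) v\<close> has not been placed in the
      span of B', so ?D is identified by testing against all y. Each test is the real part of a
      complex linear functional.\<close>
    have "inner ?D y = inner (iota (T (\<rho>L (complexify X) v))) y" for y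
    proof -
      define F where "F x = cip (Rep_ell2 (iota (T x))) (Rep_ell2 y)" for x
      have "Vector_Spaces.linear sL (*) F"
        by (rule functional) (simp_all only: F_def T_add T_scale linear_add[OF linear_iota] iota_C Rep_ell2_fun cip_add cip_scale)
      from bounded_linear.has_vector_derivative[OF bounded_linear_Re \<kappa>_deriv[OF X this]]
      have "((\<lambda>s. inner (iota (T (\<kappa> (G_exp (s *\<^sub>R X)) v))) y) has_vector_derivative inner (iota (T (\<rho>L (complexify X) v))) y) (at 0)"
        by (simp add: F_def cip_inner)
      with bounded_linear.has_vector_derivative[OF bounded_linear_inner_left D]
      show ?thesis by (rule vector_derivative_unique_at)
    qed
    then have "inner (?D - iota (T (\<rho>L (complexify X) v))) (?D - iota (T (\<rho>L (complexify X) v))) = 0" by (simp add: inner_diff_left)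
    then have "?D = iota (T (\<rho>L (complexify X) v))" by simp
    then show ?thesis using D by simp
  qed

  have zK: "G_exp (0 :: (real, 'n) mat2) \<in> K_group" and z0: "(0 :: (real, 'n) mat2) \<in> sp_compact"
  proof -
    show "(0 :: (real, 'n) mat2) \<in> sp_compact" using compact_scale[OF symp_form_compact, of 0] by simp
    then show "G_exp (0 :: (real, 'n) mat2) \<in> K_group" by (rule G_exp_in_K)
  qed
  \<comment> \<open>The class of exp 0 is idempotent and acts bijectively, hence as the
    identity.\<close>
  have \<kappa>_0: "\<kappa> (G_exp 0) v = v" for v
  proof -
    have "\<kappa> (G_exp 0) (\<kappa> (G_exp 0) v) = \<kappa> (G_exp 0) v"
      using \<kappa>_mult[OF zK zK] G_exp_add[OF compact_sp[OF z0], of 0 0] by (simp add: fun_eq_iff)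
    then show ?thesis using \<kappa>_bij[OF zK] by (meson bij_is_inj injD)
  qed
  have \<pi>_exp: "R.\<pi> (G_exp X) (iota (T v)) = iota (T (\<kappa> (G_exp X) v))" if X: "X \<in> sp_compact" for X v
  proof -
    let ?g = "\<lambda>t. T (\<kappa> (G_exp (t *\<^sub>R X)) v)"
    have "((\<lambda>s. iota (?g (t + s))) has_vector_derivative iota (\<rho>A (of_mat X) (?g t))) (at 0)" for t
    proof -
      have "\<kappa> (G_exp ((t + s) *\<^sub>R X)) v = \<kappa> (G_exp (s *\<^sub>R X)) (\<kappa> (G_exp (t *\<^sub>R X)) v)" for s
        using \<kappa>_mult[OF G_exp_in_K[OF compact_scale[OF X, of s]] G_exp_in_K[OF compact_scale[OF X, of t]]] G_exp_add[OF compact_sp[OF X], of s t]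
        by (simp add: add.commute)
      moreover have "complexify X \<in> sp_alg" using compact_sp[OF X] by (simp add: complexify_sp)
      ultimately show ?thesis using orbit_deriv[OF X, of "\<kappa> (G_exp (t *\<^sub>R X)) v"] by (simp add: \<rho>A T_\<rho>)
    qed
    from R.exp_intertwine[OF compact_sp[OF X] this, of 1] show ?thesis by (simp add: \<kappa>_0)
  qed
  have K_in_G: "a \<in> G_group" if "a \<in> K_group" for a using that by (simp add: K_group_def)
  have \<pi>_K: "R.\<pi> a (iota (T v)) = iota (T (\<kappa> a v))" if "a \<in> K_group" for a v
  proof -
    have "\<forall>v. R.\<pi> a (iota (T v)) = iota (T (\<kappa> a v))" using that
    proof (rule K_group_induct)
      show "\<forall>v. R.\<pi> (G_exp 0) (iota (T v)) = iota (T (\<kappa> (G_exp 0) v))" using \<pi>_exp[OF z0] by blast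
    next
      fix b and X :: "(real, 'n) mat2"
      assume b: "b \<in> K_group" "\<forall>v. R.\<pi> b (iota (T v)) = iota (T (\<kappa> b v))" and X: "X \<in> sp_compact"
      show "\<forall>v. R.\<pi> (G_mult b (G_exp X)) (iota (T v)) = iota (T (\<kappa> (G_mult b (G_exp X)) v))"
        using b \<pi>_exp[OF X] by (simp add: R.\<pi>_mult K_in_G G_exp_in_K[OF X] \<kappa>_mult)
    qed
    then show ?thesis by blast
  qed

  define S where "S = closure (iota ` range T)"
  have csub: "module.subspace csc (range T)"
  proof -
    interpret vector_space csc by (rule vector_space_csc)
    show ?thesis unfolding subspace_def
    proof (intro conjI ballI allI)
      show "0 \<in> range T" using T_0 by (metis rangeI)
      show "x + y \<in> range T" if "x \<in> range T" "y \<in> range T" for x y using that by (auto simp: T_add[symmetric])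
      show "csc c x \<in> range T" if "x \<in> range T" for c x using that by (auto simp: T_scale[symmetric])
    qed
  qed
  have st: "\<rho>F X w \<in> range T" if "X \<in> sp_alg" "w \<in> range T" for X w using that by (auto simp: T_\<rho>[symmetric])
  have rsub: "subspace (range T)" unfolding subspace_def
  proof (intro conjI ballI allI)
    show "0 \<in> range T" using T_0 by (metis rangeI)
    show "x + y \<in> range T" if "x \<in> range T" "y \<in> range T" for x y using that by (auto simp: T_add[symmetric])
    show "c *\<^sub>R x \<in> range T" if "x \<in> range T" for c x using that by (auto simp: scaleR_fock T_scale[symmetric])
  qed
  have S1: "closed S" "subspace S"
    unfolding S_def using subspace_closure[OF linear_subspace_image[OF linear_iota rsub]] by simp_all
  have S2: "cscale c x \<in> S" if "x \<in> S" for c x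
  proof -
    have "cscale c ` closure (iota ` range T) \<subseteq> closure (iota ` range T)"
    proof (rule image_closure_subset)
      show "cscale c ` iota ` range T \<subseteq> closure (iota ` range T)"
        using closure_subset by (force simp: iota_C[symmetric] T_scale[symmetric])
    qed (auto intro: linear_continuous_on bounded_linear_cscale)
    then show ?thesis using that by (auto simp: S_def)
  qed
  have S3: "R.\<pi> a ` S = S" if "a \<in> G_group" for a unfolding S_def
  proof (rule R.\<pi>_image[OF that rsub])
    fix X :: "('n + 'n) sqmat" and w assume "symp_star X = - X" "w \<in> range T"
    then show "\<rho>A X w \<in> range T" unfolding \<rho>A_def by (intro st) (simp_all add: complexify_sp sp_alg_iff)
  qed
  let ?\<pi> = "\<lambda>g x. Rep_ell2 (R.\<pi> g (Abs_ell2 x))" and ?H = "Rep_ell2 ` S" and ?T = "\<lambda>v. Rep_ell2 (iota (T v))"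
  have "unitary_rep psc ?H cip ?\<pi>"
    by (rule unitary_rep_ell2[OF S1 S2 S3]) (use R.\<pi>_props R.\<pi>_mult R.\<pi>_continuous \<pi>_cscale in auto)
  moreover have "K_finite_iso sL \<rho>L \<kappa> psc ?H cip ?\<pi> ?T" unfolding K_finite_iso_def
  proof (intro conjI ballI allI)
    interpret P: vector_space psc by (rule vector_space_psc)
    have T_lin: "Vector_Spaces.linear sL psc ?T" unfolding Vector_Spaces.linear_iff
      by (simp only: V.vector_space_axioms vector_space_psc T_add T_scale linear_add[OF linear_iota] iota_C Rep_ell2_fun) simp
    then show "Vector_Spaces.linear sL psc ?T" .
    have T_S: "iota (T v) \<in> S" for v unfolding S_def by (rule subsetD[OF closure_subset]) simp
    show "?T (\<kappa> a v) = ?\<pi> a (?T v)" if "a \<in> K_group" for a v by (simp add: Rep_ell2_inverse \<pi>_K[OF that])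
    show "bij_betw ?T UNIV {x \<in> ?H. K_finite psc ?\<pi> x}" unfolding bij_betw_def
    proof
      show "inj ?T"
      proof (rule injI)
        fix x y assume "?T x = ?T y"
        then have "iota (T x) = iota (T y)" by (simp add: Rep_ell2_inject)
        then have "iota (T x + C (- 1) * T y) = 0" by (simp add: linear_diff[OF linear_iota] C_minus)
        then have "T (x + sL (- 1) y) = 0" unfolding iota_eq_0 T_add T_scale .
        then show "x = y" using T_inj by fastforce
      qed
      show "range ?T = {x \<in> ?H. K_finite psc ?\<pi> x}"
      proof (intro equalityI subsetI)
        fix x assume "x \<in> range ?T"
        then obtain v where v: "x = ?T v" by blast
        obtain B where B: "finite B" "\<And>a. a \<in> K_group \<Longrightarrow> \<kappa> a v \<in> V.span B" using \<kappa>_fin[of v] unfolding K_finite_def by blast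
        have "?\<pi> a x \<in> P.span (?T ` B)" if a: "a \<in> K_group" for a
        proof -
          have "?\<pi> a x = ?T (\<kappa> a v)" by (simp add: v Rep_ell2_inverse \<pi>_K[OF a])
          moreover have "P.span (?T ` B) = ?T ` V.span B"
            by (rule module_hom.span_image[OF Vector_Spaces.linear.axioms(3)[OF T_lin]])
          ultimately show ?thesis using B(2)[OF a] by blast
        qed
        then have "K_finite psc ?\<pi> x" unfolding K_finite_def using B(1) by blast
        then show "x \<in> {x \<in> ?H. K_finite psc ?\<pi> x}" using T_S v by blast
      next
        fix x assume x: "x \<in> {x \<in> ?H. K_finite psc ?\<pi> x}"
        then obtain y where y: "y \<in> S" "x = Rep_ell2 y" by blast
        obtain B where B: "finite B" "\<And>a. a \<in> K_group \<Longrightarrow> ?\<pi> a x \<in> P.span B" using x unfolding K_finite_def by blast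
        \<comment> \<open>Of K-finiteness, the one-parameter group of J is retained; it already
          bounds the degrees.\<close>
        have "Rep_ell2 (R.\<pi> (G_exp (t *\<^sub>R symp_form)) y) \<in> P.span B" for t
          using B(2)[OF G_exp_in_K[OF compact_scale[OF symp_form_compact]], of t] by (simp add: y Rep_ell2_inverse)
        then have "y \<in> iota ` range T"
          using y(1) B(1) T_vars unfolding S_def by (intro K_finite_in_image[OF csub st]) auto
        then show "x \<in> range ?T" using y(2) by blast
      qed
    qed
    fix X :: "(real, 'n) mat2" and v assume X: "X \<in> sp_alg"
    let ?g = "\<lambda>t. R.\<pi> (G_exp (t *\<^sub>R X)) (iota (T v))" and ?d = "iota (T (\<rho>L (complexify X) v))"
    have "(?g has_vector_derivative ?d) (at 0)"
      using R.\<pi>_exp_deriv[OF X, of "T v"] X by (simp add: \<rho>A T_\<rho> complexify_sp)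
    then have lim: "((\<lambda>t. norm (?g t - ?g 0 - t *\<^sub>R ?d) / norm t) \<longlongrightarrow> 0) (at 0)"
      unfolding has_vector_derivative_def has_derivative_at by simp
    have "ip_dist ?H cip (psc (of_real (1 / t)) (?\<pi> (G_exp (t *\<^sub>R X)) (?T v) - ?T v)) (?T (\<rho>L (complexify X) v))
      = norm (?g t - ?g 0 - t *\<^sub>R ?d) / norm t" if t: "t \<noteq> 0" for t
    proof -
      have gS: "?g t \<in> S"
      proof -
        have "t *\<^sub>R X \<in> sp_alg" using X by (simp add: sp_alg_iff linear_scale[OF linear_of_mat] sp.star_scaleR)
        then show ?thesis using S3[OF G_exp_in_G] T_S by blast
      qed
      have "psc (of_real (1 / t)) (?\<pi> (G_exp (t *\<^sub>R X)) (?T v) - ?T v) = Rep_ell2 (cscale (of_real (1 / t)) (?g t - iota (T v)))"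
        by (simp only: Rep_ell2_inverse Rep_ell2_fun)
      moreover have "cscale (of_real (1 / t)) (?g t - iota (T v)) \<in> S"
        by (intro S2 Real_Vector_Spaces.subspace_diff[OF S1(2)] gS T_S)
      ultimately have "ip_dist ?H cip (psc (of_real (1 / t)) (?\<pi> (G_exp (t *\<^sub>R X)) (?T v) - ?T v)) (?T (\<rho>L (complexify X) v))
         = dist (cscale (of_real (1 / t)) (?g t - iota (T v))) ?d"
        using T_S by (simp only: ip_dist_Rep)
      also have "\<dots> = norm ((1 / t) *\<^sub>R (?g t - ?g 0 - t *\<^sub>R ?d))"
        unfolding cscale_simps dist_norm using t by (simp add: R.\<pi>_exp_0 scaleR_right_diff_distrib)
      finally show ?thesis by simp
    qed
    then show "((\<lambda>t. ip_dist ?H cip (psc (of_real (1 / t)) (?\<pi> (G_exp (t *\<^sub>R X)) (?T v) - ?T v)) (?T (\<rho>L (complexify X) v))) \<longlongrightarrow> 0) (at 0)"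
      by (intro Lim_transform_eventually[OF lim]) (auto simp: eventually_at_filter)
  qed
  ultimately show ?thesis unfolding unitary_gK_module_def by blast
qed

end

text \<open>The sum telescopes, with the last exponent formed as if a (m + 1) were - 1. The
  resulting summand 1 is the second unit drop of \<lambda> after row r; the first one comes from the
  factor \<open>minor M\<close>.\<close>

lemma sum_exponents:
  fixes a :: "nat \<Rightarrow> int"
  assumes e: "\<And>c. e c = nat (if c = m then a m + 1 else a c - a (c + 1))"
    and a: "\<And>i j. 1 \<le> i \<Longrightarrow> i \<le> j \<Longrightarrow> j \<le> m \<Longrightarrow> a j \<le> a i" "\<And>i. 1 \<le> i \<Longrightarrow> i \<le> m \<Longrightarrow> 0 \<le> a i"
  shows "(\<Sum>c\<in>{1..m}. if x < c then real (e c) else 0) = (if x < m then of_int (a (x + 1)) + 1 else 0)"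
proof -
  have "(\<Sum>c\<in>{1..m}. if x < c then real (e c) else 0) = of_int (a (x + 1)) + 1" if "x < m" using that
  proof (induction "m - x" arbitrary: x)
    case (Suc d)
    have "{1..m} = insert (x + 1) ({1..m} - {x + 1})" using Suc.prems by auto
    then have "(\<Sum>c\<in>{1..m}. if x < c then real (e c) else 0) = real (e (x + 1)) + (\<Sum>c\<in>{1..m} - {x + 1}. if x < c then real (e c) else 0)"
      using Suc.prems by (subst sum.remove[of _ "x + 1"]) auto
    also have "(\<Sum>c\<in>{1..m} - {x + 1}. if x < c then real (e c) else 0) = (\<Sum>c\<in>{1..m} - {x + 1}. if x + 1 < c then real (e c) else 0)"
      by (intro sum.cong refl) auto
    also have "\<dots> = (\<Sum>c\<in>{1..m}. if x + 1 < c then real (e c) else 0)"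
      by (rule sum.mono_neutral_left) auto
    finally have step: "(\<Sum>c\<in>{1..m}. if x < c then real (e c) else 0) = real (e (x + 1)) + (\<Sum>c\<in>{1..m}. if x + 1 < c then real (e c) else 0)" .
    show ?case
    proof (cases "x + 1 = m")
      case True
      then have "(\<Sum>c\<in>{1..m}. if x + 1 < c then real (e c) else 0) = 0" by (intro sum.neutral) auto
      moreover have "real (e (x + 1)) = of_int (a m) + 1" using True a(2)[of m] by (simp add: e)
      ultimately show ?thesis using step True by simp
    next
      case False
      then have "(\<Sum>c\<in>{1..m}. if x + 1 < c then real (e c) else 0) = of_int (a (x + 1 + 1)) + 1"
        using Suc.hyps(2) Suc.prems by (intro Suc.hyps(1)) auto
      moreover have "real (e (x + 1)) = of_int (a (x + 1)) - of_int (a (x + 1 + 1))"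
        using False Suc.prems a(1)[of "x + 1" "x + 1 + 1"] by (simp add: e)
      ultimately show ?thesis using step by simp
    qed
  qed simp
  moreover have "(\<Sum>c\<in>{1..m}. if x < c then real (e c) else 0) = 0" if "\<not> x < m"
    using that by (intro sum.neutral) auto
  ultimately show ?thesis by simp
qed

theorem theorem3p10:
  fixes n l q r :: nat and a :: "nat \<Rightarrow> int" and lam1 :: real
    and lam :: "real ^ 'n::{finite,linorder}"
    and sF :: "complex \<Rightarrow> 'f \<Rightarrow> 'f::ab_group_add"
    and \<sigma> :: "(complex, 'n) mat2 \<Rightarrow> 'f \<Rightarrow> 'f"
    and sL :: "complex \<Rightarrow> 'v \<Rightarrow> 'v::ab_group_add"
    and \<rho> :: "(complex, 'n) mat2 \<Rightarrow> 'v \<Rightarrow> 'v"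
    and \<kappa> :: "'n Gelem \<Rightarrow> 'v \<Rightarrow> 'v"
  assumes "n = CARD('n)" "1 \<le> l" "l \<le> q" "q \<le> r" "r \<le> n"
    and "\<And>i j. \<lbrakk>1 \<le> i; i \<le> j; j \<le> n - r\<rbrakk> \<Longrightarrow> a j \<le> a i"
    and "\<And>i. \<lbrakk>1 \<le> i; i \<le> n - r\<rbrakk> \<Longrightarrow> 0 \<le> a i"
    and "lam1 = - real n + (real q + real r - real l + 1) / 2"
    and "lam = (\<chi> i. if pos i \<le> q then lam1
                     else if pos i \<le> r then lam1 - 1
                     else lam1 - 2 - of_int (a (n + 1 - pos i)))"
    and "is_F lam sF \<sigma>"
    and "gK_module sL \<rho> \<kappa>" "irreducible_quotient_of_N sF \<sigma> sL \<rho>"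
  shows "unitary_gK_module sL \<rho> \<kappa>"
proof -
  \<comment> \<open>The additions precede the subtractions so that truncation at 0 never occurs: q +
    r \<le> 2 n and 1 \<le> l. Then M + m = 2 n - q - r \<le> k by 1 \<le> l, and 2 m \<le> M + m by
    q \<le> r.\<close>
  define k m M where "k = 2 * n + l - 1 - q - r" and "m = n - r" and "M = n - q"
  note h = assms(1-5)
  have kmM: "2 * m \<le> k" "m \<le> M" "M + m \<le> k" using h by (auto simp: k_def m_def M_def)
  interpret oscillator k m "TYPE('n)" by unfold_locales (rule kmM)
  define e where "e c = nat (if c = m then a m + 1 else a c - a (c + 1))" for c
  define \<Lambda> where "\<Lambda> h = (\<Sum>i\<in>UNIV. of_real (lam $ i) * h $ i)" for h :: "(complex, 'n) vec"
  obtain v where v: "v \<noteq> 0" "hw_module sL \<rho> v \<Lambda>"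
    using quotient_hw_vector[OF assms(10,12)] unfolding \<Lambda>_def by blast
  have lam: "lam $ i = - (real k / 2) - (if corow i < M then 1 else 0) - (\<Sum>c\<in>{1..m}. if corow i < c then real (e c) else 0)" for i
  proof -
    have p: "1 \<le> pos i" "pos i \<le> n" using pos_bounds[of i] h(1) by auto
    have "real k = 2 * real n + real l - 1 - real q - real r" using h unfolding k_def by (simp add: of_nat_diff)
    then have lam1: "lam1 = - (real k / 2)" unfolding assms(8) by (simp add: field_simps)
    \<comment> \<open>Rows are counted from the end starting with 0, whereas the sequence a starts
      with index 1 at the last row; hence the shift by 1.\<close>
    have M: "corow i < M \<longleftrightarrow> \<not> pos i \<le> q" and m: "corow i < m \<longleftrightarrow> \<not> pos i \<le> r" and c: "n + 1 - pos i = corow i + 1"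
      using p h by (auto simp: corow_def M_def m_def)
    have s: "(\<Sum>c\<in>{1..m}. if corow i < c then real (e c) else 0) = (if corow i < m then of_int (a (corow i + 1)) + 1 else 0)"
      by (rule sum_exponents) (use assms(6,7) in \<open>auto simp: e_def m_def\<close>)
    show ?thesis unfolding s assms(9) vec_lambda_beta M m c using h(4) by (simp add: lam1)
  qed
  have hw: "hw_module csc \<rho>F (hwv M e) \<Lambda>"
    by (rule hw_module_hwv[OF kmM(2,3)]) (simp only: \<Lambda>_def lam)
  have \<Lambda>: "\<Lambda> h0 = of_real (\<Sum>i\<in>(UNIV::'n set). lam $ i * (real (corow i) + 1))" by (simp add: \<Lambda>_def h0_def)
  have irr: "irreducible_module sp_alg sL \<rho>" using assms(12) by (simp add: irreducible_quotient_of_N_def)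
  from irreducible_embeds[OF irr v(2,1) hw hwv_nonzero \<Lambda>] obtain T where T: "\<forall>x y. T (x + y) = T x + T y" "\<forall>c x. T (sL c x) = csc c (T x)"
     "\<forall>X\<in>sp_alg. \<forall>x. T (\<rho> X x) = \<rho>F X (T x)" "\<forall>x. T x = 0 \<longrightarrow> x = 0"
     "\<forall>S. module.subspace csc S \<and> hwv M e \<in> S \<and> (\<forall>X\<in>sp_alg. \<rho>F X ` S \<subseteq> S) \<longrightarrow> range T \<subseteq> S"
    by (elim exE conjE)
  \<comment> \<open>Polynomials in the variables of \<open>vars\<close> form a submodule containing
    the highest weight vector, so they contain the image of T. In finitely many variables only
    finitely many monomials have bounded degree.\<close>
  have T_vars: "dv w (T x) = 0" if "w \<notin> vars" for w x
  proof -
    interpret vector_space csc by (rule vector_space_csc)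
    let ?S = "{f. dv w f = 0}"
    have "subspace ?S" unfolding subspace_def by (simp add: dv_add dv_C_mult)
    moreover have "hwv M e \<in> ?S" using dv_hwv_vars[OF that] kmM by simp
    moreover have "\<forall>X\<in>sp_alg. \<rho>F X ` ?S \<subseteq> ?S" using dv_\<rho>F_vars[OF that] by blast
    ultimately have "range T \<subseteq> ?S" using T(5) by blast
    then show ?thesis by blast
  qed
  show ?thesis
    by (rule unitarizable[where T=T, OF assms(11)]) (use T(1-4) T_vars in auto)
qed

end
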